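(* Let $g\in L^p(\Omega;L^2(0,T;\dot{\mathbb L}^2(\mathbb T^2)))$ for some $p>2$, and let $v$ be the unique solution of the state equation, satisfying $$\mathbb E\Big[\exp\Big\{\hat c\int_0^t\|v(s)\|_{\dot{\mathbb H}^3}^2ds\Big\}\Big]<+\infty\quad\text{for all }\hat c>0,\ t\in[0,T].$$ Then there exists a unique solution $\mathfrak p$ (in the sense defined in the context) to the adjoint system $$-\partial_t\Upsilon(\mathfrak p)=\mathcal Pg-\nu\mathcal A\mathfrak p+\mathcal P(\mathrm I-\alpha_1\Delta)[(v\cdot\nabla)\mathfrak p]-\mathcal P\Big[\sum_{j=1}^2\mathfrak p^j\nabla[\Upsilon(v)]^j\Big]-\mathcal P(\mathrm I-\alpha_1\Delta)[(\mathfrak p\cdot\nabla)v]+\mathcal P[(\mathfrak p\cdot\nabla)\Upsilon(v)]$$ $$+(\alpha_1+\alpha_2)\mathcal P\operatorname{div}(\mathrm A(v)\mathrm A(\mathfrak p)+\mathrm A(\mathfrak p)\mathrm A(v))+\beta\mathcal P\operatorname{div}(|\mathrm A(v)|^2\mathrm A(\mathfrak p))+2\beta\mathcal P\operatorname{div}[(\mathrm A(\mathfrak p):\mathrm A(v))\mathrm A(v)],\qquad\mathfrak p(T)=0.$$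
   Context: **Spaces.** Fix $\ell>0$, $T>0$, $\mathbb T^2=(\mathbb R/\ell\mathbb Z)^2$. $\dot{\mathbb L}^2(\mathbb T^2)$: mean-zero $\mathbb R^2$-valued $L^2$ fields, with norm $\|\cdot\|_2$ and inner product $(\cdot,\cdot)$; for matrices $A:B=\operatorname{Tr}(AB^T)$, $|A|^2=A:A$. $\dot{\mathbb H}^s(\mathbb T^2)$: mean-zero $\mathbb R^2$-valued $H^s$ fields with norm $\|u\|_{\dot{\mathbb H}^s}^2=\sum_{k\in\mathbb Z^2}|k|^{2s}|u_k|^2$, where $u_k$ are the Fourier coefficients. $\mathbb H$ (resp. $\mathbb V$) is the closure of the smooth mean-zero divergence-free fields in $\dot{\mathbb L}^2$ (resp. $\dot{\mathbb H}^1$); $\mathbb V'$ is the dual of $\mathbb V$ with pairing $\langle\cdot,\cdot\rangle$. $\mathcal P:\dot{\mathbb L}^2\to\mathbb H$ is the Leray projection, $\mathcal A=-\mathcal P\Delta$ the Stokes operator, $D(\mathcal A^{s/2})=\{u\in\dot{\mathbb H}^s:\operatorname{div}u=0\}$. **Parameters and notation.** $\nu>0$, $\alpha_1>0$, $\alpha_2\in\mathbb R$, $\beta>0$, $|\alpha_1+\alpha_2|\le\sqrt{24\nu\beta}$. $\Upsilon(u)=u-\alpha_1\Delta u$; $\mathrm A(u)=\nabla u+(\nabla u)^T$; $(\operatorname{div}M)_i=\sum_j\partial_jM_{ij}$; $b(u,v,w)=\sum_{i,j}\int_{\mathbb T^2}u^i\,\partial_iv^j\,w^j\,dx$. **Noise.**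 $(\Omega,\mathscr F,\{\mathscr F_t\}_{t\ge0},\mathbb P)$ is a filtered probability space (usual conditions), $\mathbb U$ a Hilbert space, $G:\mathbb U\to\mathbb H$ Hilbert–Schmidt, $\mathrm W$ an $\mathbb H$-valued $GG^*$-Wiener process. **State equation** (with force $f\in L^2(\Omega;L^2(0,T;\dot{\mathbb H}^1))$ and initial datum $v_0\in D(\mathcal A^{3/2})$): $$d\Upsilon(v)+\Big\{-\nu\Delta v+(v\cdot\nabla)\Upsilon(v)+\sum_{j=1}^2[\Upsilon(v)]^j\nabla v^j-(\alpha_1+\alpha_2)\operatorname{div}[\mathrm A(v)^2]-\beta\operatorname{div}[|\mathrm A(v)|^2\mathrm A(v)]\Big\}dt=(-\nabla p+f)\,dt+d\mathrm W,\quad\operatorname{div}v=0,\quad v(0)=v_0.$$ A *solution* is a $D(\mathcal A)$-valued $\{\mathscr F_t\}$-adapted process $v$ with paths in $C([0,T];D(\mathcal A))\cap L^\infty(0,T;D(\mathcal A^{3/2}))$ $\mathbb P$-a.s. such that, for every $t\in[0,T]$ and every $\phi\in\mathbb H$, $\mathbb P$-a.s., $$(\Upsilon(v(t)),\phi)=(\Upsilon(v_0),\phi)-\int_0^t\big[\nu(\mathcal Av,\phi)+b(v,\Upsilon(v),\phi)+b(\phi,v,\Upsilon(v))-(\alpha_1+\alpha_2)(\operatorname{div}[\mathrm A(v)^2],\phi)-\beta(\operatorname{div}[|\mathrm A(v)|^2\mathrm A(v)],\phi)\big]ds+\int_0^t(f,\phi)\,ds+(\mathrm W(t),\phi).$$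 **Solution of the adjoint system.** A stochastic process $\mathfrak p$ with trajectories in $C([0,T];\mathbb V)\cap L^\infty(0,T;D(\mathcal A))$, $\partial_t\mathfrak p\in L^2(0,T;\mathbb V)$, $\mathfrak p(T)=0$, such that $\mathbb P$-a.s., for a.e. $t\in[0,T]$ and all $\phi\in\mathbb V$, $$-\langle\partial_t\Upsilon(\mathfrak p),\phi\rangle=\Big\langle g-\nu\mathcal A\mathfrak p+(\mathrm I-\alpha_1\Delta)[(v\cdot\nabla)\mathfrak p]-\sum_{j=1}^2\mathfrak p^j\nabla[\Upsilon(v)]^j-(\mathrm I-\alpha_1\Delta)[(\mathfrak p\cdot\nabla)v]+(\mathfrak p\cdot\nabla)\Upsilon(v)$$ $$+(\alpha_1+\alpha_2)\operatorname{div}(\mathrm A(v)\mathrm A(\mathfrak p)+\mathrm A(\mathfrak p)\mathrm A(v))+\beta\operatorname{div}(|\mathrm A(v)|^2\mathrm A(\mathfrak p))+2\beta\operatorname{div}[(\mathrm A(\mathfrak p):\mathrm A(v))\mathrm A(v)],\ \phi\Big\rangle.$$ *)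

theory Defs
  imports "HOL-Probability.Probability"
begin

section \<open>Seminormed function spaces\<close>

text \<open>
  Elements of Lebesgue and Sobolev spaces are represented by functions rather than by classes of
  almost everywhere equal functions. A space is a pair of a carrier, closed under subtraction, and
  a seminorm that vanishes exactly on the representatives of 0. All spaces used below are
  separable, so Borel measurability of a map into the space and strong measurability coincide.
\<close>

type_synonym 'a nspace = "'a set \<times> ('a \<Rightarrow> real)"

abbreviation carr :: "'a nspace \<Rightarrow> 'a set" where "carr X \<equiv> fst X"

abbreviation nrm :: "'a nspace \<Rightarrow> 'a \<Rightarrow> real" where "nrm X \<equiv> snd X"

definition nborel :: "('a::minus) nspace \<Rightarrow> 'a measure" where
  "nborel X = sigma (carr X)
     {U. U \<subseteq> carr X \<and> (\<forall>u\<in>U. \<exists>r>0. \<forall>w\<in>carr X. nrm X (w - u) < r \<longrightarrow> w \<in> U)}"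

definition closure_in :: "('a::minus) nspace \<Rightarrow> 'a set \<Rightarrow> 'a set" where
  "closure_in X S = {u \<in> carr X. \<forall>e>0. \<exists>w\<in>S. nrm X (u - w) < e}"

definition bochner_Lp :: "'t measure \<Rightarrow> ('a::minus) nspace \<Rightarrow> real \<Rightarrow> ('t \<Rightarrow> 'a) nspace" where
  "bochner_Lp M X p =
     ({h. \<exists>h'\<in>measurable M (nborel X). integrable M (\<lambda>t. nrm X (h' t) powr p) \<and> (AE t in M. h t = h' t)},
      \<lambda>h. (LINT t|M. nrm X (h t) powr p) powr (1 / p))"

definition bochner_Linf :: "'t measure \<Rightarrow> ('a::minus) nspace \<Rightarrow> ('t \<Rightarrow> 'a) set" where
  "bochner_Linf M X =
     {h. \<exists>h'\<in>measurable M (nborel X). (\<exists>C. AE t in M. nrm X (h' t) \<le> C) \<and> (AE t in M. h t = h' t)}"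

definition cont_paths :: "real set \<Rightarrow> ('a::minus) nspace \<Rightarrow> (real \<Rightarrow> 'a) set" where
  "cont_paths I X =
     {h. \<forall>t\<in>I. h t \<in> carr X \<and> ((\<lambda>s. nrm X (h s - h t)) \<longlongrightarrow> 0) (at t within I)}"


section \<open>Fields on the torus\<close>

text \<open>Functions on the torus of period \<open>L\<close> are \<open>L\<close>-periodic functions on the plane.\<close>

type_synonym field = "real^2 \<Rightarrow> real^2"

definition periodic :: "real \<Rightarrow> (real^2 \<Rightarrow> 'b) \<Rightarrow> bool" where
  "periodic L f \<longleftrightarrow> (\<forall>x i. f (x + axis i L) = f x)"

definition torus :: "real \<Rightarrow> (real^2) measure" where
  "torus L = lebesgue_on {x. \<forall>i. 0 \<le> x $ i \<and> x $ i < L}"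

definition ip :: "real \<Rightarrow> field \<Rightarrow> field \<Rightarrow> real" where
  "ip L u w = (LINT x|torus L. u x \<bullet> w x)"

definition L2dot :: "real \<Rightarrow> field nspace" where
  "L2dot L =
     ({u. periodic L u \<and> u \<in> borel_measurable (torus L) \<and> integrable (torus L) (\<lambda>x. (norm (u x))\<^sup>2) \<and>
          (LINT x|torus L. u x) = 0},
      \<lambda>u. sqrt (ip L u u))"

definition freq :: "int^2 \<Rightarrow> real^2" where
  "freq k = (\<chi> i. real_of_int (k $ i))"

definition fourier :: "real \<Rightarrow> field \<Rightarrow> int^2 \<Rightarrow> complex^2" where
  "fourier L u k =
     (\<chi> i. (LINT x|torus L. complex_of_real (u x $ i) * cis (- (2 * pi / L) * (freq k \<bullet> x))) / complex_of_real (L\<^sup>2))"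

text \<open>Used for \<open>s \<ge> 0\<close>; the mode \<open>k = 0\<close> contributes nothing since \<open>0 powr a = 0\<close>.\<close>

definition Hdot :: "real \<Rightarrow> real \<Rightarrow> field nspace" where
  "Hdot L s =
     ({u \<in> carr (L2dot L).
        (\<lambda>k. norm (freq k) powr (2 * s) * (norm (fourier L u k))\<^sup>2) summable_on UNIV},
      \<lambda>u. sqrt (\<Sum>\<^sub>\<infinity>k. norm (freq k) powr (2 * s) * (norm (fourier L u k))\<^sup>2))"


subsection \<open>Classical and weak derivatives\<close>

definition pderiv_cl :: "2 \<Rightarrow> (real^2 \<Rightarrow> real) \<Rightarrow> real^2 \<Rightarrow> real" where
  "pderiv_cl j f x = frechet_derivative f (at x) (axis j 1)"

text \<open>All iterated partial derivatives exist and are differentiable, hence continuous.\<close>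

coinductive smooth :: "(real^2 \<Rightarrow> real) \<Rightarrow> bool" where
  "(\<And>x. f differentiable (at x)) \<Longrightarrow> (\<And>j. smooth (pderiv_cl j f)) \<Longrightarrow> smooth f"

definition is_wderiv :: "real \<Rightarrow> 2 \<Rightarrow> (real^2 \<Rightarrow> real) \<Rightarrow> (real^2 \<Rightarrow> real) \<Rightarrow> bool" where
  "is_wderiv L j f g \<longleftrightarrow>
     periodic L f \<and> integrable (torus L) f \<and> periodic L g \<and> integrable (torus L) g \<and>
     (\<forall>\<phi>. smooth \<phi> \<and> periodic L \<phi> \<longrightarrow>
        (LINT x|torus L. f x * pderiv_cl j \<phi> x) = - (LINT x|torus L. g x * \<phi> x))"

text \<open>The weak derivative is determined up to a null set whenever it exists; it is arbitrary otherwise.\<close>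

definition wd :: "real \<Rightarrow> 2 \<Rightarrow> (real^2 \<Rightarrow> real) \<Rightarrow> real^2 \<Rightarrow> real" where
  "wd L j f = (SOME g. is_wderiv L j f g)"

definition sgrad :: "real \<Rightarrow> (real^2 \<Rightarrow> real) \<Rightarrow> field" where
  "sgrad L f = (\<lambda>x. \<chi> i. wd L i f x)"

definition grad :: "real \<Rightarrow> field \<Rightarrow> real^2 \<Rightarrow> real^2^2" where
  "grad L u = (\<lambda>x. \<chi> i j. wd L j (\<lambda>y. u y $ i) x)"

definition lap :: "real \<Rightarrow> field \<Rightarrow> field" where
  "lap L u = (\<lambda>x. \<chi> i. \<Sum>j\<in>UNIV. wd L j (wd L j (\<lambda>y. u y $ i)) x)"

definition divg :: "real \<Rightarrow> field \<Rightarrow> real^2 \<Rightarrow> real" where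
  "divg L u = (\<lambda>x. \<Sum>j\<in>UNIV. wd L j (\<lambda>y. u y $ j) x)"

definition divm :: "real \<Rightarrow> (real^2 \<Rightarrow> real^2^2) \<Rightarrow> field" where
  "divm L A = (\<lambda>x. \<chi> i. \<Sum>j\<in>UNIV. wd L j (\<lambda>y. A y $ i $ j) x)"

definition frob :: "real^2^2 \<Rightarrow> real^2^2 \<Rightarrow> real" where
  "frob A B = trace (A ** transpose B)"


subsection \<open>Solenoidal spaces, Leray projection and Stokes operator\<close>

definition smooth_solenoidal :: "real \<Rightarrow> field set" where
  "smooth_solenoidal L =
     {u. periodic L u \<and> (\<forall>i. smooth (\<lambda>y. u y $ i)) \<and> (LINT x|torus L. u x) = 0 \<and>
         (\<forall>x. (\<Sum>j\<in>UNIV. pderiv_cl j (\<lambda>y. u y $ j) x) = 0)}"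

definition Hsp :: "real \<Rightarrow> field nspace" where
  "Hsp L = (closure_in (L2dot L) (smooth_solenoidal L), nrm (L2dot L))"

definition Vsp :: "real \<Rightarrow> field nspace" where
  "Vsp L = (closure_in (Hdot L 1) (smooth_solenoidal L), nrm (Hdot L 1))"

text \<open>\<open>DA L s\<close> is the domain of the power \<open>s/2\<close> of the Stokes operator; used for \<open>s \<ge> 1\<close>.\<close>

definition DA :: "real \<Rightarrow> real \<Rightarrow> field nspace" where
  "DA L s = ({u \<in> carr (Hdot L s). AE x in torus L. divg L u x = 0}, nrm (Hdot L s))"

definition leray :: "real \<Rightarrow> field \<Rightarrow> field" where
  "leray L u = (SOME w. w \<in> carr (Hsp L) \<and> (\<forall>\<phi>\<in>carr (Hsp L). ip L (u - w) \<phi> = 0))"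

definition stokes :: "real \<Rightarrow> field \<Rightarrow> field" where
  "stokes L u = leray L (\<lambda>x. - lap L u x)"


subsection \<open>Operators of the third grade fluid equations\<close>

definition Ups :: "real \<Rightarrow> real \<Rightarrow> field \<Rightarrow> field" where
  "Ups L a1 u = (\<lambda>x. u x - a1 *\<^sub>R lap L u x)"

definition Am :: "real \<Rightarrow> field \<Rightarrow> real^2 \<Rightarrow> real^2^2" where
  "Am L u = (\<lambda>x. grad L u x + transpose (grad L u x))"

definition trilin :: "real \<Rightarrow> field \<Rightarrow> field \<Rightarrow> field \<Rightarrow> real" where
  "trilin L u v w =
     (\<Sum>i\<in>UNIV. \<Sum>j\<in>UNIV. LINT x|torus L. u x $ i * wd L i (\<lambda>y. v y $ j) x * w x $ j)"

definition conv :: "real \<Rightarrow> field \<Rightarrow> field \<Rightarrow> field" where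
  "conv L u w = (\<lambda>x. \<chi> j. \<Sum>i\<in>UNIV. u x $ i * wd L i (\<lambda>y. w y $ j) x)"

definition tgrad :: "real \<Rightarrow> field \<Rightarrow> field \<Rightarrow> field" where
  "tgrad L u w = (\<lambda>x. \<Sum>j\<in>UNIV. u x $ j *\<^sub>R sgrad L (\<lambda>y. w y $ j) x)"

text \<open>
  The duality pairing of \<open>(I - a1 \<Delta>) w\<close> with \<open>\<phi>\<close> for an \<open>H\<^sup>1\<close> field \<open>w\<close>, where the Laplacian of \<open>w\<close>
  is the functional sending \<open>\<phi>\<close> to minus the integral of \<open>\<nabla>w : \<nabla>\<phi>\<close>.
\<close>

definition helmholtz_pairing :: "real \<Rightarrow> real \<Rightarrow> field \<Rightarrow> field \<Rightarrow> real" where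
  "helmholtz_pairing L a1 w \<phi> =
     ip L w \<phi> + a1 * (LINT x|torus L. frob (grad L w x) (grad L \<phi> x))"


section \<open>Noise\<close>

definition usual_filtration :: "'w measure \<Rightarrow> (real \<Rightarrow> 'w measure) \<Rightarrow> bool" where
  "usual_filtration M F \<longleftrightarrow>
     (\<forall>t\<ge>0. subalgebra M (F t)) \<and>
     (\<forall>s t. 0 \<le> s \<and> s \<le> t \<longrightarrow> sets (F s) \<subseteq> sets (F t)) \<and>
     (\<forall>t\<ge>0. sets (F t) = (\<Inter>s\<in>{t<..}. sets (F s))) \<and>
     (\<forall>N\<in>null_sets M. \<forall>B. B \<subseteq> N \<longrightarrow> B \<in> sets (F 0))"

definition hilbert_schmidt :: "real \<Rightarrow> ('u::{real_inner,complete_space} \<Rightarrow> field) \<Rightarrow> bool" where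
  "hilbert_schmidt L G \<longleftrightarrow>
     range G \<subseteq> carr (Hsp L) \<and>
     (\<forall>a b h k. AE x in torus L. G (a *\<^sub>R h + b *\<^sub>R k) x = a *\<^sub>R G h x + b *\<^sub>R G k x) \<and>
     (\<exists>C. \<forall>h. nrm (Hsp L) (G h) \<le> C * norm h) \<and>
     (\<exists>B. pairwise orthogonal B \<and> (\<forall>e\<in>B. norm e = 1) \<and> closure (span B) = UNIV \<and>
          (\<lambda>e. (nrm (Hsp L) (G e))\<^sup>2) summable_on B)"

definition adj :: "real \<Rightarrow> ('u::{real_inner,complete_space} \<Rightarrow> field) \<Rightarrow> field \<Rightarrow> 'u" where
  "adj L G \<phi> = (THE h. \<forall>k. h \<bullet> k = ip L \<phi> (G k))"

definition centred_gaussian :: "real \<Rightarrow> real measure" where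
  "centred_gaussian var =
     (if var = 0 then return borel 0 else density lborel (\<lambda>x. ennreal (normal_density 0 (sqrt var) x)))"

definition wiener_process ::
  "real \<Rightarrow> 'w measure \<Rightarrow> (real \<Rightarrow> 'w measure) \<Rightarrow> (field \<Rightarrow> field) \<Rightarrow> ('w \<Rightarrow> real \<Rightarrow> field) \<Rightarrow> bool" where
  "wiener_process L M F Q W \<longleftrightarrow>
     (\<forall>t\<ge>0. (\<lambda>\<omega>. W \<omega> t) \<in> measurable (F t) (nborel (Hsp L))) \<and>
     (AE \<omega> in M. AE x in torus L. W \<omega> 0 x = 0) \<and>
     (AE \<omega> in M. W \<omega> \<in> cont_paths {0..} (Hsp L)) \<and>
     (\<forall>s t. 0 \<le> s \<and> s < t \<longrightarrow>
        prob_space.indep_set M (sets (F s))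
          {(\<lambda>\<omega>. W \<omega> t - W \<omega> s) -` B \<inter> space M | B. B \<in> sets (nborel (Hsp L))} \<and>
        (\<forall>\<phi>\<in>carr (Hsp L).
           distr M borel (\<lambda>\<omega>. ip L (W \<omega> t - W \<omega> s) \<phi>) = centred_gaussian ((t - s) * ip L (Q \<phi>) \<phi>)))"


section \<open>State equation\<close>

definition state_solution ::
  "real \<Rightarrow> real \<Rightarrow> real \<Rightarrow> real \<Rightarrow> real \<Rightarrow> real \<Rightarrow> 'w measure \<Rightarrow> (real \<Rightarrow> 'w measure) \<Rightarrow>
   ('w \<Rightarrow> real \<Rightarrow> field) \<Rightarrow> ('w \<Rightarrow> real \<Rightarrow> field) \<Rightarrow> field \<Rightarrow> ('w \<Rightarrow> real \<Rightarrow> field) \<Rightarrow> bool" where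
  "state_solution L T \<nu> a1 a2 \<beta> M F W f v0 v \<longleftrightarrow>
     (\<forall>t\<in>{0..T}. (\<lambda>\<omega>. v \<omega> t) \<in> measurable (F t) (nborel (DA L 2))) \<and>
     (AE \<omega> in M. v \<omega> \<in> cont_paths {0..T} (DA L 2) \<inter> bochner_Linf (lebesgue_on {0..T}) (DA L 3)) \<and>
     (\<forall>t\<in>{0..T}. \<forall>\<phi>\<in>carr (Hsp L). AE \<omega> in M.
        ip L (Ups L a1 (v \<omega> t)) \<phi> =
          ip L (Ups L a1 v0) \<phi>
          - (LINT s|lebesgue_on {0..t}.
               \<nu> * ip L (stokes L (v \<omega> s)) \<phi>
               + trilin L (v \<omega> s) (Ups L a1 (v \<omega> s)) \<phi>
               + trilin L \<phi> (v \<omega> s) (Ups L a1 (v \<omega> s))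
               - (a1 + a2) * ip L (divm L (\<lambda>x. Am L (v \<omega> s) x ** Am L (v \<omega> s) x)) \<phi>
               - \<beta> * ip L (divm L (\<lambda>x. frob (Am L (v \<omega> s) x) (Am L (v \<omega> s) x) *\<^sub>R Am L (v \<omega> s) x)) \<phi>)
          + (LINT s|lebesgue_on {0..t}. ip L (f \<omega> s) \<phi>)
          + ip L (W \<omega> t) \<phi>)"


section \<open>Adjoint system\<close>

text \<open>
  \<open>q\<close> is the distributional derivative on \<open>(0,T)\<close> of the path \<open>h\<close>. The vector-valued identity
  between Bochner integrals is tested with the functionals \<open>ip L _ \<phi>\<close>, which separate the points
  of \<open>Hsp L\<close>.
\<close>

definition time_deriv :: "real \<Rightarrow> real \<Rightarrow> (real \<Rightarrow> field) \<Rightarrow> (real \<Rightarrow> field) \<Rightarrow> bool" where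
  "time_deriv L T h q \<longleftrightarrow>
     (\<forall>\<psi> :: real \<Rightarrow> real. \<forall>\<phi>\<in>carr (Hsp L).
        (\<forall>n x. (deriv ^^ n) \<psi> differentiable (at x)) \<and>
        (\<exists>a b. 0 < a \<and> b < T \<and> (\<forall>t. t \<notin> {a..b} \<longrightarrow> \<psi> t = 0)) \<longrightarrow>
        (LINT t|lebesgue_on {0..T}. deriv \<psi> t * ip L (h t) \<phi>) =
        - (LINT t|lebesgue_on {0..T}. \<psi> t * ip L (q t) \<phi>))"

text \<open>The right-hand side of the adjoint equation, paired with \<open>\<phi>\<close>.\<close>

definition adjoint_rhs ::
  "real \<Rightarrow> real \<Rightarrow> real \<Rightarrow> real \<Rightarrow> real \<Rightarrow> field \<Rightarrow> field \<Rightarrow> field \<Rightarrow> field \<Rightarrow> real" where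
  "adjoint_rhs L \<nu> a1 a2 \<beta> g v p \<phi> =
     ip L g \<phi>
     - \<nu> * ip L (stokes L p) \<phi>
     + helmholtz_pairing L a1 (conv L v p) \<phi>
     - ip L (tgrad L p (Ups L a1 v)) \<phi>
     - helmholtz_pairing L a1 (conv L p v) \<phi>
     + ip L (conv L p (Ups L a1 v)) \<phi>
     + (a1 + a2) * ip L (divm L (\<lambda>x. Am L v x ** Am L p x + Am L p x ** Am L v x)) \<phi>
     + \<beta> * ip L (divm L (\<lambda>x. frob (Am L v x) (Am L v x) *\<^sub>R Am L p x)) \<phi>
     + 2 * \<beta> * ip L (divm L (\<lambda>x. frob (Am L p x) (Am L v x) *\<^sub>R Am L v x)) \<phi>"

text \<open>
  With \<open>q = \<partial>\<^sub>t p\<close> valued in \<open>Vsp L\<close>, the time derivative of \<open>Ups L a1 p\<close> is \<open>(I - a1 \<Delta>) q\<close>, an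
  element of the dual of \<open>Vsp L\<close>.
\<close>

definition adjoint_solution ::
  "real \<Rightarrow> real \<Rightarrow> real \<Rightarrow> real \<Rightarrow> real \<Rightarrow> real \<Rightarrow> 'w measure \<Rightarrow>
   ('w \<Rightarrow> real \<Rightarrow> field) \<Rightarrow> ('w \<Rightarrow> real \<Rightarrow> field) \<Rightarrow> ('w \<Rightarrow> real \<Rightarrow> field) \<Rightarrow> bool" where
  "adjoint_solution L T \<nu> a1 a2 \<beta> M g v p \<longleftrightarrow>
     (\<forall>t\<in>{0..T}. (\<lambda>\<omega>. p \<omega> t) \<in> measurable M (nborel (Vsp L))) \<and>
     (AE \<omega> in M.
        p \<omega> \<in> cont_paths {0..T} (Vsp L) \<inter> bochner_Linf (lebesgue_on {0..T}) (DA L 2) \<and>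
        (AE x in torus L. p \<omega> T x = 0) \<and>
        (\<exists>q\<in>carr (bochner_Lp (lebesgue_on {0..T}) (Vsp L) 2).
           time_deriv L T (p \<omega>) q \<and>
           (AE t in lebesgue_on {0..T}. \<forall>\<phi>\<in>carr (Vsp L).
              - helmholtz_pairing L a1 (q t) \<phi> = adjoint_rhs L \<nu> a1 a2 \<beta> (g \<omega> t) (v \<omega> t) (p \<omega> t) \<phi>)))"

end

theory Submission
 imports Defs
begin

text \<open>
The proof is pathwise and works with Fourier coefficients. A mean-zero solenoidal field is determined
by the scalar sequence \<open>p k\<close> of its coefficients along \<open>i k\<^sup>\<bottom>/|k|\<close>, and with \<open>rho k = (1 + a1 |2 pi k/L|^2)^(1/2)\<close>
the adjoint system becomes \<open>- rho k ^ 2 * p' k = g k + (SUM j. K k j * p j)\<close> with terminal value 0.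
The \<open>H\<^sup>3\<close> bound on \<open>v\<close> splits \<open>K\<close> into a transport part, which is \<open>rho k ^ 2\<close> times a skew-Hermitian matrix, and
a lower order part. By the Schur test the Hermitian parts of \<open>K\<close> in the \<open>V\<close> and the \<open>D(A)\<close> inner products
are bounded, so Gronwall's lemma bounds the Galerkin solutions in \<open>D(A)\<close> and makes them a Cauchy sequence in
\<open>V\<close>, and the same estimate gives uniqueness. The Galerkin solutions are limits of Picard iterations, hence
measurable in \<open>\<omega>\<close>. A solution in the distributional sense solves the integrated equations by the
du Bois-Reymond lemma.
\<close>

text \<open>The term \<open>(I - a1 \<Delta>)[(v . \<nabla>) p]\<close> has order three while
  \<open>Ups\<close> on the left has order two, so the equation is not an ODE with a bounded
  operator in any Sobolev space. Its matrix entries are \<open>rho k ^ 2\<close> times skew entries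
  of size at most \<open>min (rho k) (rho j)\<close> times coefficients of \<open>v\<close>. In the
  \<open>V\<close> product the skew part leaves the factor \<open>rho k ^ 2 - rho j ^ 2\<close>, in
  the \<open>D(A)\<close> product \<open>rho k ^ 4 - rho j ^ 4\<close>. As \<open>rho\<close> is
  Lipschitz, one factor \<open>rho (k - j)\<close> replaces the missing derivative. It falls on
  \<open>v\<close>, whose coefficients are a square summable sequence divided by
  \<open>rho ^ 3\<close>; two powers of \<open>rho (k - j)\<close> remain, and
  \<open>1 / rho ^ 2\<close> is square summable in dimension two. This balance dictates the weights
  of all Schur bounds. The Cauchy property uses two norms at once: differences of Galerkin solutions
  are merely bounded in \<open>D(A)\<close>, but they are paired with the image of the high modes,
  which are of size \<open>n ^ (-1/2)\<close> in \<open>V\<close>.\<close>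

abbreviation (input) "cor == complex_of_real"

abbreviation (input) "iv T == lebesgue_on {0..T::real}"

abbreviation (input) "cp u i == (%x. u x $ i)"

abbreviation (input) lims (infix "---->" 60) where "X ----> l == X \<longlonglongrightarrow> l"

section \<open>Fourier coefficients on the torus\<close>

locale torus2 =
 fixes L :: real
 assumes L_pos: "L > 0"
begin

abbreviation cell :: "(real^2) set" where "cell \<equiv> {x. ALL i. 0 <= x $ i & x $ i < L}"

abbreviation kap :: real where "kap \<equiv> 2 * pi / L"

abbreviation tor :: "(real^2) measure" where "tor \<equiv> torus L"

definition chr :: "int^2 => real^2 => complex" where "chr k x = cis (kap * (freq k \<bullet> x))"

definition fc :: "(real^2 => real) => int^2 => complex" where
 "fc f k = (LINT x|tor. cor (f x) * cnj (chr k x)) / cor (L^2)"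

lemma kap_pos: "kap > 0" using L_pos by simp

lemma fourier_nth: "fourier L u k $ i = fc (cp u i) k"
 by (simp add: fourier_def fc_def chr_def cis_cnj)

lemma cell_borel [measurable]: "cell : sets borel" by measurable

lemma cell_lebesgue: "cell : sets lebesgue"
 using cell_borel by simp

lemma cell_cbox: "cell <= cbox 0 (\<chi> i. L)" "box 0 (\<chi> i. L) <= cell"
 by (auto simp: mem_box_cart less_eq_real_def)

lemma emeasure_cell: "emeasure lebesgue cell = ennreal (L^2)"
proof -
 have p: "(\<Prod>b\<in>Basis. ((\<chi> i. L) - (0::real^2)) \<bullet> b) = L^2"
 proof -
  have "((\<chi> i. L) - (0::real^2)) \<bullet> b = L" if "b : Basis" for b :: "real^2"
   using that by (auto simp: Basis_vec_def inner_axis)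
  then show ?thesis by (simp add: DIM_cart)
 qed
 have n: "!!b. b : Basis ==> (0::real^2) \<bullet> b <= (\<chi> i. L) \<bullet> b"
  using L_pos by (auto simp: Basis_vec_def inner_axis)
 have "emeasure lebesgue (cbox 0 (\<chi> i::2. L)) = ennreal (L^2)"
  using emeasure_lborel_cbox[OF n] p by simp
 moreover have "emeasure lebesgue (box 0 (\<chi> i::2. L)) = ennreal (L^2)"
  using emeasure_lborel_box[OF n] p by simp
 moreover have "emeasure lebesgue cell <= emeasure lebesgue (cbox 0 (\<chi> i::2. L))"
  by (rule emeasure_mono[OF cell_cbox(1)]) simp
 moreover have "emeasure lebesgue (box 0 (\<chi> i::2. L)) <= emeasure lebesgue cell"
  by (rule emeasure_mono[OF cell_cbox(2) cell_lebesgue])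
 ultimately show ?thesis by simp
qed

lemma space_tor: "space tor = cell" by (simp add: torus_def)

lemma finite_measure_tor: "finite_measure tor"
 by (rule finite_measureI) (simp add: torus_def emeasure_restrict_space emeasure_cell cell_lebesgue)

lemma measure_tor: "measure tor (space tor) = L^2"
 unfolding measure_def space_tor by (simp add: torus_def emeasure_restrict_space cell_lebesgue emeasure_cell)

sublocale tor: finite_measure tor by (rule finite_measure_tor)

lemma borel_measurable_tor: "f : borel_measurable borel ==> f : borel_measurable tor"
 unfolding torus_def by (intro measurable_restrict_space1 measurable_completion) auto

lemma integrable_continuous_tor:
 fixes f :: "real^2 => 'b::{banach,second_countable_topology}"
 assumes "continuous_on UNIV f"
 shows "integrable tor f"
proof -
 have "compact (f ` cbox 0 (\<chi> i. L))"
  by (intro compact_continuous_image continuous_on_subset[OF assms]) auto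
 then obtain B where B: "!!x. x : cbox 0 (\<chi> i. L) ==> norm (f x) <= B"
  by (metis bounded_iff compact_imp_bounded imageI)
 show ?thesis
 proof (rule tor.integrable_const_bound[of _ B])
  show "AE x in tor. norm (f x) <= B"
   by (rule AE_I2) (use B cell_cbox in "auto simp: space_tor")
  show "f : borel_measurable tor"
   by (rule borel_measurable_tor[OF borel_measurable_continuous_onI[OF assms]])
 qed
qed

lemma integral_tor:
 fixes f :: "real^2 => 'b::{banach,second_countable_topology}"
 shows "(LINT x|tor. f x) = (LINT x|lebesgue. indicator cell x *\<^sub>R f x)"
 unfolding torus_def using cell_lebesgue by (subst integral_restrict_space) auto

section \<open>Translation invariance on the torus and orthogonality of the characters\<close>

lemma lebesgue_integral_shift:
 fixes f :: "real^2 => 'b::{banach,second_countable_topology}"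
 assumes [measurable]: "f : borel_measurable borel"
 shows "(LINT x|lebesgue. f (a + x)) = (LINT x|lebesgue. f x)"
proof -
 have "(LINT x|lebesgue. f (a + x)) = (LINT x|lborel. f (a + x))"
  by (rule integral_completion) simp
 also have "... = (LINT x|distr lborel borel ((+) a). f x)"
  by (subst integral_distr) auto
 also have "... = (LINT x|lebesgue. f x)"
  by (simp add: lborel_distr_plus integral_completion)
 finally show ?thesis .
qed

text \<open>The cell shifted by \<open>s\<close> is cut at the face \<open>x $ i = L\<close>: the
  part that stays inside is \<open>Q1\<close>, the part that sticks out is \<open>Q2\<close> moved
  by one period.\<close>

lemma integral_tor_shift:
 fixes f :: "real^2 => 'b::{banach,second_countable_topology}"
 assumes f: "continuous_on UNIV f" and per: "periodic L f" and s: "0 <= s" "s <= L"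
 shows "(LINT x|tor. f (x + axis i s)) = (LINT x|tor. f x)"
proof -
 have fm [measurable]: "f : borel_measurable borel"
  by (rule borel_measurable_continuous_onI[OF f])
 define Q1 where "Q1 = {x:cell. x $ i >= s}"
 define Q2 where "Q2 = {x:cell. x $ i < s}"
 have [measurable]: "Q1 : sets borel" "Q2 : sets borel"
  unfolding Q1_def Q2_def by measurable
 have int: "integrable lebesgue (%x. indicator Q x *\<^sub>R f x)"
  if Q: "Q : sets borel" "Q <= cell" for Q
 proof -
  have "integrable lebesgue (%x. indicator cell x *\<^sub>R f x)"
   using integrable_continuous_tor[OF f] cell_lebesgue unfolding torus_def
   by (subst (asm) integrable_restrict_space) auto
  then have "integrable lebesgue (%x. indicator Q x *\<^sub>R indicator cell x *\<^sub>R f x)"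
   by (rule integrable_mult_indicator[rotated]) (use Q in simp)
  moreover have "indicator Q x *\<^sub>R indicator cell x *\<^sub>R f x = indicator Q x *\<^sub>R f x" for x
   using Q by (auto simp: indicator_def)
  ultimately show ?thesis by (simp only:)
 qed
 have Q2': "integrable lebesgue (%x. indicator Q2 (- axis i L + x) *\<^sub>R f (- axis i L + x))"
 proof -
  have "integrable lborel (%x. indicator Q2 x *\<^sub>R f x)"
   using int[of Q2] unfolding Q2_def by (subst integrable_completion[symmetric]) auto
  then have "integrable (distr lborel borel ((+) (- axis i L))) (%x. indicator Q2 x *\<^sub>R f x)"
   by (simp add: lborel_distr_plus)
  then have "integrable lborel (%x. indicator Q2 (- axis i L + x) *\<^sub>R f (- axis i L + x))"
   by (subst (asm) integrable_distr_eq) auto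
  then show ?thesis by (subst integrable_completion) auto
 qed
 have per': "f (- axis i L + x) = f x" for x
  using per unfolding periodic_def by (metis add.commute add_minus_cancel)
 have split: "indicator cell (- axis i s + x) *\<^sub>R f x =
   indicator Q1 x *\<^sub>R f x + indicator Q2 (- axis i L + x) *\<^sub>R f (- axis i L + x)" for x
 proof -
  define y where "y = x $ i"
  have c: "x : cell \<longleftrightarrow> 0 <= y & y < L & (ALL j. j ~= i --> 0 <= x $ j & x $ j < L)"
   if "y = x $ i" for x :: "real^2" and y
   using that by auto
  have 1: "- axis i s + x : cell \<longleftrightarrow> s <= y & y < L + s & (ALL j. j ~= i --> 0 <= x $ j & x $ j < L)"
   by (subst c[OF refl]) (auto simp: y_def axis_def)
  have 2: "- axis i L + x : Q2 \<longleftrightarrow> L <= y & y < L + s & (ALL j. j ~= i --> 0 <= x $ j & x $ j < L)"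
   unfolding Q2_def mem_Collect_eq using s by (auto simp: y_def axis_def)
  have 3: "x : Q1 \<longleftrightarrow> s <= y & y < L & (ALL j. j ~= i --> 0 <= x $ j & x $ j < L)"
  proof -
   have "x : Q1 \<longleftrightarrow> x : cell & s <= y" by (auto simp: Q1_def y_def)
   then show ?thesis unfolding c[OF y_def] using s by auto
  qed
  show ?thesis unfolding per' using 1 2 3 s
   by (cases "y < L") (auto simp: indicator_def)
 qed
 have "(LINT x|tor. f (x + axis i s)) = (LINT x|lebesgue. indicator cell x *\<^sub>R f (axis i s + x))"
  by (simp add: integral_tor add.commute)
 also have "... = (LINT x|lebesgue. (%y. indicator cell (- axis i s + y) *\<^sub>R f y) (axis i s + x))"
  by simp
 also have "... = (LINT y|lebesgue. indicator cell (- axis i s + y) *\<^sub>R f y)"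
 proof (rule lebesgue_integral_shift)
  have [measurable]: "(%y. indicat_real cell (- axis i s + y)) : borel_measurable borel"
   by (rule measurable_compose[OF _ borel_measurable_indicator[OF cell_borel]])
    (intro borel_measurable_continuous_onI continuous_intros)
  show "(%y. indicator cell (- axis i s + y) *\<^sub>R f y) : borel_measurable borel" by measurable
 qed
 also have "... = (LINT x|lebesgue. indicator Q1 x *\<^sub>R f x)
   + (LINT x|lebesgue. indicator Q2 (- axis i L + x) *\<^sub>R f (- axis i L + x))"
  unfolding split by (rule Bochner_Integration.integral_add[OF int Q2']) (auto simp: Q1_def)
 also have "(LINT x|lebesgue. indicator Q2 (- axis i L + x) *\<^sub>R f (- axis i L + x))
   = (LINT x|lebesgue. indicator Q2 x *\<^sub>R f x)"
  by (rule lebesgue_integral_shift) measurable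
 also have "(LINT x|lebesgue. indicator Q1 x *\<^sub>R f x) + ...
   = (LINT x|lebesgue. indicator Q1 x *\<^sub>R f x + indicator Q2 x *\<^sub>R f x)"
  by (rule Bochner_Integration.integral_add[symmetric]) (auto simp: Q1_def Q2_def intro!: int)
 also have "... = (LINT x|tor. f x)"
  unfolding integral_tor
  by (rule Bochner_Integration.integral_cong) (auto simp: Q1_def Q2_def indicator_def)
 finally show ?thesis .
qed

lemma chr_continuous: "continuous_on A (chr k)"
 unfolding chr_def by (intro continuous_intros)

lemma norm_chr [simp]: "norm (chr k x) = 1" by (simp add: chr_def)

lemma freq_simps: "freq (k + j) = freq k + freq j" "freq (k - j) = freq k - freq j" "freq (- k) = - freq k" "freq 0 = 0"
 by (auto simp: freq_def vec_eq_iff)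

lemma freq_nth [simp]: "freq k $ i = real_of_int (k $ i)" by (simp add: freq_def)

lemma chr_add: "chr (k + j) x = chr k x * chr j x"
 by (simp add: chr_def freq_simps inner_add_left algebra_simps cis_mult)

lemma chr_uminus: "chr (- k) x = cnj (chr k x)"
 by (simp add: chr_def freq_simps cis_cnj)

lemma chr_diff: "chr (k - j) x = chr k x * cnj (chr j x)"
 by (metis chr_add chr_uminus uminus_add_conv_diff add.commute)

lemma chr_0 [simp]: "chr 0 x = 1" by (simp add: chr_def freq_simps)

lemma chr_shift: "chr k (x + y) = chr k x * chr k y"
 by (simp add: chr_def inner_add_right algebra_simps cis_mult)

lemma chr_axis: "chr k (axis i s) = cis (kap * k $ i * s)"
 by (simp add: chr_def inner_axis algebra_simps)

lemma periodic_chr: "periodic L (chr k)"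
 unfolding periodic_def
proof (intro allI)
 fix x i
 have "kap * k $ i * L = 2 * pi * real_of_int (k $ i)" using L_pos by simp
 then have "chr k (axis i L) = 1" by (simp add: chr_axis)
 then show "chr k (x + axis i L) = chr k x" by (simp add: chr_shift)
qed

lemma integral_chr: "(LINT x|tor. chr k x) = (if k = 0 then cor (L^2) else 0)"
proof (cases "k = 0")
 case True
 then show ?thesis using measure_tor by (simp add: scaleR_conv_of_real)
next
 case False
 then obtain i where i: "k $ i ~= 0" by (auto simp: vec_eq_iff)
 \<comment> \<open>Half a wavelength in direction \<open>i\<close>: this shift turns
   \<open>chr k\<close> into its negative, so the integral equals its own negative.\<close>
 define s where "s = L / (2 * \<bar>real_of_int (k $ i)\<bar>)"
 have k1: "\<bar>real_of_int (k $ i)\<bar> >= 1" using i by linarith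
 have s: "0 <= s" "s <= L" using L_pos k1 by (auto simp: s_def divide_simps)
 have "(LINT x|tor. chr k (x + axis i s)) = (LINT x|tor. chr k x)"
  by (rule integral_tor_shift[OF chr_continuous periodic_chr s])
 moreover have "chr k (axis i s) = -1"
 proof -
  have "kap * k $ i * s = (if k $ i > 0 then pi else - pi)"
   using i L_pos by (auto simp: s_def field_simps)
  then show ?thesis by (auto simp: chr_axis complex_eq_iff)
 qed
 ultimately show ?thesis using False by (simp add: chr_shift)
qed

lemma integral_chr_cnj: "(LINT x|tor. chr k x * cnj (chr j x)) = (if k = j then cor (L^2) else 0)"
 by (simp add: chr_diff[symmetric] integral_chr)

subsection \<open>Uniqueness of Fourier coefficients\<close>

lemma integrable_mult_chr:
 assumes "integrable tor (f :: _ => complex)" shows "integrable tor (%x. f x * chr k x)" "integrable tor (%x. f x * cnj (chr k x))"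
proof -
 have m: "chr k : borel_measurable tor" "(%x. cnj (chr k x)) : borel_measurable tor"
  by (auto intro!: borel_measurable_tor borel_measurable_continuous_onI continuous_intros chr_continuous)
 have fm: "f : borel_measurable tor" using assms by auto
 show "integrable tor (%x. f x * chr k x)" "integrable tor (%x. f x * cnj (chr k x))"
  by (rule Bochner_Integration.integrable_bound[OF assms]; use m fm in "auto simp: norm_mult")+
qed

lemma fc_zero_chr:
 assumes "integrable tor h" "!!k. fc h k = 0"
 shows "(LINT x|tor. cor (h x) * chr k x) = 0"
 using assms(2)[of "- k"] L_pos by (simp add: fc_def chr_uminus)

text \<open>The torus as a compact subset of the plane \<open>C^2\<close>, where the
  Stone-Weierstrass theorem is available. Both coordinates are characters, so real polynomials in
  \<open>emb\<close> are trigonometric polynomials.\<close>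

definition emb :: "real^2 => complex \<times> complex" where "emb x = (cis (kap * x $ 1), cis (kap * x $ 2))"

lemma emb_chr: "emb x = (chr (axis 1 1) x, chr (axis 2 1) x)"
proof -
 have "freq (axis i 1) \<bullet> x = x $ i" for i
 proof -
  have "freq (axis i 1) = axis i 1" by (auto simp: freq_def axis_def vec_eq_iff)
  then show ?thesis by (simp add: inner_axis')
 qed
 then show ?thesis by (simp add: emb_def chr_def)
qed

lemma emb_continuous: "continuous_on A emb"
 unfolding emb_def by (intro continuous_intros)

text \<open>Asking that all coefficients vanish, for arbitrary \<open>h\<close>, makes the induction
  work: in the product case the second hypothesis is applied to \<open>h\<close> times the first
  polynomial.\<close>

lemma integral_polynomial_emb:
 assumes "real_polynomial_function g" "integrable tor h" "!!k. fc h k = 0"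
 shows "integrable tor (%x. h x * g (emb x)) & (ALL k. fc (%x. h x * g (emb x)) k = 0)"
 using assms
proof (induction arbitrary: h rule: real_polynomial_function.induct)
 case (linear g)
 interpret g: bounded_linear g by fact
 have int: "integrable tor (%x. cor (h x))" using linear by simp
 \<comment> \<open>A real linear form on \<open>C^2\<close> is the sum over both coordinates of
   \<open>Re (a j * z j)\<close>, that is of half the sum of \<open>a j * z j\<close> and its
   conjugate.\<close>
 define a where "a j = (if j = (1::2) then cor (g (1,0)) - \<i> * g (\<i>,0) else cor (g (0,1)) - \<i> * g (0,\<i>))" for j
 have g_eq: "cor (g (emb x)) = (SUM j:UNIV. (a j * chr (axis j 1) x + cnj (a j) * cnj (chr (axis j 1) x)) / 2)" for x
 proof -
  have "(z, w) = Re z *\<^sub>R (1, 0) + Im z *\<^sub>R (\<i>, 0) + Re w *\<^sub>R (0, 1) + Im w *\<^sub>R (0, \<i>)" for z w :: complex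
   by (auto simp: complex_eq_iff)
  then have *: "g (z, w) = Re z * g (1,0) + Im z * g (\<i>,0) + Re w * g (0,1) + Im w * g (0,\<i>)" for z w
   by (metis g.add g.scaleR real_scaleR_def)
  show ?thesis unfolding emb_chr by (subst *) (simp add: UNIV_2 a_def complex_eq_iff field_simps)
 qed
 have hg: "cor (h x * g (emb x)) * cnj (chr k x) =
  (SUM j:UNIV. (a j / 2) * (cor (h x) * chr (axis j 1 - k) x) +
    (cnj (a j) / 2) * (cor (h x) * cnj (chr (axis j 1 + k) x)))" for x k
  by (simp add: g_eq chr_add chr_diff sum_distrib_left sum_distrib_right algebra_simps add_divide_distrib)
 have i1: "integrable tor (%x. cor (h x * g (emb x)) * cnj (chr k x))" for k
  unfolding hg by (intro Bochner_Integration.integrable_sum Bochner_Integration.integrable_add integrable_mult_right integrable_mult_chr int)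
 have i2: "integrable tor (%x. cor (h x * g (emb x)))"
  using i1[of 0] by (simp only: chr_0 complex_cnj_one mult_1_right)
 have "fc (%x. h x * g (emb x)) k = 0" for k
 proof -
  have z: "(LINT x|tor. cor (h x) * chr m x) = 0" "(LINT x|tor. cor (h x) * cnj (chr m x)) = 0" for m
   using fc_zero_chr[of h m] fc_zero_chr[of h "-m"] linear by (auto simp: chr_uminus)
  show ?thesis
   unfolding fc_def hg
   by (subst Bochner_Integration.integral_sum)
    (auto simp: z int integrable_mult_chr Bochner_Integration.integrable_add integrable_mult_right)
 qed
 moreover have "integrable tor (%x. h x * g (emb x))"
  using integrable_Re[OF i2] by (simp only: Re_complex_of_real)
 ultimately show ?case by blast
next
 case (const c)
 have "(LINT x|tor. cor (h x * c) * cnj (chr k x)) = cor c * (LINT x|tor. cor (h x) * cnj (chr k x))" for k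
  by (subst Bochner_Integration.integral_mult_right_zero[symmetric]) (simp add: mult_ac)
 moreover have "(LINT x|tor. cor (h x) * cnj (chr k x)) = 0" for k
  using const(2)[of k] L_pos by (simp add: fc_def)
 ultimately show ?case using const by (simp add: fc_def)
next
 case (add f g)
 note f = add.IH(1)[OF add.prems] and g = add.IH(2)[OF add.prems]
 have i: "integrable tor (%x. cor (h x * f (emb x)) * cnj (chr k x))"
   "integrable tor (%x. cor (h x * g (emb x)) * cnj (chr k x))" for k
  by (rule integrable_mult_chr(2), rule integrable_of_real, use f g in simp)+
 have "fc (%x. h x * (f (emb x) + g (emb x))) k = fc (%x. h x * f (emb x)) k + fc (%x. h x * g (emb x)) k" for k
  unfolding fc_def of_real_add of_real_mult distrib_left distrib_right add_divide_distrib[symmetric]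
  using i[of k] by simp
 moreover have "integrable tor (%x. h x * (f (emb x) + g (emb x)))"
  using f g unfolding distrib_left by (intro Bochner_Integration.integrable_add) simp_all
 ultimately show ?case using f g by simp
next
 case (mult f g)
 note f = mult.IH(1)[OF mult.prems]
 have "integrable tor (%x. h x * f (emb x) * g (emb x)) & (ALL k. fc (%x. h x * f (emb x) * g (emb x)) k = 0)"
  by (rule mult.IH(2)) (use f in simp_all)
 then show ?case by (simp add: mult.assoc)
qed

lemma fc_zero_integral: "fc h 0 = 0 ==> (LINT x|tor. h x) = 0"
 using L_pos by (simp add: fc_def)

text \<open>A polynomial that is uniformly \<open>e\<close>-close on the compact image of the closed
  cell changes the integral by at most \<open>e\<close> times the L1 norm of
  \<open>h\<close>.\<close>

lemma integral_continuous_emb: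
 assumes c: "continuous_on UNIV g" and h: "integrable tor h" "!!k. fc h k = 0"
 shows "(LINT x|tor. h x * g (emb x)) = 0"
proof -
 have comp: "compact (emb ` cbox 0 (\<chi> i. L))"
  by (intro compact_continuous_image emb_continuous) auto
 define C where "C = (LINT x|tor. \<bar>h x\<bar>)"
 have C0: "C >= 0" unfolding C_def by (rule Bochner_Integration.integral_nonneg) auto
 have gm: "(%x. g (emb x)) : borel_measurable tor"
  by (intro borel_measurable_tor borel_measurable_continuous_onI continuous_on_compose2[OF c emb_continuous]) auto
 have "\<bar>LINT x|tor. h x * g (emb x)\<bar> <= e * C" if e: "e > 0" for e
 proof -
  obtain q where q: "real_polynomial_function q" "!!z. z : emb ` cbox 0 (\<chi> i. L) ==> \<bar>g z - q z\<bar> < e"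
   using Stone_Weierstrass_real_polynomial_function[OF comp continuous_on_subset[OF c] e] by blast
  have q0: "integrable tor (%x. h x * q (emb x))" "fc (%x. h x * q (emb x)) 0 = 0"
   using integral_polynomial_emb[OF q(1) h] by auto
  have b: "norm (h x * (g (emb x) - q (emb x))) <= e * \<bar>h x\<bar>" if "x : space tor" for x
  proof -
   have "\<bar>g (emb x) - q (emb x)\<bar> <= e"
    using q(2)[of "emb x"] that cell_cbox(1) unfolding space_tor by (meson imageI less_imp_le subsetD)
   then have "\<bar>h x\<bar> * \<bar>g (emb x) - q (emb x)\<bar> <= \<bar>h x\<bar> * e" by (intro mult_left_mono) auto
   then show ?thesis by (simp add: abs_mult mult.commute)
  qed
  have ie: "integrable tor (%x. e * \<bar>h x\<bar>)" using h by auto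
  have qm: "(%x. q (emb x)) : borel_measurable tor"
   by (intro borel_measurable_tor borel_measurable_continuous_onI continuous_on_compose2[OF _ emb_continuous]
    continuous_on_polymonial_function q(1)[unfolded real_polynomial_function_eq]) auto
  have i: "integrable tor (%x. h x * (g (emb x) - q (emb x)))"
   by (rule Bochner_Integration.integrable_bound[OF ie]) (use b gm qm h e in "auto intro!: AE_I2 simp: abs_mult")
  have "(LINT x|tor. h x * g (emb x)) = (LINT x|tor. h x * (g (emb x) - q (emb x)) + h x * q (emb x))"
   by (simp add: algebra_simps)
  also have "... = (LINT x|tor. h x * (g (emb x) - q (emb x)))"
   using i q0 by (simp add: fc_zero_integral)
  finally have eq: "(LINT x|tor. h x * g (emb x)) = (LINT x|tor. h x * (g (emb x) - q (emb x)))" .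
  have "norm (LINT x|tor. h x * (g (emb x) - q (emb x))) <= (LINT x|tor. e * \<bar>h x\<bar>)"
   by (rule Bochner_Integration.integral_norm_bound_integral[OF i ie b])
  then show ?thesis by (simp add: eq C_def)
 qed
 note * = this
 have "\<bar>LINT x|tor. h x * g (emb x)\<bar> <= 0 + d" if d: "d > 0" for d
 proof -
  have "d / (C + 1) * C <= d" using C0 d by (simp add: field_simps)
  then show ?thesis using *[of "d / (C + 1)"] d C0 by simp
 qed
 then have "\<bar>LINT x|tor. h x * g (emb x)\<bar> <= 0" by (rule field_le_epsilon)
 then show ?thesis by simp
qed

lemma emb_inj: "inj_on emb cell"
proof (rule inj_onI)
 fix x y assume x: "x : cell" and y: "y : cell" and e: "emb x = emb y"
 have a: "x $ i = y $ i" if "cis (kap * x $ i) = cis (kap * y $ i)" for i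
 proof -
  have r: "0 <= kap * z & kap * z < 2 * pi" if "0 <= z" "z < L" for z
   using that L_pos by (auto simp: field_simps)
  have "sin (kap * x $ i) = sin (kap * y $ i) & cos (kap * x $ i) = cos (kap * y $ i)"
   using that by (auto simp: complex_eq_iff)
  then obtain n :: int where n: "kap * x $ i = kap * y $ i + 2 * pi * n"
   by (auto simp: sin_cos_eq_iff)
  have "n = 0"
  proof -
   have "\<bar>2 * pi * n\<bar> < 2 * pi" using r[of "x $ i"] r[of "y $ i"] x y n unfolding abs_less_iff mem_Collect_eq by (smt (verit))
   then have "\<bar>real_of_int n\<bar> < 1" by (simp add: abs_mult)
   then show ?thesis by linarith
  qed
  then show ?thesis using n kap_pos L_pos by simp
 qed
 show "x = y" using e a[of 1] a[of 2] by (simp add: emb_def vec_eq_iff forall_2)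
qed

lemma integral_compact_zero:
 assumes h: "integrable tor h" "!!k. fc h k = 0" and A: "compact A" "A <= cell"
 shows "(LINT x|tor. h x * indicator A x) = 0"
proof (cases "A = {}")
 case False
 have cl: "closed (emb ` A)" "emb ` A ~= {}"
  using A False by (auto intro!: compact_imp_closed compact_continuous_image emb_continuous)
 \<comment> \<open>Continuous functions that decrease to the indicator of the image of
   \<open>A\<close>. Since \<open>emb\<close> is injective on the half-open cell, their pullbacks
   tend to the indicator of \<open>A\<close> there.\<close>
 define g where "g n z = max 0 (1 - real n * infdist z (emb ` A))" for n z
 have gc: "continuous_on UNIV (g n)" for n
  unfolding g_def by (intro continuous_intros)
 have "(%n. LINT x|tor. h x * g n (emb x)) ----> (LINT x|tor. h x * indicator A x)"
 proof (rule integral_dominated_convergence[where w="%x. \<bar>h x\<bar>"])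
  show "(%x. h x * indicator A x) : borel_measurable tor"
  proof -
   have "indicat_real A : borel_measurable tor"
    by (intro borel_measurable_tor borel_measurable_indicator) (use A in "auto intro: borel_compact")
   then show ?thesis using h by auto
  qed
  show "(%x. h x * g n (emb x)) : borel_measurable tor" for n
  proof -
   have "(%x. g n (emb x)) : borel_measurable tor"
    by (intro borel_measurable_tor borel_measurable_continuous_onI continuous_on_compose2[OF gc emb_continuous]) auto
   then show ?thesis using h by auto
  qed
  show "integrable tor (%x. \<bar>h x\<bar>)" using h by auto
  show "AE x in tor. norm (h x * g n (emb x)) <= \<bar>h x\<bar>" for n
  proof (rule AE_I2)
   fix x
   have "\<bar>g n (emb x)\<bar> <= 1" by (auto simp: g_def infdist_nonneg)
   then show "norm (h x * g n (emb x)) <= \<bar>h x\<bar>" by (simp add: abs_mult mult_left_le)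
  qed
  show "AE x in tor. (%n. h x * g n (emb x)) ----> h x * indicator A x"
  proof (rule AE_I2)
   fix x assume x: "x : space tor"
   have "(%n. g n (emb x)) ----> indicator A x"
   proof (cases "x : A")
    case True
    then have "g n (emb x) = 1" for n by (simp add: g_def)
    then show ?thesis using True by simp
   next
    case False
    then have "emb x ~: emb ` A" using x A emb_inj unfolding space_tor by (meson inj_on_image_mem_iff)
    then have d: "infdist (emb x) (emb ` A) > 0"
     using cl by (metis in_closed_iff_infdist_zero infdist_nonneg less_eq_real_def)
    obtain N where N: "real N * infdist (emb x) (emb ` A) >= 1" 
     using reals_Archimedean3[OF d] by (meson less_imp_le)
    have "g n (emb x) = 0" if "n >= N" for n
    proof -
     have "real n * infdist (emb x) (emb ` A) >= real N * infdist (emb x) (emb ` A)"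
      using that d by (intro mult_right_mono) auto
     then show ?thesis using N by (simp add: g_def)
    qed
    then show ?thesis using False
     by (intro tendsto_eventually) (auto simp: eventually_sequentially)
   qed
   then show "(%n. h x * g n (emb x)) ----> h x * indicator A x" by (intro tendsto_intros)
  qed
 qed
 moreover have "(LINT x|tor. h x * g n (emb x)) = 0" for n
  by (rule integral_continuous_emb[OF gc h])
 ultimately have "(%n::nat. 0::real) ----> (LINT x|tor. h x * indicator A x)" by simp
 then show ?thesis by (simp add: LIMSEQ_const_iff)
qed simp

text \<open>Inner regularity: the set where \<open>h\<close> is positive is exhausted up to small
  measure by closed subsets, and each of these is null because \<open>h\<close> is positive on it
  and has integral 0 over it.\<close>

lemma fc_zero_nonpos:
 assumes h: "integrable tor h" "!!k. fc h k = 0"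
 shows "AE x in tor. h x <= 0"
proof -
 define S where "S = {x : cell. h x > 0}"
 have "S : sets tor"
 proof -
  have "{x : space tor. h x > 0} : sets tor" using h(1) by measurable
  then show ?thesis by (simp add: S_def space_tor)
 qed
 then have S: "S : sets lebesgue"
  by (auto simp: torus_def sets_restrict_space cell_lebesgue)
 have neg: "emeasure lebesgue A = 0" if A: "closed A" "A <= S" for A
 proof -
  have cA: "compact A" using A cell_cbox(1) bounded_cbox unfolding S_def compact_eq_bounded_closed
   by (metis (no_types, lifting) bounded_subset mem_Collect_eq subset_iff)
  have Ac: "A <= cell" using A by (auto simp: S_def)
  have nn: "AE x in tor. 0 <= h x * indicator A x"
   by (rule AE_I2) (use A in "auto simp: S_def indicator_def")
  have z: "(LINT x|tor. h x * indicator A x) = 0" by (rule integral_compact_zero[OF h cA Ac])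
  have "integrable tor (%x. h x * indicator A x)"
  proof (rule Bochner_Integration.integrable_bound[OF h(1)])
   show "(%x. h x * indicator A x) : borel_measurable tor"
    by (intro borel_measurable_times borel_measurable_integrable[OF h(1)] borel_measurable_tor borel_measurable_indicator)
     (use A in auto)
  qed (auto simp: indicator_def)
  then have "AE x in tor. h x * indicator A x = 0"
   using integral_nonneg_eq_0_iff_AE[of tor "%x. h x * indicator A x"] z nn by blast
  then have "AE x in tor. x ~: A"
   by eventually_elim (use A in "auto simp: S_def indicator_def")
  then have "AE x in lebesgue. x : cell --> x ~: A"
   unfolding torus_def by (subst (asm) AE_restrict_space_iff) (use cell_lebesgue in auto)
  then have "AE x in lebesgue. x ~: A" by eventually_elim (use Ac in auto)
  then show ?thesis
   using AE_iff_measurable[of A lebesgue "%x. x ~: A"] A by (auto simp: borel_closed)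
 qed
 have eps: "emeasure lebesgue S <= 0 + ennreal e" if e: "e > 0" for e
 proof -
  obtain A where A: "closed A" "A <= S" "S - A : lmeasurable" "emeasure lebesgue (S - A) < ennreal e"
   using sets_lebesgue_inner_closed[OF S e] by metis
  have "emeasure lebesgue S <= emeasure lebesgue A + emeasure lebesgue (S - A)"
   using emeasure_subadditive[of A lebesgue "S - A"] A S by (simp add: Un_absorb1 borel_closed)
  then show ?thesis using neg[OF A(1,2)] A(4) by simp
 qed
 have "emeasure lebesgue S <= 0" by (rule ennreal_le_epsilon) (rule eps)
 then have "S : null_sets lebesgue" using S by auto
 then have "AE x in lebesgue. x ~: S" by (rule AE_not_in)
 then have "AE x in lebesgue. x : cell --> h x <= 0" by eventually_elim (auto simp: S_def)
 then show ?thesis unfolding torus_def by (subst AE_restrict_space_iff) (use cell_lebesgue in auto)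
qed

lemma fc_uminus: "fc (%x. - f x) k = - fc f k" by (simp add: fc_def)

theorem fc_zero_AE:
 assumes h: "integrable tor h" "!!k. fc h k = 0"
 shows "AE x in tor. h x = 0"
proof -
 have "AE x in tor. h x <= 0" by (rule fc_zero_nonpos[OF h])
 moreover have "AE x in tor. - h x <= 0" by (rule fc_zero_nonpos) (use h in "auto simp: fc_uminus")
 ultimately show ?thesis by eventually_elim auto
qed

lemma fc_add: "integrable tor f ==> integrable tor g ==> fc (%x. f x + g x) k = fc f k + fc g k"
 unfolding fc_def by (simp add: ring_distribs add_divide_distrib integrable_mult_chr)

lemma fc_cmul: "fc (%x. c * f x) k = cor c * fc f k"
proof -
 have "(LINT x|tor. cor (c * f x) * cnj (chr k x)) = (LINT x|tor. cor c * (cor (f x) * cnj (chr k x)))"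
  by (simp add: mult_ac)
 then show ?thesis unfolding fc_def by simp
qed

lemma fc_diff: "integrable tor f ==> integrable tor g ==> fc (%x. f x - g x) k = fc f k - fc g k"
 using fc_add[of f "%x. - g x" k] by (simp add: fc_uminus)

lemma fc_sum: "(!!i. i : I ==> integrable tor (f i)) ==> fc (%x. SUM i:I. f i x) k = (SUM i:I. fc (f i) k)"
proof (induction I rule: infinite_finite_induct)
 case (insert a I)
 then show ?case using fc_add[of "f a" "%x. SUM i:I. f i x" k] by (simp add: Bochner_Integration.integrable_sum)
qed (auto simp: fc_def)

lemma fc_cong_AE:
 assumes "AE x in tor. f x = g x" "f : borel_measurable tor" "g : borel_measurable tor"
 shows "fc f k = fc g k"
proof -
 have [measurable]: "(%x. cnj (chr k x)) : borel_measurable tor"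
  by (intro borel_measurable_tor borel_measurable_continuous_onI continuous_intros chr_continuous)
 note assms(2,3)[measurable]
 have "AE x in tor. cor (f x) * cnj (chr k x) = cor (g x) * cnj (chr k x)"
  using assms(1) by eventually_elim simp
 moreover have "(%x. cor (f x) * cnj (chr k x)) : borel_measurable tor"
  "(%x. cor (g x) * cnj (chr k x)) : borel_measurable tor" by measurable
 ultimately show ?thesis unfolding fc_def by (simp add: integral_cong_AE)
qed

theorem fc_eq_AE:
 assumes "integrable tor f" "integrable tor g" "!!k. fc f k = fc g k"
 shows "AE x in tor. f x = g x"
proof -
 have "AE x in tor. f x - g x = 0" by (rule fc_zero_AE) (use assms in "auto simp: fc_diff")
 then show ?thesis by eventually_elim simp
qed

lemma fc_cnj: "fc f (- k) = cnj (fc f k)"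
proof -
 have "(LINT x|tor. cor (f x) * cnj (chr (- k) x)) = (LINT x|tor. cnj (cor (f x) * cnj (chr k x)))"
  by (simp only: chr_uminus complex_cnj_mult complex_cnj_cnj complex_cnj_complex_of_real)
 also have "... = cnj (LINT x|tor. cor (f x) * cnj (chr k x))" by (rule Bochner_Integration.integral_cnj)
 finally show ?thesis by (simp only: fc_def complex_cnj_divide complex_cnj_complex_of_real)
qed

end

context torus2 begin

subsection \<open>Square integrable functions and trigonometric polynomials\<close>

definition l2t :: "(real^2 => real) => bool" where
 "l2t f \<longleftrightarrow> f : borel_measurable tor & integrable tor (%x. (f x)^2)"

lemma l2t_meas: "l2t f ==> f : borel_measurable tor" by (simp add: l2t_def)

lemma l2t_mult_integrable:
 assumes "l2t f" "l2t g" shows "integrable tor (%x. f x * g x)"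
proof (rule Bochner_Integration.integrable_bound)
 show "integrable tor (%x. (f x)^2 + (g x)^2)" using assms by (auto simp: l2t_def)
 show "(%x. f x * g x) : borel_measurable tor" using assms by (auto simp: l2t_def)
 show "AE x in tor. norm (f x * g x) <= norm ((f x)^2 + (g x)^2)"
 proof (rule AE_I2)
  fix x
  have "2 * (\<bar>f x\<bar> * \<bar>g x\<bar>) <= (f x)^2 + (g x)^2"
   using sum_squares_bound[of "\<bar>f x\<bar>" "\<bar>g x\<bar>"] by (simp add: mult.assoc)
  moreover have "0 <= \<bar>f x\<bar> * \<bar>g x\<bar>" by simp
  ultimately show "norm (f x * g x) <= norm ((f x)^2 + (g x)^2)"
   unfolding real_norm_def abs_mult by linarith
 qed
qed

lemma l2t_const: "l2t (%x. c)" by (simp add: l2t_def)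

lemma l2t_integrable: "l2t f ==> integrable tor f"
 using l2t_mult_integrable[of f "%x. 1"] by (simp add: l2t_const)

lemma l2t_add: "l2t f ==> l2t g ==> l2t (%x. f x + g x)"
 using l2t_mult_integrable[of f g] by (auto simp: l2t_def power2_sum mult.assoc)

lemma l2t_cmul: "l2t f ==> l2t (%x. c * f x)"
 by (auto simp: l2t_def power_mult_distrib)

lemma l2t_uminus: "l2t f ==> l2t (%x. - f x)"
 by (auto simp: l2t_def)

lemma l2t_diff: "l2t f ==> l2t g ==> l2t (%x. f x - g x)"
 using l2t_add[of f "%x. - g x"] by (simp add: l2t_uminus)

lemma l2t_continuous: "continuous_on UNIV f ==> l2t f"
 unfolding l2t_def
 by (intro conjI integrable_continuous_tor borel_measurable_tor borel_measurable_continuous_onI continuous_intros) auto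

lemma l2t_cong_AE:
 assumes "l2t f" "AE x in tor. g x = f x" "g : borel_measurable tor" shows "l2t g"
proof -
 have "integrable tor (%x. (g x)^2)"
  by (rule integrable_cong_AE_imp[of _ "%x. (f x)^2"])
   (use assms in "auto simp: l2t_def elim!: eventually_mono")
 then show ?thesis using assms by (simp add: l2t_def)
qed

lemma l2t_bounded_mult:
 assumes f: "l2t f" and g: "g : borel_measurable tor" and B: "AE x in tor. \<bar>g x\<bar> <= B"
 shows "l2t (%x. g x * f x)"
proof -
 have "integrable tor (%x. (g x * f x)^2)"
 proof (rule Bochner_Integration.integrable_bound)
  show "integrable tor (%x. B^2 * (f x)^2)" using f by (auto simp: l2t_def)
  show "(%x. (g x * f x)^2) : borel_measurable tor" using f g by (auto simp: l2t_def)
  show "AE x in tor. norm ((g x * f x)^2) <= norm (B^2 * (f x)^2)"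
   using B
  proof eventually_elim
   case (elim x)
   then have "(g x)^2 <= B^2" using abs_le_square_iff[of "g x" B] by linarith
   then have "(g x)^2 * (f x)^2 <= B^2 * (f x)^2" by (rule mult_right_mono) simp
   then show ?case by (simp add: power_mult_distrib)
  qed
 qed
 then show ?thesis using f g by (auto simp: l2t_def)
qed

lemma Re_mult_cnj: "Re (z * cnj z) = (norm z)^2"
 by (simp add: cmod_power2) (simp add: power2_eq_square)

text \<open>Taking the real part makes this a real function for every choice of coefficients; for
  symmetric index sets and \<open>herm\<close> coefficients the sum is already real, see
  \<open>tp_complex\<close>.\<close>

definition tp :: "(int^2) set => (int^2 => complex) => real^2 => real" where
 "tp F c x = Re (SUM k:F. c k * chr k x)"

definition herm :: "(int^2 => complex) => bool" where "herm c \<longleftrightarrow> (ALL k. c (- k) = cnj (c k))"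

definition symset :: "(int^2) set => bool" where "symset F \<longleftrightarrow> (ALL k:F. - k : F)"

lemma herm_fc: "herm (fc f)" by (simp add: herm_def fc_cnj)

lemma tp_continuous: "continuous_on A (tp F c)"
 unfolding tp_def[abs_def] by (intro continuous_intros chr_continuous)

lemma periodic_tp: "periodic L (tp F c)"
 using periodic_chr unfolding periodic_def tp_def by simp

lemma tp_complex:
 assumes "symset F" "herm c"
 shows "cor (tp F c x) = (SUM k:F. c k * chr k x)"
proof -
 have "cnj (SUM k:F. c k * chr k x) = (SUM k:F. c (- k) * chr (- k) x)"
  using assms by (simp add: herm_def chr_uminus)
 also have "... = (SUM k:F. c k * chr k x)"
  by (rule sum.reindex_bij_witness[of _ uminus uminus]) (use assms in "auto simp: symset_def")
 finally have "(SUM k:F. c k * chr k x) : \<real>" by (simp only: Reals_cnj_iff)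
 then show ?thesis unfolding tp_def by (simp only: of_real_Re)
qed

lemma fc_chr: "(LINT x|tor. chr k x * cnj (chr j x)) / cor (L^2) = (if k = j then 1 else 0)"
 using L_pos by (simp add: integral_chr_cnj)

lemma fc_tp:
 assumes "symset F" "herm c" "finite F"
 shows "fc (tp F c) k = (if k : F then c k else 0)"
proof -
 have i: "integrable tor (%x. c j * (chr j x * cnj (chr k x)))" for j
  by (intro integrable_mult_right integrable_continuous_tor continuous_intros chr_continuous)
 have "fc (tp F c) k = (LINT x|tor. (SUM j:F. c j * (chr j x * cnj (chr k x)))) / cor (L^2)"
  by (simp add: fc_def tp_complex[OF assms(1,2)] sum_distrib_right mult.assoc)
 also have "... = (SUM j:F. c j * ((LINT x|tor. chr j x * cnj (chr k x)) / cor (L^2)))"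
  using i by (simp add: Bochner_Integration.integral_sum sum_divide_distrib)
 also have "... = (SUM j:F. if k = j then c j else 0)"
  unfolding fc_chr by (intro sum.cong) auto
 finally show ?thesis using assms(3) by simp
qed

lemma integral_mult_tp:
 assumes "integrable tor f" "symset F" "herm c" "finite F"
 shows "(LINT x|tor. f x * tp F c x) = L^2 * (SUM k:F. Re (fc f k * cnj (c k)))"
proof -
 have i: "integrable tor (%x. cnj (c j) * (cor (f x) * cnj (chr j x)))" for j
  by (intro integrable_mult_right integrable_mult_chr integrable_of_real assms)
 have r: "cor (tp F c x) = (SUM k:F. cnj (c k) * cnj (chr k x))" for x
  using arg_cong[OF tp_complex[OF assms(2,3)], of cnj x] by simp
 have e: "cor (f x * tp F c x) = (SUM j:F. cnj (c j) * (cor (f x) * cnj (chr j x)))" for x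
  by (simp add: r sum_distrib_left mult_ac)
 have "cor (LINT x|tor. f x * tp F c x) = (LINT x|tor. cor (f x * tp F c x))"
  by (simp del: of_real_mult)
 also have "... = (SUM j:F. cnj (c j) * (LINT x|tor. cor (f x) * cnj (chr j x)))"
  unfolding e using i by (simp add: Bochner_Integration.integral_sum)
 also have "... = cor (L^2) * (SUM j:F. fc f j * cnj (c j))"
  using L_pos by (simp add: fc_def sum_distrib_left mult_ac)
 finally have "Re (cor (LINT x|tor. f x * tp F c x)) = Re (cor (L^2) * (SUM j:F. fc f j * cnj (c j)))"
  by simp
 then show ?thesis by (simp del: of_real_power)
qed

lemma integral_tp_sq:
 assumes "symset F" "herm c" "finite F"
 shows "(LINT x|tor. (tp F c x)^2) = L^2 * (SUM k:F. (norm (c k))^2)"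
proof -
 have "Re (fc (tp F c) k * cnj (c k)) = (norm (c k))^2" if "k : F" for k
  using that by (simp only: fc_tp[OF assms] if_True Re_mult_cnj)
 then show ?thesis
  using integral_mult_tp[of "tp F c" F c] assms integrable_continuous_tor[OF tp_continuous]
  by (simp add: power2_eq_square[of "tp F c _"])
qed

lemma bessel_sym:
 assumes f: "l2t f" and F: "finite F" "symset F"
 shows "L^2 * (SUM k:F. (norm (fc f k))^2) <= (LINT x|tor. (f x)^2)"
proof -
 let ?p = "tp F (fc f)"
 have p: "l2t ?p" by (rule l2t_continuous[OF tp_continuous])
 have fp: "(LINT x|tor. f x * ?p x) = L^2 * (SUM k:F. (norm (fc f k))^2)"
  using integral_mult_tp[OF l2t_integrable[OF f] F(2) herm_fc[of f] F(1)]
  by (simp only: Re_mult_cnj)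
 have pp: "(LINT x|tor. (?p x)^2) = L^2 * (SUM k:F. (norm (fc f k))^2)"
  by (rule integral_tp_sq[OF F(2) herm_fc F(1)])
 have "0 <= (LINT x|tor. (f x - ?p x)^2)" by simp
 also have "... = (LINT x|tor. (f x)^2 + ((?p x)^2 - 2 * (f x * ?p x)))"
  by (simp add: power2_diff algebra_simps)
 also have "... = (LINT x|tor. (f x)^2) + ((LINT x|tor. (?p x)^2) - 2 * (LINT x|tor. f x * ?p x))"
  using f p l2t_mult_integrable[OF f p]
  by (subst Bochner_Integration.integral_add Bochner_Integration.integral_diff | simp add: l2t_def)+
 finally show ?thesis unfolding fp pp by simp
qed

lemma bessel:
 assumes f: "l2t f" and F: "finite F"
 shows "(SUM k:F. (norm (fc f k))^2) <= (LINT x|tor. (f x)^2) / L^2"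
proof -
 have "(SUM k:F. (norm (fc f k))^2) <= (SUM k:F Un uminus ` F. (norm (fc f k))^2)"
  by (rule sum_mono2) (use F in auto)
 also have "... <= (LINT x|tor. (f x)^2) / L^2"
 proof -
  have "symset (F Un uminus ` F)" by (auto simp: symset_def image_iff)
  then show ?thesis
   using bessel_sym[OF f, of "F Un uminus ` F"] F L_pos by (simp add: field_simps)
 qed
 finally show ?thesis .
qed

definition boxes :: "nat => (int^2) set" where "boxes n = {k. ALL i. \<bar>k $ i\<bar> <= int n}"

lemma finite_boxes: "finite (boxes n)"
proof (rule finite_subset)
 show "boxes n <= (%(a, b). vector [a, b]) ` ({- int n..int n} \<times> {- int n..int n})"
 proof
  fix k :: "int^2" assume k: "k : boxes n"
  have "k = vector [k $ 1, k $ 2]" by (simp add: vec_eq_iff forall_2)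
  moreover have "\<bar>k $ 1\<bar> <= int n" "\<bar>k $ 2\<bar> <= int n" using k by (auto simp: boxes_def)
  ultimately show "k : (%(a, b). vector [a, b]) ` ({- int n..int n} \<times> {- int n..int n})"
   by (intro image_eqI[of _ _ "(k $ 1, k $ 2)"]) auto
 qed
qed auto

lemma symset_boxes: "symset (boxes n)" by (auto simp: symset_def boxes_def)

lemma boxes_mono: "m <= n ==> boxes m <= boxes n" by (auto simp: boxes_def) (meson of_nat_mono order_trans)

lemma boxes_exhaust: "filterlim boxes (finite_subsets_at_top UNIV) sequentially"
 unfolding filterlim_finite_subsets_at_top
proof (intro allI impI)
 fix X :: "(int^2) set" assume "finite X & X <= UNIV"
 then have X: "finite X" by simp
 define N where "N = (SUM k:X. SUM i:UNIV. nat \<bar>k $ i\<bar>)"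
 have "X <= boxes N"
 proof
  fix k assume k: "k : X"
  have "nat \<bar>k $ i\<bar> <= N" for i
  proof -
   have "nat \<bar>k $ i\<bar> <= (SUM i:UNIV. nat \<bar>k $ i\<bar>)" by (rule member_le_sum) auto
   also have "... <= N" unfolding N_def by (rule member_le_sum[OF k]) (use X in auto)
   finally show ?thesis .
  qed
  then show "k : boxes N" by (auto simp: boxes_def nat_le_iff)
 qed
 then show "\<forall>\<^sub>F n in sequentially. finite (boxes n) & X <= boxes n & boxes n <= UNIV"
  using boxes_mono finite_boxes unfolding eventually_sequentially by (meson subset_UNIV subset_trans)
qed

lemma has_sum_boxes: "(f has_sum s) UNIV ==> (%n. sum f (boxes n)) ----> s"
 unfolding has_sum_def by (rule filterlim_compose[OF _ boxes_exhaust])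

subsection \<open>The Riesz-Fischer theorem\<close>

lemma tp_diff:
 assumes "finite G" "F <= G" shows "tp G c x - tp F c x = tp (G - F) c x"
 using sum_diff[OF assms, of "%k. c k * chr k x"] by (simp add: tp_def)

text \<open>Completeness of L2 by a direct construction: along a subsequence whose remainders fall
  below \<open>(1/4)^i\<close> the L1 norms of the increments are summable, so the partial sums
  converge almost everywhere below an integrable majorant. Fatou's lemma gives the norm bound,
  dominated convergence the coefficients.\<close>

theorem riesz_fischer:
 assumes c: "herm c" and s: "(%k. (norm (c k))^2) summable_on UNIV"
 obtains f where "periodic L f" "l2t f" "!!k. fc f k = c k"
  "(LINT x|tor. (f x)^2) <= L^2 * (\<Sum>\<^sub>\<infinity>k. (norm (c k))^2)"
proof -
 define S where "S = (\<Sum>\<^sub>\<infinity>k. (norm (c k))^2)"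
 define A where "A n = (SUM k:boxes n. (norm (c k))^2)" for n
 have lim: "A ----> S"
  unfolding A_def S_def by (rule has_sum_boxes[OF has_sum_infsum[OF s]])
 have AS: "A n <= S" for n
  unfolding A_def S_def by (rule finite_sum_le_infsum[OF s finite_boxes]) auto
 have "EX n. ALL m>=n. S - A m <= (1/4)^i" for i :: nat
 proof -
  obtain n where "!!m. m >= n ==> norm (A m - S) < (1/4)^i"
   using LIMSEQ_D[OF lim, of "(1/4)^i"] by auto
  then have "!!m. m >= n ==> S - A m <= (1/4)^i" by (smt (verit) real_norm_def)
  then show ?thesis by blast
 qed
 then obtain r where r: "!!i m. m >= r i ==> S - A m <= (1/4)^i" by metis
 \<comment> \<open>Summing the \<open>r j\<close> makes \<open>R\<close> increasing, adding
   \<open>i\<close> makes it unbounded.\<close>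
 define R where "R i = (SUM j<=i. r j) + i" for i :: nat
 have Rr: "R i >= r i" for i unfolding R_def using member_le_sum[of i "{..i}" r] by simp
 have Rm: "R i <= R (Suc i)" for i by (simp add: R_def)
 have Ri: "R i >= i" for i by (simp add: R_def)
 define f where "f i = tp (boxes (R i)) c" for i
 have fcont: "continuous_on UNIV (f i)" for i unfolding f_def by (rule tp_continuous)
 have fl2: "l2t (f i)" for i by (rule l2t_continuous[OF fcont])
 have fm [measurable]: "f i : borel_measurable tor" for i by (rule l2t_meas[OF fl2])
 have fsq: "(LINT x|tor. (f i x)^2) = L^2 * A (R i)" for i
  unfolding f_def A_def by (rule integral_tp_sq[OF symset_boxes c finite_boxes])
 define D where "D i x = f (Suc i) x - f i x" for i x
 have Dtp: "D i = tp (boxes (R (Suc i)) - boxes (R i)) c" for i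
  unfolding D_def f_def by (rule ext, rule tp_diff[OF finite_boxes boxes_mono[OF Rm]])
 have Dl2: "l2t (D i)" for i unfolding Dtp by (rule l2t_continuous[OF tp_continuous])
 have Dsq: "(LINT x|tor. (D i x)^2) <= L^2 * (1/4)^i" for i
 proof -
  have "(LINT x|tor. (D i x)^2) = L^2 * (SUM k:boxes (R (Suc i)) - boxes (R i). (norm (c k))^2)"
   unfolding Dtp by (rule integral_tp_sq) (use finite_boxes symset_boxes c in "auto simp: symset_def boxes_def")
  also have "... = L^2 * (A (R (Suc i)) - A (R i))"
   unfolding A_def by (subst sum_diff[OF finite_boxes boxes_mono[OF Rm]]) simp
  also have "... <= L^2 * (1/4)^i"
   using r[OF Rr[of i]] AS[of "R (Suc i)"] by (intro mult_left_mono) auto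
  finally show ?thesis .
 qed
 have Dm [measurable]: "D i : borel_measurable tor" for i by (rule l2t_meas[OF Dl2])
 have DI: "integrable tor (D i)" for i by (rule l2t_integrable[OF Dl2])
 have D1: "(LINT x|tor. \<bar>D i x\<bar>) <= L^2 * (1/2)^i" for i
 proof -
  \<comment> \<open>Young's inequality with the weight \<open>2^i\<close>, matched to the L2 size
    \<open>(1/2)^i\<close> of the increment, so that both summands have the same order.\<close>
  have p: "\<bar>D i x\<bar> <= (1/2)^i / 2 + 2^i / 2 * (D i x)^2" for x
  proof -
   have "0 <= 2^i * (\<bar>D i x\<bar> - (1/2)^i)^2" by simp
   also have "... = 2^i * (D i x)^2 - 2 * \<bar>D i x\<bar> + (1/2)^i"
    by (simp add: power2_diff algebra_simps power2_eq_square power_one_over field_simps)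
   finally show ?thesis by simp
  qed
  have "(LINT x|tor. \<bar>D i x\<bar>) <= (LINT x|tor. (1/2)^i / 2 + 2^i / 2 * (D i x)^2)"
   by (rule integral_mono) (use Dl2[of i] DI p in "auto simp: l2t_def")
  also have "... = L^2 * ((1/2)^i / 2) + 2^i / 2 * (LINT x|tor. (D i x)^2)"
   using Dl2[of i] measure_tor by (simp add: l2t_def)
  also have "... <= L^2 * ((1/2)^i / 2) + 2^i / 2 * (L^2 * (1/4)^i)"
   by (intro add_left_mono mult_left_mono Dsq) auto
  also have "... = L^2 * (1/2)^i"
  proof -
   have "(2::real)^i * (1/4)^i = (1/2)^i" by (simp add: power_mult_distrib[symmetric])
   then show ?thesis by (simp add: field_simps)
  qed
  finally show ?thesis .
 qed
 have fin: "(\<integral>\<^sup>+x. (\<Sum>i. ennreal \<bar>D i x\<bar>) \<partial>tor) < \<infinity>"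
 proof -
  have "(\<integral>\<^sup>+x. (\<Sum>i. ennreal \<bar>D i x\<bar>) \<partial>tor) = (\<Sum>i. \<integral>\<^sup>+x. ennreal \<bar>D i x\<bar> \<partial>tor)"
   by (rule nn_integral_suminf) measurable
  also have "... = (\<Sum>i. ennreal (LINT x|tor. \<bar>D i x\<bar>))"
   by (intro suminf_cong nn_integral_eq_integral) (use DI in auto)
  also have "... <= (\<Sum>i. ennreal (L^2 * (1/2)^i))"
   by (intro suminf_le ennreal_leI D1) auto
  also have "... = ennreal (\<Sum>i. L^2 * (1/2)^i)"
   by (rule suminf_ennreal2) (auto intro!: summable_mult summable_geometric)
  also have "... < \<infinity>" by simp
  finally show ?thesis .
 qed
 define W where "W x = \<bar>f 0 x\<bar> + (\<Sum>i. \<bar>D i x\<bar>)" for x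
 have ae: "AE x in tor. summable (%i. \<bar>D i x\<bar>)"
 proof -
  have "AE x in tor. (\<Sum>i. ennreal \<bar>D i x\<bar>) ~= \<infinity>"
   by (rule nn_integral_noteq_infinite) (use fin in auto)
  then show ?thesis by eventually_elim (auto intro: summable_suminf_not_top)
 qed
 have Wm: "W : borel_measurable tor" unfolding W_def by measurable
 have WI: "integrable tor W"
 proof -
  have "integrable tor (%x. \<Sum>i. \<bar>D i x\<bar>)"
  proof (rule integrableI_nonneg)
   show "AE x in tor. 0 <= (\<Sum>i. \<bar>D i x\<bar>)" using ae by eventually_elim (auto intro: suminf_nonneg)
   have "(\<integral>\<^sup>+x. ennreal (\<Sum>i. \<bar>D i x\<bar>) \<partial>tor) = (\<integral>\<^sup>+x. (\<Sum>i. ennreal \<bar>D i x\<bar>) \<partial>tor)"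
   proof (rule nn_integral_cong_AE)
    show "AE x in tor. ennreal (\<Sum>i. \<bar>D i x\<bar>) = (\<Sum>i. ennreal \<bar>D i x\<bar>)"
     using ae by eventually_elim (simp add: suminf_ennreal2)
   qed
   then show "(\<integral>\<^sup>+x. ennreal (\<Sum>i. \<bar>D i x\<bar>) \<partial>tor) < \<infinity>" using fin by simp
  qed measurable
  then show ?thesis unfolding W_def using l2t_integrable[OF fl2[of 0]] by auto
 qed
 have fsum: "f n x = f 0 x + (SUM i<n. D i x)" for n x
  by (induction n) (auto simp: D_def)
 have fW: "AE x in tor. ALL n. \<bar>f n x\<bar> <= W x"
  using ae
 proof eventually_elim
  case (elim x)
  show ?case
  proof
   fix n
   have "\<bar>SUM i<n. D i x\<bar> <= (SUM i<n. \<bar>D i x\<bar>)" by (rule sum_abs)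
   also have "... <= (\<Sum>i. \<bar>D i x\<bar>)" by (rule sum_le_suminf[OF elim]) auto
   finally show "\<bar>f n x\<bar> <= W x" unfolding W_def fsum[of n x] by linarith
  qed
 qed
 \<comment> \<open>Since \<open>lim\<close> has a value at every point, \<open>g\<close> inherits
   exact periodicity although convergence holds only almost everywhere.\<close>
 define g where "g x = lim (%n. f n x)" for x
 have gm [measurable]: "g : borel_measurable tor" unfolding g_def by measurable
 have fg: "AE x in tor. (%n. f n x) ----> g x"
  using ae
 proof eventually_elim
  case (elim x)
  have "summable (%i. D i x)" using elim by (rule summable_rabs_cancel)
  then have "convergent (%n. SUM i<n. D i x)" by (simp add: summable_iff_convergent)
  then have "convergent (%n. f 0 x + (SUM i<n. D i x))" by (intro convergent_add convergent_const)
  moreover have "(%n. f n x) = (%n. f 0 x + (SUM i<n. D i x))" by (rule ext) (rule fsum)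
  ultimately have "convergent (%n. f n x)" by (simp only:)
  then show ?case by (simp add: g_def convergent_LIMSEQ_iff)
 qed
 have gsq: "(\<integral>\<^sup>+x. ennreal ((g x)^2) \<partial>tor) <= ennreal (L^2 * S)"
 proof -
  have "(\<integral>\<^sup>+x. ennreal ((g x)^2) \<partial>tor) = (\<integral>\<^sup>+x. liminf (%n. ennreal ((f n x)^2)) \<partial>tor)"
  proof (rule nn_integral_cong_AE)
   show "AE x in tor. ennreal ((g x)^2) = liminf (%n. ennreal ((f n x)^2))"
    using fg
   proof eventually_elim
    case (elim x)
    have "(%n. ennreal ((f n x)^2)) ----> ennreal ((g x)^2)"
     by (intro tendsto_ennrealI tendsto_intros elim)
    then show ?case by (metis lim_imp_Liminf trivial_limit_sequentially)
   qed
  qed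
  also have "... <= liminf (%n. \<integral>\<^sup>+x. ennreal ((f n x)^2) \<partial>tor)"
   by (rule nn_integral_liminf) measurable
  also have "... <= ennreal (L^2 * S)"
  proof -
   have "(\<integral>\<^sup>+x. ennreal ((f n x)^2) \<partial>tor) <= ennreal (L^2 * S)" for n
   proof -
    have "(\<integral>\<^sup>+x. ennreal ((f n x)^2) \<partial>tor) = ennreal (LINT x|tor. (f n x)^2)"
     by (rule nn_integral_eq_integral) (use fl2[of n] in "auto simp: l2t_def")
    also have "... <= ennreal (L^2 * S)"
     unfolding fsq by (intro ennreal_leI mult_left_mono AS) auto
    finally show ?thesis .
   qed
   then have "liminf (%n. \<integral>\<^sup>+x. ennreal ((f n x)^2) \<partial>tor) <= liminf (%n. ennreal (L^2 * S))"
    by (intro Liminf_mono always_eventually) auto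
   then show ?thesis by (simp add: Liminf_const)
  qed
  finally show ?thesis .
 qed
 have S0: "S >= 0" unfolding S_def by (rule infsum_nonneg) auto
 have gI: "integrable tor (%x. (g x)^2)"
  by (rule integrableI_nonneg) (use gsq in "auto simp: le_less_trans")
 then have gl2: "l2t g" by (simp add: l2t_def gm)
 have gle: "(LINT x|tor. (g x)^2) <= L^2 * S"
  using gsq nn_integral_eq_integral[OF gI] S0 by (simp add: ennreal_le_iff)
 have gper: "periodic L g"
  using periodic_tp unfolding periodic_def g_def f_def by simp
 have gfc: "fc g k = c k" for k
 proof -
  have chm [measurable]: "(%x. cnj (chr k x)) : borel_measurable tor"
   by (intro borel_measurable_tor borel_measurable_continuous_onI continuous_intros chr_continuous)
  have "(%n. LINT x|tor. cor (f n x) * cnj (chr k x)) ----> (LINT x|tor. cor (g x) * cnj (chr k x))"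
  proof (rule integral_dominated_convergence[where w=W])
   show "AE x in tor. (%n. cor (f n x) * cnj (chr k x)) ----> cor (g x) * cnj (chr k x)"
    using fg by eventually_elim (intro tendsto_intros)
   show "AE x in tor. norm (cor (f n x) * cnj (chr k x)) <= W x" for n
    using fW by eventually_elim (auto simp: norm_mult)
  qed (use WI in measurable)
  then have l1: "(%n. fc (f n) k) ----> fc g k"
   unfolding fc_def by (intro tendsto_divide tendsto_const) (use L_pos in auto)
  have l2: "\<forall>\<^sub>F n in sequentially. fc (f n) k = c k"
  proof -
   obtain N where N: "k : boxes N"
    using boxes_exhaust unfolding filterlim_finite_subsets_at_top eventually_sequentially
    by (metis finite.emptyI finite_insert insert_subset order_refl subset_UNIV)
   have "k : boxes (R n)" if "n >= N" for n
    using boxes_mono[of N "R n"] N Ri[of n] that by (meson order_trans subsetD)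
   then show ?thesis
    unfolding f_def fc_tp[OF symset_boxes c finite_boxes] eventually_sequentially by auto
  qed
  show ?thesis by (rule LIMSEQ_unique[OF l1 tendsto_eventually[OF l2]])
 qed
 show ?thesis using that[OF gper gl2 gfc] gle unfolding S_def .
qed

subsection \<open>Parseval, products and weak derivatives\<close>

lemma summable_fc_sq: "l2t f ==> (%k. (norm (fc f k))^2) summable_on UNIV"
 by (rule nonneg_bdd_above_summable_on) (auto intro!: bdd_aboveI bessel)

text \<open>Bessel's inequality is one half. For the other, the function that Riesz-Fischer builds
  from the coefficients of \<open>f\<close> agrees with \<open>f\<close> almost everywhere and has a
  norm bounded by the sum.\<close>

theorem parseval_sq:
 assumes "l2t f"
 shows "((%k. (norm (fc f k))^2) has_sum ((LINT x|tor. (f x)^2) / L^2)) UNIV"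
proof -
 let ?s = "\<Sum>\<^sub>\<infinity>k. (norm (fc f k))^2"
 have sm: "(%k. (norm (fc f k))^2) summable_on UNIV" by (rule summable_fc_sq[OF assms])
 obtain g where g: "l2t g" "!!k. fc g k = fc f k" "(LINT x|tor. (g x)^2) <= L^2 * ?s"
  using riesz_fischer[OF herm_fc sm] by metis
 have "AE x in tor. f x = g x"
  by (rule fc_eq_AE) (use assms g in "auto intro: l2t_integrable")
 then have "(LINT x|tor. (f x)^2) = (LINT x|tor. (g x)^2)"
  using assms g by (intro integral_cong_AE) (auto simp: l2t_def elim!: eventually_mono)
 then have "(LINT x|tor. (f x)^2) / L^2 <= ?s" using g(3) L_pos by (simp add: field_simps)
 moreover have "?s <= (LINT x|tor. (f x)^2) / L^2"
  by (rule infsum_le_finite_sums[OF sm bessel[OF assms]])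
 ultimately show ?thesis using has_sum_infsum[OF sm] by simp
qed

lemma parseval_Re:
 assumes f: "l2t f" and g: "l2t g"
 shows "((%k. Re (fc f k * cnj (fc g k))) has_sum ((LINT x|tor. f x * g x) / L^2)) UNIV"
proof -
 have If: "integrable tor f" "integrable tor g" using f g by (auto intro: l2t_integrable)
 have p: "((%k. (norm (fc (%x. f x + g x) k))^2) has_sum ((LINT x|tor. (f x + g x)^2) / L^2)) UNIV"
  by (rule parseval_sq[OF l2t_add[OF f g]])
 have m: "((%k. (norm (fc (%x. f x - g x) k))^2) has_sum ((LINT x|tor. (f x - g x)^2) / L^2)) UNIV"
  by (rule parseval_sq[OF l2t_diff[OF f g]])
 have "((%k. (1/4) * (norm (fc (%x. f x + g x) k))^2 + (-1/4) * (norm (fc (%x. f x - g x) k))^2) has_sum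
   ((1/4) * ((LINT x|tor. (f x + g x)^2) / L^2) + (-1/4) * ((LINT x|tor. (f x - g x)^2) / L^2))) UNIV"
  by (intro has_sum_add has_sum_cmult_right p m)
 moreover have "(1/4) * (norm (fc (%x. f x + g x) k))^2 + (-1/4) * (norm (fc (%x. f x - g x) k))^2 = Re (fc f k * cnj (fc g k))" for k
  unfolding fc_add[OF If] fc_diff[OF If] cmod_power2 by (simp add: power2_eq_square algebra_simps)
 moreover have "(1/4) * ((LINT x|tor. (f x + g x)^2) / L^2) + (-1/4) * ((LINT x|tor. (f x - g x)^2) / L^2) = (LINT x|tor. f x * g x) / L^2"
 proof -
  have "(LINT x|tor. (f x + g x)^2) - (LINT x|tor. (f x - g x)^2) = (LINT x|tor. (f x + g x)^2 - (f x - g x)^2)"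
   using l2t_add[OF f g] l2t_diff[OF f g] by (simp add: l2t_def)
  also have "... = (LINT x|tor. 4 * (f x * g x))"
   by (simp add: power2_eq_square algebra_simps)
  also have "... = 4 * (LINT x|tor. f x * g x)" by simp
  finally show ?thesis using L_pos by (simp add: field_simps)
 qed
 ultimately show ?thesis by simp
qed

text \<open>Replacing \<open>k\<close> by \<open>- k\<close> conjugates every summand because the
  functions are real. So the sum is its own conjugate, and its real part is known by
  polarization.\<close>

theorem parseval:
 assumes f: "l2t f" and g: "l2t g"
 shows "((%k. fc f k * cnj (fc g k)) has_sum cor ((LINT x|tor. f x * g x) / L^2)) UNIV"
proof -
 let ?F = "%k. fc f k * cnj (fc g k)"
 have "(%k. norm (?F k)) summable_on UNIV"
 proof (rule summable_on_comparison_test)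
  show "(%k. (norm (fc f k))^2 + (norm (fc g k))^2) summable_on UNIV"
   by (intro summable_on_add summable_fc_sq f g)
  show "norm (?F k) <= (norm (fc f k))^2 + (norm (fc g k))^2" for k
  proof -
   have "2 * (norm (fc f k) * norm (fc g k)) <= (norm (fc f k))^2 + (norm (fc g k))^2"
    using sum_squares_bound[of "norm (fc f k)" "norm (fc g k)"] by (simp add: mult.assoc)
   moreover have "0 <= norm (fc f k) * norm (fc g k)" by simp
   ultimately show ?thesis unfolding norm_mult complex_mod_cnj by linarith
  qed
 qed auto
 then have "?F summable_on UNIV" by (rule abs_summable_summable)
 then obtain s where s: "(?F has_sum s) UNIV" by (auto simp: summable_on_def)
 have "(?F has_sum cnj s) UNIV"
 proof -
  have "((%k. cnj (?F k)) has_sum cnj s) UNIV" by (subst has_sum_cnj_iff) (rule s)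
  then have "((%k. ?F (- k)) has_sum cnj s) UNIV" by (simp add: fc_cnj)
  then have "((%k. ?F k) has_sum cnj s) (uminus ` UNIV)"
   by (subst has_sum_reindex) (auto simp: o_def)
  moreover have "range uminus = (UNIV :: (int^2) set)" by (metis add.inverse_inverse surj_def)
  ultimately show ?thesis by simp
 qed
 then have "s = cnj s" using s has_sum_unique by blast
 then have im: "s = cor (Re s)" by (simp add: complex_eq_iff)
 have "((%k. Re (?F k)) has_sum Re s) UNIV" by (rule has_sum_Re[OF s])
 then have "Re s = (LINT x|tor. f x * g x) / L^2" using parseval_Re[OF f g] has_sum_unique by blast
 then show ?thesis using s im by simp
qed

lemma fc_mult_Re_chr:
 assumes "integrable tor g"
 shows "fc (%x. g x * Re (chr k x)) m = (fc g (m - k) + fc g (m + k)) / 2"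
  and "fc (%x. g x * Im (chr k x)) m = (- \<i> / 2) * (fc g (m - k) - fc g (m + k))"
proof -
 have i: "integrable tor (%x. cor (g x) * cnj (chr j x))" for j
  using assms by (intro integrable_mult_chr integrable_of_real)
 have 1: "cor (g x * Re (chr k x)) * cnj (chr m x)
   = (1/2) * (cor (g x) * cnj (chr (m - k) x) + cor (g x) * cnj (chr (m + k) x))" for x
  by (simp add: chr_diff chr_add complex_eq_iff field_simps)
 have 2: "cor (g x * Im (chr k x)) * cnj (chr m x)
   = (- \<i> / 2) * (cor (g x) * cnj (chr (m - k) x) - cor (g x) * cnj (chr (m + k) x))" for x
  by (simp add: chr_diff chr_add complex_eq_iff field_simps)
 show "fc (%x. g x * Re (chr k x)) m = (fc g (m - k) + fc g (m + k)) / 2"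
  unfolding fc_def 1 using i by (simp add: add_divide_distrib mult.commute)
 show "fc (%x. g x * Im (chr k x)) m = (- \<i> / 2) * (fc g (m - k) - fc g (m + k))"
  unfolding fc_def 2 using i by (simp add: diff_divide_distrib right_diff_distrib)
qed

text \<open>The product is only integrable, so Parseval is applied to \<open>f\<close> and the two
  real functions \<open>g * Re (chr k)\<close> and \<open>g * Im (chr k)\<close>; combined with the
  factor \<open>- \<i>\<close> they give \<open>g * cnj (chr k)\<close>.\<close>

theorem fc_mult:
 assumes f: "l2t f" and g: "l2t g"
 shows "((%m. fc f m * fc g (k - m)) has_sum fc (%x. f x * g x) k) UNIV"
proof -
 have cm: "(%x. Re (chr k x)) : borel_measurable tor" "(%x. Im (chr k x)) : borel_measurable tor"
  by (auto intro!: borel_measurable_tor borel_measurable_continuous_onI continuous_intros chr_continuous)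
 have cb: "\<bar>Re (chr k x)\<bar> <= 1" "\<bar>Im (chr k x)\<bar> <= 1" for x
  using abs_Re_le_cmod[of "chr k x"] abs_Im_le_cmod[of "chr k x"] by auto
 have g1: "l2t (%x. g x * Re (chr k x))" "l2t (%x. g x * Im (chr k x))"
  using l2t_bounded_mult[OF g cm(1), of 1] l2t_bounded_mult[OF g cm(2), of 1] cb by (auto simp: mult.commute)
 have Ig: "integrable tor g" by (rule l2t_integrable[OF g])
 have p1: "((%m. fc f m * cnj (fc (%x. g x * Re (chr k x)) m)) has_sum cor ((LINT x|tor. f x * (g x * Re (chr k x))) / L^2)) UNIV"
  by (rule parseval[OF f g1(1)])
 have p2: "((%m. fc f m * cnj (fc (%x. g x * Im (chr k x)) m)) has_sum cor ((LINT x|tor. f x * (g x * Im (chr k x))) / L^2)) UNIV"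
  by (rule parseval[OF f g1(2)])
 have "((%m. fc f m * cnj (fc (%x. g x * Re (chr k x)) m) + (- \<i>) * (fc f m * cnj (fc (%x. g x * Im (chr k x)) m))) has_sum
  (cor ((LINT x|tor. f x * (g x * Re (chr k x))) / L^2) + (- \<i>) * cor ((LINT x|tor. f x * (g x * Im (chr k x))) / L^2))) UNIV"
  by (intro has_sum_add has_sum_cmult_right p1 p2)
 moreover have "fc f m * cnj (fc (%x. g x * Re (chr k x)) m) + (- \<i>) * (fc f m * cnj (fc (%x. g x * Im (chr k x)) m)) = fc f m * fc g (k - m)" for m
 proof -
  have "fc g (k - m) = cnj (fc g (m - k))" using fc_cnj[of g "m - k"] by simp
  then show ?thesis unfolding fc_mult_Re_chr[OF Ig] by (simp add: field_simps)
 qed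
 moreover have "cor ((LINT x|tor. f x * (g x * Re (chr k x))) / L^2) + (- \<i>) * cor ((LINT x|tor. f x * (g x * Im (chr k x))) / L^2) = fc (%x. f x * g x) k"
 proof -
  have i: "integrable tor (%x. cor (f x * (g x * Re (chr k x))))" "integrable tor (%x. cor (f x * (g x * Im (chr k x))))"
   using l2t_mult_integrable[OF f g1(1)] l2t_mult_integrable[OF f g1(2)] by (auto intro: integrable_of_real simp del: of_real_mult)
  have "cor (f x * g x) * cnj (chr k x) = cor (f x * (g x * Re (chr k x))) + (- \<i>) * cor (f x * (g x * Im (chr k x)))" for x
   by (simp add: complex_eq_iff)
  then have "(LINT x|tor. cor (f x * g x) * cnj (chr k x)) =
   (LINT x|tor. cor (f x * (g x * Re (chr k x)))) + (- \<i>) * (LINT x|tor. cor (f x * (g x * Im (chr k x))))"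
   using i by (simp del: of_real_mult)
  also have "... = cor (LINT x|tor. f x * (g x * Re (chr k x))) + (- \<i>) * cor (LINT x|tor. f x * (g x * Im (chr k x)))"
   by (simp del: of_real_mult)
  finally show ?thesis unfolding fc_def by (simp add: add_divide_distrib diff_divide_distrib)
 qed
 ultimately show ?thesis by (simp only:)
qed

text \<open>The absolutely convergent series defines a function \<open>h\<close> bounded at every
  point. It has the coefficients of \<open>f\<close>, hence equals \<open>f\<close> almost
  everywhere.\<close>

lemma AE_bounded_fc:
 assumes f: "integrable tor f" and s: "(%k. norm (fc f k)) summable_on UNIV"
 shows "AE x in tor. \<bar>f x\<bar> <= (\<Sum>\<^sub>\<infinity>k. norm (fc f k))"
proof -
 define B where "B = (\<Sum>\<^sub>\<infinity>k. norm (fc f k))"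
 have bd: "norm (SUM k:F. fc f k * chr k x) <= B" if "finite F" for F x
 proof -
  have "norm (SUM k:F. fc f k * chr k x) <= (SUM k:F. norm (fc f k))"
   by (rule sum_norm_le) (simp add: norm_mult)
  also have "... <= B" unfolding B_def by (rule finite_sum_le_infsum[OF s that]) auto
  finally show ?thesis .
 qed
 have tb: "\<bar>tp (boxes n) (fc f) x\<bar> <= B" for n x
  unfolding tp_def using bd[OF finite_boxes[of n]] abs_Re_le_cmod order_trans by blast
 define h where "h x = Re (\<Sum>\<^sub>\<infinity>k. fc f k * chr k x)" for x
 have lim: "(%n. tp (boxes n) (fc f) x) ----> h x" for x
 proof -
  have "(%k. norm (fc f k * chr k x)) summable_on UNIV" using s by (simp add: norm_mult)
  then have "(%k. fc f k * chr k x) summable_on UNIV" by (rule abs_summable_summable)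
  then have "((%k. fc f k * chr k x) has_sum (\<Sum>\<^sub>\<infinity>k. fc f k * chr k x)) UNIV" by (rule has_sum_infsum)
  then have "(%n. SUM k:boxes n. fc f k * chr k x) ----> (\<Sum>\<^sub>\<infinity>k. fc f k * chr k x)" by (rule has_sum_boxes)
  then show ?thesis unfolding tp_def h_def by (intro tendsto_intros)
 qed
 have hb: "\<bar>h x\<bar> <= B" for x
  by (rule tendsto_upperbound[OF tendsto_rabs[OF lim[of x]]]) (use tb in auto)
 have tm [measurable]: "tp (boxes n) (fc f) : borel_measurable tor" for n
  by (intro borel_measurable_tor borel_measurable_continuous_onI tp_continuous)
 have hm [measurable]: "h : borel_measurable tor"
  by (rule borel_measurable_LIMSEQ_real[OF lim]) measurable
 have hI: "integrable tor h"
  by (rule tor.integrable_const_bound[of _ B]) (use hb in auto)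
 have hf: "fc h k = fc f k" for k
 proof -
  have chm [measurable]: "(%x. cnj (chr k x)) : borel_measurable tor"
   by (intro borel_measurable_tor borel_measurable_continuous_onI continuous_intros chr_continuous)
  have "(%n. LINT x|tor. cor (tp (boxes n) (fc f) x) * cnj (chr k x)) ----> (LINT x|tor. cor (h x) * cnj (chr k x))"
  proof (rule integral_dominated_convergence[where w="%_. B"])
   show "AE x in tor. (%n. cor (tp (boxes n) (fc f) x) * cnj (chr k x)) ----> cor (h x) * cnj (chr k x)"
    by (intro AE_I2 tendsto_intros lim)
   show "AE x in tor. norm (cor (tp (boxes n) (fc f) x) * cnj (chr k x)) <= B" for n
    using tb by (auto simp: norm_mult)
  qed measurable
  then have l1: "(%n. fc (tp (boxes n) (fc f)) k) ----> fc h k"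
   unfolding fc_def by (intro tendsto_divide tendsto_const) (use L_pos in auto)
  have l2: "\<forall>\<^sub>F n in sequentially. fc (tp (boxes n) (fc f)) k = fc f k"
  proof -
   obtain N where N: "k : boxes N"
    using boxes_exhaust unfolding filterlim_finite_subsets_at_top eventually_sequentially
    by (metis finite.emptyI finite_insert insert_subset order_refl subset_UNIV)
   then have "k : boxes n" if "n >= N" for n using boxes_mono[OF that] by blast
   then show ?thesis
    unfolding fc_tp[OF symset_boxes herm_fc finite_boxes] eventually_sequentially by auto
  qed
  show ?thesis by (rule LIMSEQ_unique[OF l1 tendsto_eventually[OF l2]])
 qed
 have "AE x in tor. h x = f x" by (rule fc_eq_AE[OF hI f hf])
 then show ?thesis unfolding B_def[symmetric] by eventually_elim (use hb in metis)
qed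

text \<open>Difference quotients along an axis have integral 0 by translation invariance, and they
  converge boundedly to the derivative.\<close>

lemma integral_directional_derivative:
 fixes h D :: "real^2 => complex"
 assumes h: "continuous_on UNIV h" "periodic L h" and D: "continuous_on UNIV D"
  and der: "!!x s. ((%s. h (x + axis j s)) has_vector_derivative D (x + axis j s)) (at s)"
 shows "(LINT x|tor. D x) = 0"
proof -
 \<comment> \<open>Twice the cell: since \<open>s n <= L\<close>, every segment from a point of the
   cell to its shift stays inside.\<close>
 define K where "K = cbox 0 (\<chi> i::2. 2 * L)"
 have "compact (D ` K)" unfolding K_def by (intro compact_continuous_image continuous_on_subset[OF D]) auto
 then obtain B where B: "!!x. x : K ==> norm (D x) <= B"
  by (metis bounded_iff compact_imp_bounded imageI)
 define s where "s n = L * inverse (real (Suc n))" for n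
 have s: "0 < s n" "s n <= L" for n using L_pos by (auto simp: s_def field_simps)
 have s0: "s ----> 0"
  unfolding s_def by (rule tendsto_mult_right_zero[OF LIMSEQ_inverse_real_of_nat])
 define q where "q n x = (h (x + axis j (s n)) - h x) /\<^sub>R s n" for n x
 have qc: "continuous_on UNIV (q n)" for n
  unfolding q_def by (intro continuous_intros continuous_on_compose2[OF h(1)]) auto
 have "(%n. LINT x|tor. q n x) ----> (LINT x|tor. D x)"
 proof (rule integral_dominated_convergence[where w="%_. B"])
  show "D : borel_measurable tor" by (intro borel_measurable_tor borel_measurable_continuous_onI D)
  show "q n : borel_measurable tor" for n by (intro borel_measurable_tor borel_measurable_continuous_onI qc)
  show "integrable tor (%_. B)" by simp
  show "AE x in tor. (%n. q n x) ----> D x"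
  proof (rule AE_I2)
   fix x :: "real^2"
   have x0: "x + axis j 0 = x" by (simp add: axis_def vec_eq_iff)
   have "((%t. norm (h (x + axis j (0 + t)) - h (x + axis j 0) - t *\<^sub>R D (x + axis j 0)) / norm t) \<longlongrightarrow> 0) (at 0)"
    using der[of x 0] unfolding has_vector_derivative_def has_derivative_at by blast
   moreover have "filterlim s (at 0) sequentially"
    using s0 s(1) by (intro filterlim_atI) (auto intro!: always_eventually simp: less_imp_neq[symmetric])
   ultimately have "(%n. norm (h (x + axis j (0 + s n)) - h (x + axis j 0) - s n *\<^sub>R D (x + axis j 0)) / norm (s n)) ----> 0"
    by (rule filterlim_compose)
   moreover have "norm (h (x + axis j (0 + s n)) - h (x + axis j 0) - s n *\<^sub>R D (x + axis j 0)) / norm (s n) = norm (q n x - D x)" for n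
   proof -
    have "h (x + axis j (0 + s n)) - h (x + axis j 0) - s n *\<^sub>R D (x + axis j 0) = s n *\<^sub>R (q n x - D x)"
     using s(1)[of n] by (simp add: q_def x0 scaleR_diff_right)
    then show ?thesis using s(1)[of n] by simp
   qed
   ultimately have "(%n. norm (q n x - D x)) ----> 0" by (simp only:)
   then show "(%n. q n x) ----> D x" by (simp add: tendsto_norm_zero_iff LIM_zero_iff)
  qed
  show "AE x in tor. norm (q n x) <= B" for n
  proof (rule AE_I2)
   fix x assume x: "x : space tor"
   have "norm (h (x + axis j (s n)) - h (x + axis j 0)) <= B * norm (s n - 0)"
   proof (rule differentiable_bound[of "{0..s n}" "%t. h (x + axis j t)" "%t y. y *\<^sub>R D (x + axis j t)"])
    show "((%t. h (x + axis j t)) has_derivative (%y. y *\<^sub>R D (x + axis j t))) (at t within {0..s n})" for t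
     using der[of x t] unfolding has_vector_derivative_def by (rule has_derivative_at_withinI)
    show "onorm (%y. y *\<^sub>R D (x + axis j t)) <= B" if t: "t : {0..s n}" for t
    proof -
     have "x + axis j t : K"
      unfolding K_def mem_box_cart
     proof
      fix i
      have "0 <= x $ i" "x $ i < L" using x by (auto simp: space_tor)
      moreover have "0 <= axis j t $ i" "axis j t $ i <= L" using t s[of n] by (auto simp: axis_def)
      ultimately show "(0::real^2) $ i <= (x + axis j t) $ i & (x + axis j t) $ i <= (\<chi> i. 2 * L) $ i"
       by simp
     qed
     then show ?thesis
      by (intro onorm_le) (metis B mult.commute mult_left_mono norm_ge_zero norm_scaleR real_norm_def)
    qed
   qed (use s[of n] in auto)
   moreover have "x + axis j 0 = x" by (simp add: axis_def vec_eq_iff)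
   ultimately have "norm (h (x + axis j (s n)) - h x) <= B * s n" using s(1)[of n] by simp
   then show "norm (q n x) <= B"
    unfolding q_def norm_scaleR using s(1)[of n] by (simp add: divide_simps)
  qed
 qed
 moreover have "(LINT x|tor. q n x) = 0" for n
 proof -
  have i: "integrable tor (%x. h (x + axis j (s n)))" "integrable tor h"
   by (intro integrable_continuous_tor continuous_on_compose2[OF h(1)] continuous_intros h | simp)+
  have "(LINT x|tor. q n x) = ((LINT x|tor. h (x + axis j (s n))) - (LINT x|tor. h x)) /\<^sub>R s n"
   unfolding q_def using i by simp
  then show ?thesis using integral_tor_shift[OF h less_imp_le[OF s(1)] s(2)] by simp
 qed
 ultimately have "(%n::nat. 0::complex) ----> (LINT x|tor. D x)" by simp
 then show ?thesis by (simp add: LIMSEQ_const_iff)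
qed

section \<open>Classical and weak derivatives in terms of coefficients\<close>

lemma smooth_D: "smooth f ==> f differentiable (at x)" "smooth f ==> smooth (pderiv_cl j f)"
 by (auto elim: smooth.cases)

lemma smooth_continuous: "smooth f ==> continuous_on A f"
 using smooth_D(1) by (meson continuous_at_imp_continuous_on differentiable_imp_continuous_within)

lemma cis_has_derivative: "(cis has_derivative (%t. t *\<^sub>R (\<i> * cis s))) (at s)"
proof -
 have 1: "((%s. cor (cos s)) has_vector_derivative cor (- sin s)) (at s)"
  by (rule has_vector_derivative_of_real) (auto simp: has_real_derivative_iff_has_vector_derivative[symmetric])
 have 2: "((%s. cor (sin s)) has_vector_derivative cor (cos s)) (at s)"
  by (rule has_vector_derivative_of_real) (auto simp: has_real_derivative_iff_has_vector_derivative[symmetric])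
 have "((%s. cor (cos s) + \<i> * cor (sin s)) has_vector_derivative cor (- sin s) + \<i> * cor (cos s)) (at s)"
  by (intro has_vector_derivative_add has_vector_derivative_mult_right 1 2)
 moreover have "(%s. cor (cos s) + \<i> * cor (sin s)) = cis"
  by (rule ext) (simp add: complex_eq_iff)
 moreover have "cor (- sin s) + \<i> * cor (cos s) = \<i> * cis s"
  by (simp add: complex_eq_iff)
 ultimately show ?thesis by (simp add: has_vector_derivative_def)
qed

lemma chr_line_derivative:
 "((%s. chr k (x + axis j s)) has_vector_derivative (\<i> * (kap * k $ j)) * chr k (x + axis j s)) (at s)"
proof -
 have "((%s. cis (kap * k $ j * s)) has_derivative (%t. (kap * k $ j * t) *\<^sub>R (\<i> * cis (kap * k $ j * s)))) (at s)"
  by (rule has_derivative_compose[OF _ cis_has_derivative]) (intro has_derivative_mult_right has_derivative_ident)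
 then have "((%s. chr k x * cis (kap * k $ j * s)) has_derivative (%t. chr k x * ((kap * k $ j * t) *\<^sub>R (\<i> * cis (kap * k $ j * s))))) (at s)"
  by (rule has_derivative_mult_right)
 then have "((%s. chr k x * cis (kap * k $ j * s)) has_vector_derivative chr k x * (\<i> * (kap * k $ j) * cis (kap * k $ j * s))) (at s)"
  by (simp add: has_vector_derivative_def scaleR_conv_of_real mult_ac)
 then show ?thesis by (simp add: chr_shift chr_axis mult_ac)
qed

text \<open>The derivative of \<open>f * cnj (chr k)\<close> along axis \<open>j\<close> has
  integral 0; the product rule then gives the factor.\<close>

lemma fc_pderiv:
 assumes f: "smooth f" "periodic L f"
 shows "fc (pderiv_cl j f) k = \<i> * (kap * k $ j) * fc f k"
proof -
 let ?D = "%x. cor (pderiv_cl j f x) * cnj (chr k x) - \<i> * (kap * k $ j) * (cor (f x) * cnj (chr k x))"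
 have fc: "continuous_on UNIV f" "continuous_on UNIV (pderiv_cl j f)"
  by (rule smooth_continuous[OF f(1)], rule smooth_continuous[OF smooth_D(2)[OF f(1)]])
 have "(LINT x|tor. ?D x) = 0"
 proof (rule integral_directional_derivative[where h="%x. cor (f x) * cnj (chr k x)" and j=j])
  show "continuous_on UNIV (%x. cor (f x) * cnj (chr k x))" "continuous_on UNIV ?D"
   by (intro continuous_intros fc chr_continuous)+
  show "periodic L (%x. cor (f x) * cnj (chr k x))"
   using f(2) periodic_chr by (simp add: periodic_def)
  fix x s
  have "((%s. f (x + axis j s)) has_vector_derivative pderiv_cl j f (x + axis j s)) (at s)"
  proof -
   have "(f has_derivative frechet_derivative f (at (x + axis j s))) (at (x + axis j s))"
    using smooth_D(1)[OF f(1)] frechet_derivative_works by blast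
   moreover have "((%s. x + axis j s) has_derivative (%s. axis j s)) (at s)"
   proof -
    have "linear (%s::real. axis j s)" by (rule linearI) (auto simp: axis_def vec_eq_iff)
    then have "bounded_linear (%s::real. axis j s)" by (rule linear_conv_bounded_linear[THEN iffD1])
    then show ?thesis by (auto intro!: derivative_eq_intros bounded_linear_imp_has_derivative)
   qed
   ultimately have d: "((%s. f (x + axis j s)) has_derivative (%t. frechet_derivative f (at (x + axis j s)) (axis j t))) (at s)"
    by (rule has_derivative_compose[rotated])
   have "axis j t = t *\<^sub>R axis j 1" for t :: real by (auto simp: axis_def vec_eq_iff)
   then have "frechet_derivative f (at (x + axis j s)) (axis j t) = t *\<^sub>R pderiv_cl j f (x + axis j s)" for t
    unfolding pderiv_cl_def using linear_frechet_derivative[OF smooth_D(1)[OF f(1)]] by (metis linear_scale)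
   then show ?thesis using d by (simp add: has_vector_derivative_def)
  qed
  then have 1: "((%s. cor (f (x + axis j s))) has_vector_derivative cor (pderiv_cl j f (x + axis j s))) (at s)"
   by (intro has_vector_derivative_of_real) (simp add: has_real_derivative_iff_has_vector_derivative)
  have 2: "((%s. cnj (chr k (x + axis j s))) has_vector_derivative cnj ((\<i> * (kap * k $ j)) * chr k (x + axis j s))) (at s)"
   by (rule bounded_linear.has_vector_derivative[OF bounded_linear_cnj chr_line_derivative])
  show "((%s. cor (f (x + axis j s)) * cnj (chr k (x + axis j s))) has_vector_derivative ?D (x + axis j s)) (at s)"
   using has_vector_derivative_mult[OF 1 2] by (simp add: algebra_simps)
 qed
 moreover have "integrable tor (%x. cor (pderiv_cl j f x) * cnj (chr k x))" "integrable tor (%x. cor (f x) * cnj (chr k x))"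
  by (intro integrable_continuous_tor continuous_intros fc chr_continuous)+
 ultimately have "(LINT x|tor. cor (pderiv_cl j f x) * cnj (chr k x)) = \<i> * (kap * k $ j) * (LINT x|tor. cor (f x) * cnj (chr k x))"
  by simp
 then show ?thesis by (simp add: fc_def)
qed

lemma tp_has_derivative:
 "(tp F c has_derivative (%y. SUM j:UNIV. y $ j * tp F (%k. \<i> * (kap * k $ j) * c k) x)) (at x)"
proof -
 have d: "(chr k has_derivative (%y. \<i> * cor (kap * (freq k \<bullet> y)) * chr k x)) (at x)" for k
 proof -
  have "((%x. kap * (freq k \<bullet> x)) has_derivative (%y. kap * (freq k \<bullet> y))) (at x)"
   by (intro has_derivative_mult_right has_derivative_inner_right has_derivative_ident)
  then have "((%x. cis (kap * (freq k \<bullet> x))) has_derivative (%y. (kap * (freq k \<bullet> y)) *\<^sub>R (\<i> * cis (kap * (freq k \<bullet> x))))) (at x)"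
   by (rule has_derivative_compose[OF _ cis_has_derivative])
  then show ?thesis by (simp add: chr_def[abs_def] scaleR_conv_of_real mult_ac)
 qed
 have "(tp F c has_derivative (%y. Re (SUM k:F. c k * (\<i> * cor (kap * (freq k \<bullet> y)) * chr k x)))) (at x)"
  unfolding tp_def[abs_def] by (intro has_derivative_Re has_derivative_sum has_derivative_mult_right d)
 moreover have "Re (SUM k:F. c k * (\<i> * cor (kap * (freq k \<bullet> y)) * chr k x)) = (SUM j:UNIV. y $ j * tp F (%k. \<i> * (kap * k $ j) * c k) x)" for y
  by (simp add: tp_def inner_vec_def sum_2 UNIV_2 sum_distrib_left sum.distrib[symmetric] algebra_simps)
 ultimately show ?thesis by simp
qed

lemma pderiv_tp: "pderiv_cl j (tp F c) = tp F (%k. \<i> * (kap * k $ j) * c k)"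
proof
 fix x
 have "frechet_derivative (tp F c) (at x) = (%y. SUM j:UNIV. y $ j * tp F (%k. \<i> * (kap * k $ j) * c k) x)"
  using frechet_derivative_at[OF tp_has_derivative] by metis
 then show "pderiv_cl j (tp F c) x = tp F (%k. \<i> * (kap * k $ j) * c k) x"
  by (simp add: pderiv_cl_def axis_def if_distrib if_distribR sum.delta' cong: if_cong)
qed

text \<open>Coinduction over all coefficient families at once, because a partial derivative of a
  trigonometric sum is again one with other coefficients.\<close>

lemma smooth_tp: "smooth (tp F c)"
proof (coinduction arbitrary: c)
 case smooth
 have "tp F c differentiable (at x)" for x using tp_has_derivative by (auto simp: differentiable_def)
 then show ?case using pderiv_tp by blast
qed

text \<open>\<open>wd\<close> is an arbitrary choice. Riesz-Fischer provides some weak derivative,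
  so the choice has the defining property; its coefficients are then read off by testing with single
  modes.\<close>

theorem wd_fc:
 assumes f: "periodic L f" "l2t f" and s: "(%k. (norm (kap * k $ j * fc f k))^2) summable_on UNIV"
 shows "periodic L (wd L j f)" "l2t (wd L j f)" "fc (wd L j f) k = \<i> * (kap * k $ j) * fc f k"
proof -
 define c where "c k = \<i> * (kap * k $ j) * fc f k" for k
 have hc: "herm c" by (simp add: herm_def c_def fc_cnj)
 have "(%k. (norm (c k))^2) summable_on UNIV" using s by (simp add: c_def norm_mult norm_divide)
 then obtain g where g: "periodic L g" "l2t g" "!!k. fc g k = c k"
  using riesz_fischer[OF hc] by metis
 have "is_wderiv L j f g"
  unfolding is_wderiv_def
 proof (intro conjI allI impI f g l2t_integrable)
  fix ph assume p: "smooth ph & periodic L ph"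
  have pl: "l2t ph" "l2t (pderiv_cl j ph)"
   using p by (auto intro!: l2t_continuous smooth_continuous smooth_D)
  have "((%k. - (fc f k * cnj (fc (pderiv_cl j ph) k))) has_sum - cor ((LINT x|tor. f x * pderiv_cl j ph x) / L^2)) UNIV"
   by (intro has_sum_uminusI parseval f pl)
  moreover have "- (fc f k * cnj (fc (pderiv_cl j ph) k)) = fc g k * cnj (fc ph k)" for k
   using p by (simp add: fc_pderiv g c_def)
  moreover have "((%k. fc g k * cnj (fc ph k)) has_sum cor ((LINT x|tor. g x * ph x) / L^2)) UNIV"
   by (intro parseval g pl)
  ultimately have "- cor ((LINT x|tor. f x * pderiv_cl j ph x) / L^2) = cor ((LINT x|tor. g x * ph x) / L^2)"
   using has_sum_unique by (metis (no_types, lifting) has_sum_cong)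
  then have "- ((LINT x|tor. f x * pderiv_cl j ph x) / L^2) = (LINT x|tor. g x * ph x) / L^2"
   using of_real_eq_iff[of "- ((LINT x|tor. f x * pderiv_cl j ph x) / L^2)"] by (metis of_real_minus)
  then show "(LINT x|tor. f x * pderiv_cl j ph x) = - (LINT x|tor. g x * ph x)"
   using L_pos by (simp add: field_simps)
 qed
 then have w: "is_wderiv L j f (wd L j f)" unfolding wd_def by (rule someI[of "is_wderiv L j f"])
 then show "periodic L (wd L j f)" by (simp add: is_wderiv_def)
 have wI: "integrable tor (wd L j f)" using w by (simp add: is_wderiv_def)
 \<comment> \<open>Testing with one real mode of amplitude \<open>a\<close> yields
   \<open>Re (a * fc h k)\<close>; the amplitudes 1 and \<open>- \<i>\<close> together determine the
   coefficient.\<close>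
 have tpk: "(LINT x|tor. h x * tp {- k} (%_. a) x) = L^2 * Re (a * fc h k)" if h: "integrable tor h" for h a k
 proof -
  have i: "integrable tor (%x. a * (cor (h x) * cnj (chr k x)))"
   by (intro integrable_mult_right integrable_mult_chr integrable_of_real h)
  have "(LINT x|tor. h x * tp {- k} (%_. a) x) = (LINT x|tor. Re (a * (cor (h x) * cnj (chr k x))))"
   by (rule Bochner_Integration.integral_cong) (auto simp: tp_def chr_uminus algebra_simps)
  also have "... = Re (a * (LINT x|tor. cor (h x) * cnj (chr k x)))"
   using integral_Re[OF i] by simp
  also have "... = Re (cor (L^2) * (a * fc h k))" using L_pos by (simp add: fc_def)
  finally show ?thesis by (simp del: of_real_power)
 qed
 have wfc: "fc (wd L j f) k = c k" for k
 proof -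
  have "Re (a * fc (wd L j f) k) = Re (a * c k)" for a
  proof -
   have "(LINT x|tor. f x * pderiv_cl j (tp {- k} (%_. a)) x) = - (LINT x|tor. wd L j f x * tp {- k} (%_. a) x)"
    using w smooth_tp periodic_tp unfolding is_wderiv_def by blast
   moreover have "pderiv_cl j (tp {- k} (%_. a)) = tp {- k} (%_. - (\<i> * (kap * k $ j) * a))"
    unfolding pderiv_tp by (rule ext) (simp add: tp_def)
   ultimately have "L^2 * Re (- (\<i> * (kap * k $ j) * a) * fc f k) = - (L^2 * Re (a * fc (wd L j f) k))"
    using tpk[OF wI] tpk[OF l2t_integrable[OF f(2)]] by metis
   then have "Re (- (\<i> * (kap * k $ j) * a) * fc f k) = - Re (a * fc (wd L j f) k)"
    using L_pos by (metis mult_minus_right mult_cancel_left power_not_zero less_irrefl)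
   then show ?thesis by (simp add: c_def algebra_simps)
  qed
  from this[of 1] this[of "- \<i>"] show ?thesis by (simp add: complex_eq_iff)
 qed
 then show "fc (wd L j f) k = \<i> * (kap * k $ j) * fc f k" by (simp add: c_def)
 have "AE x in tor. wd L j f x = g x" by (rule fc_eq_AE) (use wI g wfc l2t_integrable in auto)
 then show "l2t (wd L j f)" by (rule l2t_cong_AE[OF g(2)]) (use wI in auto)
qed

end

section \<open>Weighted sequences and Schur bounds\<close>

text \<open>A uniform bound over finite sets. In this form square summability with a given constant
  passes to pointwise limits without mention of infinite sums.\<close>

definition l2b :: "real => ('k => real) => bool" where
 "l2b A f \<longleftrightarrow> (ALL F. finite F --> L2_set f F <= A)"

text \<open>The kernel \<open>X\<close> as a bounded bilinear form on l2, tested on finite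
  nonnegative sequences only. The signs make the notion monotone in \<open>X\<close>.\<close>

definition sch :: "real => ('k => 'k => real) => bool" where
 "sch C X \<longleftrightarrow> (ALL F G b c. finite F --> finite G --> (ALL k. 0 <= b k) --> (ALL j. 0 <= c j) -->
  (SUM k:F. SUM j:G. X k j * b k * c j) <= C * L2_set b F * L2_set c G)"

lemma l2b_D: "l2b A f ==> finite F ==> L2_set f F <= A" by (simp add: l2b_def)

lemma l2b_nonneg: "l2b A f ==> 0 <= A" using l2b_D[of A f "{}"] by simp

lemma l2b_sum_sq: "l2b A f ==> finite F ==> (SUM k:F. (f k)^2) <= A^2"
proof -
 assume a: "l2b A f" "finite F"
 have "(L2_set f F)^2 <= A^2" by (rule power_mono[OF l2b_D[OF a]]) simp
 then show ?thesis by (simp add: L2_set_def sum_nonneg)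
qed

lemma l2b_I: "(!!F. finite F ==> (SUM k:F. (f k)^2) <= A) ==> l2b (sqrt A) f"
 unfolding l2b_def L2_set_def by (auto intro: real_sqrt_le_mono)

lemma l2b_summable: "l2b A f ==> (%k. (f k)^2) summable_on UNIV"
 by (rule nonneg_bdd_above_summable_on) (auto intro!: bdd_aboveI[of _ "A^2"] l2b_sum_sq)

lemma summable_l2b: "(%k. (f k)^2) summable_on UNIV ==> l2b (sqrt (\<Sum>\<^sub>\<infinity>k. (f k)^2)) f"
 by (rule l2b_I) (auto intro!: finite_sum_le_infsum)

lemma l2b_mono_abs: "l2b A f ==> (!!k. \<bar>g k\<bar> <= \<bar>f k\<bar>) ==> l2b A g"
proof -
 assume a: "l2b A f" "!!k. \<bar>g k\<bar> <= \<bar>f k\<bar>"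
 have "L2_set g F <= L2_set f F" for F
  unfolding L2_set_def by (intro real_sqrt_le_mono sum_mono) (metis a(2) abs_le_square_iff)
 then show ?thesis using a(1) unfolding l2b_def by (meson order_trans)
qed

lemma l2b_weaken: "l2b A f ==> A <= B ==> l2b B f" unfolding l2b_def by (meson order_trans)

lemma l2b_add:
 fixes f g :: "'k => real"
 assumes "l2b A f" "l2b B g" shows "l2b (A + B) (%k. f k + g k)"
 unfolding l2b_def
proof (intro allI impI)
 fix F :: "'k set" assume "finite F"
 then have "L2_set f F <= A" "L2_set g F <= B" using l2b_D assms by blast+
 then show "L2_set (%k. f k + g k) F <= A + B" using L2_set_triangle_ineq[of f g F] by linarith
qed

lemma l2b_cmul: "l2b A f ==> l2b (\<bar>c\<bar> * A) (%k. c * f k)"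
proof -
 assume a: "l2b A f"
 have "L2_set (%k. c * f k) F = \<bar>c\<bar> * L2_set f F" for F
  unfolding L2_set_def by (simp add: power_mult_distrib sum_distrib_left[symmetric] real_sqrt_mult)
 then show ?thesis using a unfolding l2b_def by (auto intro: mult_left_mono)
qed

lemma l2b_point: "l2b A f ==> \<bar>f k\<bar> <= A"
 using l2b_D[of A f "{k}"] by (simp add: L2_set_def)

lemma l2b_zero: "l2b 0 (%k. 0)" by (simp add: l2b_def L2_set_def)

lemma l2b_sum: "finite I ==> (!!i. i : I ==> l2b (A i) (f i)) ==> l2b (SUM i:I. A i) (%k. SUM i:I. f i k)"
 by (induction I rule: finite_induct) (auto intro: l2b_zero l2b_add)

lemma l2b_reindex: "l2b A f ==> inj h ==> l2b A (%k. f (h k))"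
proof -
 assume a: "l2b A f" "inj h"
 have "L2_set (%k. f (h k)) F = L2_set f (h ` F)" for F
  unfolding L2_set_def by (subst sum.reindex) (use a in "auto intro: inj_on_subset simp: o_def")
 then show ?thesis using a unfolding l2b_def by simp
qed

lemma l2b_prod_summable:
 assumes "l2b A f" "l2b B g" "!!k. 0 <= f k" "!!k. 0 <= g k"
 shows "(%k. f k * g k) summable_on UNIV" "finite F ==> (SUM k:F. f k * g k) <= A * B"
  "(\<Sum>\<^sub>\<infinity>k. f k * g k) <= A * B"
proof -
 show *: "(SUM k:F. f k * g k) <= A * B" if "finite F" for F
 proof -
  have "(SUM k:F. f k * g k) <= L2_set f F * L2_set g F"
   using L2_set_mult_ineq[of f g F] assms by simp
  also have "... <= A * B" by (intro mult_mono l2b_D assms that) (auto intro: l2b_nonneg[OF assms(1)])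
  finally show ?thesis .
 qed
 show s: "(%k. f k * g k) summable_on UNIV"
  by (rule nonneg_bdd_above_summable_on) (use assms * in \<open>auto intro!: bdd_aboveI[of _ "A * B"]\<close>)
 show "(\<Sum>\<^sub>\<infinity>k. f k * g k) <= A * B" by (rule infsum_le_finite_sums[OF s *])
qed

lemma sch_D: "sch C X ==> finite F ==> finite G ==> (!!k. 0 <= b k) ==> (!!j. 0 <= c j) ==>
  (SUM k:F. SUM j:G. X k j * b k * c j) <= C * L2_set b F * L2_set c G"
 by (simp add: sch_def)

lemma sch_mono: "sch C X ==> (!!k j. Y k j <= X k j) ==> sch C Y"
 unfolding sch_def
proof (intro allI impI)
 fix F G :: "'a set" and b c :: "'a => real"
 assume a: "ALL F G b c. finite F --> finite G --> (ALL k. 0 <= b k) --> (ALL j. 0 <= c j) -->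
  (SUM k:F. SUM j:G. X k j * b k * c j) <= C * L2_set b F * L2_set c G" "!!k j. Y k j <= X k j"
 "finite F" "finite G" "ALL k. 0 <= b k" "ALL j. 0 <= c j"
 have "(SUM k:F. SUM j:G. Y k j * b k * c j) <= (SUM k:F. SUM j:G. X k j * b k * c j)"
  by (intro sum_mono mult_right_mono) (use a in auto)
 then show "(SUM k:F. SUM j:G. Y k j * b k * c j) <= C * L2_set b F * L2_set c G" using a by (meson order_trans)
qed

lemma sch_cmul: "sch C X ==> 0 <= r ==> sch (r * C) (%k j. r * X k j)"
 unfolding sch_def by (simp add: mult.assoc sum_distrib_left[symmetric] mult_left_mono)

lemma sch_add: "sch C X ==> sch D Y ==> sch (C + D) (%k j. X k j + Y k j)"
 unfolding sch_def by (simp add: distrib_right sum.distrib add_mono)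

lemma sch_image_finite:
 assumes X: "sch C X" "!!k j. 0 <= X k j" and c: "l2b B c" "!!j. 0 <= c j" and C: "0 <= C"
  and F: "finite F" "finite G"
 shows "L2_set (%k. SUM j:G. X k j * c j) F <= C * B"
proof -
 \<comment> \<open>Duality: the form is tested with the image itself, and one factor of its norm is
   cancelled.\<close>
 define b where "b k = (SUM j:G. X k j * c j)" for k
 have b0: "0 <= b k" for k unfolding b_def by (intro sum_nonneg mult_nonneg_nonneg X c)
 have "(L2_set b F)^2 = (SUM k:F. b k * b k)" by (simp add: L2_set_def sum_nonneg power2_eq_square)
 also have "... = (SUM k:F. SUM j:G. X k j * b k * c j)"
  by (intro sum.cong refl, subst (1) b_def) (simp add: sum_distrib_left sum_distrib_right mult_ac)
 also have "... <= C * L2_set b F * L2_set c G" by (rule sch_D[OF X(1) F b0 c(2)])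
 also have "... <= C * L2_set b F * B" by (intro mult_left_mono l2b_D[OF c(1) F(2)]) (use C in auto)
 finally have "L2_set b F * L2_set b F <= (C * B) * L2_set b F" by (simp add: power2_eq_square mult_ac)
 then have "L2_set b F <= C * B"
 proof (cases "L2_set b F = 0")
  case True
  then show ?thesis using C l2b_nonneg[OF c(1)] by simp
 next
  case False
  then have "L2_set b F > 0" using L2_set_nonneg[of b F] by linarith
  then show ?thesis using \<open>L2_set b F * L2_set b F <= (C * B) * L2_set b F\<close> by simp
 qed
 then show ?thesis unfolding b_def .
qed

lemma sch_image:
 assumes X: "sch C X" "!!k j. 0 <= X k j" and c: "l2b B c" "!!j. 0 <= c j" and C: "0 <= C"
 shows "(%j. X k j * c j) summable_on UNIV" "l2b (C * B) (%k. \<Sum>\<^sub>\<infinity>j. X k j * c j)"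
proof -
 have fin: "(SUM j:G. X k j * c j) <= C * B" if "finite G" for k G
  using sch_image_finite[OF X c C, of "{k}" G] that by (simp add: L2_set_def)
 show s: "(%j. X k j * c j) summable_on UNIV" for k
  by (rule nonneg_bdd_above_summable_on) (use X c fin in \<open>auto intro!: bdd_aboveI[of _ "C * B"]\<close>)
 show "l2b (C * B) (%k. \<Sum>\<^sub>\<infinity>j. X k j * c j)"
  unfolding l2b_def
 proof (intro allI impI)
  fix F :: "'a set" assume F: "finite F"
  have lim: "((%G. SUM j:G. X k j * c j) \<longlongrightarrow> (\<Sum>\<^sub>\<infinity>j. X k j * c j)) (finite_subsets_at_top UNIV)" for k
   using has_sum_infsum[OF s[of k]] unfolding has_sum_def .
  have "((%G. L2_set (%k. SUM j:G. X k j * c j) F) \<longlongrightarrow> L2_set (%k. \<Sum>\<^sub>\<infinity>j. X k j * c j) F) (finite_subsets_at_top UNIV)"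
   unfolding L2_set_def by (intro tendsto_real_sqrt tendsto_sum tendsto_power lim)
  then show "L2_set (%k. \<Sum>\<^sub>\<infinity>j. X k j * c j) F <= C * B"
   by (rule tendsto_upperbound) (auto intro!: eventually_finite_subsets_at_top_weakI sch_image_finite[OF X c C F])
 qed
qed

text \<open>The Schur test for a summable convolution kernel: the kernel is written as a product of
  two square roots, and Cauchy-Schwarz on the product set leaves its row and column sums.\<close>

lemma sum_sum_sqrt_le:
 fixes \<alpha> :: "'k::ab_group_add => real"
 assumes a: "!!m. 0 <= \<alpha> m" "!!F. finite F ==> sum \<alpha> F <= A" and A: "0 <= A"
 shows "sch A (%k j. \<alpha> (k - j))"
 unfolding sch_def
proof (intro allI impI)
 fix F G :: "'k set" and b c :: "'k => real"
 assume F: "finite F" "finite G" and b: "ALL k. 0 <= b k" "ALL j. 0 <= c j"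
 have r1: "(SUM k:F. \<alpha> (k - j)) <= A" for j
 proof -
  have "(SUM k:F. \<alpha> (k - j)) = sum \<alpha> ((%k. k - j) ` F)" by (subst sum.reindex) (auto simp: inj_on_def o_def)
  then show ?thesis using a(2) F by simp
 qed
 have r2: "(SUM j:G. \<alpha> (k - j)) <= A" for k
 proof -
  have "(SUM j:G. \<alpha> (k - j)) = sum \<alpha> ((%j. k - j) ` G)" by (subst sum.reindex) (auto simp: inj_on_def o_def)
  then show ?thesis using a(2) F by simp
 qed
 let ?f = "%(k, j). sqrt (\<alpha> (k - j)) * b k" and ?g = "%(k, j). sqrt (\<alpha> (k - j)) * c j"
 have sq: "sqrt (\<alpha> m) * sqrt (\<alpha> m) = \<alpha> m" for m using a(1) by simp
 have "(SUM k:F. SUM j:G. \<alpha> (k - j) * b k * c j) = (SUM p:F \<times> G. \<bar>?f p\<bar> * \<bar>?g p\<bar>)"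
  unfolding sum.cartesian_product
  by (intro sum.cong refl) (use a b sq in "auto simp: abs_mult mult_ac")
 also have "... <= L2_set ?f (F \<times> G) * L2_set ?g (F \<times> G)" by (rule L2_set_mult_ineq)
 also have "... <= (sqrt A * L2_set b F) * (sqrt A * L2_set c G)"
 proof (intro mult_mono)
  have "(SUM p:F \<times> G. (?f p)^2) = (SUM k:F. (SUM j:G. \<alpha> (k - j)) * (b k)^2)"
  proof -
   have "(SUM p:F \<times> G. (?f p)^2) = (\<Sum>(k, j)\<in>F \<times> G. \<alpha> (k - j) * (b k)^2)"
    by (rule sum.cong) (use a in "auto simp: power_mult_distrib")
   then show ?thesis by (simp add: sum.cartesian_product[symmetric] sum_distrib_right)
  qed
  also have "... <= (SUM k:F. A * (b k)^2)" by (intro sum_mono mult_right_mono r2) auto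
  finally show "L2_set ?f (F \<times> G) <= sqrt A * L2_set b F"
   unfolding L2_set_def by (simp add: sum_distrib_left[symmetric] real_sqrt_mult[symmetric])
  have "(SUM p:F \<times> G. (?g p)^2) = (SUM j:G. (SUM k:F. \<alpha> (k - j)) * (c j)^2)"
  proof -
   have "(SUM p:F \<times> G. (?g p)^2) = (\<Sum>(k, j)\<in>F \<times> G. \<alpha> (k - j) * (c j)^2)"
    by (rule sum.cong) (use a in "auto simp: power_mult_distrib")
   also have "... = (SUM k:F. SUM j:G. \<alpha> (k - j) * (c j)^2)" by (simp add: sum.cartesian_product)
   also have "... = (SUM j:G. SUM k:F. \<alpha> (k - j) * (c j)^2)" by (rule sum.swap)
   finally show ?thesis by (simp add: sum_distrib_right)
  qed
  also have "... <= (SUM j:G. A * (c j)^2)" by (intro sum_mono mult_right_mono r1) auto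
  finally show "L2_set ?g (F \<times> G) <= sqrt A * L2_set c G"
   unfolding L2_set_def by (simp add: sum_distrib_left[symmetric] real_sqrt_mult[symmetric])
 qed (use A in auto)
 also have "... = A * L2_set b F * L2_set c G" using A by (simp add: mult_ac)
 finally show "(SUM k:F. SUM j:G. \<alpha> (k - j) * b k * c j) <= A * L2_set b F * L2_set c G" .
qed

text \<open>Multiplication by the l2 weight \<open>u\<close> maps l2 into l1, and convolution with
  the l2 sequence \<open>a\<close> maps l1 into l2.\<close>

lemma sch_right_weight:
 fixes a :: "'k::ab_group_add => real"
 assumes a: "l2b A a" "!!m. 0 <= a m" and u: "l2b S u" "!!m. 0 <= u m"
 shows "sch (A * S) (%k j. a (k - j) * u j)"
 unfolding sch_def
proof (intro allI impI)
 fix F G :: "'k set" and b c :: "'k => real"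
 assume F: "finite F" "finite G" and b: "ALL k. 0 <= b k" "ALL j. 0 <= c j"
 have 1: "(SUM k:F. a (k - j) * b k) <= A * L2_set b F" for j
 proof -
  have "l2b A (%k. a (k - j))" by (rule l2b_reindex[OF a(1)]) (simp add: inj_def)
  then have "L2_set (%k. a (k - j)) F * L2_set b F <= A * L2_set b F"
   using l2b_D F by (intro mult_right_mono) auto
  moreover have "(SUM k:F. a (k - j) * b k) <= L2_set (%k. a (k - j)) F * L2_set b F"
   using L2_set_mult_ineq[of "%k. a (k - j)" b F] a b by simp
  ultimately show ?thesis by linarith
 qed
 have 2: "(SUM j:G. u j * c j) <= S * L2_set c G"
 proof -
  have "(SUM j:G. u j * c j) <= L2_set u G * L2_set c G"
   using L2_set_mult_ineq[of u c G] u b by simp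
  also have "... <= S * L2_set c G" by (intro mult_right_mono l2b_D u F) auto
  finally show ?thesis .
 qed
 have "(SUM k:F. SUM j:G. a (k - j) * u j * b k * c j) = (SUM j:G. (SUM k:F. a (k - j) * b k) * (u j * c j))"
  by (subst sum.swap) (simp add: sum_distrib_right sum_distrib_left mult_ac)
 also have "... <= (SUM j:G. (A * L2_set b F) * (u j * c j))"
  by (intro sum_mono mult_right_mono 1) (use u b in auto)
 also have "... = (A * L2_set b F) * (SUM j:G. u j * c j)" by (simp add: sum_distrib_left)
 also have "... <= (A * L2_set b F) * (S * L2_set c G)"
  by (intro mult_left_mono 2) (use l2b_nonneg[OF a(1)] in auto)
 finally show "(SUM k:F. SUM j:G. a (k - j) * u j * b k * c j) <= A * S * L2_set b F * L2_set c G"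
  by (simp add: mult_ac)
qed

lemma sch_swap: "sch C X ==> sch C (%k j. X j k)"
 unfolding sch_def
proof (intro allI impI)
 fix F G :: "'a set" and b c :: "'a => real"
 assume a: "ALL F G b c. finite F --> finite G --> (ALL k. 0 <= b k) --> (ALL j. 0 <= c j) -->
  (SUM k:F. SUM j:G. X k j * b k * c j) <= C * L2_set b F * L2_set c G"
 "finite F" "finite G" "ALL k. 0 <= b k" "ALL j. 0 <= c j"
 then have "(SUM k:G. SUM j:F. X k j * c k * b j) <= C * L2_set c G * L2_set b F" by blast
 then show "(SUM k:F. SUM j:G. X j k * b k * c j) <= C * L2_set b F * L2_set c G"
  by (subst sum.swap) (simp add: mult_ac)
qed

section \<open>The square root of the symbol of \<open>I - a1 \<Delta>\<close> as a weight on
  frequencies\<close>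

locale helm = torus2 L for L +
 fixes a1 :: real
 assumes a1_pos: "a1 > 0"
begin

definition cc :: real where "cc = sqrt a1 * kap"

definition rho :: "int^2 => real" where "rho k = sqrt (1 + cc^2 * (norm (freq k))^2)"

lemma cc_pos: "cc > 0" unfolding cc_def using kap_pos a1_pos by (intro mult_pos_pos) auto

lemma cc_sq: "cc^2 = a1 * kap^2" unfolding cc_def power_mult_distrib using a1_pos by simp

lemma rho_sq: "(rho k)^2 = 1 + cc^2 * (norm (freq k))^2"
 unfolding rho_def by simp

text \<open>Written as the norm of a vector with constant first entry, \<open>rho\<close> inherits
  the triangle inequality, which is the Lipschitz bound used in all commutator estimates.\<close>

lemma rho_norm: "rho k = norm (1::real, cc *\<^sub>R freq k)"
 unfolding rho_def norm_Pair using cc_pos by (simp add: power_mult_distrib)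

lemma rho_ge1: "rho k >= 1"
 unfolding rho_def by simp

lemma rho_pos [simp]: "rho k > 0" "rho k ~= 0" "rho k >= 0" using rho_ge1[of k] by auto

lemma rho_uminus [simp]: "rho (- k) = rho k" by (simp add: rho_def freq_simps)

lemma rho_0 [simp]: "rho 0 = 1" by (simp add: rho_def freq_simps)

lemma norm_freq_le: "cc * norm (freq k) <= rho k"
 unfolding rho_norm using norm_snd_le[of "cc *\<^sub>R freq k" "1::real"] cc_pos by simp

lemma kap_le_rho: "kap * \<bar>real_of_int (k $ i)\<bar> <= rho k / sqrt a1"
proof -
 have "\<bar>real_of_int (k $ i)\<bar> <= norm (freq k)" using component_le_norm_cart[of "freq k" i] by simp
 then have "cc * \<bar>real_of_int (k $ i)\<bar> <= cc * norm (freq k)" using cc_pos by (intro mult_left_mono) auto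
 also have "... <= rho k" by (rule norm_freq_le)
 finally show ?thesis using a1_pos unfolding cc_def by (simp add: pos_le_divide_eq mult_ac)
qed

lemma rho_triangle: "rho k <= rho j + rho (k - j)"
proof -
 have "(1::real, cc *\<^sub>R freq k) = (1, cc *\<^sub>R freq j) + (0, cc *\<^sub>R freq (k - j))"
  by (simp add: freq_simps scaleR_diff_right)
 then have "rho k <= rho j + norm (0::real, cc *\<^sub>R freq (k - j))"
  unfolding rho_norm using norm_triangle_ineq by metis
 also have "norm (0::real, cc *\<^sub>R freq (k - j)) <= rho (k - j)"
  using norm_freq_le[of "k - j"] cc_pos by (simp add: norm_Pair)
 finally show ?thesis by simp
qed

lemma rho_diff_commute: "rho (j - k) = rho (k - j)"
 using rho_uminus[of "k - j"] by simp

lemma rho_triangle2: "rho j <= rho k + rho (k - j)" using rho_triangle[of j k] rho_diff_commute by simp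

lemma rho_le_freq: "k ~= 0 ==> rho k <= sqrt (1 + cc^2) * norm (freq k)"
proof -
 assume "k ~= 0"
 then obtain i where "k $ i ~= 0" by (auto simp: vec_eq_iff)
 then have "1 <= \<bar>real_of_int (k $ i)\<bar>" by linarith
 also have "... <= norm (freq k)" using component_le_norm_cart[of "freq k" i] by simp
 finally have n: "1 <= (norm (freq k))^2" by (simp add: one_le_power)
 have "(rho k)^2 <= (norm (freq k))^2 + cc^2 * (norm (freq k))^2"
  using n by (simp add: rho_sq)
 also have "... = (sqrt (1 + cc^2) * norm (freq k))^2" by (simp add: power_mult_distrib distrib_right)
 finally show ?thesis by (rule power2_le_imp_le) simp
qed

lemma finite_low: "finite {k. (rho k)^2 <= R}"
proof -
 define N where "N = nat \<lceil>sqrt (R / cc^2)\<rceil>"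
 have "{k. (rho k)^2 <= R} <= boxes N"
 proof
  fix k assume "k : {k. (rho k)^2 <= R}"
  then have "cc^2 * (norm (freq k))^2 <= R" by (simp add: rho_sq)
  then have "(norm (freq k))^2 <= R / cc^2" using cc_pos by (simp add: field_simps)
  then have n: "norm (freq k) <= sqrt (R / cc^2)" by (rule real_le_rsqrt)
  have "\<bar>k $ i\<bar> <= int N" for i
  proof -
   have "\<bar>real_of_int (k $ i)\<bar> <= sqrt (R / cc^2)"
    using component_le_norm_cart[of "freq k" i] n by simp
   then have "\<bar>k $ i\<bar> <= \<lceil>sqrt (R / cc^2)\<rceil>" by linarith
   then show ?thesis unfolding N_def by linarith
  qed
  then show "k : boxes N" by (simp add: boxes_def)
 qed
 then show ?thesis using finite_boxes finite_subset by blast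
qed

lemma finite_subset_boxes: "finite F ==> EX N. F <= boxes N"
proof -
 assume F: "finite F"
 have "\<forall>\<^sub>F n in sequentially. finite (boxes n) & F <= boxes n & boxes n <= UNIV"
  using boxes_exhaust F unfolding filterlim_finite_subsets_at_top by blast
 then show ?thesis by (auto simp: eventually_sequentially)
qed

text \<open>Here dimension two enters. With \<open>a\<close> and \<open>b\<close> the two squared
  frequency components scaled by \<open>c\<close>,
  \<open>(1 + a) * (1 + b) <= (1 + a + b)^2\<close>, so the sum of \<open>1 / rho ^ 4\<close> over a
  box is at most a product of two one-dimensional sums of \<open>1 / (1 + c * n^2)\<close>.\<close>

lemma rho_m2_bounded: "EX S. l2b S (%k. 1 / (rho k)^2)"
proof -
 define c where "c = cc^2"
 have c: "c > 0" using cc_pos by (simp add: c_def)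
 define h where "h n = 1 / (1 + c * (real_of_int n)^2)" for n :: int
 have h0: "0 <= h n" for n using c by (simp add: h_def)
 have sm: "summable (%n. 1 / c * (1 / real (Suc n) ^ 2))"
 proof (intro summable_mult)
  have "summable (%n. 1 / real n ^ 2)"
   using inverse_power_summable[of 2, where 'a=real] by (simp add: inverse_eq_divide)
  then show "summable (%n. 1 / real (Suc n) ^ 2)"
   using summable_Suc_iff[of "%n. 1 / real n ^ 2"] by blast
 qed
 define H where "H = (\<Sum>n. 1 / c * (1 / real (Suc n) ^ 2))"
 have hs: "(SUM n:{- int N..int N}. h n) <= 1 + 2 * H" for N
 proof -
  have p: "(SUM n<N. h (int (Suc n))) <= H"
  proof -
   have "(SUM n<N. h (int (Suc n))) <= (SUM n<N. 1 / c * (1 / real (Suc n) ^ 2))"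
   proof (rule sum_mono)
    fix n
    have "c * (real (Suc n))^2 > 0" using c by simp
    then show "h (int (Suc n)) <= 1 / c * (1 / real (Suc n) ^ 2)"
     by (simp add: h_def frac_le del: of_nat_Suc)
   qed
   also have "... <= H" unfolding H_def by (rule sum_le_suminf[OF sm]) (use c in auto)
   finally show ?thesis .
  qed
  have "(SUM n:{- int N..int N}. h n) = 1 + 2 * (SUM n<N. h (int (Suc n)))"
  proof (induction N)
   case 0
   then show ?case by (simp add: h_def)
  next
   case (Suc N)
   have "{- int (Suc N)..int (Suc N)} = insert (- int (Suc N)) (insert (int (Suc N)) {- int N..int N})" by auto
   then have "(SUM n:{- int (Suc N)..int (Suc N)}. h n) = h (- int (Suc N)) + (h (int (Suc N)) + (SUM n:{- int N..int N}. h n))"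
    by simp
   moreover have "h (- int (Suc N)) = h (int (Suc N))" by (simp add: h_def del: of_nat_Suc)
   ultimately show ?case using Suc by simp
  qed
  then show ?thesis using p by simp
 qed
 have prod: "(1 / (rho k)^2)^2 <= h (k $ 1) * h (k $ 2)" for k
 proof -
  define a b where "a = c * (real_of_int (k $ 1))^2" and "b = c * (real_of_int (k $ 2))^2"
  have ab: "0 <= a" "0 <= b" using c by (auto simp: a_def b_def)
  have "(rho k)^2 = 1 + a + b"
   unfolding rho_sq power2_norm_eq_inner inner_vec_def
   by (simp add: sum_2 a_def b_def c_def power2_eq_square algebra_simps)
  moreover have "(1 + a) * (1 + b) <= (1 + a + b)^2"
   using ab mult_nonneg_nonneg[OF ab] by (simp add: power2_eq_square algebra_simps add_nonneg_nonneg)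
  ultimately have "1 / ((rho k)^2)^2 <= 1 / ((1 + a) * (1 + b))"
   using ab by (intro divide_left_mono) auto
  then show ?thesis by (simp add: h_def a_def b_def power_divide)
 qed
 have "l2b (sqrt ((1 + 2 * H)^2)) (%k. 1 / (rho k)^2)"
 proof (rule l2b_I)
  fix F :: "(int^2) set" assume F: "finite F"
  obtain N where N: "F <= boxes N"
   using finite_subset_boxes[OF F] by blast
  have "(SUM k:F. (1 / (rho k)^2)^2) <= (SUM k:boxes N. h (k $ 1) * h (k $ 2))"
   by (rule order_trans[OF sum_mono[OF prod] sum_mono2]) (use N finite_boxes h0 in auto)
  also have "... = (\<Sum>(a, b)\<in>{- int N..int N} \<times> {- int N..int N}. h a * h b)"
   by (rule sum.reindex_bij_witness[where i="%(a, b). vector [a, b]" and j="%k. (k $ 1, k $ 2)"])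
    (auto simp: boxes_def vec_eq_iff forall_2 abs_le_iff minus_le_iff)
  also have "... = (SUM n:{- int N..int N}. h n)^2"
   by (simp add: sum.cartesian_product[symmetric] power2_eq_square sum_product)
  also have "... <= (1 + 2 * H)^2" by (rule power_mono[OF hs]) (simp add: h0 sum_nonneg)
  finally show "(SUM k:F. (1 / (rho k)^2)^2) <= (1 + 2 * H)^2" .
 qed
 then show ?thesis by blast
qed

definition SS :: real where "SS = (SOME S. l2b S (%k. 1 / (rho k)^2))"

lemma l2b_rho_m2: "l2b SS (%k. 1 / (rho k)^2)"
 unfolding SS_def by (rule someI_ex[OF rho_m2_bounded])

lemma SS_nonneg: "SS >= 0" by (rule l2b_nonneg[OF l2b_rho_m2])

text \<open>The embedding of \<open>H^2\<close> into functions with absolutely convergent Fourier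
  series, by Cauchy-Schwarz with the weight \<open>1 / rho ^ 2\<close>.\<close>

lemma l2b_imp_l1:
 assumes "l2b A (%k. (rho k)^2 * f k)" "!!k. 0 <= f k"
 shows "f summable_on UNIV" "finite F ==> sum f F <= A * SS" "(\<Sum>\<^sub>\<infinity>k. f k) <= A * SS"
proof -
 have e: "(rho k)^2 * f k * (1 / (rho k)^2) = f k" for k by simp
 show "f summable_on UNIV" "finite F ==> sum f F <= A * SS" "(\<Sum>\<^sub>\<infinity>k. f k) <= A * SS"
  using l2b_prod_summable[OF assms(1) l2b_rho_m2] assms(2) unfolding e by auto
qed

text \<open>All bilinear estimates below reduce to this one: after dividing by the weights, each kernel is
 dominated by a square summable function of the difference times the sum of the three inverse
 squared weights.\<close>

theorem master_kernel:
 assumes a: "l2b A a" "!!m. 0 <= a m"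
 shows "sch (3 * A * SS) (%k j. a (k - j) * (1 / (rho (k - j))^2 + 1 / (rho j)^2 + 1 / (rho k)^2))"
proof -
 have A: "0 <= A" by (rule l2b_nonneg[OF a(1)])
 have 1: "sch (A * SS) (%k j. a (k - j) * (1 / (rho (k - j))^2))"
  using sum_sum_sqrt_le[of "%m. a m * (1 / (rho m)^2)" "A * SS"] a A SS_nonneg
   l2b_prod_summable(2)[OF a(1) l2b_rho_m2] by simp
 have 2: "sch (A * SS) (%k j. a (k - j) * (1 / (rho j)^2))"
  by (rule sch_right_weight[OF a l2b_rho_m2]) simp
 have 3: "sch (A * SS) (%k j. a (- (k - j)) * (1 / (rho j)^2))"
  by (rule sch_right_weight[OF l2b_reindex[OF a(1)] _ l2b_rho_m2]) (use a in "auto simp: inj_def")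
 have "sch (A * SS + A * SS + A * SS) (%k j. a (k - j) * (1 / (rho (k - j))^2) + a (k - j) * (1 / (rho j)^2) + a (- (j - k)) * (1 / (rho k)^2))"
  by (intro sch_add 1 2 sch_swap[OF 3])
 then show ?thesis by (simp add: distrib_left algebra_simps)
qed

end

section \<open>Integrals over the tail of an interval\<close>

text \<open>The data of the adjoint problem sit at time \<open>T\<close>, so every absolutely
  continuous path is written as an integral from \<open>t\<close> to \<open>T\<close>.\<close>

definition itail :: "real => (real => 'b::{banach,second_countable_topology}) => real => 'b" where
 "itail T f t = (LINT s|lebesgue_on {t..T}. f s)"

lemma integrable_lebesgue_on_subset:
 fixes f :: "real => 'b::{banach,second_countable_topology}"
 assumes "integrable (lebesgue_on S) f" "S' <= S" "S : sets lebesgue" "S' : sets lebesgue"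
 shows "integrable (lebesgue_on S') f"
proof -
 have "integrable lebesgue (%x. indicator S x *\<^sub>R f x)"
  using assms by (subst (asm) integrable_restrict_space) auto
 then have "integrable lebesgue (%x. indicator S' x *\<^sub>R indicator S x *\<^sub>R f x)"
  by (rule integrable_mult_indicator[rotated]) (use assms in simp)
 moreover have "indicator S' x *\<^sub>R indicator S x *\<^sub>R f x = indicator S' x *\<^sub>R f x" for x
  using assms(2) by (auto simp: indicator_def)
 ultimately have "integrable lebesgue (%x. indicator S' x *\<^sub>R f x)" by (simp only:)
 then show ?thesis using assms by (subst integrable_restrict_space) auto
qed

lemma integrable_tail:
 fixes f :: "real => 'b::{banach,second_countable_topology}"
 shows "integrable (iv T) f ==> 0 <= t ==> integrable (lebesgue_on {t..T}) f"
 by (erule integrable_lebesgue_on_subset) auto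

lemma integrable_continuous_on:
 fixes f :: "real => 'b::euclidean_space"
 assumes "continuous_on {a..b} f" shows "integrable (lebesgue_on {a..b}) f"
 by (rule continuous_imp_integrable_real[OF assms])

lemma itail_eq_integral:
 fixes f :: "real => 'b::euclidean_space"
 assumes "integrable (iv T) f" "0 <= t"
 shows "itail T f t = integral {t..T} f"
 unfolding itail_def by (rule lebesgue_integral_eq_integral[OF integrable_tail[OF assms]]) auto

lemma itail_continuous:
 fixes f :: "real => 'b::euclidean_space"
 assumes "integrable (iv T) f" shows "continuous_on {0..T} (itail T f)"
proof -
 have "f integrable_on {0..T}"
  using integrable_on_lebesgue_on[OF assms] by auto
 then have "continuous_on {0..T} (%t. integral {t..T} f)" by (rule indefinite_integral_continuous_1')
 then show ?thesis by (rule continuous_on_eq) (use assms in "simp add: itail_eq_integral")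
qed

lemma itail_end [simp]: "itail T f T = 0"
proof -
 have "AE s in lebesgue_on {T..T}. f s = 0"
 proof -
  have "AE s in lebesgue. s ~= T" by (rule AE_completion[OF AE_lborel_singleton])
  then have "AE s in lebesgue. s : {T..T} --> f s = 0" by eventually_elim auto
  then show ?thesis by (subst AE_restrict_space_iff) auto
 qed
 then show ?thesis unfolding itail_def by (rule integral_eq_zero_AE)
qed

lemma itail_add:
 fixes f g :: "real => 'b::{banach,second_countable_topology}"
 assumes "integrable (iv T) f" "integrable (iv T) g" "0 <= t"
 shows "itail T (%s. f s + g s) t = itail T f t + itail T g t"
  and "itail T (%s. f s - g s) t = itail T f t - itail T g t"
 unfolding itail_def using assms by (simp_all add: integrable_tail)

lemma itail_cmul:
 fixes f :: "real => 'b::{real_normed_field,banach,second_countable_topology}"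
 shows "itail T (%s. c * f s) t = c * itail T f t"
 unfolding itail_def by simp

lemma itail_cong: "(!!s. s : {t..T} ==> f s = g s) ==> itail T f t = itail T g t"
 unfolding itail_def by (rule Bochner_Integration.integral_cong) auto

lemma itail_cong_AE:
 assumes "AE s in iv T. f s = g s" "f : borel_measurable (iv T)"
  "g : borel_measurable (iv T)" "0 <= t"
 shows "itail T f t = itail T g t"
proof -
 have m: "h : borel_measurable (lebesgue_on {t..T})" if "h : borel_measurable (iv T)" for h :: "real => 'a"
  by (rule measurable_restrict_mono[OF that]) (use assms in auto)
 have "AE s in lebesgue. s : {0..T} --> f s = g s" using assms(1) by (subst (asm) AE_restrict_space_iff) auto
 then have "AE s in lebesgue. s : {t..T} --> f s = g s" by eventually_elim (use assms in auto)
 then have "AE s in lebesgue_on {t..T}. f s = g s" by (subst AE_restrict_space_iff) auto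
 then show ?thesis unfolding itail_def by (intro integral_cong_AE m assms(2,3))
qed

lemma itail_mono:
 fixes f g :: "real => real"
 assumes "integrable (iv T) f" "integrable (iv T) g" "0 <= t"
  and "!!s. s : {t..T} ==> f s <= g s"
 shows "itail T f t <= itail T g t"
 unfolding itail_def by (rule integral_mono) (use assms in "auto intro: integrable_tail")

lemma norm_itail_le:
 fixes f :: "real => 'b::{banach,second_countable_topology}"
 assumes "integrable (iv T) f" "integrable (iv T) g" "0 <= t"
  and "!!s. s : {t..T} ==> norm (f s) <= g s"
 shows "norm (itail T f t) <= itail T g t"
 unfolding itail_def by (rule Bochner_Integration.integral_norm_bound_integral) (use assms in "auto intro: integrable_tail")

lemma itail_const: "t <= T ==> itail T (%s. c) t = (T - t) * (c::real)"
 unfolding itail_def by (simp add: measure_restrict_space)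

lemma id_measurable_lebesgue_on: "(%x::real. x) : borel_measurable (lebesgue_on S)"
 by (intro measurable_restrict_space1 measurable_completion) simp

text \<open>Fubini on the square, cut along the diagonal. It replaces integration by parts for
  integrands that are merely integrable.\<close>

theorem itail_parts:
 fixes y z :: "real => complex"
 assumes y: "integrable (iv T) y" and z: "integrable (iv T) z" and t: "0 <= t"
 shows "itail T y t * itail T z t = itail T (%s. y s * itail T z s) t + itail T (%s. itail T y s * z s) t"
proof -
 define M where "M = lebesgue_on {t..T}"
 have fm: "finite_measure M" unfolding M_def
  by (rule finite_measureI) (simp add: emeasure_restrict_space emeasure_lborel_Icc_eq)
 interpret M: finite_measure M by (rule fm)
 interpret P: pair_sigma_finite M M by standard
 have yM: "integrable M y" and zM: "integrable M z" unfolding M_def using y z t by (auto intro: integrable_tail)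
 have [measurable]: "y : borel_measurable M" "z : borel_measurable M" using yM zM by auto
 have [measurable]: "(%x. x) : borel_measurable M" unfolding M_def by (rule id_measurable_lebesgue_on)
 have spM: "space M = {t..T}" by (simp add: M_def)
 have PI: "integrable (M \<Otimes>\<^sub>M M) (%(s, r). y s * z r)"
 proof (rule P.Fubini_integrable)
  show "(%(s, r). y s * z r) : borel_measurable (M \<Otimes>\<^sub>M M)" by measurable
  show "integrable M (%s. LINT r|M. norm (case (s, r) of (s, r) => y s * z r))"
   using yM zM by (simp add: norm_mult)
  show "AE s in M. integrable M (%r. case (s, r) of (s, r) => y s * z r)" using zM by simp
 qed
 have [measurable]: "{p : space (M \<Otimes>\<^sub>M M). fst p <= snd p} : sets (M \<Otimes>\<^sub>M M)"
  "{p : space (M \<Otimes>\<^sub>M M). snd p < fst p} : sets (M \<Otimes>\<^sub>M M)" by measurable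
 let ?A = "{p : space (M \<Otimes>\<^sub>M M). fst p <= snd p}" and ?B = "{p : space (M \<Otimes>\<^sub>M M). snd p < fst p}"
 have IA: "integrable (M \<Otimes>\<^sub>M M) (%p. indicator ?A p *\<^sub>R (case p of (s, r) => y s * z r))"
  "integrable (M \<Otimes>\<^sub>M M) (%p. indicator ?B p *\<^sub>R (case p of (s, r) => y s * z r))"
  by (rule integrable_mult_indicator[OF _ PI]; measurable)+
 have tail: "(LINT r|M. indicator {s..} r *\<^sub>R h r) = itail T h s" if "s : {t..T}" for s and h :: "real => complex"
 proof -
  have "(LINT r|M. indicator {s..} r *\<^sub>R h r) = (LINT r|lebesgue. indicator {t..T} r *\<^sub>R indicator {s..} r *\<^sub>R h r)"
   unfolding M_def by (subst integral_restrict_space) auto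
  also have "... = (LINT r|lebesgue. indicator {s..T} r *\<^sub>R h r)"
   by (rule Bochner_Integration.integral_cong) (use that in "auto simp: indicator_def")
  also have "... = itail T h s" unfolding itail_def by (subst integral_restrict_space) auto
  finally show ?thesis .
 qed
 \<comment> \<open>Below the diagonal the region is open. The missing point is a null set, so the
   strict and the weak inequality give the same inner integral.\<close>
 have tail': "(LINT r|M. indicator {s<..} r *\<^sub>R h r) = itail T h s" if "s : {t..T}" and [measurable]: "h : borel_measurable M" for s and h :: "real => complex"
 proof -
  have "AE r in lebesgue. r ~= s" by (rule AE_completion[OF AE_lborel_singleton])
  then have "AE r in lebesgue. r : {t..T} --> r ~= s" by eventually_elim auto
  then have ae: "AE r in M. r ~= s" unfolding M_def by (subst AE_restrict_space_iff) auto
  have "(LINT r|M. indicator {s<..} r *\<^sub>R h r) = (LINT r|M. indicator {s..} r *\<^sub>R h r)"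
  proof (rule integral_cong_AE)
   show "AE r in M. indicator {s<..} r *\<^sub>R h r = indicator {s..} r *\<^sub>R h r"
    using ae by eventually_elim (auto simp: indicator_def)
  qed measurable
  then show ?thesis using tail that by simp
 qed
 have "itail T y t * itail T z t = (LINT s|M. y s * (LINT r|M. z r))"
  by (simp add: itail_def M_def)
 also have "... = (LINT s|M. LINT r|M. (case (s, r) of (s, r) => y s * z r))" by simp
 also have "... = (LINT p|(M \<Otimes>\<^sub>M M). (case p of (s, r) => y s * z r))"
  by (rule P.integral_fst'[OF PI])
 also have "... = (LINT p|(M \<Otimes>\<^sub>M M). indicator ?A p *\<^sub>R (case p of (s, r) => y s * z r) + indicator ?B p *\<^sub>R (case p of (s, r) => y s * z r))"
  by (rule Bochner_Integration.integral_cong) (auto simp: indicator_def)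
 also have "... = (LINT p|(M \<Otimes>\<^sub>M M). indicator ?A p *\<^sub>R (case p of (s, r) => y s * z r))
   + (LINT p|(M \<Otimes>\<^sub>M M). indicator ?B p *\<^sub>R (case p of (s, r) => y s * z r))"
  by (rule Bochner_Integration.integral_add[OF IA])
 also have "(LINT p|(M \<Otimes>\<^sub>M M). indicator ?A p *\<^sub>R (case p of (s, r) => y s * z r)) = (LINT s|M. LINT r|M. indicator ?A (s, r) *\<^sub>R (y s * z r))"
  using P.integral_fst'[OF IA(1)] by simp
 also have "... = itail T (%s. y s * itail T z s) t"
  unfolding itail_def[of T "%s. y s * itail T z s"] M_def[symmetric]
 proof (rule Bochner_Integration.integral_cong[OF refl])
  fix s assume s: "s : space M"
  have "(LINT r|M. indicator ?A (s, r) *\<^sub>R (y s * z r)) = (LINT r|M. y s * (indicator {s..} r *\<^sub>R z r))"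
   by (rule Bochner_Integration.integral_cong) (use s in "auto simp: indicator_def space_pair_measure")
  also have "... = y s * itail T z s" by (simp only: Bochner_Integration.integral_mult_right_zero tail[OF s[unfolded spM]])
  finally show "(LINT r|M. indicator ?A (s, r) *\<^sub>R (y s * z r)) = y s * itail T z s" .
 qed
 also have "(LINT p|(M \<Otimes>\<^sub>M M). indicator ?B p *\<^sub>R (case p of (s, r) => y s * z r)) = (LINT r|M. LINT s|M. indicator ?B (s, r) *\<^sub>R (y s * z r))"
 proof -
  have "integrable (M \<Otimes>\<^sub>M M) (%(s, r). indicator ?B (s, r) *\<^sub>R (y s * z r))"
   using IA(2) by (simp add: case_prod_beta')
  from P.integral_snd[OF this] show ?thesis by (simp add: case_prod_beta')
 qed
 also have "... = itail T (%s. itail T y s * z s) t"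
  unfolding itail_def[of T "%s. itail T y s * z s"] M_def[symmetric]
 proof (rule Bochner_Integration.integral_cong[OF refl])
  fix r assume r: "r : space M"
  have "(LINT s|M. indicator ?B (s, r) *\<^sub>R (y s * z r)) = (LINT s|M. (indicator {r<..} s *\<^sub>R y s) * z r)"
   by (rule Bochner_Integration.integral_cong) (use r in "auto simp: indicator_def space_pair_measure")
  also have "... = itail T y r * z r" using tail'[of r y] r unfolding spM by (simp only: Bochner_Integration.integral_mult_left_zero) simp
  finally show "(LINT s|M. indicator ?B (s, r) *\<^sub>R (y s * z r)) = itail T y r * z r" .
 qed
 finally show ?thesis .
qed

lemma integrable_mult_continuous:
 fixes f :: "real => complex"
 assumes "integrable (iv T) f" "continuous_on {0..T} h"
 shows "integrable (iv T) (%s. f s * h s)"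
proof -
 have "compact (h ` {0..T})" by (intro compact_continuous_image assms) auto
 then obtain B where B: "!!s. s : {0..T} ==> norm (h s) <= B" by (metis bounded_iff compact_imp_bounded imageI)
 have hm: "h : borel_measurable (iv T)"
  using integrable_continuous_on[OF assms(2)] by auto
 show ?thesis
 proof (rule Bochner_Integration.integrable_bound)
  show "integrable (iv T) (%s. B * norm (f s))" using assms by auto
  show "(%s. f s * h s) : borel_measurable (iv T)" using assms hm by auto
  show "AE s in iv T. norm (f s * h s) <= norm (B * norm (f s))"
  proof (rule AE_I2)
   fix s assume "s : space (iv T)"
   then have b: "norm (h s) <= B" using B by simp
   then have "norm (f s) * norm (h s) <= norm (f s) * B" by (intro mult_left_mono) auto
   moreover have "B >= 0" using b norm_ge_zero order_trans by blast
   ultimately show "norm (f s * h s) <= norm (B * norm (f s))" by (simp add: norm_mult mult.commute)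
  qed
 qed
qed

lemma itail_Re: "integrable (iv T) f ==> 0 <= t ==> itail T (%s. Re (f s)) t = Re (itail T f t)"
 unfolding itail_def by (rule integral_Re) (rule integrable_tail)

lemma itail_cnj: "itail T (%s. cnj (f s)) t = cnj (itail T f t)"
 unfolding itail_def by (rule Bochner_Integration.integral_cnj)

text \<open>The case \<open>z = cnj y\<close> of \<open>itail_parts\<close>, whose two halves are
  conjugate: an energy identity that needs no pointwise derivative of the path.\<close>

lemma itail_energy:
 fixes y :: "real => complex"
 assumes y: "integrable (iv T) y" and t: "0 <= t"
 shows "(norm (itail T y t))^2 = itail T (%s. 2 * Re (cnj (itail T y s) * y s)) t"
  and "integrable (iv T) (%s. 2 * Re (cnj (itail T y s) * y s))"
proof -
 have yc: "integrable (iv T) (%s. cnj (y s))" using y by simp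
 have c: "continuous_on {0..T} (%s. cnj (itail T y s))" by (intro continuous_intros itail_continuous y)
 have i1: "integrable (iv T) (%s. y s * cnj (itail T y s))"
  by (rule integrable_mult_continuous[OF y c])
 then have i1': "integrable (iv T) (%s. cnj (itail T y s) * y s)" by (simp add: mult.commute)
 then show "integrable (iv T) (%s. 2 * Re (cnj (itail T y s) * y s))"
  by (intro integrable_mult_right integrable_Re)
 have "cor ((norm (itail T y t))^2) = itail T y t * itail T (%s. cnj (y s)) t"
  unfolding itail_cnj by (rule complex_norm_square)
 also have "... = itail T (%s. y s * itail T (%s. cnj (y s)) s) t + itail T (%s. itail T y s * cnj (y s)) t"
  by (rule itail_parts[OF y yc t])
 also have "... = itail T (%s. y s * cnj (itail T y s)) t + cnj (itail T (%s. y s * cnj (itail T y s)) t)"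
  by (simp add: itail_cnj[symmetric] mult.commute)
 finally have "(norm (itail T y t))^2 = Re (itail T (%s. y s * cnj (itail T y s)) t + cnj (itail T (%s. y s * cnj (itail T y s)) t))"
  by (metis Re_complex_of_real)
 also have "... = 2 * Re (itail T (%s. y s * cnj (itail T y s)) t)" by simp
 also have "... = 2 * itail T (%s. Re (y s * cnj (itail T y s))) t" by (simp only: itail_Re[OF i1 t])
 also have "... = itail T (%s. 2 * Re (cnj (itail T y s) * y s)) t"
  by (simp only: itail_cmul[symmetric] mult.commute[of "cnj _"])
 finally show "(norm (itail T y t))^2 = itail T (%s. 2 * Re (cnj (itail T y s) * y s)) t" .
qed

lemma gronwall_tail:
 fixes E :: "real => real"
 assumes E: "continuous_on {0..T} E" and C: "0 <= C"
  and le: "!!t. t : {0..T} ==> E t <= H + C * itail T E t" and t: "t : {0..T}"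
 shows "E t <= H * exp (C * (T - t))"
proof -
 have EI: "integrable (iv T) E" by (rule integrable_continuous_on[OF E])
 \<comment> \<open>The integrating factor for a backward inequality: \<open>f\<close> increases up
   to its value \<open>H * exp (C * T)\<close> at the final time.\<close>
 define f where "f s = (H + C * integral {s..T} E) * exp (C * s)" for s
 have "f t <= f T"
 proof (rule DERIV_nonneg_imp_increasing_open[of t T f])
  show "t <= T" using t by simp
  show "continuous_on {t..T} f"
   unfolding f_def by (intro continuous_intros indefinite_integral_continuous_1' integrable_continuous_real continuous_on_subset[OF E]) (use t in auto)
  fix s assume s: "t < s" "s < T"
  have "((%s. integral {s..T} E) has_real_derivative - E s) (at s within {0..T})"
   using integral_has_real_derivative'[OF E, of s] s t by auto
  then have d: "((%s. integral {s..T} E) has_real_derivative - E s) (at s)"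
   using s t by (subst (asm) at_within_interior) (auto simp: interior_atLeastAtMost_real)
  have "(f has_real_derivative ((H + C * integral {s..T} E) * (exp (C * s) * C) + (C * - E s) * exp (C * s))) (at s)"
   unfolding f_def by (auto intro!: derivative_eq_intros d)
  moreover have "0 <= (H + C * integral {s..T} E) * (exp (C * s) * C) + (C * - E s) * exp (C * s)"
  proof -
   have "E s <= H + C * integral {s..T} E"
    using le[of s] itail_eq_integral[OF EI, of s] s t by simp
   then have "0 <= (C * exp (C * s)) * (H + C * integral {s..T} E - E s)" using C by simp
   then show ?thesis by (simp add: algebra_simps)
  qed
  ultimately show "EX y. (f has_real_derivative y) (at s) & 0 <= y" by blast
 qed
 then have 1: "(H + C * integral {t..T} E) * exp (C * t) <= H * exp (C * T)" by (simp add: f_def)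
 have "E t <= H + C * integral {t..T} E"
  using le[OF t] itail_eq_integral[OF EI, of t] t by simp
 also have "... = (H + C * integral {t..T} E) * exp (C * t) * exp (- C * t)" by (simp add: mult_exp_exp mult.assoc)
 also have "... <= H * exp (C * T) * exp (- C * t)" by (rule mult_right_mono[OF 1]) simp
 also have "... = H * exp (C * (T - t))" by (simp add: mult_exp_exp mult.assoc algebra_simps)
 finally show ?thesis .
qed

lemma itail_exp: "t : {0..T} ==> c > 0 ==> itail T (%s. exp (c * (T - s))) t = (exp (c * (T - t)) - 1) / c"
proof -
 assume t: "t : {0..T}" and c: "c > 0"
 have "((%s. exp (c * (T - s))) has_integral (- exp (c * (T - T)) / c - (- exp (c * (T - t)) / c))) {t..T}"
  by (rule fundamental_theorem_of_calculus)
   (use t c in "auto intro!: derivative_eq_intros simp: has_real_derivative_iff_has_vector_derivative[symmetric]")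
 then have "integral {t..T} (%s. exp (c * (T - s))) = (exp (c * (T - t)) - 1) / c"
  using c by (simp add: integral_unique diff_divide_distrib)
 moreover have "integrable (iv T) (%s. exp (c * (T - s)))"
  by (intro integrable_continuous_on continuous_intros)
 ultimately show ?thesis using t by (simp add: itail_eq_integral)
qed

section \<open>A linear evolution equation for sequences\<close>

text \<open>Picard iteration for the system truncated to \<open>J\<close>. All data are arguments,
  outside of any locale, so that \<open>evs_measurable\<close> can let them vary with the random
  parameter.\<close>

primrec pic :: "real => ('k => real) => (real => 'k => 'k => complex) => ('k => real => complex) => 'k set => nat => 'k => real => complex" where
 "pic T rh K g J 0 = (%k t. 0)"
| "pic T rh K g J (Suc i) = (%k t. if k : J then
  (itail T (g k) t + itail T (%s. SUM j:J. K s k j * pic T rh K g J i j s) t) / cor ((rh k)^2) else 0)"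

definition gal :: "real => ('k => real) => (real => 'k => 'k => complex) => ('k => real => complex) => nat => 'k => real => complex" where
 "gal T rh K g n k t = lim (%i. pic T rh K g {k. (rh k)^2 <= real n} i k t)"

definition evs :: "real => ('k => real) => (real => 'k => 'k => complex) => ('k => real => complex) => 'k => real => complex" where
 "evs T rh K g k t = lim (%n. gal T rh K g n k t)"

lemma itail_le_itail_0:
 fixes h :: "real => real"
 assumes h: "integrable (iv T) h" "!!s. s : {0..T} ==> 0 <= h s" and t: "0 <= t"
 shows "itail T h t <= itail T h 0"
proof -
 have i: "h integrable_on {0..T}" using integrable_on_lebesgue_on[OF h(1)] by auto
 have "integral {t..T} h <= integral {0..T} h"
  by (rule integral_subset_le) (use h t integrable_on_subinterval[OF i] i in auto)
 then show ?thesis using itail_eq_integral[OF h(1)] t by simp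
qed

text \<open>Used twice: with weights \<open>rh ^ 4\<close> for the \<open>D(A)\<close> bound and
  with weights \<open>rh ^ 2\<close> for differences measured in \<open>V\<close>.\<close>

lemma energy_gronwall:
 fixes x y :: "'k => real => complex"
 assumes J: "finite J" and yI: "!!k. k : J ==> integrable (iv T) (y k)"
  and x: "!!k t. k : J ==> t : {0..T} ==> x k t = itail T (y k) t"
  and h: "integrable (iv T) h" "!!s. s : {0..T} ==> 0 <= h s" and C: "0 <= C"
  and le: "!!s. s : {0..T} ==> (SUM k:J. w k * (2 * Re (cnj (x k s) * y k s))) <= C * (SUM k:J. w k * (norm (x k s))^2) + h s"
  and t: "t : {0..T}"
 shows "(SUM k:J. w k * (norm (x k t))^2) <= itail T h 0 * exp (C * T)"
proof -
 define E where "E t = (SUM k:J. w k * (norm (x k t))^2)" for t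
 have Ec: "continuous_on {0..T} E"
 proof -
  have xc: "continuous_on {0..T} (x k)" if "k : J" for k
   using itail_continuous[OF yI[OF that]] by (rule continuous_on_eq) (use x[OF that] in simp)
  show ?thesis unfolding E_def by (intro continuous_intros xc)
 qed
 have EI: "integrable (iv T) E" by (rule integrable_continuous_on[OF Ec])
 have E: "E t = itail T (%s. SUM k:J. w k * (2 * Re (cnj (x k s) * y k s))) t"
  and I: "integrable (iv T) (%s. SUM k:J. w k * (2 * Re (cnj (x k s) * y k s)))"
  if t: "t : {0..T}" for t
 proof -
  have i: "integrable (iv T) (%s. w k * (2 * Re (cnj (x k s) * y k s)))" if k: "k : J" for k
  proof -
   have I: "integrable (iv T) (%s. w k * (2 * Re (cnj (itail T (y k) s) * y k s)))"
    by (rule integrable_mult_right, rule itail_energy(2)[OF yI[OF k] order_refl])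
   show ?thesis
    by (rule Bochner_Integration.integrable_cong[THEN iffD1, OF refl _ I]) (use x[OF k] in simp)
  qed
  then show "integrable (iv T) (%s. SUM k:J. w k * (2 * Re (cnj (x k s) * y k s)))"
   by (rule Bochner_Integration.integrable_sum)
  have "w k * (norm (x k t))^2 = itail T (%s. w k * (2 * Re (cnj (x k s) * y k s))) t" if k: "k : J" for k
  proof -
   have "(norm (x k t))^2 = itail T (%s. 2 * Re (cnj (itail T (y k) s) * y k s)) t"
    using itail_energy(1)[OF yI[OF k], of t] x[OF k t] t by simp
   also have "... = itail T (%s. 2 * Re (cnj (x k s) * y k s)) t"
    by (rule itail_cong) (use x[OF k] t in auto)
   finally show ?thesis by (simp only: itail_cmul)
  qed
  then have "E t = (SUM k:J. itail T (%s. w k * (2 * Re (cnj (x k s) * y k s))) t)" by (simp add: E_def)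
  also have "... = itail T (%s. SUM k:J. w k * (2 * Re (cnj (x k s) * y k s))) t"
   unfolding itail_def by (rule Bochner_Integration.integral_sum[symmetric]) (rule integrable_tail[OF i], use t in auto)
  finally show "E t = itail T (%s. SUM k:J. w k * (2 * Re (cnj (x k s) * y k s))) t" .
 qed
 have h0: "0 <= itail T h 0" unfolding itail_def by (rule Bochner_Integration.integral_nonneg) (use h in auto)
 have "E t <= itail T h 0 + C * itail T E t" if t: "t : {0..T}" for t
 proof -
  have "E t <= itail T (%s. C * E s + h s) t"
   unfolding E[OF t]
  proof (rule itail_mono[OF I[OF t]])
   show "integrable (iv T) (%s. C * E s + h s)" using EI h by auto
   show "0 <= t" using t by simp
   fix s assume "s : {t..T}"
   then have "s : {0..T}" using t by auto
   from le[OF this] show "(SUM k:J. w k * (2 * Re (cnj (x k s) * y k s))) <= C * E s + h s"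
    by (simp only: E_def)
  qed
  also have "... = C * itail T E t + itail T h t"
   using itail_add(1)[of T "%s. C * E s" h t] EI h t by (simp add: itail_cmul)
  also have "itail T h t <= itail T h 0" by (rule itail_le_itail_0[OF h]) (use t in auto)
  finally show ?thesis by simp
 qed
 then have "E t <= itail T h 0 * exp (C * (T - t))" by (rule gronwall_tail[OF Ec C _ t])
 also have "... <= itail T h 0 * exp (C * T)"
  using C t h0 by (intro mult_left_mono) (auto intro!: mult_left_mono)
 finally show ?thesis by (simp add: E_def)
qed

text \<open>Only the Hermitian part of \<open>M\<close> contributes to the real part of the form,
  and this part can be bounded in the weight \<open>r\<close> when \<open>M\<close> is not.\<close>

lemma quadratic_form_bound:
 fixes x :: "'k => complex"
 assumes J: "finite J" and S: "sch C (%k j. norm (M k j + cnj (M j k)) / (r k * r j))" and r: "!!k. r k > 0"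
 shows "2 * Re (SUM k:J. SUM j:J. cnj (x k) * M k j * x j) <= C * (SUM k:J. (r k)^2 * (norm (x k))^2)"
proof -
 let ?S = "SUM k:J. SUM j:J. cnj (x k) * M k j * x j"
 have "cnj ?S = (SUM j:J. SUM k:J. cnj (x k) * cnj (M j k) * x j)"
  by (simp add: mult_ac)
 also have "... = (SUM k:J. SUM j:J. cnj (x k) * cnj (M j k) * x j)" by (rule sum.swap)
 finally have "?S + cnj ?S = (SUM k:J. SUM j:J. cnj (x k) * (M k j + cnj (M j k)) * x j)"
  by (simp add: sum.distrib[symmetric] algebra_simps)
 then have "2 * Re ?S = Re (SUM k:J. SUM j:J. cnj (x k) * (M k j + cnj (M j k)) * x j)"
  by (metis complex_add_cnj Re_complex_of_real)
 also have "... <= norm (SUM k:J. SUM j:J. cnj (x k) * (M k j + cnj (M j k)) * x j)" by (rule complex_Re_le_cmod)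
 also have "... <= (SUM k:J. SUM j:J. norm (M k j + cnj (M j k)) / (r k * r j) * (r k * norm (x k)) * (r j * norm (x j)))"
 proof (intro sum_norm_le)
  fix k j
  have "r k ~= 0" "r j ~= 0" using r[of k] r[of j] by auto
  then show "norm (cnj (x k) * (M k j + cnj (M j k)) * x j) <= norm (M k j + cnj (M j k)) / (r k * r j) * (r k * norm (x k)) * (r j * norm (x j))"
   by (simp add: norm_mult)
 qed
 also have "... <= C * L2_set (%k. r k * norm (x k)) J * L2_set (%k. r k * norm (x k)) J"
  by (rule sch_D[OF S J J]) (use r in "auto simp: less_imp_le")
 also have "... = C * (SUM k:J. (r k)^2 * (norm (x k))^2)"
  by (simp add: L2_set_def mult.assoc power_mult_distrib sum_nonneg)
 finally show ?thesis .
qed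

text \<open>\<open>S0\<close> controls \<open>K\<close> itself at the price of one weight
  \<open>rh\<close>: sequences in \<open>V\<close> give time derivatives in l2. \<open>S1\<close>
  and \<open>S2\<close> say that the energies of \<open>V\<close> and of \<open>D(A)\<close> lose
  nothing. \<open>low\<close> makes the truncations finite, and \<open>gam\<close> majorizes the
  forcing at every time.\<close>

locale evol =
 fixes T C :: real and rh :: "'k => real" and K :: "real => 'k => 'k => complex"
  and g :: "'k => real => complex" and gam :: "real => real"
 assumes T_pos: "0 < T" and C0: "0 <= C" and rh1: "!!k. 1 <= rh k" and low: "!!R. finite {k. (rh k)^2 <= R}"
  and Kc: "!!k j. continuous_on {0..T} (%t. K t k j)"
  and S0: "!!t. t : {0..T} ==> sch C (%k j. norm (K t k j) / ((rh k)^2 * rh j))"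
  and S1: "!!t. t : {0..T} ==> sch C (%k j. norm (K t k j + cnj (K t j k)) / (rh k * rh j))"
  and S2: "!!t. t : {0..T} ==> sch C (%k j. norm ((rh k)^2 * K t k j + cnj ((rh j)^2 * K t j k)) / ((rh k)^2 * (rh j)^2))"
  and gI: "!!k. integrable (iv T) (g k)"
  and gb: "!!t F. t : {0..T} ==> finite F ==> (SUM k:F. (norm (g k t))^2) <= gam t"
  and gamI: "integrable (iv T) gam"
begin

lemma rh_pos: "0 < rh k" "rh k ~= 0" "0 < (rh k)^2" "1 <= (rh k)^2"
 using rh1[of k] by (auto simp: one_le_power)

lemma gam_nonneg: "t : {0..T} ==> 0 <= gam t" using gb[of t "{}"] by simp

definition galsol :: "'k set => ('k => real => complex) => bool" where
 "galsol J x \<longleftrightarrow> (ALL k. continuous_on {0..T} (x k)) & (ALL k t. k ~: J --> x k t = 0) &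
  (ALL k:J. ALL t:{0..T}. x k t = itail T (%s. (g k s + (SUM j:J. K s k j * x j s)) / cor ((rh k)^2)) t)"

lemma galsol_integrable:
 assumes "!!k. continuous_on {0..T} (x k)"
 shows "integrable (iv T) (%s. SUM j:J. K s k j * x j s)"
  "integrable (iv T) (%s. (g k s + (SUM j:J. K s k j * x j s)) / cor ((rh k)^2))"
proof -
 show 1: "integrable (iv T) (%s. SUM j:J. K s k j * x j s)"
  by (intro integrable_continuous_on continuous_intros Kc assms)
 show "integrable (iv T) (%s. (g k s + (SUM j:J. K s k j * x j s)) / cor ((rh k)^2))"
  by (intro integrable_divide Bochner_Integration.integrable_add gI 1)
qed

lemma pic_continuous: "continuous_on {0..T} (pic T rh K g J i k)"
proof (induction i arbitrary: k)
 case (Suc i)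
 have "continuous_on {0..T} (%t. (itail T (g k) t + itail T (%s. SUM j:J. K s k j * pic T rh K g J i j s) t) / cor ((rh k)^2))"
  by (intro continuous_intros itail_continuous gI galsol_integrable(1) Suc) (use rh_pos in auto)
 then show ?case by (cases "k : J") auto
qed simp

text \<open>The truncated system is linear with continuous coefficients apart from the additive
  forcing, which cancels in the increments. So Picard iteration converges uniformly on the whole
  interval, not just on a short one.\<close>

lemma galerkin_exists:
 assumes J: "finite J"
 shows "galsol J (%k t. if t : {0..T} then lim (%i. pic T rh K g J i k t) else 0)"
  and "k ~: J ==> lim (%i. pic T rh K g J i k t) = 0"
  and "t : {0..T} ==> (%i. pic T rh K g J i k t) ----> lim (%i. pic T rh K g J i k t)"
proof -
 define P where "P i = pic T rh K g J i" for i
 have Pc: "continuous_on {0..T} (P i k)" for i k unfolding P_def by (rule pic_continuous)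
 have P0: "P 0 k t = 0" for k t by (simp add: P_def)
 have Pout: "P i k t = 0" if "k ~: J" for i k t using that by (cases i) (auto simp: P_def)
 have PS: "P (Suc i) k t = (itail T (g k) t + itail T (%s. SUM j:J. K s k j * P i j s) t) / cor ((rh k)^2)" if "k : J" for i k t
  using that by (simp add: P_def)
 have bd: "EX B. ALL s:{0..T}. f s <= B" if "continuous_on {0..T} f" for f :: "real => real"
  using compact_continuous_image[OF that] by (meson bdd_above_def bounded_imp_bdd_above compact_Icc compact_imp_bounded imageI)
 have "continuous_on {0..T} (%s. SUM k:J. SUM j:J. norm (K s k j))" by (intro continuous_intros Kc)
 then obtain B1 where B1: "!!s. s : {0..T} ==> (SUM k:J. SUM j:J. norm (K s k j)) <= B1" using bd by blast
 define Lam where "Lam = max 1 B1"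
 have Lam: "Lam >= 1" "!!s. s : {0..T} ==> (SUM k:J. SUM j:J. norm (K s k j)) <= Lam"
  using B1 by (auto simp: Lam_def le_max_iff_disj)
 define D where "D i s = (SUM k:J. norm (P (Suc i) k s - P i k s))" for i s
 have Dc: "continuous_on {0..T} (D i)" for i unfolding D_def by (intro continuous_intros Pc)
 have D0: "0 <= D i s" for i s unfolding D_def by (intro sum_nonneg) auto
 obtain A1 where A1: "!!s. s : {0..T} ==> D 0 s <= A1" using bd[OF Dc[of 0]] by blast
 define A where "A = max 0 A1"
 have A: "0 <= A" "!!s. s : {0..T} ==> D 0 s <= A" using A1 by (auto simp: A_def le_max_iff_disj)
 \<comment> \<open>The exponential weight gains \<open>1 / (2 * Lam)\<close> at each integration
   against the factor \<open>Lam\<close> of the kernel, so the weighted increments are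
   halved.\<close>
 have Db: "D i t <= A * (1/2)^i * exp (2 * Lam * (T - t))" if "t : {0..T}" for i t
  using that
 proof (induction i arbitrary: t)
  case 0
  have "1 <= exp (2 * Lam * (T - t))" using Lam 0 by simp
  then have "A * 1 <= A * exp (2 * Lam * (T - t))" using A by (intro mult_left_mono)
  then show ?case using A(2)[OF 0] by simp
 next
  case (Suc i)
  have t: "t : {0..T}" "0 <= t" using Suc by auto
  have dk: "norm (P (Suc (Suc i)) k t - P (Suc i) k t) <= itail T (%s. SUM j:J. norm (K s k j) * D i s) t" if k: "k : J" for k
  proof -
   have I: "integrable (iv T) (%s. SUM j:J. K s k j * P i j s)" for i by (rule galsol_integrable(1)[OF Pc])
   have "P (Suc (Suc i)) k t - P (Suc i) k t = (itail T (%s. SUM j:J. K s k j * P (Suc i) j s) t - itail T (%s. SUM j:J. K s k j * P i j s) t) / cor ((rh k)^2)"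
    unfolding PS[OF k] by (simp add: diff_divide_distrib add_divide_distrib)
   also have "... = itail T (%s. (SUM j:J. K s k j * P (Suc i) j s) - (SUM j:J. K s k j * P i j s)) t / cor ((rh k)^2)"
    by (subst itail_add(2)[OF I I t(2)]) simp
   also have "norm ... <= norm (itail T (%s. (SUM j:J. K s k j * P (Suc i) j s) - (SUM j:J. K s k j * P i j s)) t)"
    using rh_pos(4)[of k] rh_pos(3)[of k] by (simp add: norm_divide norm_power divide_le_eq mult_le_cancel_left1 del: of_real_power)
   also have "... <= itail T (%s. SUM j:J. norm (K s k j) * D i s) t"
   proof (rule norm_itail_le[OF _ _ t(2)])
    show "integrable (iv T) (%s. (SUM j:J. K s k j * P (Suc i) j s) - (SUM j:J. K s k j * P i j s))" using I by auto
    show "integrable (iv T) (%s. SUM j:J. norm (K s k j) * D i s)"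
     by (intro integrable_continuous_on continuous_intros Kc Dc)
    fix s
    have "norm (P (Suc i) j s - P i j s) <= D i s" if "j : J" for j
     unfolding D_def by (rule member_le_sum[OF that]) (use J in auto)
    then have "norm (SUM j:J. K s k j * (P (Suc i) j s - P i j s)) <= (SUM j:J. norm (K s k j) * D i s)"
     by (intro sum_norm_le) (auto simp: norm_mult intro: mult_left_mono)
    then show "norm ((SUM j:J. K s k j * P (Suc i) j s) - (SUM j:J. K s k j * P i j s)) <= (SUM j:J. norm (K s k j) * D i s)"
     by (simp add: sum_subtractf[symmetric] right_diff_distrib)
   qed
   finally show ?thesis .
  qed
  have "D (Suc i) t <= (SUM k:J. itail T (%s. SUM j:J. norm (K s k j) * D i s) t)"
   unfolding D_def[of "Suc i"] by (rule sum_mono[OF dk])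
  also have "... = itail T (%s. SUM k:J. SUM j:J. norm (K s k j) * D i s) t"
   unfolding itail_def
   by (rule Bochner_Integration.integral_sum[symmetric], rule integrable_tail[OF _ t(2)])
    (intro integrable_continuous_on continuous_intros Kc Dc)
  also have "... <= itail T (%s. (Lam * A * (1/2)^i) * exp (2 * Lam * (T - s))) t"
  proof (rule itail_mono[OF _ _ t(2)])
   show "integrable (iv T) (%s. SUM k:J. SUM j:J. norm (K s k j) * D i s)"
    by (intro integrable_continuous_on continuous_intros Kc Dc)
   show "integrable (iv T) (%s. (Lam * A * (1/2)^i) * exp (2 * Lam * (T - s)))"
    by (intro integrable_continuous_on continuous_intros)
   fix s assume "s : {t..T}"
   then have s: "s : {0..T}" using t by auto
   have "(SUM k:J. SUM j:J. norm (K s k j) * D i s) = (SUM k:J. SUM j:J. norm (K s k j)) * D i s"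
    by (simp add: sum_distrib_right)
   also have "... <= Lam * (A * (1/2)^i * exp (2 * Lam * (T - s)))"
    using Lam(1) by (intro mult_mono Lam(2)[OF s] Suc.IH[OF s] D0) auto
   finally show "(SUM k:J. SUM j:J. norm (K s k j) * D i s) <= (Lam * A * (1/2)^i) * exp (2 * Lam * (T - s))"
    by (simp add: mult_ac)
  qed
  also have "... = (Lam * A * (1/2)^i) * ((exp (2 * Lam * (T - t)) - 1) / (2 * Lam))"
   using itail_exp[OF t(1), of "2 * Lam"] Lam(1) by (simp only: itail_cmul)
  also have "... = A * (1/2)^Suc i * (exp (2 * Lam * (T - t)) - 1)" using Lam(1) by (simp add: field_simps)
  also have "... <= A * (1/2)^Suc i * exp (2 * Lam * (T - t))" using A by (intro mult_left_mono) auto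
  finally show ?case .
 qed
 define Q where "Q = A * exp (2 * Lam * T)"
 have Q: "norm (P (Suc i) k t - P i k t) <= Q * (1/2)^i" if t: "t : {0..T}" for i k t
 proof (cases "k : J")
  case True
  have "norm (P (Suc i) k t - P i k t) <= D i t" unfolding D_def by (rule member_le_sum[OF True]) (use J in auto)
  also have "... <= A * (1/2)^i * exp (2 * Lam * (T - t))" by (rule Db[OF t])
  also have "... <= A * (1/2)^i * exp (2 * Lam * T)" using A Lam t by (intro mult_left_mono) auto
  finally show ?thesis by (simp add: Q_def mult_ac)
 next
  case False
  then show ?thesis using A by (simp add: Pout Q_def)
 qed
 have tel: "(SUM i<n. P (Suc i) k t - P i k t) = P n k t" for n k t
  using sum_lessThan_telescope[of "%i. P i k t" n] P0 by simp
 have smQ: "summable (%i. Q * (1/2)^i)" by (intro summable_mult summable_geometric) auto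
 have UL: "uniform_limit {0..T} (%n t. P n k t) (%t. \<Sum>i. P (Suc i) k t - P i k t) sequentially" for k
 proof -
  have "uniform_limit {0..T} (%n t. SUM i<n. P (Suc i) k t - P i k t) (%t. \<Sum>i. P (Suc i) k t - P i k t) sequentially"
   by (rule Weierstrass_m_test[OF _ smQ]) (rule Q)
  then show ?thesis unfolding tel .
 qed
 define X where "X k t = lim (%i. P i k t)" for k t
 have Plim: "(%n. P n k t) ----> X k t" if "t : {0..T}" for k t
  using tendsto_uniform_limitI[OF UL that] unfolding X_def by (metis limI)
 then show "t : {0..T} ==> (%i. pic T rh K g J i k t) ----> lim (%i. pic T rh K g J i k t)" for k t
  by (simp add: X_def P_def)
 have Xeq: "X k t = (\<Sum>i. P (Suc i) k t - P i k t)" if "t : {0..T}" for k t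
  by (rule LIMSEQ_unique[OF Plim[OF that] tendsto_uniform_limitI[OF UL that]])
 have Xc: "continuous_on {0..T} (X k)" for k
  by (rule continuous_on_eq[OF uniform_limit_theorem[OF _ UL]]) (use Pc Xeq in "auto intro!: always_eventually")
 have Xout: "X k t = 0" if "k ~: J" for k t using Pout[OF that] by (simp add: X_def)
 then show "k ~: J ==> lim (%i. pic T rh K g J i k t) = 0" for k t by (simp add: X_def P_def)
 have Pb: "norm (P n k t) <= (\<Sum>i. Q * (1/2)^i)" if t: "t : {0..T}" for n k t
 proof -
  have "norm (P n k t) <= (SUM i<n. Q * (1/2)^i)"
   unfolding tel[where n=n and k=k and t=t, symmetric] by (rule sum_norm_le) (rule Q[OF t])
  also have "... <= (\<Sum>i. Q * (1/2)^i)" by (rule sum_le_suminf[OF smQ]) (use A in "auto simp: Q_def")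
  finally show ?thesis .
 qed
 define QQ where "QQ = (\<Sum>i. Q * (1/2)^i)"
 have Xeqn: "X k t = itail T (%s. (g k s + (SUM j:J. K s k j * X j s)) / cor ((rh k)^2)) t" if k: "k : J" and t: "t : {0..T}" for k t
 proof -
  have I: "integrable (iv T) (%s. SUM j:J. K s k j * X j s)" by (rule galsol_integrable(1)[OF Xc])
  have lim: "(%n. itail T (%s. SUM j:J. K s k j * P n j s) t) ----> itail T (%s. SUM j:J. K s k j * X j s) t"
   unfolding itail_def
  proof (rule integral_dominated_convergence[where w="%s. SUM j:J. norm (K s k j) * QQ"])
   show "(%s. SUM j:J. K s k j * X j s) : borel_measurable (lebesgue_on {t..T})"
    by (rule borel_measurable_integrable[OF integrable_tail[OF I]]) (use t in auto)
   show "(%s. SUM j:J. K s k j * P n j s) : borel_measurable (lebesgue_on {t..T})" for n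
    by (rule borel_measurable_integrable[OF integrable_tail[OF galsol_integrable(1)[OF Pc]]]) (use t in auto)
   show "integrable (lebesgue_on {t..T}) (%s. SUM j:J. norm (K s k j) * QQ)"
    by (rule integrable_tail) (use t in "auto intro!: integrable_continuous_on continuous_intros Kc")
   show "AE s in lebesgue_on {t..T}. (%n. SUM j:J. K s k j * P n j s) ----> (SUM j:J. K s k j * X j s)"
    by (intro AE_I2 tendsto_intros Plim) (use t in auto)
   show "AE s in lebesgue_on {t..T}. norm (SUM j:J. K s k j * P n j s) <= (SUM j:J. norm (K s k j) * QQ)" for n
   proof (intro AE_I2 sum_norm_le)
    fix s j assume "s : space (lebesgue_on {t..T})"
    then have "norm (P n j s) <= QQ" unfolding QQ_def using Pb t by auto
    then show "norm (K s k j * P n j s) <= norm (K s k j) * QQ" by (simp add: norm_mult mult_left_mono)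
   qed
  qed
  have "(%n. P (Suc n) k t) ----> (itail T (g k) t + itail T (%s. SUM j:J. K s k j * X j s) t) / cor ((rh k)^2)"
   unfolding PS[OF k] by (intro tendsto_divide tendsto_add tendsto_const lim) (use rh_pos in auto)
  then have "X k t = (itail T (g k) t + itail T (%s. SUM j:J. K s k j * X j s) t) / cor ((rh k)^2)"
   using LIMSEQ_unique[OF LIMSEQ_Suc[OF Plim[OF t]]] by blast
  also have "... = itail T (%s. (g k s + (SUM j:J. K s k j * X j s)) / cor ((rh k)^2)) t"
   using itail_add(1)[OF gI I, of t k] t by (simp add: itail_def)
  finally show ?thesis .
 qed
 have "galsol J (%k t. if t : {0..T} then X k t else 0)"
  unfolding galsol_def
 proof (intro conjI allI ballI impI)
  show "continuous_on {0..T} (%t. if t : {0..T} then X k t else 0)" for k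
   by (rule continuous_on_eq[OF Xc]) auto
  show "(if t : {0..T} then X k t else 0) = 0" if "k ~: J" for k t using Xout[OF that] by simp
  fix k t assume k: "k : J" and t: "t : {0..T}"
  have "itail T (%s. (g k s + (SUM j:J. K s k j * X j s)) / cor ((rh k)^2)) t = itail T (%s. (g k s + (SUM j:J. K s k j * (if s : {0..T} then X j s else 0))) / cor ((rh k)^2)) t"
   by (rule itail_cong) (use t in auto)
  then show "(if t : {0..T} then X k t else 0) = itail T (%s. (g k s + (SUM j:J. K s k j * (if s : {0..T} then X j s else 0))) / cor ((rh k)^2)) t"
   using Xeqn[OF k t] t by (simp only: if_True)
 qed
 then show "galsol J (%k t. if t : {0..T} then lim (%i. pic T rh K g J i k t) else 0)"
  unfolding X_def P_def .
qed

end

lemma Re_of_real_mult: "Re (cor r * z) = r * Re z" by simp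

section \<open>Energy bounds for the truncated systems and comparison with untruncated
  solutions\<close>

context evol begin

lemma rh_le_sq: "\<bar>rh k * norm z\<bar> <= \<bar>(rh k)^2 * norm z\<bar>"
proof -
 have "1 * rh k <= rh k * rh k" using rh1[of k] rh_pos(1)[of k] by (intro mult_right_mono) auto
 then have "rh k * norm z <= (rh k)^2 * norm z" unfolding power2_eq_square by (intro mult_right_mono) auto
 then show ?thesis using rh_pos(1)[of k] by simp
qed

definition Gam :: real where "Gam = itail T gam 0"

text \<open>The Gronwall constant of \<open>galsol_bound\<close>; the additional 1 in the exponent
  absorbs the forcing by Young's inequality.\<close>

definition B0 :: real where "B0 = sqrt (Gam * exp ((C + 1) * T))"

lemma B0_nonneg: "0 <= B0" and B0_sq: "B0^2 = Gam * exp ((C + 1) * T)"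
proof -
 have "0 <= Gam" unfolding Gam_def itail_def
  by (rule Bochner_Integration.integral_nonneg) (use gam_nonneg in auto)
 then show "0 <= B0" "B0^2 = Gam * exp ((C + 1) * T)" by (auto simp: B0_def)
qed

text \<open>The weight \<open>rh ^ 4\<close> meets the division by \<open>rh ^ 2\<close> in the
  equation, so the form that appears is that of \<open>rh ^ 2 * K\<close>, bounded by
  \<open>S2\<close>. The forcing is paired with \<open>rh ^ 2 * x\<close> and is therefore needed in
  l2 only.\<close>

lemma galsol_bound:
 assumes J: "finite J" and x: "galsol J x" and t: "t : {0..T}"
 shows "l2b B0 (%k. (rh k)^2 * norm (x k t))"
proof -
 have xc: "!!k. continuous_on {0..T} (x k)" and xo: "!!k t. k ~: J ==> x k t = 0"
  using x by (auto simp: galsol_def)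
 define y where "y k s = (g k s + (SUM j:J. K s k j * x j s)) / cor ((rh k)^2)" for k s
 have yI: "integrable (iv T) (y k)" for k unfolding y_def by (rule galsol_integrable(2)[OF xc])
 have xy: "x k t = itail T (y k) t" if "k : J" "t : {0..T}" for k t
  using x that unfolding galsol_def y_def[abs_def] by blast
 have le: "(SUM k:J. (rh k)^4 * (2 * Re (cnj (x k s) * y k s))) <= (C + 1) * (SUM k:J. (rh k)^4 * (norm (x k s))^2) + gam s" if s: "s : {0..T}" for s
 proof -
  have w: "(rh k)^4 = (rh k)^2 * (rh k)^2" for k by (simp add: power2_eq_square power4_eq_xxxx)
  have e: "(rh k)^4 * (2 * Re (cnj (x k s) * y k s)) = 2 * ((rh k)^2 * Re (cnj (x k s) * g k s)) + 2 * Re (SUM j:J. cnj (x k s) * ((rh k)^2 * K s k j) * x j s)" for k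
  proof -
   have "(rh k)^4 * Re (cnj (x k s) * y k s) = Re (cor ((rh k)^4) * (cnj (x k s) * y k s))" by simp
   also have "cor ((rh k)^4) * (cnj (x k s) * y k s) = cor ((rh k)^2) * (cnj (x k s) * g k s) + (SUM j:J. cnj (x k s) * ((rh k)^2 * K s k j) * x j s)"
    unfolding w y_def using rh_pos(2)[of k] by (simp add: field_simps sum_distrib_left power2_eq_square)
   finally have "(rh k)^4 * Re (cnj (x k s) * y k s) = (rh k)^2 * Re (cnj (x k s) * g k s) + Re (SUM j:J. cnj (x k s) * ((rh k)^2 * K s k j) * x j s)"
    by (simp only: plus_complex.sel Re_of_real_mult)
   then show ?thesis by linarith
  qed
  have q: "2 * Re (SUM k:J. SUM j:J. cnj (x k s) * (cor ((rh k)^2) * K s k j) * x j s) <= C * (SUM k:J. ((rh k)^2)^2 * (norm (x k s))^2)"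
   by (rule quadratic_form_bound[OF J]) (use S2[OF s] rh_pos in auto)
  have gx: "2 * ((rh k)^2 * Re (cnj (x k s) * g k s)) <= (rh k)^4 * (norm (x k s))^2 + (norm (g k s))^2" for k
  proof -
   have "Re (cnj (x k s) * g k s) <= norm (x k s) * norm (g k s)"
    using complex_Re_le_cmod[of "cnj (x k s) * g k s"] by (simp add: norm_mult)
   then have "2 * ((rh k)^2 * Re (cnj (x k s) * g k s)) <= 2 * ((rh k)^2 * (norm (x k s) * norm (g k s)))"
    by (intro mult_left_mono) auto
   also have "... = 2 * ((rh k)^2 * norm (x k s)) * norm (g k s)" by simp
   also have "... <= ((rh k)^2 * norm (x k s))^2 + (norm (g k s))^2" by (rule sum_squares_bound)
   finally show ?thesis by (simp add: power_mult_distrib)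
  qed
  have "(SUM k:J. (rh k)^4 * (2 * Re (cnj (x k s) * y k s))) = (SUM k:J. 2 * ((rh k)^2 * Re (cnj (x k s) * g k s))) + 2 * Re (SUM k:J. SUM j:J. cnj (x k s) * (cor ((rh k)^2) * K s k j) * x j s)"
   unfolding e sum.distrib Re_sum sum_distrib_left ..
  also have "... <= (SUM k:J. (rh k)^4 * (norm (x k s))^2 + (norm (g k s))^2) + C * (SUM k:J. ((rh k)^2)^2 * (norm (x k s))^2)"
   by (intro add_mono sum_mono gx q)
  also have "... = (C + 1) * (SUM k:J. (rh k)^4 * (norm (x k s))^2) + (SUM k:J. (norm (g k s))^2)"
   by (simp add: sum.distrib algebra_simps)
  also have "... <= (C + 1) * (SUM k:J. (rh k)^4 * (norm (x k s))^2) + gam s"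
   using gb[OF s J] by simp
  finally show ?thesis .
 qed
 have E: "(SUM k:J. (rh k)^4 * (norm (x k t))^2) <= itail T gam 0 * exp ((C + 1) * T)"
  by (rule energy_gronwall[OF J yI xy gamI gam_nonneg _ le t]) (use C0 in auto)
 show ?thesis
  unfolding B0_def
 proof (rule l2b_I)
  fix F :: "'k set" assume F: "finite F"
  have "(SUM k:F. ((rh k)^2 * norm (x k t))^2) = (SUM k:F Int J. ((rh k)^2 * norm (x k t))^2)"
   by (rule sum.mono_neutral_right) (use F xo in auto)
  also have "... <= (SUM k:J. ((rh k)^2 * norm (x k t))^2)" by (rule sum_mono2) (use J in auto)
  also have "... = (SUM k:J. (rh k)^4 * (norm (x k t))^2)" by (simp add: power_mult_distrib)
  finally show "(SUM k:F. ((rh k)^2 * norm (x k t))^2) <= Gam * exp ((C + 1) * T)" using E by (simp add: Gam_def)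
 qed
qed

lemma kernel_row:
 assumes s: "s : {0..T}" and x: "l2b e (%j. rh j * norm (x j))"
 shows "(%j. norm (K s k j * x j)) summable_on UNIV" "norm (\<Sum>\<^sub>\<infinity>j. K s k j * x j) <= (rh k)^2 * (C * e)"
  "l2b (C * e) (%k. norm (\<Sum>\<^sub>\<infinity>j. K s k j * x j) / (rh k)^2)"
proof -
 let ?X = "%k j. norm (K s k j) / ((rh k)^2 * rh j)"
 have X0: "0 <= ?X k j" for k j using rh_pos by (simp add: less_imp_le)
 note im = sch_image[OF S0[OF s] X0 x _ C0]
 have c0: "0 <= rh j * norm (x j)" for j using rh_pos(1)[of j] by simp
 have eq: "norm (K s k j * x j) = (rh k)^2 * (?X k j * (rh j * norm (x j)))" for k j
  using rh_pos(2)[of k] rh_pos(2)[of j] by (simp add: norm_mult)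
 show sm: "(%j. norm (K s k j * x j)) summable_on UNIV" for k
  unfolding eq by (rule summable_on_cmult_right) (rule im(1)[OF c0])
 have le: "norm (\<Sum>\<^sub>\<infinity>j. K s k j * x j) <= (rh k)^2 * (\<Sum>\<^sub>\<infinity>j. ?X k j * (rh j * norm (x j)))" for k
 proof -
  have "norm (\<Sum>\<^sub>\<infinity>j. K s k j * x j) <= (\<Sum>\<^sub>\<infinity>j. norm (K s k j * x j))" by (rule norm_infsum_bound[OF sm])
  also have "... = (rh k)^2 * (\<Sum>\<^sub>\<infinity>j. ?X k j * (rh j * norm (x j)))" unfolding eq by (rule infsum_cmult_right')
  finally show ?thesis .
 qed
 have l2: "l2b (C * e) (%k. \<Sum>\<^sub>\<infinity>j. ?X k j * (rh j * norm (x j)))" by (rule im(2)[OF c0])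
 have "(\<Sum>\<^sub>\<infinity>j. ?X k j * (rh j * norm (x j))) <= C * e" using l2b_point[OF l2, of k] by simp
 then have "(rh k)^2 * (\<Sum>\<^sub>\<infinity>j. ?X k j * (rh j * norm (x j))) <= (rh k)^2 * (C * e)" by (rule mult_left_mono) simp
 then show "norm (\<Sum>\<^sub>\<infinity>j. K s k j * x j) <= (rh k)^2 * (C * e)" using le[of k] by linarith
 show "l2b (C * e) (%k. norm (\<Sum>\<^sub>\<infinity>j. K s k j * x j) / (rh k)^2)"
 proof (rule l2b_mono_abs[OF l2])
  fix k
  have "norm (\<Sum>\<^sub>\<infinity>j. K s k j * x j) / (rh k)^2 <= (\<Sum>\<^sub>\<infinity>j. ?X k j * (rh j * norm (x j)))"
   using le[of k] rh_pos(3)[of k] by (simp add: field_simps)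
  then show "\<bar>norm (\<Sum>\<^sub>\<infinity>j. K s k j * x j) / (rh k)^2\<bar> <= \<bar>\<Sum>\<^sub>\<infinity>j. ?X k j * (rh j * norm (x j))\<bar>"
   using rh_pos(3)[of k] by simp
 qed
qed

text \<open>On the modes with \<open>rh ^ 2 > n\<close> one factor \<open>rh\<close> is worth at
  least \<open>sqrt n\<close>.\<close>

lemma l2b_high:
 assumes x: "l2b B (%k. (rh k)^2 * norm (x k))" and n: "0 < n"
 shows "l2b (B / sqrt n) (%k. rh k * norm (if (rh k)^2 <= n then 0 else x k))"
proof -
 have "l2b (\<bar>1 / sqrt n\<bar> * B) (%k. 1 / sqrt n * ((rh k)^2 * norm (x k)))" by (rule l2b_cmul[OF x])
 then have l: "l2b (B / sqrt n) (%k. 1 / sqrt n * ((rh k)^2 * norm (x k)))" using n by simp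
 show ?thesis
 proof (rule l2b_mono_abs[OF l])
  fix k
  show "\<bar>rh k * norm (if (rh k)^2 <= n then 0 else x k)\<bar> <= \<bar>1 / sqrt n * ((rh k)^2 * norm (x k))\<bar>"
  proof (cases "(rh k)^2 <= n")
   case False
   then have "sqrt n <= rh k" using rh_pos(1)[of k] by (intro real_le_lsqrt) auto
   then have "sqrt n * (rh k * norm (x k)) <= rh k * (rh k * norm (x k))" using rh_pos(1)[of k] by (intro mult_right_mono) auto
   then show ?thesis using False n rh_pos(1)[of k] by (simp add: field_simps power2_eq_square abs_mult)
  qed simp
 qed
qed

text \<open>Here \<open>x\<close> may be a larger Galerkin solution, where the infinite sum is
  finite, or any solution bounded in \<open>D(A)\<close>. Up to sign, the image of the high modes of
  \<open>x\<close> is the only forcing left in the equation for the difference, since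
  \<open>g\<close> cancels.\<close>

lemma comparison:
 assumes n: "0 < n" and J: "J = {k. (rh k)^2 <= n}" and x0: "galsol J x0"
  and xb: "!!t. t : {0..T} ==> l2b B (%k. (rh k)^2 * norm (x k t))"
  and xI: "!!k. k : J ==> integrable (iv T) (%s. \<Sum>\<^sub>\<infinity>j. K s k j * x j s)"
  and xe: "!!k t. k : J ==> t : {0..T} ==> x k t = itail T (%s. (g k s + (\<Sum>\<^sub>\<infinity>j. K s k j * x j s)) / cor ((rh k)^2)) t"
  and t: "t : {0..T}"
 shows "(SUM k:J. (rh k)^2 * (norm (x0 k t - x k t))^2) <= T * (2 * (B0 + B) * (C * (B / sqrt n))) * exp (C * T)"
proof -
 have Jf: "finite J" unfolding J by (rule low)
 have x0c: "!!k. continuous_on {0..T} (x0 k)" and x0o: "!!k t. k ~: J ==> x0 k t = 0"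
  and x0e: "!!k t. k : J ==> t : {0..T} ==> x0 k t = itail T (%s. (g k s + (SUM j:J. K s k j * x0 j s)) / cor ((rh k)^2)) t"
  using x0 by (auto simp: galsol_def)
 have B: "0 <= B" using l2b_nonneg[OF xb[of 0]] T_pos by simp
 define y where "y k s = ((SUM j:J. K s k j * x0 j s) - (\<Sum>\<^sub>\<infinity>j. K s k j * x j s)) / cor ((rh k)^2)" for k s
 define d where "d k t = x0 k t - x k t" for k t
 define tl where "tl k s = (\<Sum>\<^sub>\<infinity>j. K s k j * (if (rh j)^2 <= n then 0 else x j s))" for k s
 have yI: "integrable (iv T) (y k)" if "k : J" for k
  unfolding y_def by (intro integrable_divide Bochner_Integration.integrable_diff galsol_integrable(1) x0c xI that)
 have dy: "d k t = itail T (y k) t" if k: "k : J" and t: "t : {0..T}" for k t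
 proof -
  have i1: "integrable (iv T) (%s. (g k s + (SUM j:J. K s k j * x0 j s)) / cor ((rh k)^2))"
   by (rule galsol_integrable(2)[OF x0c])
  have i2: "integrable (iv T) (%s. (g k s + (\<Sum>\<^sub>\<infinity>j. K s k j * x j s)) / cor ((rh k)^2))"
   by (intro integrable_divide Bochner_Integration.integrable_add gI xI k)
  have "d k t = itail T (%s. (g k s + (SUM j:J. K s k j * x0 j s)) / cor ((rh k)^2) - (g k s + (\<Sum>\<^sub>\<infinity>j. K s k j * x j s)) / cor ((rh k)^2)) t"
   unfolding d_def x0e[OF k t] xe[OF k t] by (rule itail_add(2)[OF i1 i2, symmetric]) (use t in auto)
  also have "... = itail T (y k) t"
   by (rule itail_cong) (simp add: y_def diff_divide_distrib add_divide_distrib)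
  finally show ?thesis .
 qed
 define h where "h = 2 * (B0 + B) * (C * (B / sqrt n))"
 have h0: "0 <= h" unfolding h_def using B0_nonneg B C0 n by simp
 have le: "(SUM k:J. (rh k)^2 * (2 * Re (cnj (d k s) * y k s))) <= C * (SUM k:J. (rh k)^2 * (norm (d k s))^2) + h" if s: "s : {0..T}" for s
 proof -
  have xs: "l2b B (%j. rh j * norm (x j s))"
   by (rule l2b_mono_abs[OF xb[OF s]]) (rule rh_le_sq)
  have hi: "l2b (B / sqrt n) (%k. rh k * norm (if (rh k)^2 <= n then 0 else x k s))"
   by (rule l2b_high[OF xb[OF s] n])
  have split: "(\<Sum>\<^sub>\<infinity>j. K s k j * x j s) = (SUM j:J. K s k j * x j s) + tl k s" for k
  proof -
   have "(\<Sum>\<^sub>\<infinity>j. K s k j * x j s) = (\<Sum>\<^sub>\<infinity>j\<in>J Un - J. K s k j * x j s)" by simp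
   also have "... = (\<Sum>\<^sub>\<infinity>j\<in>J. K s k j * x j s) + (\<Sum>\<^sub>\<infinity>j\<in>- J. K s k j * x j s)"
    by (rule infsum_Un_disjoint)
     (use summable_on_subset[OF abs_summable_summable[OF kernel_row(1)[OF s xs]]] in auto)
   also have "(\<Sum>\<^sub>\<infinity>j\<in>- J. K s k j * x j s) = tl k s"
    unfolding tl_def by (rule infsum_cong_neutral) (auto simp: J)
   also have "(\<Sum>\<^sub>\<infinity>j\<in>J. K s k j * x j s) = (SUM j:J. K s k j * x j s)" using Jf by simp
   finally show ?thesis .
  qed
  have e: "(rh k)^2 * (2 * Re (cnj (d k s) * y k s)) = 2 * Re (SUM j:J. cnj (d k s) * K s k j * d j s) + 2 * - Re (cnj (d k s) * tl k s)" for k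
  proof -
   have "(rh k)^2 * Re (cnj (d k s) * y k s) = Re (cor ((rh k)^2) * (cnj (d k s) * y k s))" by (simp del: of_real_power)
   also have "cor ((rh k)^2) * (cnj (d k s) * y k s) = cnj (d k s) * ((SUM j:J. K s k j * x0 j s) - (\<Sum>\<^sub>\<infinity>j. K s k j * x j s))"
    unfolding y_def using rh_pos(2)[of k] by simp
   also have "... = (SUM j:J. cnj (d k s) * K s k j * d j s) - cnj (d k s) * tl k s"
   proof -
    have "(SUM j:J. K s k j * x0 j s) - (SUM j:J. K s k j * x j s) = (SUM j:J. K s k j * d j s)"
     by (simp add: d_def sum_subtractf[symmetric] right_diff_distrib)
    then have "(SUM j:J. K s k j * x0 j s) - (\<Sum>\<^sub>\<infinity>j. K s k j * x j s) = (SUM j:J. K s k j * d j s) - tl k s"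
     unfolding split by (simp add: algebra_simps)
    then show ?thesis by (simp add: right_diff_distrib sum_distrib_left mult.assoc)
   qed
   finally have "(rh k)^2 * Re (cnj (d k s) * y k s) = Re (SUM j:J. cnj (d k s) * K s k j * d j s) - Re (cnj (d k s) * tl k s)"
    by (simp only: minus_complex.sel)
   then show ?thesis by linarith
  qed
  have q: "2 * Re (SUM k:J. SUM j:J. cnj (d k s) * K s k j * d j s) <= C * (SUM k:J. (rh k)^2 * (norm (d k s))^2)"
   by (rule quadratic_form_bound[OF Jf S1[OF s]]) (rule rh_pos)
  \<comment> \<open>The weight is distributed as \<open>rh ^ 2\<close> and
    \<open>1 / rh ^ 2\<close>: the difference is bounded in \<open>D(A)\<close>, while
    \<open>S0\<close> applied to the high modes in \<open>V\<close> supplies the decay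
    \<open>1 / sqrt n\<close>.\<close>
  have tlb: "(SUM k:J. - Re (cnj (d k s) * tl k s)) <= (B0 + B) * (C * (B / sqrt n))"
  proof -
   have "(SUM k:J. - Re (cnj (d k s) * tl k s)) <= (SUM k:J. \<bar>(rh k)^2 * norm (d k s)\<bar> * \<bar>norm (tl k s) / (rh k)^2\<bar>)"
   proof (rule sum_mono)
    fix k
    have "- Re (cnj (d k s) * tl k s) <= norm (cnj (d k s) * tl k s)"
     using abs_Re_le_cmod[of "cnj (d k s) * tl k s"] by linarith
    then show "- Re (cnj (d k s) * tl k s) <= \<bar>(rh k)^2 * norm (d k s)\<bar> * \<bar>norm (tl k s) / (rh k)^2\<bar>"
     using rh_pos(2)[of k] by (simp add: norm_mult abs_mult)
   qed
   also have "... <= L2_set (%k. (rh k)^2 * norm (d k s)) J * L2_set (%k. norm (tl k s) / (rh k)^2) J"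
    by (rule L2_set_mult_ineq)
   also have "... <= (B0 + B) * (C * (B / sqrt n))"
   proof (intro mult_mono)
    have "l2b (B0 + B) (%k. (rh k)^2 * norm (x0 k s) + (rh k)^2 * norm (x k s))"
     by (rule l2b_add[OF galsol_bound[OF Jf x0 s] xb[OF s]])
    then have "l2b (B0 + B) (%k. (rh k)^2 * norm (d k s))"
    proof (rule l2b_mono_abs)
     fix k
     have "norm (d k s) <= norm (x0 k s) + norm (x k s)" unfolding d_def by (rule norm_triangle_ineq4)
     then have "(rh k)^2 * norm (d k s) <= (rh k)^2 * (norm (x0 k s) + norm (x k s))" by (intro mult_left_mono) auto
     then show "\<bar>(rh k)^2 * norm (d k s)\<bar> <= \<bar>(rh k)^2 * norm (x0 k s) + (rh k)^2 * norm (x k s)\<bar>" by (simp add: distrib_left)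
    qed
    then show "L2_set (%k. (rh k)^2 * norm (d k s)) J <= B0 + B" by (rule l2b_D[OF _ Jf])
    show "L2_set (%k. norm (tl k s) / (rh k)^2) J <= C * (B / sqrt n)"
     unfolding tl_def by (rule l2b_D[OF kernel_row(3)[OF s hi] Jf])
   qed (use B0_nonneg B in auto)
   finally show ?thesis .
  qed
  have "(SUM k:J. (rh k)^2 * (2 * Re (cnj (d k s) * y k s))) = 2 * Re (SUM k:J. SUM j:J. cnj (d k s) * K s k j * d j s) + 2 * (SUM k:J. - Re (cnj (d k s) * tl k s))"
   unfolding e sum.distrib Re_sum sum_distrib_left ..
  also have "... <= C * (SUM k:J. (rh k)^2 * (norm (d k s))^2) + h"
   using q tlb unfolding h_def by linarith
  finally show ?thesis .
 qed
 have "(SUM k:J. (rh k)^2 * (norm (d k t))^2) <= itail T (%_. h) 0 * exp (C * T)"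
  by (rule energy_gronwall[OF Jf yI dy _ _ C0 le t]) (use h0 in "auto intro: integrable_continuous_on")
 then show ?thesis using T_pos by (simp add: itail_const h_def d_def)
qed

section \<open>The limit of the Galerkin solutions\<close>

definition Jn :: "nat => 'k set" where "Jn n = {k. (rh k)^2 <= real n}"

definition gn :: "nat => 'k => real => complex" where
 "gn n k t = (if t : {0..T} then gal T rh K g n k t else 0)"

definition ev :: "'k => real => complex" where "ev k t = evs T rh K g k t"

lemma galsol_gn: "galsol (Jn n) (gn n)"
 using galerkin_exists(1)[of "Jn n"] low unfolding gn_def[abs_def] Jn_def gal_def by simp

lemma gn_out: "k ~: Jn n ==> gn n k t = 0" using galsol_gn[of n] by (simp add: galsol_def)

lemma finite_Jn: "finite (Jn n)" unfolding Jn_def by (rule low)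

lemma gn_infsum: "(\<Sum>\<^sub>\<infinity>j. K s k j * gn n j s) = (SUM j:Jn n. K s k j * gn n j s)"
proof -
 have "(\<Sum>\<^sub>\<infinity>j. K s k j * gn n j s) = (\<Sum>\<^sub>\<infinity>j\<in>Jn n. K s k j * gn n j s)"
  by (rule infsum_cong_neutral) (use gn_out in auto)
 then show ?thesis using finite_Jn by simp
qed

definition epsn :: "real => nat => real" where "epsn B n = T * (2 * (B0 + B) * (C * (B / sqrt (real n)))) * exp (C * T)"

lemma epsn_lim: "epsn B ----> 0"
proof -
 have "(%n. 1 / sqrt (real n)) ----> 0"
  by (intro tendsto_divide_0[OF tendsto_const] filterlim_at_top_imp_at_infinity filterlim_compose[OF sqrt_at_top filterlim_real_sequentially])
 then have "(%n. T * (2 * (B0 + B) * (C * B)) * exp (C * T) * (1 / sqrt (real n))) ----> T * (2 * (B0 + B) * (C * B)) * exp (C * T) * 0"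
  by (intro tendsto_intros)
 then show ?thesis unfolding epsn_def[abs_def] by (simp add: mult_ac)
qed

lemma gn_comparison:
 assumes nm: "0 < n" "n <= m" and t: "t : {0..T}"
 shows "(SUM k:Jn n. (rh k)^2 * (norm (gn n k t - gn m k t))^2) <= epsn B0 n"
 unfolding epsn_def
proof (rule comparison[OF _ Jn_def galsol_gn _ _ _ t])
 show "0 < real n" using nm by simp
 show "l2b B0 (%k. (rh k)^2 * norm (gn m k t))" if "t : {0..T}" for t
  by (rule galsol_bound[OF finite_Jn galsol_gn that])
 show "integrable (iv T) (%s. \<Sum>\<^sub>\<infinity>j. K s k j * gn m j s)" for k
  unfolding gn_infsum by (rule galsol_integrable(1)) (use galsol_gn[of m] in "auto simp: galsol_def")
 fix k t assume k: "k : Jn n" and t: "t : {0..T}"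
 have "k : Jn m" using k nm unfolding Jn_def by auto
 then show "gn m k t = itail T (%s. (g k s + (\<Sum>\<^sub>\<infinity>j. K s k j * gn m j s)) / cor ((rh k)^2)) t"
  unfolding gn_infsum using galsol_gn[of m] t unfolding galsol_def by blast
qed

lemma in_Jn: "EX N>0. ALL n>=N. k : Jn n"
proof -
 obtain N where "(rh k)^2 <= real N" using real_arch_simple by blast
 then show ?thesis unfolding Jn_def by (intro exI[of _ "Suc N"]) auto
qed

lemma gn_lim: "t : {0..T} ==> (%n. gn n k t) ----> ev k t"
proof -
 assume t: "t : {0..T}"
 have c: "norm (gn n k t - gn m k t) <= sqrt (epsn B0 n)" if "k : Jn n" "0 < n" "n <= m" for n m
 proof (rule real_le_rsqrt)
  have "(norm (gn n k t - gn m k t))^2 <= (rh k)^2 * (norm (gn n k t - gn m k t))^2"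
   using rh_pos(4)[of k] by (simp add: mult_le_cancel_right1)
  also have "... <= (SUM k:Jn n. (rh k)^2 * (norm (gn n k t - gn m k t))^2)"
   by (rule member_le_sum[OF that(1)]) (use finite_Jn in auto)
  also have "... <= epsn B0 n" by (rule gn_comparison[OF that(2,3) t])
  finally show "(norm (gn n k t - gn m k t))^2 <= epsn B0 n" .
 qed
 have e0: "(%n. sqrt (epsn B0 n)) ----> 0" using tendsto_real_sqrt[OF epsn_lim] by simp
 obtain N where N: "0 < N" "!!n. n >= N ==> k : Jn n" using in_Jn by blast
 have "Cauchy (%n. gn n k t)"
 proof (rule CauchyI)
  fix e :: real assume "0 < e"
  then obtain M where M: "!!n. n >= M ==> sqrt (epsn B0 n) < e / 2"
   using order_tendstoD(2)[OF e0, of "e/2"] unfolding eventually_sequentially by auto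
  define p where "p = max M N"
  have "norm (gn m k t - gn n k t) < e" if "m >= p" "n >= p" for m n
  proof -
   have 1: "norm (gn p k t - gn q k t) < e / 2" if "q >= p" for q
    using c[of p q] N(2)[of p] N(1) M[of p] that unfolding p_def by (smt (verit) max.cobounded1 max.cobounded2 le_trans less_le_trans)
   have "gn m k t - gn n k t = (gn p k t - gn n k t) - (gn p k t - gn m k t)" by simp
   then have "norm (gn m k t - gn n k t) <= norm (gn p k t - gn n k t) + norm (gn p k t - gn m k t)"
    by (metis norm_triangle_ineq4)
   then show ?thesis using 1[OF that(1)] 1[OF that(2)] by linarith
  qed
  then show "EX M. ALL m>=M. ALL n>=M. norm (gn m k t - gn n k t) < e" by blast
 qed
 then have "convergent (%n. gn n k t)" by (simp add: Cauchy_convergent_iff)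
 then have "(%n. gn n k t) ----> lim (%n. gn n k t)" by (simp add: convergent_LIMSEQ_iff)
 then show ?thesis using t by (simp add: ev_def evs_def gn_def)
qed

lemma ev_bound: "t : {0..T} ==> l2b B0 (%k. (rh k)^2 * norm (ev k t))"
 unfolding l2b_def
proof (intro allI impI)
 fix F :: "'k set" assume t: "t : {0..T}" and F: "finite F"
 have "(%n. L2_set (%k. (rh k)^2 * norm (gn n k t)) F) ----> L2_set (%k. (rh k)^2 * norm (ev k t)) F"
  unfolding L2_set_def by (intro tendsto_intros gn_lim t)
 then show "L2_set (%k. (rh k)^2 * norm (ev k t)) F <= B0"
  by (rule tendsto_upperbound) (auto intro!: always_eventually l2b_D[OF galsol_bound[OF finite_Jn galsol_gn t] F])
qed

definition en :: "nat => real" where "en n = sqrt (epsn B0 n) + B0 / sqrt (real n)"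

lemma en_lim: "en ----> 0"
proof -
 have "(%n. B0 / sqrt (real n)) ----> 0"
  by (intro tendsto_divide_0[OF tendsto_const] filterlim_at_top_imp_at_infinity filterlim_compose[OF sqrt_at_top filterlim_real_sequentially])
 then have "(%n. sqrt (epsn B0 n) + B0 / sqrt (real n)) ----> sqrt 0 + 0"
  by (intro tendsto_intros epsn_lim)
 then show ?thesis by (simp add: en_def[abs_def])
qed

text \<open>On the retained modes \<open>m\<close> tends to infinity in
  \<open>gn_comparison\<close>; on the others \<open>gn\<close> vanishes and the \<open>D(A)\<close>
  bound on \<open>ev\<close> makes it small. The two errors are the summands of
  \<open>en\<close>.\<close>

lemma gn_ev:
 assumes n: "0 < n" and t: "t : {0..T}"
 shows "l2b (en n) (%k. rh k * norm (gn n k t - ev k t))"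
proof -
 have 1: "(SUM k:Jn n. (rh k)^2 * (norm (gn n k t - ev k t))^2) <= epsn B0 n"
 proof (rule tendsto_upperbound)
  show "(%m. SUM k:Jn n. (rh k)^2 * (norm (gn n k t - gn m k t))^2) ----> (SUM k:Jn n. (rh k)^2 * (norm (gn n k t - ev k t))^2)"
   by (intro tendsto_intros gn_lim t)
  show "\<forall>\<^sub>F m in sequentially. (SUM k:Jn n. (rh k)^2 * (norm (gn n k t - gn m k t))^2) <= epsn B0 n"
   unfolding eventually_sequentially using gn_comparison[OF n _ t] by blast
 qed simp
 define a where "a k = (if k : Jn n then rh k * norm (gn n k t - ev k t) else 0)" for k
 have la: "l2b (sqrt (epsn B0 n)) a"
 proof (rule l2b_I)
  fix F :: "'k set" assume F: "finite F"
  have "(SUM k:F. (a k)^2) = (SUM k:F Int Jn n. (a k)^2)"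
   by (rule sum.mono_neutral_right) (use F in "auto simp: a_def")
  also have "... <= (SUM k:Jn n. (a k)^2)" by (rule sum_mono2) (use finite_Jn in auto)
  also have "... <= epsn B0 n" using 1 by (simp add: a_def power_mult_distrib)
  finally show "(SUM k:F. (a k)^2) <= epsn B0 n" .
 qed
 have lb: "l2b (B0 / sqrt (real n)) (%k. rh k * norm (if (rh k)^2 <= real n then 0 else ev k t))"
  by (rule l2b_high[OF ev_bound[OF t]]) (use n in simp)
 have "l2b (en n) (%k. a k + rh k * norm (if (rh k)^2 <= real n then 0 else ev k t))"
  unfolding en_def by (rule l2b_add[OF la lb])
 moreover have "a k + rh k * norm (if (rh k)^2 <= real n then 0 else ev k t) = rh k * norm (gn n k t - ev k t)" for k
  using gn_out[of k n t] by (auto simp: a_def Jn_def)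
 ultimately show ?thesis by simp
qed

lemma ev_uniform: "uniform_limit {0..T} (%n. gn n k) (ev k) sequentially"
proof (rule uniform_limitI)
 fix e :: real assume e: "0 < e"
 have "\<forall>\<^sub>F n in sequentially. en n < e" by (rule order_tendstoD(2)[OF en_lim e])
 then show "\<forall>\<^sub>F n in sequentially. ALL t:{0..T}. dist (gn n k t) (ev k t) < e"
  using eventually_gt_at_top[of 0]
 proof eventually_elim
  case (elim n)
  show ?case
  proof
   fix t assume t: "t : {0..T}"
   have "norm (gn n k t - ev k t) <= rh k * norm (gn n k t - ev k t)" using rh1[of k] by (simp add: mult_le_cancel_right1)
   also have "... <= en n" using l2b_point[OF gn_ev[OF elim(2) t], of k] by simp
   finally show "dist (gn n k t) (ev k t) < e" using elim by (simp add: dist_norm)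
  qed
 qed
qed

lemma gn_continuous: "continuous_on {0..T} (gn n k)" using galsol_gn[of n] by (simp add: galsol_def)

lemma ev_continuous: "continuous_on {0..T} (ev k)"
 by (rule uniform_limit_theorem[OF _ ev_uniform]) (auto intro!: always_eventually gn_continuous)

lemma ev_V: "t : {0..T} ==> l2b B0 (%k. rh k * norm (ev k t))"
 by (rule l2b_mono_abs[OF ev_bound], assumption, rule rh_le_sq)

text \<open>By \<open>S0\<close> each row of \<open>K\<close> is a functional bounded in
  \<open>V\<close> uniformly in time, so the uniform convergence in \<open>V\<close> of
  \<open>gn_ev\<close> carries over. Continuity in time of the infinite row sum follows from
  this.\<close>

lemma Kev_uniform: "uniform_limit {0..T} (%n s. SUM j:Jn n. K s k j * gn n j s) (%s. \<Sum>\<^sub>\<infinity>j. K s k j * ev j s) sequentially"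
proof (rule uniform_limitI)
 fix e :: real assume e: "0 < e"
 have "(%n. (rh k)^2 * (C * en n)) ----> (rh k)^2 * (C * 0)" by (intro tendsto_intros en_lim)
 then have "(%n. (rh k)^2 * (C * en n)) ----> 0" by simp
 then have "\<forall>\<^sub>F n in sequentially. (rh k)^2 * (C * en n) < e" by (rule order_tendstoD(2)[OF _ e])
 then show "\<forall>\<^sub>F n in sequentially. ALL s:{0..T}. dist (SUM j:Jn n. K s k j * gn n j s) (\<Sum>\<^sub>\<infinity>j. K s k j * ev j s) < e"
  using eventually_gt_at_top[of 0]
 proof eventually_elim
  case (elim n)
  show ?case
  proof
   fix s assume s: "s : {0..T}"
   have "(\<Sum>\<^sub>\<infinity>j. K s k j * gn n j s) = (\<Sum>\<^sub>\<infinity>j. K s k j * (gn n j s - ev j s) + K s k j * ev j s)"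
    by (simp add: algebra_simps)
   also have "... = (\<Sum>\<^sub>\<infinity>j. K s k j * (gn n j s - ev j s)) + (\<Sum>\<^sub>\<infinity>j. K s k j * ev j s)"
    by (rule infsum_add) (use abs_summable_summable[OF kernel_row(1)[OF s gn_ev[OF elim(2) s]]] abs_summable_summable[OF kernel_row(1)[OF s ev_V[OF s]]] in auto)
   finally have "(SUM j:Jn n. K s k j * gn n j s) - (\<Sum>\<^sub>\<infinity>j. K s k j * ev j s) = (\<Sum>\<^sub>\<infinity>j. K s k j * (gn n j s - ev j s))"
    unfolding gn_infsum by simp
   also have "norm ... <= (rh k)^2 * (C * en n)" by (rule kernel_row(2)[OF s gn_ev[OF elim(2) s]])
   finally show "dist (SUM j:Jn n. K s k j * gn n j s) (\<Sum>\<^sub>\<infinity>j. K s k j * ev j s) < e" using elim by (simp add: dist_norm)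
  qed
 qed
qed

lemma Kev_continuous: "continuous_on {0..T} (%s. \<Sum>\<^sub>\<infinity>j. K s k j * ev j s)"
 by (rule uniform_limit_theorem[OF _ Kev_uniform]) (auto intro!: always_eventually continuous_intros Kc gn_continuous)

theorem ev_equation:
 assumes t: "t : {0..T}"
 shows "ev k t = itail T (%s. (g k s + (\<Sum>\<^sub>\<infinity>j. K s k j * ev j s)) / cor ((rh k)^2)) t"
proof -
 obtain N where N: "0 < N" "!!n. n >= N ==> k : Jn n" using in_Jn by blast
 have KI: "integrable (iv T) (%s. \<Sum>\<^sub>\<infinity>j. K s k j * ev j s)"
  by (rule integrable_continuous_on[OF Kev_continuous])
 have nI: "integrable (iv T) (%s. SUM j:Jn n. K s k j * gn n j s)" for n
  by (rule galsol_integrable(1)[OF gn_continuous])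
 define a where "a n = itail T (%s. SUM j:Jn n. K s k j * gn n j s) t" for n
 define b where "b = itail T (%s. \<Sum>\<^sub>\<infinity>j. K s k j * ev j s) t"
 have ab: "a ----> b"
 proof (rule LIMSEQ_I)
  fix e :: real assume e: "0 < e"
  have eT: "0 < e / (T + 1)" using e T_pos by simp
  have "\<forall>\<^sub>F n in sequentially. ALL s:{0..T}. dist (SUM j:Jn n. K s k j * gn n j s) (\<Sum>\<^sub>\<infinity>j. K s k j * ev j s) < e / (T + 1)"
   by (rule uniform_limitD[OF Kev_uniform eT])
  then obtain M where M: "!!n s. n >= M ==> s : {0..T} ==> dist (SUM j:Jn n. K s k j * gn n j s) (\<Sum>\<^sub>\<infinity>j. K s k j * ev j s) < e / (T + 1)"
   unfolding eventually_sequentially by blast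
  have "norm (a n - b) < e" if n: "n >= M" for n
  proof -
   have "a n - b = itail T (%s. (SUM j:Jn n. K s k j * gn n j s) - (\<Sum>\<^sub>\<infinity>j. K s k j * ev j s)) t"
    unfolding a_def b_def by (rule itail_add(2)[OF nI KI, symmetric]) (use t in auto)
   also have "norm ... <= itail T (%_. e / (T + 1)) t"
    by (rule norm_itail_le) (use nI KI t M[OF n] in "auto simp: dist_norm intro: integrable_continuous_on less_imp_le")
   also have "... = (T - t) * (e / (T + 1))" by (rule itail_const) (use t in auto)
   also have "... <= T * (e / (T + 1))" using t eT by (intro mult_right_mono) auto
   also have "... < e" using T_pos e by (simp add: field_simps)
   finally show ?thesis .
  qed
  then show "EX M. ALL n>=M. norm (a n - b) < e" by blast
 qed
 have "(%n. (itail T (g k) t + a n) / cor ((rh k)^2)) ----> (itail T (g k) t + b) / cor ((rh k)^2)"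
  by (intro tendsto_divide tendsto_add tendsto_const ab) (use rh_pos in auto)
 moreover have "\<forall>\<^sub>F n in sequentially. (itail T (g k) t + a n) / cor ((rh k)^2) = gn n k t"
  unfolding eventually_sequentially
 proof (intro exI allI impI)
  fix n assume "N <= n"
  then have "gn n k t = itail T (%s. (g k s + (SUM j:Jn n. K s k j * gn n j s)) / cor ((rh k)^2)) t"
   using galsol_gn[of n] N(2) t unfolding galsol_def by blast
  also have "... = itail T (%s. g k s + (SUM j:Jn n. K s k j * gn n j s)) t / cor ((rh k)^2)"
   by (simp add: itail_def)
  also have "... = (itail T (g k) t + a n) / cor ((rh k)^2)"
   unfolding a_def using itail_add(1)[OF gI nI] t by simp
  finally show "(itail T (g k) t + a n) / cor ((rh k)^2) = gn n k t" by simp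
 qed
 ultimately have "(%n. gn n k t) ----> (itail T (g k) t + b) / cor ((rh k)^2)"
  by (rule Lim_transform_eventually)
 then have "ev k t = (itail T (g k) t + b) / cor ((rh k)^2)"
  using LIMSEQ_unique[OF gn_lim[OF t]] by blast
 also have "... = itail T (%s. g k s + (\<Sum>\<^sub>\<infinity>j. K s k j * ev j s)) t / cor ((rh k)^2)"
  unfolding b_def using itail_add(1)[OF gI KI] t by simp
 also have "... = itail T (%s. (g k s + (\<Sum>\<^sub>\<infinity>j. K s k j * ev j s)) / cor ((rh k)^2)) t"
  by (simp add: itail_def)
 finally show ?thesis .
qed

text \<open>The candidate is compared with the Galerkin solutions instead of with \<open>ev\<close>,
  so finite sums suffice in the energy identity and no such identity is required for the infinite
  system.\<close>

theorem ev_unique: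
 assumes xb: "!!t. t : {0..T} ==> l2b B (%k. (rh k)^2 * norm (x k t))"
  and xI: "!!k. integrable (iv T) (%s. \<Sum>\<^sub>\<infinity>j. K s k j * x j s)"
  and xe: "!!k t. t : {0..T} ==> x k t = itail T (%s. (g k s + (\<Sum>\<^sub>\<infinity>j. K s k j * x j s)) / cor ((rh k)^2)) t"
  and t: "t : {0..T}"
 shows "x k t = ev k t"
proof -
 have c: "norm (gn n k t - x k t) <= sqrt (epsn B n)" if "k : Jn n" "0 < n" for n
 proof (rule real_le_rsqrt)
  have "(norm (gn n k t - x k t))^2 <= (rh k)^2 * (norm (gn n k t - x k t))^2"
   using rh_pos(4)[of k] by (simp add: mult_le_cancel_right1)
  also have "... <= (SUM k:Jn n. (rh k)^2 * (norm (gn n k t - x k t))^2)"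
   by (rule member_le_sum[OF that(1)]) (use finite_Jn in auto)
  also have "... <= epsn B n" unfolding epsn_def
   by (rule comparison[OF _ Jn_def galsol_gn xb xI xe t]) (use that in auto)
  finally show "(norm (gn n k t - x k t))^2 <= epsn B n" .
 qed
 obtain N where N: "0 < N" "!!n. n >= N ==> k : Jn n" using in_Jn by blast
 have "(%n. gn n k t - x k t) ----> 0"
 proof (rule Lim_null_comparison)
  show "\<forall>\<^sub>F n in sequentially. norm (gn n k t - x k t) <= sqrt (epsn B n)"
   unfolding eventually_sequentially using c N by (meson less_le_trans)
  show "(%n. sqrt (epsn B n)) ----> 0" using tendsto_real_sqrt[OF epsn_lim] by simp
 qed
 then have "(%n. gn n k t) ----> x k t" by (simp add: LIM_zero_iff)
 then show ?thesis using LIMSEQ_unique[OF gn_lim[OF t]] by auto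
qed

end

section \<open>Sobolev spaces on the torus\<close>

text \<open>In \<open>hsb_mult\<close>, \<open>x\<close> is the weight at the output frequency,
  \<open>y\<close> and \<open>z\<close> are those of the two factors. The right-hand side is the
  weight of \<open>master_kernel\<close>; the factor 4 covers all three exponents.\<close>

lemma weight_ineq:
 fixes x y z :: real
 assumes "1 <= x" "1 <= y" "1 <= z" "x <= y + z" "s <= 2"
 shows "x ^ s / (z^2 * y ^ s) <= 4 * (1 / z^2 + 1 / y^2 + 1 / x^2)"
proof -
 have p: "0 < x" "0 < y" "0 < z" using assms by auto
 define a b c d where "a = 1 / x^2" and "b = 1 / y^2" and "c = 1 / z^2" and "d = 1 / (y * z)"
 have yz: "2 * d <= b + c"
  using sum_squares_bound[of "1 / y" "1 / z"] by (simp add: power_divide b_def c_def d_def)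
 have nn: "0 <= a" "0 <= b" "0 <= c" by (auto simp: a_def b_def c_def)
 define m where "m = x ^ s / (z^2 * y ^ s)"
 have "m <= 4 * (c + b + a)"
 proof -
  consider "s = 0" | "s = 1" | "s = 2" using assms(5) by linarith
  then show ?thesis
  proof cases
   case 1
   have "m = c" by (simp add: 1 c_def m_def)
   then show ?thesis using nn unfolding distrib_left by linarith
  next
   case 2
   have "m <= (y + z) / (z^2 * y)" using p assms unfolding m_def 2 power_one_right by (intro divide_right_mono) auto
   also have "... = c + d" using p by (simp add: field_simps power2_eq_square c_def d_def)
   finally show ?thesis using yz nn unfolding distrib_left by linarith
  next
   case 3
   have "x^2 <= (y + z)^2" using p assms by (intro power_mono) auto
   also have "... <= 2 * (y^2 + z^2)" using sum_squares_bound[of y z] by (simp add: power2_sum)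
   finally have "m <= 2 * (y^2 + z^2) / (z^2 * y^2)" using p unfolding m_def 3 by (intro divide_right_mono) auto
   also have "... = 2 * c + 2 * b" using p by (simp add: field_simps c_def b_def)
   finally show ?thesis using nn unfolding distrib_left by linarith
  qed
 qed
 then show ?thesis by (simp only: a_def b_def c_def m_def)
qed

context helm begin

abbreviation (input) "DS s == DA L (real s)"

text \<open>The Sobolev bound carries an explicit constant because the Schur constants must be
  uniform along a path.\<close>

definition hsb :: "nat => real => (real^2 => real) => bool" where
 "hsb s A f \<longleftrightarrow> periodic L f & l2t f & l2b A (%k. rho k ^ s * norm (fc f k))"

abbreviation hs :: "nat => (real^2 => real) => bool" where "hs s f \<equiv> EX A. hsb s A f"

lemma hsb_D: "hsb s A f ==> periodic L f" "hsb s A f ==> l2t f" "hsb s A f ==> l2b A (%k. rho k ^ s * norm (fc f k))"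
 by (auto simp: hsb_def)

lemma hsb_nonneg: "hsb s A f ==> 0 <= A" by (rule l2b_nonneg[OF hsb_D(3)])

lemma hsb_int: "hsb s A f ==> integrable tor f" by (rule l2t_integrable[OF hsb_D(2)])

lemma hsb_mono: "hsb s A f ==> s' <= s ==> hsb s' A f"
proof -
 assume a: "hsb s A f" "s' <= s"
 have "l2b A (%k. rho k ^ s' * norm (fc f k))"
 proof (rule l2b_mono_abs[OF hsb_D(3)[OF a(1)]])
  fix k
  have "rho k ^ s' <= rho k ^ s" by (rule power_increasing[OF a(2) rho_ge1])
  then show "\<bar>rho k ^ s' * norm (fc f k)\<bar> <= \<bar>rho k ^ s * norm (fc f k)\<bar>"
   by (simp add: abs_mult mult_right_mono)
 qed
 then show ?thesis using a by (simp add: hsb_def)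
qed

lemma hsb_weaken: "hsb s A f ==> A <= B ==> hsb s B f" using l2b_weaken by (auto simp: hsb_def)

lemma periodic_add: "periodic L f ==> periodic L g ==> periodic L (%x. f x + g x)"
 and periodic_mult: "periodic L f' ==> periodic L g' ==> periodic L (%x. f' x * (g' x :: real))"
 and periodic_const: "periodic L (%x. c)"
 for f g :: "real^2 => real"
 by (auto simp: periodic_def)

lemma hsb_add: "hsb s A f ==> hsb s B g ==> hsb s (A + B) (%x. f x + g x)"
proof -
 assume a: "hsb s A f" "hsb s B g"
 have "l2b (A + B) (%k. rho k ^ s * norm (fc (%x. f x + g x) k))"
 proof (rule l2b_mono_abs[OF l2b_add[OF hsb_D(3)[OF a(1)] hsb_D(3)[OF a(2)]]])
  fix k
  have "norm (fc (%x. f x + g x) k) <= norm (fc f k) + norm (fc g k)"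
   unfolding fc_add[OF hsb_int[OF a(1)] hsb_int[OF a(2)]] by (rule norm_triangle_ineq)
  then have "rho k ^ s * norm (fc (%x. f x + g x) k) <= rho k ^ s * (norm (fc f k) + norm (fc g k))"
   by (intro mult_left_mono) auto
  then show "\<bar>rho k ^ s * norm (fc (%x. f x + g x) k)\<bar> <= \<bar>rho k ^ s * norm (fc f k) + rho k ^ s * norm (fc g k)\<bar>"
   by (simp add: distrib_left)
 qed
 then show ?thesis using a by (simp add: hsb_def periodic_add l2t_add)
qed

lemma hsb_cmul: "hsb s A f ==> hsb s (\<bar>c\<bar> * A) (%x. c * f x)"
proof -
 assume a: "hsb s A f"
 have "l2b (\<bar>c\<bar> * A) (%k. rho k ^ s * norm (fc (%x. c * f x) k))"
  by (rule l2b_mono_abs[OF l2b_cmul[OF hsb_D(3)[OF a], of c]]) (simp add: fc_cmul norm_mult abs_mult)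
 then show ?thesis using a by (simp add: hsb_def periodic_mult periodic_const l2t_cmul)
qed

lemma hsb_diff: "hsb s A f ==> hsb s B g ==> hsb s (A + B) (%x. f x - g x)"
 using hsb_add[of s A f B "%x. -1 * g x"] hsb_cmul[of s B g "-1"] by simp

lemma hsb_zero: "hsb s 0 (%x. 0)"
 unfolding hsb_def using l2b_zero by (simp add: l2t_const periodic_const fc_def)

lemma hsb_sum: "finite I ==> (!!i. i : I ==> hsb s (A i) (f i)) ==> hsb s (SUM i:I. A i) (%x. SUM i:I. f i x)"
 by (induction I rule: finite_induct) (auto intro: hsb_zero hsb_add)

lemma hsb_0: "periodic L f ==> l2t f ==> hs 0 f"
 using summable_l2b[OF summable_fc_sq] by (auto simp: hsb_def)

lemma norm_iksym: "norm (\<i> * cor (kap * real_of_int (k $ j))) <= rho k / sqrt a1"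
proof -
 have "norm (\<i> * cor (kap * real_of_int (k $ j))) = kap * \<bar>real_of_int (k $ j)\<bar>"
  using abs_of_pos[OF kap_pos] by (simp only: norm_mult norm_ii mult_1_left norm_of_real abs_mult)
 then show ?thesis using kap_le_rho[of k j] by simp
qed

lemma hsb_wd:
 assumes f: "hsb (Suc s) A f"
 shows "hsb s (A / sqrt a1) (wd L j f)" "fc (wd L j f) k = \<i> * (kap * k $ j) * fc f k"
proof -
 note p = hsb_D(1)[OF f] and l = hsb_D(2)[OF f]
 have bd: "norm (kap * k $ j * fc f k) <= (1 / sqrt a1) * (rho k * norm (fc f k))" for k
 proof -
  have "norm (kap * k $ j * fc f k) = norm (\<i> * cor (kap * real_of_int (k $ j))) * norm (fc f k)"
   by (simp add: norm_mult norm_divide)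
  also have "... <= rho k / sqrt a1 * norm (fc f k)" by (rule mult_right_mono[OF norm_iksym]) simp
  finally show ?thesis by simp
 qed
 have l1: "l2b (\<bar>1 / sqrt a1\<bar> * A) (%k. 1 / sqrt a1 * (rho k ^ 1 * norm (fc f k)))"
  by (rule l2b_cmul[OF hsb_D(3)[OF hsb_mono[OF f]]]) simp
 have "l2b (\<bar>1 / sqrt a1\<bar> * A) (%k. norm (kap * k $ j * fc f k))"
  by (rule l2b_mono_abs[OF l1]) (use bd a1_pos in simp)
 then have s: "(%k. (norm (kap * k $ j * fc f k))^2) summable_on UNIV" by (rule l2b_summable)
 note w = wd_fc[OF p l s]
 show fcw: "fc (wd L j f) k = \<i> * (kap * k $ j) * fc f k" for k by (rule w(3))
 have l2: "l2b (\<bar>1 / sqrt a1\<bar> * A) (%k. 1 / sqrt a1 * (rho k ^ Suc s * norm (fc f k)))"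
  by (rule l2b_cmul[OF hsb_D(3)[OF f]])
 have "l2b (\<bar>1 / sqrt a1\<bar> * A) (%k. rho k ^ s * norm (fc (wd L j f) k))"
 proof (rule l2b_mono_abs[OF l2])
  fix k
  have "norm (fc (wd L j f) k) <= 1 / sqrt a1 * (rho k * norm (fc f k))"
   using bd[of k] unfolding fcw by (simp add: norm_mult norm_divide)
  then have "rho k ^ s * norm (fc (wd L j f) k) <= rho k ^ s * (1 / sqrt a1 * (rho k * norm (fc f k)))"
   by (intro mult_left_mono) auto
  then show "\<bar>rho k ^ s * norm (fc (wd L j f) k)\<bar> <= \<bar>1 / sqrt a1 * (rho k ^ Suc s * norm (fc f k))\<bar>"
   using a1_pos by (simp add: mult_ac)
 qed
 then show "hsb s (A / sqrt a1) (wd L j f)" using w a1_pos by (simp add: hsb_def)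
qed

lemma hs_bounded:
 assumes f: "hsb 2 A f" shows "AE x in tor. \<bar>f x\<bar> <= A * SS"
proof -
 have l: "l2b A (%k. (rho k)^2 * norm (fc f k))" by (rule hsb_D(3)[OF f])
 note s = l2b_imp_l1[OF l]
 have "AE x in tor. \<bar>f x\<bar> <= (\<Sum>\<^sub>\<infinity>k. norm (fc f k))"
  by (rule AE_bounded_fc[OF hsb_int[OF f]]) (rule s(1), simp)
 then show ?thesis by eventually_elim (use s(3) in force)
qed

text \<open>A factor in \<open>H^2\<close> is bounded, so the product is square integrable and its
  coefficients are a convolution; the weighted kernel reduces to \<open>master_kernel\<close>. The
  constant 12 is 4 from \<open>weight_ineq\<close> times 3 from
  \<open>master_kernel\<close>.\<close>

lemma hsb_mult:
 assumes f: "hsb 2 A f" and h: "hsb s B h" and s: "s <= 2"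
 shows "hsb s (12 * A * SS * B) (%x. f x * h x)"
  and "((%m. fc f (k - m) * fc h m) has_sum fc (%x. f x * h x) k) UNIV"
proof -
 note fl = hsb_D(2)[OF f] and hl = hsb_D(2)[OF h]
 have fm: "f : borel_measurable tor" by (rule l2t_meas[OF fl])
 have l: "l2t (%x. f x * h x)" by (rule l2t_bounded_mult[OF hl fm hs_bounded[OF f]])
 show hm: "((%m. fc f (k - m) * fc h m) has_sum fc (%x. f x * h x) k) UNIV" for k
  using fc_mult[OF hl fl, of k] by (simp add: mult.commute)
 define a where "a m = (rho m)^2 * norm (fc f m)" for m
 have a: "l2b A a" "!!m. 0 <= a m" unfolding a_def using hsb_D(3)[OF f] by auto
 define c where "c m = rho m ^ s * norm (fc h m)" for m
 have c: "l2b B c" "!!m. 0 <= c m" unfolding c_def using hsb_D(3)[OF h] by auto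
 define X where "X k m = a (k - m) * (rho k ^ s / ((rho (k - m))^2 * rho m ^ s))" for k m
 have X0: "0 <= X k m" for k m unfolding X_def using a by simp
 have "sch (4 * (3 * A * SS)) (%k j. 4 * (a (k - j) * (1 / (rho (k - j))^2 + 1 / (rho j)^2 + 1 / (rho k)^2)))"
  by (rule sch_cmul[OF master_kernel[OF a]]) simp
 then have "sch (4 * (3 * A * SS)) X"
 proof (rule sch_mono)
  fix k j
  have "rho k ^ s / ((rho (k - j))^2 * rho j ^ s) <= 4 * (1 / (rho (k - j))^2 + 1 / (rho j)^2 + 1 / (rho k)^2)"
   by (rule weight_ineq) (use rho_ge1 rho_triangle s in auto)
  then have "a (k - j) * (rho k ^ s / ((rho (k - j))^2 * rho j ^ s)) <= a (k - j) * (4 * (1 / (rho (k - j))^2 + 1 / (rho j)^2 + 1 / (rho k)^2))"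
   by (rule mult_left_mono[OF _ a(2)])
  then show "X k j <= 4 * (a (k - j) * (1 / (rho (k - j))^2 + 1 / (rho j)^2 + 1 / (rho k)^2))"
   unfolding X_def mult.left_commute[of "a (k - j)" 4] .
 qed
 note im = sch_image[OF this X0 c]
 have C: "0 <= 4 * (3 * A * SS)" using hsb_nonneg[OF f] SS_nonneg by simp
 have l2: "l2b (12 * A * SS * B) (%k. \<Sum>\<^sub>\<infinity>j. X k j * c j)" using im(2)[OF C] by (simp add: mult.assoc)
 have "l2b (12 * A * SS * B) (%k. rho k ^ s * norm (fc (%x. f x * h x) k))"
 proof (rule l2b_mono_abs[OF l2])
  fix k
  have e: "rho k ^ s * norm (fc f (k - m) * fc h m) = X k m * c m" for m
   by (simp add: X_def a_def c_def norm_mult)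
  have sm: "(%m. norm (fc f (k - m) * fc h m)) summable_on UNIV"
  proof -
   have "(%m. (1 / rho k ^ s) * (X k m * c m)) summable_on UNIV" by (rule summable_on_cmult_right[OF im(1)[OF C]])
   then show ?thesis unfolding e[symmetric] by simp
  qed
  have "norm (fc (%x. f x * h x) k) <= (\<Sum>\<^sub>\<infinity>m. norm (fc f (k - m) * fc h m))"
   using norm_infsum_bound[OF sm] infsumI[OF hm[of k]] by simp
  then have "rho k ^ s * norm (fc (%x. f x * h x) k) <= rho k ^ s * (\<Sum>\<^sub>\<infinity>m. norm (fc f (k - m) * fc h m))"
   by (intro mult_left_mono) auto
  also have "... = (\<Sum>\<^sub>\<infinity>j. X k j * c j)" unfolding e[symmetric] by (rule infsum_cmult_right'[symmetric])
  finally show "\<bar>rho k ^ s * norm (fc (%x. f x * h x) k)\<bar> <= \<bar>\<Sum>\<^sub>\<infinity>j. X k j * c j\<bar>" by simp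
 qed
 then show "hsb s (12 * A * SS * B) (%x. f x * h x)"
  using l hsb_D(1)[OF f] hsb_D(1)[OF h] by (simp add: hsb_def periodic_mult)
qed

subsection \<open>Vector fields\<close>

definition solen :: "field => bool" where
 "solen u \<longleftrightarrow> (ALL k. (SUM i:UNIV. real_of_int (k $ i) * fc (cp u i) k) = 0)"

definition fsb :: "nat => real => field => bool" where
 "fsb s A u \<longleftrightarrow> (ALL i. hsb s A (cp u i)) & (ALL i. fc (cp u i) 0 = 0)"

lemma periodic_nth: "periodic L u \<longleftrightarrow> (ALL i. periodic L (cp u i))"
 by (auto simp: periodic_def vec_eq_iff)

lemma measurable_nth: "u : borel_measurable tor \<longleftrightarrow> (ALL i. (cp u i) : borel_measurable tor)" for u :: field
proof
 assume "u : borel_measurable tor"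
 then show "ALL i. (cp u i) : borel_measurable tor"
  using borel_measurable_inner[of u tor "%_. axis _ 1"] by (simp add: inner_axis)
next
 assume a: "ALL i. (cp u i) : borel_measurable tor"
 show "u : borel_measurable tor"
  by (subst borel_measurable_euclidean_space) (use a in "auto simp: Basis_vec_def inner_axis")
qed

lemma mean_zero_nth: "(!!i. l2t (cp u i)) ==> (LINT x|tor. u x) = 0 \<longleftrightarrow> (ALL i. fc (cp u i) 0 = 0)" for u :: field
proof -
 assume l: "!!i. l2t (cp u i)"
 have i: "integrable tor u"
 proof (rule Bochner_Integration.integrable_bound)
  show "integrable tor (%x. SUM i:UNIV. \<bar>u x $ i\<bar>)"
   by (intro Bochner_Integration.integrable_sum integrable_abs l2t_integrable l)
  show "u : borel_measurable tor" by (rule measurable_nth[THEN iffD2]) (use l in "simp add: l2t_def")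
  show "AE x in tor. norm (u x) <= norm (SUM i:UNIV. \<bar>u x $ i\<bar>)"
   by (rule AE_I2) (use norm_le_l1_cart order_trans abs_ge_self in "metis real_norm_def")
 qed
 have "(LINT x|tor. u x) $ i = (LINT x|tor. u x $ i)" for i
  by (rule integral_bounded_linear[OF bounded_linear_vec_nth i, symmetric])
 moreover have "fc (cp u i) 0 = cor ((LINT x|tor. u x $ i) / L^2)" for i
  by (simp add: fc_def)
 ultimately show ?thesis using L_pos by (simp add: vec_eq_iff)
qed

lemma L2dot_iff: "u : carr (L2dot L) \<longleftrightarrow> (ALL i. periodic L (cp u i) & l2t (cp u i)) & (ALL i. fc (cp u i) 0 = 0)"
proof -
 have sq: "(norm (u x))^2 = (SUM i:UNIV. (u x $ i)^2)" for x
  by (simp add: norm_vec_def L2_set_def sum_nonneg)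
 have "u : borel_measurable tor & integrable tor (%x. (norm (u x))^2) \<longleftrightarrow> (ALL i. l2t (cp u i))"
 proof
  assume a: "u : borel_measurable tor & integrable tor (%x. (norm (u x))^2)"
  then have m: "!!i. (cp u i) : borel_measurable tor" by (simp add: measurable_nth)
  have "integrable tor (%x. (u x $ i)^2)" for i
  proof (rule Bochner_Integration.integrable_bound)
   show "integrable tor (%x. (norm (u x))^2)" using a by blast
   show "(%x. (u x $ i)^2) : borel_measurable tor" using m[of i] by auto
   show "AE x in tor. norm ((u x $ i)^2) <= norm ((norm (u x))^2)"
    unfolding sq by (rule AE_I2) (auto intro!: member_le_sum order_trans[OF _ abs_ge_self])
  qed
  then show "ALL i. l2t (cp u i)" using m by (simp add: l2t_def)
 next
  assume a: "ALL i. l2t (cp u i)"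
  then show "u : borel_measurable tor & integrable tor (%x. (norm (u x))^2)"
   unfolding sq measurable_nth by (auto simp: l2t_def)
 qed
 then show ?thesis using mean_zero_nth[of u] periodic_nth[of u] unfolding L2dot_def by auto
qed

lemma norm_fourier_sq: "(norm (fourier L u k))^2 = (SUM i:UNIV. (norm (fc (cp u i) k))^2)"
 by (simp add: norm_vec_def L2_set_def sum_nonneg fourier_nth)

lemma freq_powr: "norm (freq k) powr (2 * real s) = (if k = 0 then 0 else (norm (freq k) ^ s)^2)"
proof -
 have z: "freq k = 0 \<longleftrightarrow> k = 0" by (simp add: freq_def vec_eq_iff)
 show ?thesis
 proof (cases "k = 0")
  case False
  have "(norm (freq k) ^ s)^2 = norm (freq k) ^ (2 * s)" by (simp add: power_mult[symmetric] mult.commute)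
  also have "... = norm (freq k) powr real (2 * s)" by (rule powr_realpow[symmetric]) (use False z in simp)
  finally show ?thesis using False by simp
 qed (simp add: freq_simps)
qed

text \<open>Away from the zero mode \<open>rho k\<close> and \<open>norm (freq k)\<close> are
  comparable, with constants \<open>c1\<close> and \<open>1 / cc\<close>. This translates between
  \<open>Hdot\<close> and \<open>hsb\<close>.\<close>

definition c1 :: real where "c1 = sqrt (1 + cc^2)"

lemma c1_ge1: "1 <= c1" by (simp add: c1_def)

lemma rho_freq_pow: "k ~= 0 ==> rho k ^ s <= c1 ^ s * norm (freq k) ^ s"
proof -
 assume k: "k ~= 0"
 have "rho k ^ s <= (c1 * norm (freq k)) ^ s" by (rule power_mono) (use rho_le_freq[OF k] in "auto simp: c1_def")
 then show ?thesis by (simp add: power_mult_distrib)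
qed

lemma freq_rho_pow: "norm (freq k) ^ s <= (1 / cc) ^ s * rho k ^ s"
proof -
 have "norm (freq k) <= 1 / cc * rho k" using norm_freq_le[of k] cc_pos by (simp add: field_simps)
 then have "norm (freq k) ^ s <= (1 / cc * rho k) ^ s" by (rule power_mono) simp
 then show ?thesis by (simp only: power_mult_distrib)
qed

lemma Hdot_fsb:
 assumes u: "u : carr (Hdot L (real s))"
 shows "fsb s (c1 ^ s * nrm (Hdot L (real s)) u) u"
proof -
 have L: "u : carr (L2dot L)" and sm: "(%k. norm (freq k) powr (2 * real s) * (norm (fourier L u k))^2) summable_on UNIV"
  using u by (auto simp: Hdot_def)
 have z: "fc (cp u i) 0 = 0" for i using L by (simp add: L2dot_iff)
 define N where "N = (\<Sum>\<^sub>\<infinity>k. norm (freq k) powr (2 * real s) * (norm (fourier L u k))^2)"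
 have "l2b (sqrt ((c1 ^ s)^2 * N)) (%k. rho k ^ s * norm (fc (cp u i) k))" for i
 proof (rule l2b_I)
  fix F :: "(int^2) set" assume F: "finite F"
  have "(rho k ^ s * norm (fc (cp u i) k))^2 <= (c1 ^ s)^2 * (norm (freq k) powr (2 * real s) * (norm (fourier L u k))^2)" for k
  proof (cases "k = 0")
   case True
   then show ?thesis by (simp add: z)
  next
   case False
   have "(rho k ^ s)^2 <= (c1 ^ s * norm (freq k) ^ s)^2" by (rule power_mono[OF rho_freq_pow[OF False]]) simp
   moreover have "(norm (fc (cp u i) k))^2 <= (norm (fourier L u k))^2"
    unfolding norm_fourier_sq by (rule member_le_sum) auto
   ultimately have "(rho k ^ s)^2 * (norm (fc (cp u i) k))^2 <= (c1 ^ s * norm (freq k) ^ s)^2 * (norm (fourier L u k))^2"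
    by (intro mult_mono) auto
   moreover have "norm (freq k) powr (2 * real s) = (norm (freq k) ^ s)^2" using False by (simp only: freq_powr if_False)
   ultimately show ?thesis by (simp only: power_mult_distrib mult.assoc)
  qed
  then have "(SUM k:F. (rho k ^ s * norm (fc (cp u i) k))^2) <= (SUM k:F. (c1 ^ s)^2 * (norm (freq k) powr (2 * real s) * (norm (fourier L u k))^2))"
   by (rule sum_mono)
  also have "... <= (c1 ^ s)^2 * N"
   unfolding sum_distrib_left[symmetric] N_def by (intro mult_left_mono finite_sum_le_infsum[OF sm F]) auto
  finally show "(SUM k:F. (rho k ^ s * norm (fc (cp u i) k))^2) <= (c1 ^ s)^2 * N" .
 qed
 moreover have "sqrt ((c1 ^ s)^2 * N) = c1 ^ s * nrm (Hdot L (real s)) u"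
  using c1_ge1 by (simp add: real_sqrt_mult Hdot_def N_def)
 ultimately show ?thesis using L by (simp add: fsb_def hsb_def L2dot_iff)
qed

lemma fsb_Hdot:
 assumes u: "fsb s A u"
 shows "u : carr (Hdot L (real s))" "nrm (Hdot L (real s)) u <= (1 / cc) ^ s * (2 * A)"
  "finite F ==> (SUM k:F. norm (freq k) powr (2 * real s) * (norm (fourier L u k))^2) <= ((1 / cc) ^ s * (2 * A))^2"
proof -
 have h: "hsb s A (cp u i)" for i using u by (simp add: fsb_def)
 have A: "0 <= A" by (rule hsb_nonneg[OF h[of 1]])
 have L: "u : carr (L2dot L)" using u by (auto simp: L2dot_iff fsb_def hsb_def)
 show b: "(SUM k:F. norm (freq k) powr (2 * real s) * (norm (fourier L u k))^2) <= ((1 / cc) ^ s * (2 * A))^2" if F: "finite F" for F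
 proof -
  have "norm (freq k) powr (2 * real s) * (norm (fourier L u k))^2 <= (SUM i:UNIV. ((1 / cc) ^ s)^2 * (rho k ^ s * norm (fc (cp u i) k))^2)" for k
  proof -
   have "norm (freq k) powr (2 * real s) <= (norm (freq k) ^ s)^2" by (simp add: freq_powr)
   also have "... <= ((1 / cc) ^ s * rho k ^ s)^2" by (rule power_mono[OF freq_rho_pow]) simp
   finally have "norm (freq k) powr (2 * real s) * (norm (fourier L u k))^2 <= ((1 / cc) ^ s * rho k ^ s)^2 * (norm (fourier L u k))^2"
    by (rule mult_right_mono) simp
   then show ?thesis unfolding norm_fourier_sq by (simp add: power_mult_distrib sum_distrib_left mult_ac)
  qed
  then have "(SUM k:F. norm (freq k) powr (2 * real s) * (norm (fourier L u k))^2) <= (SUM k:F. SUM i:UNIV. ((1 / cc) ^ s)^2 * (rho k ^ s * norm (fc (cp u i) k))^2)"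
   by (rule sum_mono)
  also have "... = (SUM i:UNIV. ((1 / cc) ^ s)^2 * (SUM k:F. (rho k ^ s * norm (fc (cp u i) k))^2))"
   by (subst sum.swap) (simp add: sum_distrib_left)
  also have "... <= (SUM i:(UNIV::2 set). ((1 / cc) ^ s)^2 * A^2)"
   by (intro sum_mono mult_left_mono l2b_sum_sq[OF hsb_D(3)[OF h] F]) auto
  \<comment> \<open>Two components give \<open>2 * A^2\<close>, which is rounded up to
    \<open>(2 * A)^2\<close> to avoid a root.\<close>
  also have "... <= ((1 / cc) ^ s * (2 * A))^2" by (simp add: power_mult_distrib)
  finally show ?thesis .
 qed
 have sm: "(%k. norm (freq k) powr (2 * real s) * (norm (fourier L u k))^2) summable_on UNIV"
  by (rule nonneg_bdd_above_summable_on) (auto intro!: bdd_aboveI[of _ "((1 / cc) ^ s * (2 * A))^2"] b)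
 then show "u : carr (Hdot L (real s))" using L by (simp add: Hdot_def)
 have "(\<Sum>\<^sub>\<infinity>k. norm (freq k) powr (2 * real s) * (norm (fourier L u k))^2) <= ((1 / cc) ^ s * (2 * A))^2"
  by (rule infsum_le_finite_sums[OF sm b])
 then have "sqrt (\<Sum>\<^sub>\<infinity>k. norm (freq k) powr (2 * real s) * (norm (fourier L u k))^2) <= (1 / cc) ^ s * (2 * A)"
  by (intro real_le_lsqrt) (use A cc_pos in auto)
 then show "nrm (Hdot L (real s)) u <= (1 / cc) ^ s * (2 * A)" by (simp add: Hdot_def)
qed

end

lemma has_sum_finite_sum:
 fixes f :: "'i => 'a => complex"
 assumes "finite I" "!!i. i : I ==> (f i has_sum s i) A"
 shows "((%k. SUM i:I. f i k) has_sum (SUM i:I. s i)) A"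
 using assms by (induction I rule: finite_induct) (auto intro: has_sum_add has_sum_0)

context helm begin

lemma hsb_max: "(!!i. hsb s (A i) (f i)) ==> hsb s (max (A 1) (A 2)) (f (i::2))"
 by (rule hsb_weaken[of s "A i"]) (use exhaust_2[of i] in auto)

subsection \<open>Scalar coefficients of solenoidal fields\<close>

text \<open>The factor \<open>\<i>\<close> gives \<open>nv (- k) = cnj (nv k)\<close>, so real
  fields correspond to Hermitian scalar sequences. The value 0 at \<open>k = 0\<close> encodes zero
  mean.\<close>

definition nv :: "int^2 => 2 => complex" where
 "nv k i = (if k = 0 then 0 else \<i> * cor ((if i = 1 then - real_of_int (k $ 2) else real_of_int (k $ 1)) / norm (freq k)))"

definition pr :: "field => int^2 => complex" where
 "pr u k = (SUM i:UNIV. fc (cp u i) k * cnj (nv k i))"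

lemma nv_0 [simp]: "nv 0 i = 0" by (simp add: nv_def)

lemma pr_0 [simp]: "pr u 0 = 0" by (simp add: pr_def)

lemma nv_uminus: "nv (- k) i = cnj (nv k i)"
 by (auto simp: nv_def freq_simps)

lemma pr_uminus: "pr u (- k) = cnj (pr u k)"
 by (simp add: pr_def nv_uminus fc_cnj)

lemma norm_freq_sq: "(norm (freq k))^2 = (real_of_int (k $ 1))^2 + (real_of_int (k $ 2))^2"
 unfolding power2_norm_eq_inner inner_vec_def by (simp add: sum_2 power2_eq_square)

lemma freq_eq_0: "freq k = 0 \<longleftrightarrow> k = 0" by (simp add: freq_def vec_eq_iff)

lemma norm_nv: "norm (nv k i) <= 1"
proof (cases "k = 0")
 case False
 then have p: "0 < norm (freq k)" by (simp add: freq_eq_0)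
 have c: "\<bar>real_of_int (k $ j)\<bar> <= norm (freq k)" for j using component_le_norm_cart[of "freq k" j] by simp
 then show ?thesis using False p by (auto simp: nv_def norm_mult norm_divide)
qed simp

lemma nv_solen: "(SUM i:UNIV. real_of_int (k $ i) * nv k i) = 0"
 by (simp add: nv_def UNIV_2 field_simps)

lemma nv_norm1: "(SUM i:UNIV. nv k i * cnj (nv k i)) = (if k = 0 then 0 else 1)"
proof (cases "k = 0")
 case False
 then have p: "norm (freq k) ~= 0" by (simp add: freq_eq_0)
 let ?a = "real_of_int (k $ 1)" and ?b = "real_of_int (k $ 2)" and ?n = "norm (freq k)"
 have "(SUM i:UNIV. nv k i * cnj (nv k i)) = cor (SUM i:UNIV. (norm (nv k i))^2)"
  by (simp only: complex_norm_square of_real_sum)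
 also have "(SUM i:UNIV. (norm (nv k i))^2) = ?b^2 / ?n^2 + ?a^2 / ?n^2"
  using False by (simp add: nv_def UNIV_2 norm_mult norm_divide power_divide)
 also have "... = (?a^2 + ?b^2) / ?n^2" by (simp add: add_divide_distrib)
 also have "... = 1" unfolding norm_freq_sq[symmetric] using p by simp
 finally show ?thesis using False by simp
qed simp

text \<open>In dimension two the vectors orthogonal to \<open>k\<close> form a line, spanned by
  \<open>nv k\<close>; the cross product \<open>b * u 1 - a * u 2\<close> is the remaining
  coordinate.\<close>

lemma nv_complete:
 fixes u :: "2 => complex"
 assumes "k ~= 0" "(SUM i:UNIV. real_of_int (k $ i) * u i) = 0"
 shows "u i = (SUM j:UNIV. u j * cnj (nv k j)) * nv k i"
proof -
 define a b n where "a = cor (real_of_int (k $ 1))" and "b = cor (real_of_int (k $ 2))" and "n = cor (norm (freq k))"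
 have n: "n ~= 0" using assms by (simp add: n_def freq_eq_0)
 have n2: "n * n = a * a + b * b"
  using arg_cong[OF norm_freq_sq[of k], of cor] by (simp add: a_def b_def n_def power2_eq_square)
 have d: "a * u 1 + b * u 2 = 0" using assms(2) by (simp add: UNIV_2 a_def b_def)
 have n1: "nv k 1 = - \<i> * b / n" "nv k 2 = \<i> * a / n" using assms(1) by (auto simp: nv_def a_def b_def n_def)
 have c1: "cnj (nv k 1) = \<i> * b / n" "cnj (nv k 2) = - \<i> * a / n" unfolding n1 by (auto simp: a_def b_def n_def)
 have s: "(SUM j:UNIV. u j * cnj (nv k j)) = \<i> * (b * u 1 - a * u 2) / n"
  unfolding UNIV_2 by (simp add: c1 algebra_simps diff_divide_distrib)
 have e1: "(b * u 1 - a * u 2) * b = n * n * u 1"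
 proof -
  have "(b * u 1 - a * u 2) * b = (a * a + b * b) * u 1 - a * (a * u 1 + b * u 2)" by (simp add: algebra_simps)
  then show ?thesis by (simp add: d n2)
 qed
 have e2: "(b * u 1 - a * u 2) * a = - (n * n * u 2)"
 proof -
  have "(b * u 1 - a * u 2) * a = - ((a * a + b * b) * u 2) + b * (a * u 1 + b * u 2)" by (simp add: algebra_simps)
  then show ?thesis by (simp add: d n2)
 qed
 have f1: "\<i> * (b * u 1 - a * u 2) / n * (- \<i> * b / n) = (b * u 1 - a * u 2) * b / (n * n)"
  and f2: "\<i> * (b * u 1 - a * u 2) / n * (\<i> * a / n) = - ((b * u 1 - a * u 2) * a) / (n * n)"
  by (simp_all add: algebra_simps diff_divide_distrib)
 have h1: "u 1 = (SUM j:UNIV. u j * cnj (nv k j)) * nv k 1" unfolding s n1 f1 e1 using n by simp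
 have h2: "u 2 = (SUM j:UNIV. u j * cnj (nv k j)) * nv k 2" unfolding s n1 f2 e2 using n by simp
 show ?thesis using exhaust_2[of i]
 proof
  assume "i = 1" show ?thesis unfolding \<open>i = 1\<close> by (rule h1)
 next
  assume "i = 2" show ?thesis unfolding \<open>i = 2\<close> by (rule h2)
 qed
qed

lemma fc_pr:
 assumes "solen u" "!!i. fc (cp u i) 0 = 0"
 shows "fc (cp u i) k = pr u k * nv k i"
proof (cases "k = 0")
 case False
 then show ?thesis unfolding pr_def
  by (rule nv_complete) (use assms(1) in "simp add: solen_def")
qed (simp add: assms)

lemma norm_pr_le: "norm (pr u k) <= (SUM i:UNIV. norm (fc (cp u i) k))"
 unfolding pr_def
proof (rule sum_norm_le)
 fix i
 have "norm (fc (cp u i) k) * norm (nv k i) <= norm (fc (cp u i) k) * 1"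
  by (intro mult_left_mono norm_nv) auto
 then show "norm (fc (cp u i) k * cnj (nv k i)) <= norm (fc (cp u i) k)" by (simp add: norm_mult)
qed

lemma l2b_pr: "(!!i. hsb s A (cp u i)) ==> l2b (2 * A) (%k. rho k ^ s * norm (pr u k))"
proof -
 assume h: "!!i. hsb s A (cp u i)"
 have "l2b (SUM i:(UNIV::2 set). A) (%k. SUM i:UNIV. rho k ^ s * norm (fc (cp u i) k))"
  by (rule l2b_sum) (use hsb_D(3)[OF h] in auto)
 then have l: "l2b (2 * A) (%k. SUM i:UNIV. rho k ^ s * norm (fc (cp u i) k))" by simp
 show ?thesis
 proof (rule l2b_mono_abs[OF l])
  fix k
  have "rho k ^ s * norm (pr u k) <= rho k ^ s * (SUM i:UNIV. norm (fc (cp u i) k))"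
   by (intro mult_left_mono norm_pr_le) simp
  then show "\<bar>rho k ^ s * norm (pr u k)\<bar> <= \<bar>SUM i:UNIV. rho k ^ s * norm (fc (cp u i) k)\<bar>"
   by (simp add: sum_distrib_left)
 qed
qed

text \<open>The inverse of \<open>pr\<close>, as a choice of representatives. The entry of
  \<open>c\<close> at 0 has no influence because \<open>nv 0 i = 0\<close>.\<close>

definition fld :: "(int^2 => complex) => field" where
 "fld c = (SOME u. ALL i. periodic L (cp u i) & l2t (cp u i) & (ALL k. fc (cp u i) k = c k * nv k i))"

lemma fld:
 assumes c: "herm c" and s: "l2b A (%k. rho k ^ s * norm (c k))"
 shows "fc (cp (fld c) i) k = c k * nv k i" "fsb s A (fld c)" "solen (fld c)" "k ~= 0 ==> pr (fld c) k = c k"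
proof -
 have n: "rho k ^ s' * norm (c k * nv k i) <= rho k ^ s' * norm (c k)" for k i s'
  unfolding norm_mult by (intro mult_left_mono) (auto intro: mult_left_le norm_nv)
 have l: "l2b A (%k. rho k ^ s * norm (c k * nv k i))" for i
  by (rule l2b_mono_abs[OF s]) (use n in simp)
 have l0: "l2b A (%k. norm (c k * nv k i))" for i
 proof (rule l2b_mono_abs[OF l[of i]])
  fix k
  have "1 * norm (c k * nv k i) <= rho k ^ s * norm (c k * nv k i)"
   by (intro mult_right_mono one_le_power rho_ge1) auto
  then show "\<bar>norm (c k * nv k i)\<bar> <= \<bar>rho k ^ s * norm (c k * nv k i)\<bar>" by simp
 qed
 have "EX f. periodic L f & l2t f & (ALL k. fc f k = c k * nv k i)" for i
 proof -
  have h: "herm (%k. c k * nv k i)" using c by (simp add: herm_def nv_uminus)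
  show ?thesis using riesz_fischer[OF h l2b_summable[OF l0]] by metis
 qed
 then obtain f where f: "!!i. periodic L (f i) & l2t (f i) & (ALL k. fc (f i) k = c k * nv k i)" by metis
 have ex: "EX u::field. ALL i. periodic L (cp u i) & l2t (cp u i) & (ALL k. fc (cp u i) k = c k * nv k i)"
  by (rule exI[of _ "%x. \<chi> i. f i x"]) (use f in simp)
 have P0: "ALL i. periodic L (cp (fld c) i) & l2t (cp (fld c) i) & (ALL k. fc (cp (fld c) i) k = c k * nv k i)"
  unfolding fld_def by (rule someI_ex[OF ex])
 have P: "periodic L (cp (fld c) i)" "l2t (cp (fld c) i)" "fc (cp (fld c) i) k = c k * nv k i" for i k
  using P0 by auto
 show "fc (cp (fld c) i) k = c k * nv k i" by (rule P)
 show "fsb s A (fld c)" using P l by (simp add: fsb_def hsb_def)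
 show "solen (fld c)"
 proof -
  have "(SUM i:UNIV. real_of_int (k $ i) * (c k * nv k i)) = c k * (SUM i:UNIV. real_of_int (k $ i) * nv k i)" for k
   by (simp add: sum_distrib_left mult_ac)
  then show ?thesis unfolding solen_def P nv_solen by simp
 qed
 assume k: "k ~= 0"
 have "pr (fld c) k = c k * (SUM i:UNIV. nv k i * cnj (nv k i))"
  unfolding pr_def P by (simp add: sum_distrib_left mult_ac)
 then show "pr (fld c) k = c k" using k by (simp only: nv_norm1 if_False mult_1_right)
qed

subsection \<open>The spaces H, V and the domains of the Stokes operator\<close>

lemma infsum_outside_boxes:
 fixes a :: "int^2 => real"
 assumes "a summable_on UNIV"
 shows "(%N. \<Sum>\<^sub>\<infinity>k. if k : boxes N then 0 else a k) ----> 0"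
  and "(%k. if k : boxes N then 0 else a k) summable_on UNIV"
proof -
 have h: "((%k. if k : boxes N then 0 else a k) has_sum ((\<Sum>\<^sub>\<infinity>k. a k) - sum a (boxes N))) UNIV" for N
 proof -
  have "((%k. a k) has_sum ((\<Sum>\<^sub>\<infinity>k. a k) - sum a (boxes N))) (UNIV - boxes N)"
   by (rule has_sum_Diff) (use assms finite_boxes in "auto intro: has_sum_finite")
  then show ?thesis by (subst (asm) has_sum_cong_neutral[of UNIV]) auto
 qed
 show "(%k. if k : boxes N then 0 else a k) summable_on UNIV" using h by (auto simp: summable_on_def)
 have "(%N. (\<Sum>\<^sub>\<infinity>k. a k) - sum a (boxes N)) ----> (\<Sum>\<^sub>\<infinity>k. a k) - (\<Sum>\<^sub>\<infinity>k. a k)"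
  by (intro tendsto_intros has_sum_boxes has_sum_infsum assms)
 then show "(%N. \<Sum>\<^sub>\<infinity>k. if k : boxes N then 0 else a k) ----> 0" using infsumI[OF h] by simp
qed

definition trunc :: "nat => field => field" where
 "trunc N u = (%x. \<chi> i. tp (boxes N) (fc (cp u i)) x)"

lemma fc_trunc: "fc (%x. trunc N u x $ i) k = (if k : boxes N then fc (cp u i) k else 0)"
 unfolding trunc_def by (simp add: fc_tp[OF symset_boxes herm_fc finite_boxes])

lemma trunc_smooth_solenoidal:
 assumes u: "u : carr (L2dot L)" "solen u" shows "trunc N u : smooth_solenoidal L"
proof -
 have 1: "periodic L (trunc N u)" unfolding periodic_nth trunc_def by (simp add: periodic_tp)
 have 2: "smooth (%y. trunc N u y $ i)" for i unfolding trunc_def by (simp add: smooth_tp)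
 have 3: "(LINT x|tor. trunc N u x) = 0"
 proof (subst mean_zero_nth)
  show "l2t (%x. trunc N u x $ i)" for i unfolding trunc_def by (simp add: l2t_continuous tp_continuous)
  show "ALL i. fc (%x. trunc N u x $ i) 0 = 0" using u(1) by (simp add: fc_trunc L2dot_iff)
 qed
 have 4: "(SUM j:UNIV. pderiv_cl j (%y. trunc N u y $ j) x) = 0" for x
 proof -
  have "pderiv_cl j (%y. trunc N u y $ j) x = Re (SUM k:boxes N. \<i> * (kap * k $ j) * fc (cp u j) k * chr k x)" for j
   unfolding trunc_def by (simp add: pderiv_tp) (simp add: tp_def)
  then have "(SUM j:UNIV. pderiv_cl j (%y. trunc N u y $ j) x) = Re (SUM j:UNIV. SUM k:boxes N. \<i> * (kap * k $ j) * fc (cp u j) k * chr k x)"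
   by (simp only: Re_sum)
  also have "(SUM j:UNIV. SUM k:boxes N. \<i> * (kap * k $ j) * fc (cp u j) k * chr k x) = (SUM k:boxes N. \<i> * kap * (SUM j:UNIV. real_of_int (k $ j) * fc (cp u j) k) * chr k x)"
   by (subst sum.swap) (simp add: sum_distrib_left sum_distrib_right mult_ac)
  also have "... = 0" using u(2) by (simp add: solen_def)
  finally show ?thesis by simp
 qed
 show ?thesis unfolding smooth_solenoidal_def using 1 2 3 4 by blast
qed

text \<open>First derivatives suffice: \<open>rho k\<close> is at most 1 plus \<open>cc\<close>
  times the sum of the \<open>\<bar>k $ j\<bar>\<close>, so the weighted coefficients are dominated
  by those of the field and of its partial derivatives.\<close>

lemma smooth_solenoidalD:
 assumes w: "w : smooth_solenoidal L"
 shows "EX A. fsb 1 A w" "solen w"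
proof -
 have sm: "smooth (cp w i)" and per: "periodic L (cp w i)" for i
  using w by (auto simp: smooth_solenoidal_def periodic_nth)
 have l: "l2t (cp w i)" for i by (rule l2t_continuous[OF smooth_continuous[OF sm]])
 have lp: "l2t (pderiv_cl j (cp w i))" for i j by (rule l2t_continuous[OF smooth_continuous[OF smooth_D(2)[OF sm]]])
 have z: "fc (cp w i) 0 = 0" for i using w mean_zero_nth[OF l] by (auto simp: smooth_solenoidal_def)
 have "EX A. l2b A (%k. rho k ^ 1 * norm (fc (cp w i) k))" for i
 proof -
  let ?f = "%x. w x $ i"
  obtain A0 where A0: "l2b A0 (%k. norm (fc ?f k))" using summable_l2b[OF summable_fc_sq[OF l[of i]]] by blast
  have "EX A. l2b A (%k. norm (fc (pderiv_cl j ?f) k))" for j using summable_l2b[OF summable_fc_sq[OF lp[of j i]]] by blast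
  then obtain B where B: "!!j. l2b (B j) (%k. norm (fc (pderiv_cl j ?f) k))" by metis
  have l2: "l2b (A0 + \<bar>sqrt a1\<bar> * (SUM j:UNIV. B j)) (%k. norm (fc ?f k) + sqrt a1 * (SUM j:UNIV. norm (fc (pderiv_cl j ?f) k)))"
   by (intro l2b_add l2b_cmul l2b_sum A0 B) auto
  have "l2b (A0 + \<bar>sqrt a1\<bar> * (SUM j:UNIV. B j)) (%k. rho k ^ 1 * norm (fc ?f k))"
  proof (rule l2b_mono_abs[OF l2])
   fix k
   have "rho k <= 1 + cc * (SUM j:UNIV. \<bar>real_of_int (k $ j)\<bar>)"
   proof -
    have "rho k <= norm (1::real) + norm (cc *\<^sub>R freq k)" unfolding rho_norm by (rule norm_Pair_le)
    also have "norm (cc *\<^sub>R freq k) <= cc * (SUM j:UNIV. \<bar>real_of_int (k $ j)\<bar>)"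
     using norm_le_l1_cart[of "freq k"] cc_pos by simp
    finally show ?thesis by simp
   qed
   then have "rho k * norm (fc ?f k) <= (1 + cc * (SUM j:UNIV. \<bar>real_of_int (k $ j)\<bar>)) * norm (fc ?f k)"
    by (rule mult_right_mono) simp
   also have "... = norm (fc ?f k) + sqrt a1 * (SUM j:UNIV. norm (fc (pderiv_cl j ?f) k))"
   proof -
    have "norm (fc (pderiv_cl j ?f) k) = kap * \<bar>real_of_int (k $ j)\<bar> * norm (fc ?f k)" for j
     unfolding fc_pderiv[OF sm per] norm_mult norm_of_real abs_mult abs_of_pos[OF kap_pos] by simp
    then have "(SUM j:UNIV. norm (fc (pderiv_cl j ?f) k)) = kap * (SUM j:UNIV. \<bar>real_of_int (k $ j)\<bar>) * norm (fc ?f k)"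
     by (simp only: sum_distrib_left sum_distrib_right)
    then show ?thesis unfolding cc_def by (simp only: distrib_right mult_1_left mult.assoc)
   qed
   finally show "\<bar>rho k ^ 1 * norm (fc ?f k)\<bar> <= \<bar>norm (fc ?f k) + sqrt a1 * (SUM j:UNIV. norm (fc (pderiv_cl j ?f) k))\<bar>"
    by (simp add: abs_mult)
  qed
  then show ?thesis by blast
 qed
 then obtain A where A: "!!i. l2b (A i) (%k. rho k ^ 1 * norm (fc (cp w i) k))" by metis
 have "hsb 1 (A i) (cp w i)" for i using A[of i] l per by (simp add: hsb_def)
 then have "hsb 1 (max (A 1) (A 2)) (cp w i)" for i by (rule hsb_max)
 then show "EX A. fsb 1 A w" using z by (auto simp: fsb_def)
 have "(SUM i:UNIV. real_of_int (k $ i) * fc (cp w i) k) = 0" for k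
 proof -
  have "(%x. SUM j:UNIV. pderiv_cl j (cp w j) x) = (%x. 0)"
   using w by (auto simp: smooth_solenoidal_def)
  then have "(SUM j:UNIV. fc (pderiv_cl j (cp w j)) k) = 0"
   using fc_sum[of UNIV "%j. pderiv_cl j (cp w j)" k] l2t_integrable[OF lp] by (simp add: fc_def)
  then have "\<i> * kap * (SUM i:UNIV. real_of_int (k $ i) * fc (cp w i) k) = 0"
   unfolding fc_pderiv[OF sm per] by (simp add: sum_distrib_left mult_ac)
  then show ?thesis using kap_pos L_pos by simp
 qed
 then show "solen w" by (simp add: solen_def)
qed

lemma fc_field_diff: "(!!i. integrable tor (cp u i)) ==> (!!i. integrable tor (cp w i)) ==>
 fc (%x. (u - w) x $ i) k = fc (cp u i) k - fc (cp w i) k" for u w :: field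
 by (simp add: fc_diff)

lemma solenI:
 assumes "!!e. e > 0 ==> EX w. solen w & (ALL i. norm (fc (cp u i) k - fc (cp w i) k) <= e)"
 shows "(SUM i:UNIV. real_of_int (k $ i) * fc (cp u i) k) = 0"
proof -
 let ?s = "SUM i:UNIV. real_of_int (k $ i) * fc (cp u i) k" and ?n = "SUM i:(UNIV::2 set). \<bar>real_of_int (k $ i)\<bar>"
 have "norm ?s <= 0 + e" if e: "e > 0" for e
 proof -
  have n0: "0 <= ?n" by (intro sum_nonneg) auto
  obtain w where w: "solen w" "!!i. norm (fc (cp u i) k - fc (cp w i) k) <= e / (?n + 1)"
   using assms[of "e / (?n + 1)"] e n0 by auto
  have eq: "?s = (SUM i:UNIV. real_of_int (k $ i) * (fc (cp u i) k - fc (cp w i) k))"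
   using w(1) by (simp add: solen_def right_diff_distrib sum_subtractf)
  have "norm ?s <= (SUM i:UNIV. \<bar>real_of_int (k $ i)\<bar> * (e / (?n + 1)))"
   unfolding eq
  proof (intro sum_norm_le)
   fix i
   have "\<bar>real_of_int (k $ i)\<bar> * norm (fc (cp u i) k - fc (cp w i) k) <= \<bar>real_of_int (k $ i)\<bar> * (e / (?n + 1))"
    by (intro mult_left_mono w(2)) auto
   then show "norm (cor (real_of_int (k $ i)) * (fc (cp u i) k - fc (cp w i) k)) <= \<bar>real_of_int (k $ i)\<bar> * (e / (?n + 1))"
    by (simp only: norm_mult norm_of_real)
  qed
  also have "... = ?n * (e / (?n + 1))" by (simp only: sum_distrib_right)
  also have "... <= e"
  proof -
   have "n * (e / (n + 1)) <= e" if "0 <= n" for n :: real using that e by (simp add: field_simps)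
   then show ?thesis using n0 by blast
  qed
  finally show ?thesis by simp
 qed
 then have "norm ?s <= 0" by (rule field_le_epsilon)
 then show ?thesis by simp
qed

lemma ip_self: "(!!i. l2t (cp u i)) ==> ip L u u = (SUM i:UNIV. LINT x|tor. (u x $ i)^2)" for u :: field
 unfolding ip_def inner_vec_def by (simp add: l2t_def power2_eq_square Bochner_Integration.integral_sum)

text \<open>Each coefficient is continuous in L2, so orthogonality to \<open>k\<close> survives the
  closure. Conversely the Fourier truncations are smooth and solenoidal and converge by
  Parseval.\<close>

lemma Hsp_iff: "u : carr (Hsp L) \<longleftrightarrow> u : carr (L2dot L) & solen u"
proof
 assume "u : carr (Hsp L)"
 then have u: "u : carr (L2dot L)" and cl: "!!e. e > 0 ==> EX w:smooth_solenoidal L. nrm (L2dot L) (u - w) < e"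
  by (auto simp: Hsp_def closure_in_def)
 have ul: "l2t (cp u i)" for i using u by (simp add: L2dot_iff)
 have "solen u" unfolding solen_def
 proof (intro allI solenI)
  fix k and e :: real assume e: "e > 0"
  obtain w where w: "w : smooth_solenoidal L" "nrm (L2dot L) (u - w) < e * L" using cl[of "e * L"] e L_pos by auto
  have wl: "l2t (cp w i)" for i using smooth_solenoidalD(1)[OF w(1)] by (auto simp: fsb_def hsb_def)
  have dl: "l2t (%x. (u - w) x $ i)" for i using l2t_diff[OF ul wl] by simp
  have "norm (fc (cp u i) k - fc (cp w i) k) <= e" for i
  proof -
   have "(norm (fc (%x. (u - w) x $ i) k))^2 <= (LINT x|tor. ((u - w) x $ i)^2) / L^2"
    using bessel[OF dl, of "{k}"] by simp
   also have "... <= ip L (u - w) (u - w) / L^2"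
    unfolding ip_self[OF dl] by (intro divide_right_mono member_le_sum) auto
   also have "... <= (e * L)^2 / L^2"
   proof -
    have "sqrt (ip L (u - w) (u - w)) <= e * L" using w(2) by (simp add: L2dot_def)
    then show ?thesis using e L_pos by (intro divide_right_mono) (auto dest: sqrt_le_D)
   qed
   finally have "(norm (fc (%x. (u - w) x $ i) k))^2 <= e^2" using L_pos by (simp add: power_mult_distrib)
   then have "norm (fc (%x. (u - w) x $ i) k) <= e" by (rule power2_le_imp_le) (use e in simp)
   then show ?thesis using fc_field_diff[OF l2t_integrable[OF ul] l2t_integrable[OF wl]] by simp
  qed
  then show "EX w. solen w & (ALL i. norm (fc (cp u i) k - fc (cp w i) k) <= e)"
   using smooth_solenoidalD(2)[OF w(1)] by blast
 qed
 then show "u : carr (L2dot L) & solen u" using u by simp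
next
 assume u: "u : carr (L2dot L) & solen u"
 have ul: "l2t (cp u i)" for i using u by (simp add: L2dot_iff)
 have tl: "l2t (%x. trunc N u x $ i)" for i N unfolding trunc_def by (simp add: l2t_continuous tp_continuous)
 have dl: "l2t (%x. (u - trunc N u) x $ i)" for i N using l2t_diff[OF ul tl] by simp
 have "(%N. nrm (L2dot L) (u - trunc N u)) ----> 0"
 proof -
  have e: "(LINT x|tor. ((u - trunc N u) x $ i)^2) = L^2 * (\<Sum>\<^sub>\<infinity>k. if k : boxes N then 0 else (norm (fc (cp u i) k))^2)" for i N
  proof -
   have "(LINT x|tor. ((u - trunc N u) x $ i)^2) / L^2 = (\<Sum>\<^sub>\<infinity>k. (norm (fc (%x. (u - trunc N u) x $ i) k))^2)"
    using infsumI[OF parseval_sq[OF dl]] by simp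
   also have "... = (\<Sum>\<^sub>\<infinity>k. if k : boxes N then 0 else (norm (fc (cp u i) k))^2)"
    unfolding fc_field_diff[OF l2t_integrable[OF ul] l2t_integrable[OF tl]] fc_trunc by (rule infsum_cong) simp
   finally show ?thesis using L_pos by (simp add: field_simps)
  qed
  have "(%N. sqrt (SUM i:UNIV. L^2 * (\<Sum>\<^sub>\<infinity>k. if k : boxes N then 0 else (norm (fc (cp u i) k))^2))) ----> sqrt (SUM i:(UNIV::2 set). L^2 * 0)"
   by (intro tendsto_intros infsum_outside_boxes(1) summable_fc_sq ul)
  then show ?thesis unfolding L2dot_def by (simp add: ip_self[OF dl] e[simplified])
 qed
 then have "\<forall>\<^sub>F N in sequentially. nrm (L2dot L) (u - trunc N u) < e" if "e > 0" for e by (rule order_tendstoD(2)[OF _ that])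
 then have "EX w:smooth_solenoidal L. nrm (L2dot L) (u - w) < e" if "e > 0" for e
  using that trunc_smooth_solenoidal[of u] u unfolding eventually_sequentially by blast
 then show "u : carr (Hsp L)" using u by (simp add: Hsp_def closure_in_def)
qed

lemma nrm_Hdot_point:
 assumes d: "fsb s A u"
 shows "norm (freq k) ^ s * norm (fc (cp u i) k) <= nrm (Hdot L (real s)) u"
proof (cases "k = 0")
 case True
 have "0 <= nrm (Hdot L (real s)) u" by (simp add: Hdot_def infsum_nonneg)
 then show ?thesis using True d by (simp add: fsb_def)
next
 case False
 have sm: "(%k. norm (freq k) powr (2 * real s) * (norm (fourier L u k))^2) summable_on UNIV"
  using fsb_Hdot(1)[OF d] by (simp add: Hdot_def)
 have "(norm (freq k) ^ s * norm (fc (cp u i) k))^2 <= (norm (freq k) ^ s)^2 * (norm (fourier L u k))^2"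
  unfolding power_mult_distrib norm_fourier_sq by (intro mult_left_mono member_le_sum) auto
 also have "... = norm (freq k) powr (2 * real s) * (norm (fourier L u k))^2" using False by (simp only: freq_powr if_False)
 also have "... <= (\<Sum>\<^sub>\<infinity>k. norm (freq k) powr (2 * real s) * (norm (fourier L u k))^2)"
  using finite_sum_le_infsum[OF sm, of "{k}"] by simp
 finally show ?thesis unfolding Hdot_def by (simp add: real_le_rsqrt)
qed

lemma fsb_diff: "fsb s A u ==> fsb s B w ==> fsb s (A + B) (u - w)"
proof -
 assume a: "fsb s A u" and b: "fsb s B w"
 have i: "integrable tor (cp u i)" "integrable tor (cp w i)" for i
  using hsb_int[of s A "%x. u x $ i"] hsb_int[of s B "%x. w x $ i"] a b by (simp_all add: fsb_def)
 have "hsb s (A + B) (%x. (u - w) x $ i)" for i using hsb_diff[of s A "%x. u x $ i" B "%x. w x $ i"] a b by (simp add: fsb_def)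
 moreover have "fc (%x. (u - w) x $ i) 0 = 0" for i unfolding fc_field_diff[OF i] using a b by (simp add: fsb_def)
 ultimately show ?thesis by (simp add: fsb_def)
qed

lemma Vsp_iff: "u : carr (Vsp L) \<longleftrightarrow> u : carr (Hdot L 1) & solen u"
proof
 assume "u : carr (Vsp L)"
 then have u: "u : carr (Hdot L 1)" and cl: "!!e. e > 0 ==> EX w:smooth_solenoidal L. nrm (Hdot L 1) (u - w) < e"
  by (auto simp: Vsp_def closure_in_def)
 obtain A where A: "fsb 1 A u" using Hdot_fsb[of u 1] u by auto
 have "solen u" unfolding solen_def
 proof (intro allI solenI)
  fix k and e :: real assume e: "e > 0"
  obtain w where w: "w : smooth_solenoidal L" "nrm (Hdot L 1) (u - w) < e" using cl[of e] e by auto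
  obtain B where B: "fsb 1 B w" using smooth_solenoidalD(1)[OF w(1)] by blast
  have "norm (fc (cp u i) k - fc (cp w i) k) <= e" for i
  proof (cases "k = 0")
   case True
   then show ?thesis using A B e by (simp add: fsb_def)
  next
   case False
   then obtain j where "k $ j ~= 0" by (auto simp: vec_eq_iff)
   then have "1 <= \<bar>real_of_int (k $ j)\<bar>" by linarith
   also have "... <= norm (freq k)" using component_le_norm_cart[of "freq k" j] by simp
   finally have "1 * norm (fc (%x. (u - w) x $ i) k) <= norm (freq k) * norm (fc (%x. (u - w) x $ i) k)"
    by (rule mult_right_mono) simp
   also have "... <= nrm (Hdot L 1) (u - w)" using nrm_Hdot_point[OF fsb_diff[OF A B], of k i] by simp
   finally have "norm (fc (%x. (u - w) x $ i) k) <= e" using w(2) by simp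
   moreover have "integrable tor (cp u i)" "integrable tor (cp w i)" for i
    using hsb_int[of 1 A "%x. u x $ i"] hsb_int[of 1 B "%x. w x $ i"] A B by (simp_all add: fsb_def)
   ultimately show ?thesis by (simp only: fc_field_diff)
  qed
  then show "EX w. solen w & (ALL i. norm (fc (cp u i) k - fc (cp w i) k) <= e)"
   using smooth_solenoidalD(2)[OF w(1)] by blast
 qed
 then show "u : carr (Hdot L 1) & solen u" using u by simp
next
 assume u: "u : carr (Hdot L 1) & solen u"
 then have uL: "u : carr (L2dot L)" and sm: "(%k. norm (freq k) powr (2 * 1) * (norm (fourier L u k))^2) summable_on UNIV" by (auto simp: Hdot_def)
 have ul: "l2t (cp u i)" for i using uL by (simp add: L2dot_iff)
 have tl: "l2t (%x. trunc N u x $ i)" for i N unfolding trunc_def by (simp add: l2t_continuous tp_continuous)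
 have "nrm (Hdot L 1) (u - trunc N u) = sqrt (\<Sum>\<^sub>\<infinity>k. if k : boxes N then 0 else norm (freq k) powr (2 * 1) * (norm (fourier L u k))^2)" for N
 proof -
  have "norm (freq k) powr (2 * 1) * (norm (fourier L (u - trunc N u) k))^2 = (if k : boxes N then 0 else norm (freq k) powr (2 * 1) * (norm (fourier L u k))^2)" for k
   unfolding norm_fourier_sq fc_field_diff[OF l2t_integrable[OF ul] l2t_integrable[OF tl]] fc_trunc by simp
  then show ?thesis by (simp only: Hdot_def snd_conv)
 qed
 moreover have "(%N. sqrt (\<Sum>\<^sub>\<infinity>k. if k : boxes N then 0 else norm (freq k) powr (2 * 1) * (norm (fourier L u k))^2)) ----> sqrt 0"
  by (intro tendsto_real_sqrt infsum_outside_boxes(1) sm)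
 ultimately have "(%N. nrm (Hdot L 1) (u - trunc N u)) ----> 0" by simp
 then have "\<forall>\<^sub>F N in sequentially. nrm (Hdot L 1) (u - trunc N u) < e" if "e > 0" for e by (rule order_tendstoD(2)[OF _ that])
 then have "EX w:smooth_solenoidal L. nrm (Hdot L 1) (u - w) < e" if "e > 0" for e
  using that trunc_smooth_solenoidal[of u] u uL unfolding eventually_sequentially by blast
 then show "u : carr (Vsp L)" using u by (simp add: Vsp_def closure_in_def)
qed

lemma DA_iff:
 assumes "s >= 1"
 shows "u : carr (DS s) \<longleftrightarrow> u : carr (Hdot L (real s)) & solen u"
proof -
 have "(AE x in tor. divg L u x = 0) \<longleftrightarrow> solen u" if u: "u : carr (Hdot L (real s))"
 proof -
  obtain A where "fsb s A u" using Hdot_fsb[OF u] by blast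
  then have h: "hsb (Suc 0) A (cp u i)" for i
   using hsb_mono[of s A "%x. u x $ i" "Suc 0"] assms by (simp add: fsb_def)
  have w: "integrable tor (wd L j (cp u j))" for j by (rule hsb_int[OF hsb_wd(1)[OF h]])
  have f: "fc (divg L u) k = \<i> * kap * (SUM i:UNIV. real_of_int (k $ i) * fc (cp u i) k)" for k
   unfolding divg_def by (subst fc_sum[OF w]) (simp add: hsb_wd(2)[OF h] sum_distrib_left mult_ac)
  have I: "integrable tor (divg L u)" unfolding divg_def by (intro Bochner_Integration.integrable_sum w)
  have "(AE x in tor. divg L u x = 0) \<longleftrightarrow> (ALL k. fc (divg L u) k = 0)"
  proof
   assume a: "AE x in tor. divg L u x = 0"
   show "ALL k. fc (divg L u) k = 0" using fc_cong_AE[OF a] I by (auto simp: fc_def)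
  qed (use fc_zero_AE[OF I] in blast)
  then show ?thesis unfolding f solen_def using kap_pos L_pos by simp
 qed
 then show ?thesis unfolding DA_def by auto
qed

text \<open>A solenoidal \<open>ph\<close> sees only the component of \<open>u\<close> along
  \<open>nv k\<close>. The Leray projection is thus built into \<open>pr\<close>.\<close>

lemma ip_pr:
 assumes u: "!!i. l2t (cp u i)" and ph: "ph : carr (Hsp L)"
 shows "((%k. pr u k * cnj (pr ph k)) has_sum cor (ip L u ph / L^2)) UNIV"
proof -
 have p: "l2t (cp ph i)" "fc (cp ph i) k = pr ph k * nv k i" for i k
  using ph fc_pr[of ph] by (auto simp: Hsp_iff L2dot_iff)
 have "((%k. SUM i:UNIV. fc (cp u i) k * cnj (fc (cp ph i) k)) has_sum (SUM i:UNIV. cor ((LINT x|tor. u x $ i * ph x $ i) / L^2))) UNIV"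
  by (intro has_sum_finite_sum finite_class.finite_UNIV parseval u p)
 moreover have "(SUM i:UNIV. fc (cp u i) k * cnj (fc (cp ph i) k)) = pr u k * cnj (pr ph k)" for k
  unfolding p(2) pr_def[of u] by (simp add: sum_distrib_left sum_distrib_right mult_ac)
 moreover have "(SUM i:UNIV. cor ((LINT x|tor. u x $ i * ph x $ i) / L^2)) = cor (ip L u ph / L^2)"
  unfolding ip_def inner_vec_def using l2t_mult_integrable[OF u p(1)]
  by (simp add: Bochner_Integration.integral_sum sum_divide_distrib)
 ultimately show ?thesis by simp
qed

lemma Vsp_fsb: "ph : carr (Vsp L) ==> EX A. fsb 1 A ph"
 using Hdot_fsb[of ph 1] by (auto simp: Vsp_iff)

lemma Vsp_Hsp: "ph : carr (Vsp L) ==> ph : carr (Hsp L)"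
 by (auto simp: Vsp_iff Hsp_iff Hdot_def)

lemma helmholtz_pr:
 assumes u: "!!i. hsb 1 A (cp u i)" and ph: "ph : carr (Vsp L)"
 shows "((%k. cor ((rho k)^2) * pr u k * cnj (pr ph k)) has_sum cor (helmholtz_pairing L a1 u ph / L^2)) UNIV"
proof -
 obtain B where B: "hsb (Suc 0) B (cp ph i)" for i using Vsp_fsb[OF ph] by (auto simp: fsb_def)
 have u': "hsb (Suc 0) A (cp u i)" for i using u by simp
 have p: "fc (cp ph i) k = pr ph k * nv k i" for i k
  using Vsp_Hsp[OF ph] fc_pr[of ph] by (auto simp: Hsp_iff L2dot_iff)
 have l: "l2t (wd L j (cp u i))" "l2t (wd L j (cp ph i))" for i j
  using hsb_D(2)[OF hsb_wd(1)[OF u']] hsb_D(2)[OF hsb_wd(1)[OF B]] by auto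
 have g: "(LINT x|tor. frob (grad L u x) (grad L ph x)) = (SUM i:UNIV. SUM j:UNIV. LINT x|tor. wd L j (cp u i) x * wd L j (cp ph i) x)"
 proof -
  have "frob (grad L u x) (grad L ph x) = (SUM i:UNIV. SUM j:UNIV. wd L j (cp u i) x * wd L j (cp ph i) x)" for x
   unfolding frob_def trace_def matrix_matrix_mult_def transpose_def grad_def by simp
  then show ?thesis using l2t_mult_integrable[OF l] by (simp add: Bochner_Integration.integral_sum)
 qed
 have "((%k. SUM i:UNIV. SUM j:UNIV. fc (wd L j (cp u i)) k * cnj (fc (wd L j (cp ph i)) k)) has_sum
   (SUM i:UNIV. SUM j:UNIV. cor ((LINT x|tor. wd L j (cp u i) x * wd L j (cp ph i) x) / L^2))) UNIV"
  by (intro has_sum_finite_sum finite_class.finite_UNIV parseval l)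
 moreover have "(SUM i:UNIV. SUM j:UNIV. cor ((LINT x|tor. wd L j (cp u i) x * wd L j (cp ph i) x) / L^2)) = cor ((LINT x|tor. frob (grad L u x) (grad L ph x)) / L^2)"
  unfolding g by (simp add: sum_divide_distrib)
 moreover have "(SUM i:UNIV. SUM j:UNIV. fc (wd L j (cp u i)) k * cnj (fc (wd L j (cp ph i)) k)) = cor (kap^2 * (norm (freq k))^2) * (pr u k * cnj (pr ph k))" for k
 proof -
  define kc where "kc = cor kap"
  have cj: "fc (wd L j (cp u i)) k * cnj (fc (wd L j (cp ph i)) k) = kc^2 * cor ((real_of_int (k $ j))^2) * (fc (cp u i) k * cnj (nv k i) * cnj (pr ph k))" for i j
   unfolding hsb_wd(2)[OF u'] hsb_wd(2)[OF B] p of_real_mult kc_def[symmetric] by (simp add: kc_def power2_eq_square mult_ac)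
  have n: "cor ((norm (freq k))^2) = (SUM j:UNIV. cor ((real_of_int (k $ j))^2))"
   unfolding norm_freq_sq by (simp add: UNIV_2)
  have e: "cor (kap^2 * N) = kc^2 * cor N" for N by (simp only: of_real_mult of_real_power kc_def)
  show ?thesis unfolding cj e n pr_def[of u]
   by (simp add: UNIV_2 algebra_simps)
 qed
 ultimately have 1: "((%k. cor (kap^2 * (norm (freq k))^2) * (pr u k * cnj (pr ph k))) has_sum cor ((LINT x|tor. frob (grad L u x) (grad L ph x)) / L^2)) UNIV"
  by simp
 have 0: "((%k. pr u k * cnj (pr ph k)) has_sum cor (ip L u ph / L^2)) UNIV"
  by (rule ip_pr[OF hsb_D(2)[OF u] Vsp_Hsp[OF ph]])
 have "((%k. pr u k * cnj (pr ph k) + cor a1 * (cor (kap^2 * (norm (freq k))^2) * (pr u k * cnj (pr ph k)))) has_sum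
  (cor (ip L u ph / L^2) + cor a1 * cor ((LINT x|tor. frob (grad L u x) (grad L ph x)) / L^2))) UNIV"
  by (intro has_sum_add has_sum_cmult_right 0 1)
 moreover have "pr u k * cnj (pr ph k) + cor a1 * (cor (kap^2 * (norm (freq k))^2) * (pr u k * cnj (pr ph k))) = cor ((rho k)^2) * pr u k * cnj (pr ph k)" for k
  unfolding rho_sq cc_sq of_real_add of_real_mult by (simp add: algebra_simps)
 moreover have "cor (ip L u ph / L^2) + cor a1 * cor ((LINT x|tor. frob (grad L u x) (grad L ph x)) / L^2) = cor (helmholtz_pairing L a1 u ph / L^2)"
  unfolding helmholtz_pairing_def by (simp add: add_divide_distrib)
 ultimately show ?thesis by simp
qed

text \<open>The choice in \<open>leray\<close> is justified by the witness
  \<open>fld (pr u)\<close>, which has the same scalar coefficients as \<open>u\<close>.\<close>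

lemma ip_leray:
 assumes u: "!!i. periodic L (cp u i)" "!!i. l2t (cp u i)" and ph: "ph : carr (Hsp L)"
 shows "ip L (leray L u) ph = ip L u ph"
proof -
 have "hs 0 (cp u i)" for i by (rule hsb_0[OF u])
 then obtain A where A: "!!i. hsb 0 (A i) (cp u i)" by metis
 have "hsb 0 (max (A 1) (A 2)) (cp u i)" for i by (rule hsb_max[OF A])
 then have l: "l2b (2 * max (A 1) (A 2)) (%k. rho k ^ 0 * norm (pr u k))" by (rule l2b_pr)
 have h: "herm (pr u)" by (simp add: herm_def pr_uminus)
 note f = fld[OF h l]
 let ?w = "fld (pr u)"
 have w: "?w : carr (Hsp L)" using f(2,3) by (auto simp: Hsp_iff L2dot_iff fsb_def hsb_def)
 have prw: "pr ?w k = pr u k" for k using f(4)[of k] by (cases "k = 0") auto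
 have d: "ip L (u - z) psi = ip L u psi - ip L z psi" if "z : carr (Hsp L)" "psi : carr (Hsp L)" for z psi
 proof -
  have "l2t (cp z i)" "l2t (cp psi i)" for i using that by (auto simp: Hsp_iff L2dot_iff)
  then show ?thesis unfolding ip_def inner_vec_def using u(2)
   by (simp add: left_diff_distrib sum_subtractf l2t_mult_integrable Bochner_Integration.integral_sum Bochner_Integration.integral_diff)
 qed
 have wl: "l2t (%x. ?w x $ i)" for i using w by (simp add: Hsp_iff L2dot_iff)
 have "ip L (u - ?w) psi = 0" if p: "psi : carr (Hsp L)" for psi
 proof -
  have "cor (ip L u psi / L^2) = cor (ip L ?w psi / L^2)"
   using ip_pr[OF u(2) p] ip_pr[OF wl p] unfolding prw by (rule has_sum_unique)
  then show ?thesis using d[OF w p] L_pos by simp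
 qed
 then have ex: "EX w. w : carr (Hsp L) & (ALL ph:carr (Hsp L). ip L (u - w) ph = 0)" using w by blast
 from someI_ex[OF ex] have "leray L u : carr (Hsp L)" "ip L (u - leray L u) ph = 0"
  unfolding leray_def[symmetric] using ph by auto
 then show ?thesis using d[OF _ ph] by simp
qed

end

context helm begin

section \<open>The adjoint operator as an infinite matrix\<close>

definition ik :: "int^2 => 2 => complex" where "ik k d = \<i> * cor (kap * real_of_int (k $ d))"

lemma norm_ik: "norm (ik k d) <= rho k / sqrt a1" unfolding ik_def by (rule norm_iksym)

lemma ik_add: "ik (k + j) d = ik k d + ik j d" and ik_uminus: "ik (- k) d = - ik k d" and ik_cnj: "cnj (ik k d) = - ik k d"
 by (auto simp: ik_def distrib_left distrib_right add_divide_distrib)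

lemma hsb_wd_ik: "hsb (Suc s) A f ==> fc (wd L d f) k = ik k d * fc f k"
 by (simp add: hsb_wd(2) ik_def)

text \<open>The coefficients of \<open>f\<close> as the image of the scalar sequence
  \<open>\<pi>\<close> under the matrix \<open>R\<close>. The Sobolev order is carried along so that
  products and derivatives can be composed.\<close>

definition krep :: "(int^2 => complex) => nat => (int^2 => int^2 => complex) => (real^2 => real) => bool" where
 "krep \<pi> s R f \<longleftrightarrow> hs s f & (ALL k. ((%j. R k j * \<pi> j) has_sum fc f k) UNIV)"

lemma krep_hs: "krep \<pi> s R f ==> hs s f" by (simp add: krep_def)

lemma krep_mono: "krep \<pi> s R f ==> s' <= s ==> krep \<pi> s' R f" unfolding krep_def using hsb_mono by blast

lemma krep_l2t: "krep \<pi> s R f ==> l2t f" unfolding krep_def using hsb_D(2) by blast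

lemma krep_add:
 assumes "krep \<pi> s R f" "krep \<pi> s R' f'" shows "krep \<pi> s (%k j. R k j + R' k j) (%x. f x + f' x)"
proof -
 obtain A B where h: "hsb s A f" "hsb s B f'" using assms unfolding krep_def by blast
 have "((%j. R k j * \<pi> j + R' k j * \<pi> j) has_sum (fc f k + fc f' k)) UNIV" for k
  using assms unfolding krep_def by (intro has_sum_add) auto
 then show ?thesis unfolding krep_def using hsb_add[OF h] fc_add[OF hsb_int[OF h(1)] hsb_int[OF h(2)]]
  by (auto simp: distrib_right)
qed

lemma krep_zero: "krep \<pi> s (%k j. 0) (%x. 0)"
 unfolding krep_def using hsb_zero by (auto simp: fc_def intro: has_sum_0)

lemma krep_sum: "finite I ==> (!!i. i : I ==> krep \<pi> s (R i) (f i)) ==> krep \<pi> s (%k j. SUM i:I. R i k j) (%x. SUM i:I. f i x)"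
 by (induction I rule: finite_induct) (auto intro: krep_zero krep_add)

lemma krep_mult:
 assumes h: "hsb 2 A h" and P: "hsb s B P" "!!j. fc P j = \<sigma> j * \<pi> j" and s: "s <= 2"
 shows "krep \<pi> s (%k j. fc h (k - j) * \<sigma> j) (%x. h x * P x)" "krep \<pi> s (%k j. fc h (k - j) * \<sigma> j) (%x. P x * h x)"
proof -
 show 1: "krep \<pi> s (%k j. fc h (k - j) * \<sigma> j) (%x. h x * P x)"
  unfolding krep_def using hsb_mult[OF h P(1) s] by (auto simp: P(2) mult.assoc)
 then show "krep \<pi> s (%k j. fc h (k - j) * \<sigma> j) (%x. P x * h x)" by (simp add: mult.commute)
qed

text \<open>The roles of the factors are exchanged: the unknown is the \<open>H^2\<close> factor and
  \<open>h\<close>, which will contain third derivatives of \<open>v\<close>, is only in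
  \<open>H^s\<close>. Reindexing keeps the convolution in the form of
  \<open>krep_mult\<close>.\<close>

lemma krep_mult':
 assumes h: "hsb s A h" and P: "hsb 2 B P" "!!j. fc P j = \<sigma> j * \<pi> j" and s: "s <= 2"
 shows "krep \<pi> s (%k j. fc h (k - j) * \<sigma> j) (%x. P x * h x)"
proof -
 have "((%m. fc P (k - m) * fc h m) has_sum fc (%x. P x * h x) k) UNIV" for k by (rule hsb_mult(2)[OF P(1) h s])
 moreover have "((%m. fc P (k - m) * fc h m) has_sum S) UNIV \<longleftrightarrow> ((%j. fc h (k - j) * \<sigma> j * \<pi> j) has_sum S) UNIV" for k S
  by (rule has_sum_reindex_bij_witness[of _ "%j. k - j" "%j. k - j"]) (auto simp: P(2) mult_ac)
 ultimately show ?thesis unfolding krep_def using hsb_mult(1)[OF P(1) h s] by blast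
qed

lemma krep_wd:
 assumes "krep \<pi> (Suc s) R f" shows "krep \<pi> s (%k j. ik k d * R k j) (wd L d f)"
proof -
 obtain A where h: "hsb (Suc s) A f" using assms unfolding krep_def by blast
 have "((%j. ik k d * (R k j * \<pi> j)) has_sum (ik k d * fc f k)) UNIV" for k
  using assms unfolding krep_def by (intro has_sum_cmult_right) auto
 then show ?thesis unfolding krep_def using hsb_wd(1)[OF h] by (auto simp: hsb_wd_ik[OF h] mult.assoc)
qed

text \<open>Coefficients of \<open>v\<close>, of \<open>Ups v\<close>, of the entries of
  \<open>A(v)\<close> and of products of two such entries; \<open>PA j\<close> is the matrix of
  \<open>A(p)\<close> at frequency \<open>j\<close> per unit of \<open>pr p j\<close>.\<close>

definition Vc :: "field => 2 => int^2 => complex" where "Vc v i m = fc (cp v i) m"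
definition Uc :: "field => 2 => int^2 => complex" where "Uc v i m = cor ((rho m)^2) * Vc v i m"
definition GA :: "field => 2 => 2 => int^2 => complex" where "GA v a b m = ik m b * Vc v a m + ik m a * Vc v b m"
definition HH :: "field => 2 => 2 => 2 => 2 => int^2 => complex" where
 "HH v a b c d m = fc (%x. Am L v x $ a $ b * Am L v x $ c $ d) m"
definition PA :: "int^2 => 2 => 2 => complex" where "PA j a b = ik j b * nv j a + ik j a * nv j b"

lemma Am_nth: "Am L u x $ a $ b = wd L b (cp u a) x + wd L a (cp u b) x"
 by (simp add: Am_def grad_def transpose_def)

lemma hsb_Am:
 assumes "!!i. hsb (Suc s) A (cp u i)"
 shows "hsb s (2 * (A / sqrt a1)) (%x. Am L u x $ a $ b)"
  "fc (%x. Am L u x $ a $ b) k = ik k b * fc (cp u a) k + ik k a * fc (cp u b) k"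
proof -
 note w = hsb_wd(1)[OF assms, of _ _]
 have "hsb s (A / sqrt a1 + A / sqrt a1) (%x. Am L u x $ a $ b)" unfolding Am_nth by (intro hsb_add w)
 then show "hsb s (2 * (A / sqrt a1)) (%x. Am L u x $ a $ b)" by (simp only: mult_2)
 show "fc (%x. Am L u x $ a $ b) k = ik k b * fc (cp u a) k + ik k a * fc (cp u b) k"
  unfolding Am_nth by (subst fc_add) (auto intro: hsb_int[OF w] simp: hsb_wd_ik[OF assms])
qed

lemma lap_nth:
 assumes "!!i. hsb (Suc (Suc s)) A (cp u i)"
 shows "EX B. hsb s B (%x. lap L u x $ i)" "fc (%x. lap L u x $ i) k = - cor (kap^2 * (norm (freq k))^2) * fc (cp u i) k"
proof -
 note w = hsb_wd(1)[OF assms]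
 note w2 = hsb_wd(1)[OF w]
 have e: "(%x. lap L u x $ i) = (%x. SUM j:UNIV. wd L j (wd L j (cp u i)) x)" by (simp add: lap_def)
 show "EX B. hsb s B (%x. lap L u x $ i)" unfolding e by (rule exI, rule hsb_sum) (auto intro: w2)
 have "fc (%x. lap L u x $ i) k = (SUM j:UNIV. ik k j * (ik k j * fc (cp u i) k))"
  unfolding e by (subst fc_sum) (auto intro: hsb_int[OF w2] simp: hsb_wd_ik[OF w] hsb_wd_ik[OF assms])
 also have "... = (SUM j:UNIV. ik k j * ik k j) * fc (cp u i) k" by (simp add: sum_distrib_right mult.assoc)
 also have "(SUM j:UNIV. ik k j * ik k j) = - cor (kap^2 * (norm (freq k))^2)"
 proof -
  have "ik k j * ik k j = - cor (kap^2 * (real_of_int (k $ j))^2)" for j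
  proof -
   have "ik k j * ik k j = (\<i> * \<i>) * cor ((kap * real_of_int (k $ j)) * (kap * real_of_int (k $ j)))"
    unfolding ik_def of_real_mult by (simp only: mult_ac)
   also have "(kap * real_of_int (k $ j)) * (kap * real_of_int (k $ j)) = kap^2 * (real_of_int (k $ j))^2"
    by (simp only: power2_eq_square mult_ac)
   finally show ?thesis by simp
  qed
  then have "(SUM j:UNIV. ik k j * ik k j) = - cor (SUM j:UNIV. kap^2 * (real_of_int (k $ j))^2)"
   by (simp only: of_real_sum sum_negf)
  then show ?thesis unfolding norm_freq_sq by (simp only: sum_2 distrib_left)
 qed
 finally show "fc (%x. lap L u x $ i) k = - cor (kap^2 * (norm (freq k))^2) * fc (cp u i) k" .
qed

lemma Ups_nth:
 assumes h: "!!i. hsb (Suc (Suc s)) A (cp v i)"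
 shows "EX B. hsb s B (%x. Ups L a1 v x $ i)" "fc (%x. Ups L a1 v x $ i) m = Uc v i m"
proof -
 obtain B where B: "hsb s B (%x. lap L v x $ i)" using lap_nth(1)[OF h] by blast
 have h0: "hsb s A (cp v i)" by (rule hsb_mono[OF h]) simp
 have e: "(%x. Ups L a1 v x $ i) = (%x. v x $ i - a1 * lap L v x $ i)" by (simp add: Ups_def)
 show "EX B. hsb s B (%x. Ups L a1 v x $ i)" unfolding e using hsb_diff[OF h0 hsb_cmul[OF B]] by blast
 show "fc (%x. Ups L a1 v x $ i) m = Uc v i m"
  unfolding e fc_diff[OF hsb_int[OF h0] hsb_int[OF hsb_cmul[OF B]]] fc_cmul lap_nth(2)[OF h] Uc_def Vc_def rho_sq cc_sq of_real_add of_real_mult of_real_1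
  by (simp only: ring_distribs mult_minus_left mult_minus_right diff_minus_eq_add mult_1_left mult.assoc)
qed

text \<open>One kernel for each term: \<open>Kc\<close> for the transport of \<open>p\<close> by
  \<open>v\<close>, \<open>K2\<close> for the sum of \<open>p j\<close> times the gradient of
  \<open>Ups v\<close>, \<open>K3\<close> and \<open>K4\<close> for the transport by
  \<open>p\<close> of \<open>v\<close> and of \<open>Ups v\<close>, \<open>K5\<close> to
  \<open>K7\<close> for the three divergences. Factors \<open>ik j\<close> are derivatives of
  \<open>p\<close>, \<open>ik (k - j)\<close> of \<open>v\<close>, and \<open>ik k\<close> of a
  product.\<close>

definition Kc :: "field => int^2 => int^2 => 2 => complex" where
 "Kc v k j b = (SUM i:UNIV. Vc v i (k - j) * (ik j i * nv j b))"
definition K2 :: "field => int^2 => int^2 => 2 => complex" where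
 "K2 v k j i = (SUM b:UNIV. ik (k - j) i * Uc v b (k - j) * nv j b)"
definition K3 :: "field => int^2 => int^2 => 2 => complex" where
 "K3 v k j b = (SUM i:UNIV. ik (k - j) i * Vc v b (k - j) * nv j i)"
definition K4 :: "field => int^2 => int^2 => 2 => complex" where
 "K4 v k j b = (SUM i:UNIV. ik (k - j) i * Uc v b (k - j) * nv j i)"
definition K5 :: "field => int^2 => int^2 => 2 => complex" where
 "K5 v k j i = (SUM d:UNIV. ik k d * ((SUM b:UNIV. GA v i b (k - j) * PA j b d) + (SUM b:UNIV. GA v b d (k - j) * PA j i b)))"
definition K6 :: "field => int^2 => int^2 => 2 => complex" where
 "K6 v k j i = (SUM d:UNIV. ik k d * (SUM a:UNIV. SUM b:UNIV. HH v a b a b (k - j) * PA j i d))"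
definition K7 :: "field => int^2 => int^2 => 2 => complex" where
 "K7 v k j i = (SUM d:UNIV. ik k d * (SUM a:UNIV. SUM b:UNIV. HH v a b i d (k - j) * PA j a b))"

context
 fixes v p :: field and A B :: real
 assumes v: "fsb 3 A v" and p: "fsb 2 B p" and ps: "solen p"
begin

lemma v3: "hsb 3 A (cp v i)" and p2: "hsb 2 B (cp p i)"
 using v p by (auto simp: fsb_def)

lemma v3': "hsb (Suc (Suc (Suc 0))) A (cp v i)" and p2': "hsb (Suc (Suc 0)) B (cp p i)"
 using v3[of i] p2[of i] by (simp_all only: numeral_2_eq_2 numeral_3_eq_3)

lemma p_fc: "fc (cp p i) j = nv j i * pr p j"
 using fc_pr[OF ps, of i j] p by (simp add: fsb_def mult.commute)

lemma dp_fc: "fc (wd L d (cp p i)) j = ik j d * nv j i * pr p j"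
 by (simp add: hsb_wd_ik[OF p2'] p_fc)

lemma v2: "hsb 2 A (cp v i)" by (rule hsb_mono[OF v3]) simp

lemma dv2: "hsb 2 (A / sqrt a1) (wd L d (cp v i))"
 using hsb_wd(1)[OF v3'] by (simp only: numeral_2_eq_2)

lemma dv_fc: "fc (wd L d (cp v i)) m = ik m d * Vc v i m"
 by (simp add: hsb_wd_ik[OF v3'] Vc_def)

lemma dp1: "hsb 1 (B / sqrt a1) (wd L d (cp p i))"
 using hsb_wd(1)[OF p2'] by (simp only: One_nat_def)

lemma dU0: "hs 0 (wd L d (%x. Ups L a1 v x $ i))" and dU_fc: "fc (wd L d (%x. Ups L a1 v x $ i)) m = ik m d * Uc v i m"
proof -
 obtain Q where Q: "hsb (Suc 0) Q (%x. Ups L a1 v x $ i)" using Ups_nth(1)[OF v3'] by blast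
 show "hs 0 (wd L d (%x. Ups L a1 v x $ i))" using hsb_wd(1)[OF Q] by blast
 show "fc (wd L d (%x. Ups L a1 v x $ i)) m = ik m d * Uc v i m"
  by (simp add: hsb_wd_ik[OF Q] Ups_nth(2)[OF v3'])
qed

lemma krep_conv_vp: "krep (pr p) 1 (%k j. Kc v k j b) (%x. conv L v p x $ b)"
proof -
 have "krep (pr p) 1 (%k j. fc (cp v i) (k - j) * (ik j i * nv j b)) (%x. v x $ i * wd L i (cp p b) x)" for i
  by (rule krep_mult(1)[OF v2 dp1 dp_fc]) simp
 then have "krep (pr p) 1 (%k j. SUM i:UNIV. fc (cp v i) (k - j) * (ik j i * nv j b)) (%x. SUM i:UNIV. v x $ i * wd L i (cp p b) x)"
  by (intro krep_sum) auto
 then show ?thesis by (simp add: Kc_def[abs_def] Vc_def conv_def)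
qed

lemma krep_tgrad: "krep (pr p) 0 (%k j. K2 v k j i) (%x. tgrad L p (Ups L a1 v) x $ i)"
proof -
 have "krep (pr p) 0 (%k j. fc (wd L i (%y. Ups L a1 v y $ b)) (k - j) * nv j b) (%x. p x $ b * wd L i (%y. Ups L a1 v y $ b) x)" for b
  using dU0[of i b] krep_mult'[OF _ p2 p_fc] by blast
 then have "krep (pr p) 0 (%k j. SUM b:UNIV. fc (wd L i (%y. Ups L a1 v y $ b)) (k - j) * nv j b) (%x. SUM b:UNIV. p x $ b * wd L i (%y. Ups L a1 v y $ b) x)"
  by (intro krep_sum) auto
 then show ?thesis by (simp add: K2_def[abs_def] dU_fc tgrad_def sgrad_def)
qed

lemma krep_conv_pv: "krep (pr p) 1 (%k j. K3 v k j b) (%x. conv L p v x $ b)"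
proof -
 have "krep (pr p) 1 (%k j. fc (wd L i (cp v b)) (k - j) * nv j i) (%x. p x $ i * wd L i (cp v b) x)" for i
  by (rule krep_mono[OF krep_mult(2)[OF dv2 p2 p_fc]]) auto
 then have "krep (pr p) 1 (%k j. SUM i:UNIV. fc (wd L i (cp v b)) (k - j) * nv j i) (%x. SUM i:UNIV. p x $ i * wd L i (cp v b) x)"
  by (intro krep_sum) auto
 then show ?thesis by (simp add: K3_def[abs_def] dv_fc conv_def)
qed

lemma krep_conv_pU: "krep (pr p) 0 (%k j. K4 v k j b) (%x. conv L p (Ups L a1 v) x $ b)"
proof -
 have "krep (pr p) 0 (%k j. fc (wd L i (%y. Ups L a1 v y $ b)) (k - j) * nv j i) (%x. p x $ i * wd L i (%y. Ups L a1 v y $ b) x)" for i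
  using dU0[of i b] krep_mult'[OF _ p2 p_fc] by blast
 then have "krep (pr p) 0 (%k j. SUM i:UNIV. fc (wd L i (%y. Ups L a1 v y $ b)) (k - j) * nv j i) (%x. SUM i:UNIV. p x $ i * wd L i (%y. Ups L a1 v y $ b) x)"
  by (intro krep_sum) auto
 then show ?thesis by (simp add: K4_def[abs_def] dU_fc conv_def)
qed

lemma Av2: "hsb 2 (2 * (A / sqrt a1)) (%x. Am L v x $ a $ b)" and Av_fc: "fc (%x. Am L v x $ a $ b) m = GA v a b m"
 using hsb_Am(1)[OF v3'] hsb_Am(2)[OF v3'] by (simp_all add: numeral_2_eq_2 GA_def Vc_def)

lemma Ap1: "hsb 1 (2 * (B / sqrt a1)) (%x. Am L p x $ a $ b)" and Ap_fc: "fc (%x. Am L p x $ a $ b) j = PA j a b * pr p j"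
 using hsb_Am(1)[OF p2'] hsb_Am(2)[OF p2'] by (simp_all add: PA_def p_fc algebra_simps)

lemma AA2: "EX Q. hsb 2 Q (%x. Am L v x $ a $ b * Am L v x $ c $ d)"
 using hsb_mult(1)[OF Av2 Av2] by blast

lemma krep_divm:
 assumes "!!d. krep (pr p) (Suc 0) (R d) (%x. M x $ i $ d)"
 shows "krep (pr p) 0 (%k j. SUM d:UNIV. ik k d * R d k j) (%x. divm L M x $ i)"
proof -
 have "krep (pr p) 0 (%k j. SUM d:UNIV. ik k d * R d k j) (%x. SUM d:UNIV. wd L d (%y. M y $ i $ d) x)"
  by (intro krep_sum krep_wd assms) auto
 then show ?thesis by (simp add: divm_def)
qed

lemma krep_div1: "krep (pr p) 0 (%k j. K5 v k j i) (%x. divm L (%x. Am L v x ** Am L p x + Am L p x ** Am L v x) x $ i)"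
proof -
 have "krep (pr p) (Suc 0) (%k j. (SUM b:UNIV. GA v i b (k - j) * PA j b d) + (SUM b:UNIV. GA v b d (k - j) * PA j i b)) (%x. (Am L v x ** Am L p x + Am L p x ** Am L v x) $ i $ d)" for d
 proof -
  have 1: "krep (pr p) 1 (%k j. fc (%x. Am L v x $ i $ b) (k - j) * PA j b d) (%x. Am L v x $ i $ b * Am L p x $ b $ d)" for b
   by (rule krep_mult(1)[OF Av2 Ap1 Ap_fc]) simp
  have 2: "krep (pr p) 1 (%k j. fc (%x. Am L v x $ b $ d) (k - j) * PA j i b) (%x. Am L p x $ i $ b * Am L v x $ b $ d)" for b
   by (rule krep_mult(2)[OF Av2 Ap1 Ap_fc]) simp
  have "krep (pr p) 1 (%k j. (SUM b:UNIV. fc (%x. Am L v x $ i $ b) (k - j) * PA j b d) + (SUM b:UNIV. fc (%x. Am L v x $ b $ d) (k - j) * PA j i b))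
   (%x. (SUM b:UNIV. Am L v x $ i $ b * Am L p x $ b $ d) + (SUM b:UNIV. Am L p x $ i $ b * Am L v x $ b $ d))"
   by (intro krep_add krep_sum 1 2) auto
  then show ?thesis by (simp add: Av_fc matrix_matrix_mult_def)
 qed
 from krep_divm[OF this] show ?thesis by (simp add: K5_def[abs_def])
qed

lemma frob_sum: "frob X Y = (SUM a:UNIV. SUM b:UNIV. X $ a $ b * Y $ a $ b)"
 by (simp add: frob_def trace_def matrix_matrix_mult_def transpose_def)

lemma krep_div2: "krep (pr p) 0 (%k j. K6 v k j i) (%x. divm L (%x. frob (Am L v x) (Am L v x) *\<^sub>R Am L p x) x $ i)"
proof -
 have "krep (pr p) (Suc 0) (%k j. SUM a:UNIV. SUM b:UNIV. HH v a b a b (k - j) * PA j i d) (%x. (frob (Am L v x) (Am L v x) *\<^sub>R Am L p x) $ i $ d)" for d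
 proof -
  have 1: "krep (pr p) 1 (%k j. HH v a b a b (k - j) * PA j i d) (%x. (Am L v x $ a $ b * Am L v x $ a $ b) * Am L p x $ i $ d)" for a b
   using AA2[of a b a b] krep_mult(1)[OF _ Ap1 Ap_fc] unfolding HH_def by fastforce
  have "krep (pr p) 1 (%k j. SUM a:UNIV. SUM b:UNIV. HH v a b a b (k - j) * PA j i d) (%x. SUM a:UNIV. SUM b:UNIV. (Am L v x $ a $ b * Am L v x $ a $ b) * Am L p x $ i $ d)"
   by (intro krep_sum 1) auto
  then show ?thesis by (simp add: frob_sum sum_distrib_right)
 qed
 from krep_divm[OF this] show ?thesis by (simp add: K6_def[abs_def])
qed

lemma krep_div3: "krep (pr p) 0 (%k j. K7 v k j i) (%x. divm L (%x. frob (Am L p x) (Am L v x) *\<^sub>R Am L v x) x $ i)"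
proof -
 have "krep (pr p) (Suc 0) (%k j. SUM a:UNIV. SUM b:UNIV. HH v a b i d (k - j) * PA j a b) (%x. (frob (Am L p x) (Am L v x) *\<^sub>R Am L v x) $ i $ d)" for d
 proof -
  have 1: "krep (pr p) 1 (%k j. HH v a b i d (k - j) * PA j a b) (%x. (Am L v x $ a $ b * Am L v x $ i $ d) * Am L p x $ a $ b)" for a b
   using AA2[of a b i d] krep_mult(1)[OF _ Ap1 Ap_fc] unfolding HH_def by fastforce
  have "krep (pr p) 1 (%k j. SUM a:UNIV. SUM b:UNIV. HH v a b i d (k - j) * PA j a b) (%x. SUM a:UNIV. SUM b:UNIV. (Am L v x $ a $ b * Am L v x $ i $ d) * Am L p x $ a $ b)"
   by (intro krep_sum 1) auto
  then show ?thesis by (simp add: frob_sum sum_distrib_right sum_distrib_left mult_ac)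
 qed
 from krep_divm[OF this] show ?thesis by (simp add: K7_def[abs_def])
qed

lemma pr_krep:
 assumes "!!i. krep (pr p) s (R i) (cp w i)"
 shows "((%j. (SUM i:UNIV. cnj (nv k i) * R i k j) * pr p j) has_sum pr w k) UNIV"
proof -
 have "((%j. SUM i:UNIV. cnj (nv k i) * (R i k j * pr p j)) has_sum (SUM i:UNIV. cnj (nv k i) * fc (cp w i) k)) UNIV"
  by (intro has_sum_finite_sum has_sum_cmult_right) (use assms in "auto simp: krep_def")
 moreover have "(SUM i:UNIV. cnj (nv k i) * R i k j) * pr p j = (SUM i:UNIV. cnj (nv k i) * (R i k j * pr p j))" for j
  by (simp only: sum_distrib_right mult.assoc)
 moreover have "pr w k = (SUM i:UNIV. cnj (nv k i) * fc (cp w i) k)"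
  unfolding pr_def by (rule sum.cong) (simp_all add: mult.commute)
 ultimately show ?thesis by simp
qed

end

section \<open>Assembly of the full matrix\<close>

definition cn :: "(int^2 => int^2 => 2 => complex) => int^2 => int^2 => complex" where
 "cn R k j = (SUM i:UNIV. cnj (nv k i) * R k j i)"

text \<open>Everything except the transport term, which is kept apart because only its skew symmetry
  makes it tractable. The last line is the viscous diagonal.\<close>

definition RR :: "real => real => real => field => int^2 => int^2 => complex" where
 "RR nu a2 be v k j = - cn (K2 v) k j - cor ((rho k)^2) * cn (K3 v) k j + cn (K4 v) k j
  + cor (a1 + a2) * cn (K5 v) k j + cor be * cn (K6 v) k j + cor (2 * be) * cn (K7 v) k j
  + (if j = k then - cor (nu * (kap^2 * (norm (freq k))^2)) else 0)"

definition KK :: "real => real => real => field => int^2 => int^2 => complex" where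
 "KK nu a2 be v k j = cor ((rho k)^2) * cn (Kc v) k j + RR nu a2 be v k j"

text \<open>Each term of the weak equation is a Parseval sum against \<open>ph\<close>. The two
  Helmholtz pairings contribute the factor \<open>rho k ^ 2\<close>, and summing the kernels gives
  row \<open>k\<close> of \<open>KK\<close>.\<close>

theorem adjoint_rhs_pr:
 assumes v: "fsb 3 A v" and p: "fsb 2 B p" and ps: "solen p" and g: "!!i. l2t (cp g i)" and ph: "ph : carr (Vsp L)"
 shows "((%k. (pr g k + (\<Sum>\<^sub>\<infinity>j. KK nu a2 be v k j * pr p j)) * cnj (pr ph k)) has_sum
   cor (adjoint_rhs L nu a1 a2 be g v p ph / L^2)) UNIV"
proof -
 note kr = krep_conv_vp[OF v p ps] krep_tgrad[OF v p ps] krep_conv_pv[OF v p ps] krep_conv_pU[OF v p ps]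
  krep_div1[OF v p ps] krep_div2[OF v p ps] krep_div3[OF v p ps]
 note pk = pr_krep[OF v p ps]
 have phH: "ph : carr (Hsp L)" by (rule Vsp_Hsp[OF ph])
 have h1: "EX Q. ALL i. hsb 1 Q (cp w i)" if kh: "!!i. krep (pr p) 1 (R i) (cp w i)" for R and w :: field
 proof -
  obtain Q where "!!i. hsb 1 (Q i) (cp w i)" using krep_hs[OF kh] by metis
  then have "ALL i. hsb 1 (max (Q 1) (Q 2)) (cp w i)" using hsb_max[of 1 Q "%i x. w x $ i"] by blast
  then show ?thesis by blast
 qed
 obtain Q1 where Q1: "!!i. hsb 1 Q1 (%x. conv L v p x $ i)" using h1[OF kr(1)] by blast
 obtain Q3 where Q3: "!!i. hsb 1 Q3 (%x. conv L p v x $ i)" using h1[OF kr(3)] by blast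
 have p2': "hsb (Suc (Suc 0)) B (cp p i)" for i using p by (simp add: fsb_def numeral_2_eq_2)
 have lp: "fc (%x. (- lap L p x) $ i) k = cor (kap^2 * (norm (freq k))^2) * fc (cp p i) k" for i k
  using fc_uminus[of "%x. lap L p x $ i" k] lap_nth(2)[OF p2', of i k] by simp
 have lp0: "periodic L (%x. (- lap L p x) $ i)" "l2t (%x. (- lap L p x) $ i)" for i
 proof -
  obtain Q where "hsb 0 Q (%x. lap L p x $ i)" using lap_nth(1)[OF p2'] by blast
  from hsb_cmul[OF this, of "-1"] show "periodic L (%x. (- lap L p x) $ i)" "l2t (%x. (- lap L p x) $ i)" by (auto simp: hsb_def)
 qed
 have prl: "pr (%x. - lap L p x) k = cor (kap^2 * (norm (freq k))^2) * pr p k" for k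
  unfolding pr_def lp by (simp only: sum_distrib_left mult.assoc)
 have st: "((%k. cor (kap^2 * (norm (freq k))^2) * pr p k * cnj (pr ph k)) has_sum cor (ip L (stokes L p) ph / L^2)) UNIV"
  using ip_pr[OF lp0(2) phH] unfolding prl stokes_def ip_leray[OF lp0 phH] .
 define T1 T2 T3 T4 T5 T6 T7 where
  "T1 = conv L v p" and "T2 = tgrad L p (Ups L a1 v)" and "T3 = conv L p v" and "T4 = conv L p (Ups L a1 v)"
  and "T5 = divm L (%x. Am L v x ** Am L p x + Am L p x ** Am L v x)"
  and "T6 = divm L (%x. frob (Am L v x) (Am L v x) *\<^sub>R Am L p x)"
  and "T7 = divm L (%x. frob (Am L p x) (Am L v x) *\<^sub>R Am L v x)"
 note Td = T1_def T2_def T3_def T4_def T5_def T6_def T7_def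
 have s: "((%j. cn (Kc v) k j * pr p j) has_sum pr T1 k) UNIV" "((%j. cn (K2 v) k j * pr p j) has_sum pr T2 k) UNIV"
  "((%j. cn (K3 v) k j * pr p j) has_sum pr T3 k) UNIV" "((%j. cn (K4 v) k j * pr p j) has_sum pr T4 k) UNIV"
  "((%j. cn (K5 v) k j * pr p j) has_sum pr T5 k) UNIV" "((%j. cn (K6 v) k j * pr p j) has_sum pr T6 k) UNIV"
  "((%j. cn (K7 v) k j * pr p j) has_sum pr T7 k) UNIV" for k
  unfolding cn_def Td by (rule pk[OF kr(1)] pk[OF kr(2)] pk[OF kr(3)] pk[OF kr(4)] pk[OF kr(5)] pk[OF kr(6)] pk[OF kr(7)])+
 define W where "W k = cor ((rho k)^2)" for k
 define N where "N k = cor (nu * (kap^2 * (norm (freq k))^2))" for k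
 have diag: "((%j. (if j = k then - N k else 0) * pr p j) has_sum (- N k * pr p k)) UNIV" for k
 proof -
  have "((%j. (if j = k then - N k else 0) * pr p j) has_sum (SUM j:{k}. (if j = k then - N k else 0) * pr p j)) {k}"
   by (rule has_sum_finite) simp
  then show ?thesis by (subst (asm) has_sum_cong_neutral[of UNIV]) auto
 qed
 have "((%j. W k * (cn (Kc v) k j * pr p j) + (- 1) * (cn (K2 v) k j * pr p j) + (- W k) * (cn (K3 v) k j * pr p j) + cn (K4 v) k j * pr p j
   + cor (a1 + a2) * (cn (K5 v) k j * pr p j) + cor be * (cn (K6 v) k j * pr p j) + cor (2 * be) * (cn (K7 v) k j * pr p j)
   + (if j = k then - N k else 0) * pr p j) has_sum
   (W k * pr T1 k + (- 1) * pr T2 k + (- W k) * pr T3 k + pr T4 k + cor (a1 + a2) * pr T5 k + cor be * pr T6 k + cor (2 * be) * pr T7 k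
   + (- N k * pr p k))) UNIV" for k
  by (intro has_sum_add has_sum_cmult_right s diag)
 moreover have "W k * (cn (Kc v) k j * pr p j) + (- 1) * (cn (K2 v) k j * pr p j) + (- W k) * (cn (K3 v) k j * pr p j) + cn (K4 v) k j * pr p j
   + cor (a1 + a2) * (cn (K5 v) k j * pr p j) + cor be * (cn (K6 v) k j * pr p j) + cor (2 * be) * (cn (K7 v) k j * pr p j)
   + (if j = k then - N k else 0) * pr p j = KK nu a2 be v k j * pr p j" for k j
  unfolding KK_def RR_def W_def N_def[symmetric] by (simp only: ring_distribs mult_minus_left mult_1_left diff_conv_add_uminus add.assoc mult.assoc)
 ultimately have KKs: "(\<Sum>\<^sub>\<infinity>j. KK nu a2 be v k j * pr p j) = W k * pr T1 k + (- 1) * pr T2 k + (- W k) * pr T3 k + pr T4 k + cor (a1 + a2) * pr T5 k + cor be * pr T6 k + cor (2 * be) * pr T7 k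
   + (- N k * pr p k)" for k
  by (intro infsumI) simp
 have i: "((%k. pr T2 k * cnj (pr ph k)) has_sum cor (ip L T2 ph / L^2)) UNIV"
  "((%k. pr T4 k * cnj (pr ph k)) has_sum cor (ip L T4 ph / L^2)) UNIV"
  "((%k. pr T5 k * cnj (pr ph k)) has_sum cor (ip L T5 ph / L^2)) UNIV"
  "((%k. pr T6 k * cnj (pr ph k)) has_sum cor (ip L T6 ph / L^2)) UNIV"
  "((%k. pr T7 k * cnj (pr ph k)) has_sum cor (ip L T7 ph / L^2)) UNIV"
  unfolding Td by (rule ip_pr[OF krep_l2t[OF kr(2)] phH] ip_pr[OF krep_l2t[OF kr(4)] phH] ip_pr[OF krep_l2t[OF kr(5)] phH] ip_pr[OF krep_l2t[OF kr(6)] phH] ip_pr[OF krep_l2t[OF kr(7)] phH])+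
 have hh: "((%k. W k * pr T1 k * cnj (pr ph k)) has_sum cor (helmholtz_pairing L a1 T1 ph / L^2)) UNIV"
  "((%k. W k * pr T3 k * cnj (pr ph k)) has_sum cor (helmholtz_pairing L a1 T3 ph / L^2)) UNIV"
  unfolding W_def Td by (rule helmholtz_pr[OF Q1 ph] helmholtz_pr[OF Q3 ph])+
 have gg: "((%k. pr g k * cnj (pr ph k)) has_sum cor (ip L g ph / L^2)) UNIV" by (rule ip_pr[OF g phH])
 have "((%k. pr g k * cnj (pr ph k) + cor (- nu) * (cor (kap^2 * (norm (freq k))^2) * pr p k * cnj (pr ph k))
  + W k * pr T1 k * cnj (pr ph k) + (- 1) * (pr T2 k * cnj (pr ph k)) + (- 1) * (W k * pr T3 k * cnj (pr ph k)) + pr T4 k * cnj (pr ph k)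
  + cor (a1 + a2) * (pr T5 k * cnj (pr ph k)) + cor be * (pr T6 k * cnj (pr ph k)) + cor (2 * be) * (pr T7 k * cnj (pr ph k)))
  has_sum (cor (ip L g ph / L^2) + cor (- nu) * cor (ip L (stokes L p) ph / L^2)
  + cor (helmholtz_pairing L a1 T1 ph / L^2) + (- 1) * cor (ip L T2 ph / L^2) + (- 1) * cor (helmholtz_pairing L a1 T3 ph / L^2)
  + cor (ip L T4 ph / L^2) + cor (a1 + a2) * cor (ip L T5 ph / L^2) + cor be * cor (ip L T6 ph / L^2)
  + cor (2 * be) * cor (ip L T7 ph / L^2))) UNIV"
  by (intro has_sum_add has_sum_cmult_right gg st hh i)
 moreover have "pr g k * cnj (pr ph k) + cor (- nu) * (cor (kap^2 * (norm (freq k))^2) * pr p k * cnj (pr ph k))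
  + W k * pr T1 k * cnj (pr ph k) + (- 1) * (pr T2 k * cnj (pr ph k)) + (- 1) * (W k * pr T3 k * cnj (pr ph k)) + pr T4 k * cnj (pr ph k)
  + cor (a1 + a2) * (pr T5 k * cnj (pr ph k)) + cor be * (pr T6 k * cnj (pr ph k)) + cor (2 * be) * (pr T7 k * cnj (pr ph k))
  = (pr g k + (\<Sum>\<^sub>\<infinity>j. KK nu a2 be v k j * pr p j)) * cnj (pr ph k)" for k
 proof -
  have n: "cor (- nu) * (cor (kap^2 * (norm (freq k))^2) * pr p k * cnj (pr ph k)) = - N k * pr p k * cnj (pr ph k)"
   unfolding N_def of_real_mult[of nu] of_real_minus by (simp only: mult.assoc mult_minus_left)
  show ?thesis unfolding KKs n by (simp only: ring_distribs mult_minus_left mult_1_left mult.assoc add.assoc) (simp only: add_ac)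
 qed
 moreover have "cor (ip L g ph / L^2) + cor (- nu) * cor (ip L (stokes L p) ph / L^2)
  + cor (helmholtz_pairing L a1 T1 ph / L^2) + (- 1) * cor (ip L T2 ph / L^2) + (- 1) * cor (helmholtz_pairing L a1 T3 ph / L^2)
  + cor (ip L T4 ph / L^2) + cor (a1 + a2) * cor (ip L T5 ph / L^2) + cor be * cor (ip L T6 ph / L^2)
  + cor (2 * be) * cor (ip L T7 ph / L^2) = cor (adjoint_rhs L nu a1 a2 be g v p ph / L^2)"
  unfolding adjoint_rhs_def Td[symmetric] by (simp add: add_divide_distrib diff_divide_distrib)
 ultimately show ?thesis by (simp only:)
qed

end

section \<open>Bounds for the matrix of the adjoint operator\<close>

text \<open>Here \<open>x\<close>, \<open>y\<close>, \<open>z\<close> stand for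
  \<open>rho k\<close>, \<open>rho j\<close>, \<open>rho (k - j)\<close>. The first three bounds
  serve the lower order part, the next two the transport part by itself, the last two its Hermitian
  parts in \<open>V\<close> and \<open>D(A)\<close>. There \<open>\<bar>x - y\<bar> <= z\<close>
  spends one of the three powers of \<open>z\<close>.\<close>

lemma weight_estimates:
 fixes x y z :: real
 assumes x: "1 <= x" and y: "1 <= y" and z: "1 <= z" and t: "x <= y + z" "y <= x + z"
 defines "S \<equiv> 1 / z^2 + 1 / y^2 + 1 / x^2"
 shows "(1 + (x^2 + x * y) / z^2) / (x^2 * y) <= 4 * S"
  and "(1 + (x^2 + x * y) / z^2) / (x * y) <= 4 * S"
  and "(1 + (x^2 + x * y) / z^2) / y^2 <= 4 * S"
  and "x^2 * (y / z ^ 3) / (x^2 * y) <= S"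
  and "x^2 * (y / z ^ 3) / (x * y^2) <= 2 * S"
  and "\<bar>x^2 - y^2\<bar> * (min x y / z ^ 3) / (x * y) <= 2 * S"
  and "\<bar>x ^ 4 - y ^ 4\<bar> * (min x y / z ^ 3) / (x^2 * y^2) <= 6 * S"
proof -
 have p: "0 < x" "0 < y" "0 < z" using x y z by auto
 define a b c where "a = 1 / x" and "b = 1 / y" and "c = 1 / z"
 have abc: "0 < a" "a <= 1" "0 < b" "b <= 1" "0 < c" "c <= 1" using x y z by (auto simp: a_def b_def c_def)
 have S: "S = c^2 + b^2 + a^2" by (simp add: S_def a_def b_def c_def power_divide)
 have am: "2 * (b * c) <= b^2 + c^2" "2 * (a * c) <= a^2 + c^2" "2 * (a * b) <= a^2 + b^2"
  using sum_squares_bound[of b c] sum_squares_bound[of a c] sum_squares_bound[of a b] by (simp_all add: mult.assoc)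
 have nn: "0 <= a^2" "0 <= b^2" "0 <= c^2" by auto
 have xb: "x * b <= 1 + z * b" using t(1) p by (simp add: b_def field_simps)
 have ya: "y * a <= 1 + z * a" using t(2) p by (simp add: a_def field_simps)
 have one: "x * a = 1" "y * b = 1" "z * c = 1" using p by (auto simp: a_def b_def c_def)
 have c2z: "c^2 * (z * r) = c * r" for r using one(3) by (simp add: power2_eq_square mult_ac)
 have xbc: "c^2 * (x * b) <= c^2 + b * c"
  using mult_left_mono[OF xb nn(3)] by (simp only: distrib_left mult_1_right c2z mult.commute[of b c])
 have yac: "c^2 * (y * a) <= c^2 + a * c"
  using mult_left_mono[OF ya nn(3)] by (simp only: distrib_left mult_1_right c2z mult.commute[of a c])
 have aa: "a * a <= a" "b * b <= b" "c * c <= c" using abc by (simp_all add: mult_left_le)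
 have c32: "c ^ 3 <= c^2" using abc by (simp add: power_decreasing)
 show "(1 + (x^2 + x * y) / z^2) / (x^2 * y) <= 4 * S"
 proof -
  have "(1 + (x^2 + x * y) / z^2) / (x^2 * y) = a^2 * b + c^2 * b + c^2 * a"
   using p by (simp add: a_def b_def c_def field_simps power2_eq_square)
  also have "... <= a^2 * 1 + c^2 * 1 + c^2 * 1" using abc nn by (intro add_mono mult_left_mono) auto
  also have "... <= 4 * S" unfolding S using nn unfolding distrib_left by linarith
  finally show ?thesis .
 qed
 show "(1 + (x^2 + x * y) / z^2) / (x * y) <= 4 * S"
 proof -
  have "(1 + (x^2 + x * y) / z^2) / (x * y) = a * b + c^2 * (x * b) + c^2"
   using p by (simp add: a_def b_def c_def field_simps power2_eq_square)
  also have "... <= 4 * S" unfolding S using nn am xbc unfolding distrib_left by linarith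
  finally show ?thesis .
 qed
 show R2: "(1 + (x^2 + x * y) / z^2) / y^2 <= 4 * S"
 proof -
  have "(1 + (x^2 + x * y) / z^2) / y^2 = b^2 + c^2 * (x * b)^2 + c^2 * (x * b)"
   using p by (simp add: a_def b_def c_def field_simps power2_eq_square)
  moreover have "c^2 * (x * b)^2 <= c^2 + 2 * (b * c) + b^2"
  proof -
   have "(x * b)^2 <= (1 + z * b)^2" using xb p abc by (intro power_mono) auto
   then have "c^2 * (x * b)^2 <= c^2 * (1 + z * b)^2" by (rule mult_left_mono) simp
   also have "... = (c + (z * c) * b)^2" by (simp add: power2_eq_square algebra_simps)
   also have "... = c^2 + 2 * (b * c) + b^2" unfolding one by (simp add: power2_sum mult_ac)
   finally show ?thesis .
  qed
  ultimately show ?thesis unfolding S using nn am xbc unfolding distrib_left by linarith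
 qed
 show "x^2 * (y / z ^ 3) / (x^2 * y) <= S"
 proof -
  have "x^2 * (y / z ^ 3) / (x^2 * y) = c ^ 3" using p by (simp add: c_def power_divide)
  then show ?thesis unfolding S using c32 nn by linarith
 qed
 show "x^2 * (y / z ^ 3) / (x * y^2) <= 2 * S"
 proof -
  have "x^2 * (y / z ^ 3) / (x * y^2) = c * (c^2 * (x * b))" using p by (simp add: c_def b_def field_simps power2_eq_square power3_eq_cube)
  also have "... <= 1 * (c^2 * (x * b))" using abc p by (intro mult_right_mono) auto
  also have "... <= 2 * S" unfolding S using nn am xbc unfolding distrib_left by linarith
  finally show ?thesis .
 qed
 have d: "\<bar>x - y\<bar> <= z" using t by linarith
 \<comment> \<open>The reason for the minimum in the transport bound: with either single frequency
   in its place, the factor \<open>x + y\<close> could not be absorbed into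
   \<open>x * y\<close>.\<close>
 have mn: "min x y * (x + y) <= 2 * (x * y)"
  using p by (cases "x <= y") (auto simp: min_def distrib_left intro: mult_mono)
 have c3: "z * (1 / z ^ 3) = c^2" using p by (simp add: c_def power_divide power2_eq_square power3_eq_cube)
 show "\<bar>x^2 - y^2\<bar> * (min x y / z ^ 3) / (x * y) <= 2 * S"
 proof -
  have "\<bar>x^2 - y^2\<bar> = \<bar>x - y\<bar> * (x + y)" using p by (simp add: power2_eq_square square_diff_square_factored abs_mult)
  also have "... <= z * (x + y)" by (rule mult_right_mono[OF d]) (use p in auto)
  finally have "\<bar>x^2 - y^2\<bar> * (min x y / z ^ 3) <= z * (x + y) * (min x y / z ^ 3)"
   by (rule mult_right_mono) (use p in auto)
  also have "... = (z * (1 / z ^ 3)) * (min x y * (x + y))" by (simp add: mult_ac)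
  also have "... <= c^2 * (2 * (x * y))" unfolding c3 by (rule mult_left_mono[OF mn]) simp
  finally have "\<bar>x^2 - y^2\<bar> * (min x y / z ^ 3) / (x * y) <= c^2 * (2 * (x * y)) / (x * y)" using p by (intro divide_right_mono) auto
  also have "... = 2 * c^2" using p by simp
  also have "... <= 2 * S" unfolding S using nn unfolding distrib_left by linarith
  finally show ?thesis .
 qed
 show "\<bar>x ^ 4 - y ^ 4\<bar> * (min x y / z ^ 3) / (x^2 * y^2) <= 6 * S"
 proof -
  have "x ^ 4 - y ^ 4 = (x - y) * (x + y) * (x^2 + y^2)" by (simp add: power2_eq_square power4_eq_xxxx algebra_simps)
  then have "\<bar>x ^ 4 - y ^ 4\<bar> = \<bar>x - y\<bar> * ((x + y) * (x^2 + y^2))" using p by (simp add: abs_mult)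
  also have "... <= z * ((x + y) * (x^2 + y^2))" by (rule mult_right_mono[OF d]) (use p in auto)
  finally have "\<bar>x ^ 4 - y ^ 4\<bar> * (min x y / z ^ 3) <= z * ((x + y) * (x^2 + y^2)) * (min x y / z ^ 3)"
   by (rule mult_right_mono) (use p in auto)
  also have "... = (z * (1 / z ^ 3)) * ((x^2 + y^2) * (min x y * (x + y)))" by (simp add: mult_ac)
  also have "... <= c^2 * ((x^2 + y^2) * (2 * (x * y)))" unfolding c3 by (intro mult_left_mono mn) auto
  finally have "\<bar>x ^ 4 - y ^ 4\<bar> * (min x y / z ^ 3) / (x^2 * y^2) <= c^2 * ((x^2 + y^2) * (2 * (x * y))) / (x^2 * y^2)"
   using p by (intro divide_right_mono) auto
  also have "... = 2 * (c^2 * (x * b)) + 2 * (c^2 * (y * a))" using p by (simp add: a_def b_def c_def field_simps power2_eq_square)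
  also have "... <= 6 * S" unfolding S using nn am xbc yac unfolding distrib_left by linarith
  finally show ?thesis .
 qed
qed

lemma norm_sum2_le: "(!!i::2. norm (f i :: complex) <= B) ==> norm (SUM i:UNIV. f i) <= 2 * B"
 using sum_norm_bound[of UNIV f B] by simp

section \<open>Entrywise bounds and the Schur constant\<close>

context helm begin

abbreviation c0 :: real where "c0 \<equiv> 1 / sqrt a1"

lemma c0_pos: "0 < c0" using a1_pos by simp

text \<open>Square summable profiles: \<open>al\<close> of \<open>v\<close> in \<open>H^3\<close>,
  \<open>et\<close> of the products of entries of \<open>A(v)\<close> in \<open>H^2\<close>. The
  unit mass at 0 in \<open>am\<close> pays for the viscous diagonal.\<close>

definition al :: "field => int^2 => real" where "al v m = (SUM i:UNIV. rho m ^ 3 * norm (Vc v i m))"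
definition et :: "field => int^2 => real" where "et v m = (SUM a:UNIV. SUM b:UNIV. SUM c:UNIV. SUM d:UNIV. (rho m)^2 * norm (HH v a b c d m))"
definition am :: "field => int^2 => real" where "am v m = al v m + et v m + (if m = 0 then 1 else 0)"

lemma al_nonneg: "0 <= al v m" and et_nonneg: "0 <= et v m" and am_nonneg: "0 <= am v m"
 by (auto simp: al_def et_def am_def intro!: sum_nonneg add_nonneg_nonneg)

lemma Vc_uminus: "Vc v i (- m) = cnj (Vc v i m)" by (simp add: Vc_def fc_cnj)

lemma HH_uminus: "HH v a b c d (- m) = cnj (HH v a b c d m)" by (simp add: HH_def fc_cnj)

lemma am_uminus: "am v (- m) = am v m"
 by (simp add: am_def al_def et_def Vc_uminus HH_uminus)

text \<open>The constant adds two components of \<open>v\<close>, sixteen index quadruples of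
  products, and the unit mass; \<open>2 * (A / sqrt a1)\<close> bounds an entry of
  \<open>A(v)\<close> in \<open>H^2\<close>, and 12 comes from \<open>hsb_mult\<close>.\<close>

lemma l2b_am:
 assumes v: "fsb 3 A v"
 shows "l2b (2 * A + 16 * (12 * (2 * (A / sqrt a1)) * SS * (2 * (A / sqrt a1))) + 1) (am v)"
proof -
 have v3: "hsb 3 A (cp v i)" for i using v by (simp add: fsb_def)
 have v3': "hsb (Suc (Suc (Suc 0))) A (cp v i)" for i using v3[of i] by (simp only: numeral_3_eq_3)
 let ?Q = "12 * (2 * (A / sqrt a1)) * SS * (2 * (A / sqrt a1))"
 have Av: "hsb 2 (2 * (A / sqrt a1)) (%x. Am L v x $ a $ b)" for a b
  using hsb_Am(1)[OF v3'] by (simp only: numeral_2_eq_2)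
 have 1: "l2b (SUM i:(UNIV::2 set). A) (al v)" unfolding al_def[abs_def] Vc_def
  by (rule l2b_sum) (use hsb_D(3)[OF v3] in auto)
 have "l2b (SUM a:(UNIV::2 set). SUM b:(UNIV::2 set). SUM c:(UNIV::2 set). SUM d:(UNIV::2 set). ?Q) (et v)"
  unfolding et_def[abs_def] HH_def
  by (intro l2b_sum finite_class.finite_UNIV hsb_D(3)[OF hsb_mult(1)[OF Av Av]]) auto
 then have 2: "l2b (16 * ?Q) (et v)" by simp
 have "l2b (sqrt 1) (%m::int^2. if m = 0 then 1 else 0)"
 proof (rule l2b_I)
  fix F :: "(int^2) set" assume F: "finite F"
  have "(SUM k:F. ((if k = 0 then 1 else 0)::real)^2) = (SUM k:F. if k = 0 then 1 else 0)" by (rule sum.cong) auto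
  also have "... <= 1" using F by (simp add: sum.delta)
  finally show "(SUM k:F. ((if k = 0 then 1 else 0)::real)^2) <= 1" .
 qed
 then have 3: "l2b 1 (%m::int^2. if m = 0 then 1 else 0)" by simp
 have "l2b ((SUM i:(UNIV::2 set). A) + 16 * ?Q + 1) (am v)" unfolding am_def[abs_def] by (intro l2b_add 1 2 3)
 then show ?thesis by simp
qed

lemma norm_Vc: "norm (Vc v i m) <= al v m / rho m ^ 3"
proof -
 have "rho m ^ 3 * norm (Vc v i m) <= al v m" unfolding al_def by (rule member_le_sum) auto
 then show ?thesis by (simp add: field_simps)
qed

lemma norm_Uc: "norm (Uc v i m) <= al v m / rho m"
proof -
 have "norm (Uc v i m) = (rho m)^2 * norm (Vc v i m)" by (simp add: Uc_def norm_mult norm_power)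
 also have "... <= (rho m)^2 * (al v m / rho m ^ 3)" by (intro mult_left_mono norm_Vc) simp
 also have "... = al v m / rho m" by (simp add: power2_eq_square power3_eq_cube)
 finally show ?thesis .
qed

lemma norm_GA: "norm (GA v a b m) <= 2 * c0 * al v m / (rho m)^2"
proof -
 have t: "norm (ik m b * Vc v a m) <= c0 * al v m / (rho m)^2" for a b
 proof -
  have "norm (ik m b * Vc v a m) <= (rho m / sqrt a1) * (al v m / rho m ^ 3)"
   unfolding norm_mult by (intro mult_mono norm_ik norm_Vc) (auto simp: a1_pos less_imp_le)
  also have "... = c0 * al v m / (rho m)^2" by (simp add: power2_eq_square power3_eq_cube)
  finally show ?thesis .
 qed
 have "norm (GA v a b m) <= norm (ik m b * Vc v a m) + norm (ik m a * Vc v b m)" unfolding GA_def by (rule norm_triangle_ineq)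
 also have "... <= c0 * al v m / (rho m)^2 + c0 * al v m / (rho m)^2" by (intro add_mono t)
 finally show ?thesis by simp
qed

lemma norm_HH: "norm (HH v a b c d m) <= et v m / (rho m)^2"
proof -
 have "(rho m)^2 * norm (HH v a b c d m) <= (SUM d:UNIV. (rho m)^2 * norm (HH v a b c d m))"
  by (rule member_le_sum) auto
 also have "... <= (SUM c:UNIV. SUM d:UNIV. (rho m)^2 * norm (HH v a b c d m))" by (rule member_le_sum[where i=c]) (auto intro: sum_nonneg)
 also have "... <= (SUM b:UNIV. SUM c:UNIV. SUM d:UNIV. (rho m)^2 * norm (HH v a b c d m))" by (rule member_le_sum[where i=b]) (auto intro!: sum_nonneg)
 also have "... <= et v m" unfolding et_def by (rule member_le_sum[where i=a]) (auto intro!: sum_nonneg)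
 finally show ?thesis by (simp add: field_simps)
qed

lemma norm_PA: "norm (PA j a b) <= 2 * c0 * rho j"
proof -
 have t: "norm (ik j b * nv j a) <= c0 * rho j" for a b
 proof -
  have "norm (ik j b * nv j a) <= (rho j / sqrt a1) * 1" unfolding norm_mult by (intro mult_mono norm_ik norm_nv) (auto simp: a1_pos less_imp_le)
  then show ?thesis by simp
 qed
 have "norm (PA j a b) <= norm (ik j b * nv j a) + norm (ik j a * nv j b)" unfolding PA_def by (rule norm_triangle_ineq)
 then show ?thesis using t[of b a] t[of a b] by simp
qed

lemma norm_cn: "(!!i. norm (R k j i) <= B) ==> norm (cn R k j) <= 2 * B"
 unfolding cn_def
proof (rule norm_sum2_le)
 fix i assume B: "!!i. norm (R k j i) <= B"
 have "norm (nv k i) * norm (R k j i) <= 1 * B" by (intro mult_mono norm_nv B) auto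
 then show "norm (cnj (nv k i) * R k j i) <= B" by (simp add: norm_mult)
qed

lemma norm_K2: "norm (cn (K2 v) k j) <= 4 * c0 * al v (k - j)" and norm_K4: "norm (cn (K4 v) k j) <= 4 * c0 * al v (k - j)"
proof -
 have t: "norm (ik (k - j) i * Uc v b (k - j) * nv j e) <= c0 * al v (k - j)" for i b e
 proof -
  have "norm (ik (k - j) i * Uc v b (k - j) * nv j e) <= (rho (k - j) / sqrt a1) * (al v (k - j) / rho (k - j)) * 1"
   unfolding norm_mult by (intro mult_mono norm_ik norm_Uc norm_nv) (auto simp: a1_pos less_imp_le al_nonneg)
  then show ?thesis by simp
 qed
 have n: "norm (K2 v k j i) <= 2 * (c0 * al v (k - j))" "norm (K4 v k j i) <= 2 * (c0 * al v (k - j))" for i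
  unfolding K2_def K4_def by (rule norm_sum2_le, rule t)+
 show "norm (cn (K2 v) k j) <= 4 * c0 * al v (k - j)" "norm (cn (K4 v) k j) <= 4 * c0 * al v (k - j)"
  using norm_cn[of "K2 v" k j, OF n(1)] norm_cn[of "K4 v" k j, OF n(2)] by simp_all
qed

lemma norm_K3: "norm (cn (K3 v) k j) <= 4 * c0 * (al v (k - j) / (rho (k - j))^2)"
proof -
 have t: "norm (ik (k - j) i * Vc v b (k - j) * nv j i) <= c0 * (al v (k - j) / (rho (k - j))^2)" for i b
 proof -
  have "norm (ik (k - j) i * Vc v b (k - j) * nv j i) <= (rho (k - j) / sqrt a1) * (al v (k - j) / rho (k - j) ^ 3) * 1"
   unfolding norm_mult by (intro mult_mono norm_ik norm_Vc norm_nv) (auto simp: a1_pos less_imp_le al_nonneg)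
  also have "... = c0 * (al v (k - j) / (rho (k - j))^2)" by (simp add: power2_eq_square power3_eq_cube)
  finally show ?thesis .
 qed
 have "norm (K3 v k j b) <= 2 * (c0 * (al v (k - j) / (rho (k - j))^2))" for b unfolding K3_def by (rule norm_sum2_le, rule t)
 then have "norm (cn (K3 v) k j) <= 2 * (2 * (c0 * (al v (k - j) / (rho (k - j))^2)))" by (rule norm_cn)
 then show ?thesis by simp
qed

lemma norm_K5: "norm (cn (K5 v) k j) <= 64 * c0 ^ 3 * (al v (k - j) * (rho k * rho j) / (rho (k - j))^2)"
proof -
 define g where "g = (2 * c0 * al v (k - j) / (rho (k - j))^2) * (2 * c0 * rho j)"
 have g: "norm (GA v a b (k - j) * PA j c d) <= g" for a b c d
  unfolding g_def norm_mult using a1_pos by (intro mult_mono norm_GA norm_PA) (auto simp: al_nonneg)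
 have "norm (K5 v k j i) <= 2 * ((rho k / sqrt a1) * (2 * g + 2 * g))" for i
  unfolding K5_def
 proof (rule norm_sum2_le)
  fix d
  have "norm ((SUM b:UNIV. GA v i b (k - j) * PA j b d) + (SUM b:UNIV. GA v b d (k - j) * PA j i b)) <= 2 * g + 2 * g"
   by (rule order_trans[OF norm_triangle_ineq add_mono]) (rule norm_sum2_le, rule g)+
  then show "norm (ik k d * ((SUM b:UNIV. GA v i b (k - j) * PA j b d) + (SUM b:UNIV. GA v b d (k - j) * PA j i b))) <= (rho k / sqrt a1) * (2 * g + 2 * g)"
   unfolding norm_mult by (intro mult_mono norm_ik) (auto simp: a1_pos less_imp_le)
 qed
 then have "norm (cn (K5 v) k j) <= 2 * (2 * ((rho k / sqrt a1) * (2 * g + 2 * g)))" by (rule norm_cn)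
 also have "... = 64 * c0 ^ 3 * (al v (k - j) * (rho k * rho j) / (rho (k - j))^2)"
  by (simp add: g_def power3_eq_cube mult_ac del: real_sqrt_mult_self)
 finally show ?thesis .
qed

lemma norm_K6: "norm (cn (K6 v) k j) <= 32 * c0^2 * (et v (k - j) * (rho k * rho j) / (rho (k - j))^2)"
 and norm_K7: "norm (cn (K7 v) k j) <= 32 * c0^2 * (et v (k - j) * (rho k * rho j) / (rho (k - j))^2)"
proof -
 define g where "g = (et v (k - j) / (rho (k - j))^2) * (2 * c0 * rho j)"
 have g: "norm (HH v a b c d (k - j) * PA j e f) <= g" for a b c d e f
  unfolding g_def norm_mult using a1_pos by (intro mult_mono norm_HH norm_PA) (auto simp: et_nonneg)
 have m: "norm (ik k d * w) <= (rho k / sqrt a1) * (2 * (2 * g))" if "norm w <= 2 * (2 * g)" for d w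
  unfolding norm_mult using that by (intro mult_mono norm_ik) (auto simp: a1_pos less_imp_le)
 have 6: "norm (K6 v k j i) <= 2 * ((rho k / sqrt a1) * (2 * (2 * g)))" for i
  unfolding K6_def by (rule norm_sum2_le, rule m, rule norm_sum2_le, rule norm_sum2_le, rule g)
 have 7: "norm (K7 v k j i) <= 2 * ((rho k / sqrt a1) * (2 * (2 * g)))" for i
  unfolding K7_def by (rule norm_sum2_le, rule m, rule norm_sum2_le, rule norm_sum2_le, rule g)
 have e: "2 * (2 * ((rho k / sqrt a1) * (2 * (2 * g)))) = 32 * c0^2 * (et v (k - j) * (rho k * rho j) / (rho (k - j))^2)"
  by (simp add: g_def power2_eq_square mult_ac del: real_sqrt_mult_self)
 show "norm (cn (K6 v) k j) <= 32 * c0^2 * (et v (k - j) * (rho k * rho j) / (rho (k - j))^2)"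
  using norm_cn[of "K6 v" k j, OF 6] unfolding e .
 show "norm (cn (K7 v) k j) <= 32 * c0^2 * (et v (k - j) * (rho k * rho j) / (rho (k - j))^2)"
  using norm_cn[of "K7 v" k j, OF 7] unfolding e .
qed

text \<open>One summand per term of \<open>RR\<close>: \<open>8 * c0\<close> for \<open>K2\<close>
  and \<open>K4\<close> together, \<open>4 * c0\<close> for \<open>K3\<close>, then
  \<open>K5\<close>, \<open>K6\<close>, \<open>K7\<close> and the viscosity.\<close>

definition MR :: "real => real => real => real" where
 "MR nu a2 be = 8 * c0 + 4 * c0 + \<bar>a1 + a2\<bar> * (64 * c0 ^ 3) + \<bar>be\<bar> * (32 * c0^2) + \<bar>2 * be\<bar> * (32 * c0^2) + \<bar>nu\<bar> * c0^2"

lemma MR_nonneg: "0 <= MR nu a2 be" unfolding MR_def using a1_pos by simp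

text \<open>\<open>K2\<close> and \<open>K4\<close> need no weight. \<open>K3\<close> carries
  \<open>rho k ^ 2\<close> from the Helmholtz operator, and the divergences carry
  \<open>rho k\<close> from the outer derivative and \<open>rho j\<close> from the derivative of
  \<open>p\<close>; each of these is divided by \<open>rho (k - j) ^ 2\<close>.\<close>

lemma norm_RR:
 "norm (RR nu a2 be v k j) <= MR nu a2 be * am v (k - j) * (1 + ((rho k)^2 + rho k * rho j) / (rho (k - j))^2)"
proof -
 define x y z where "x = rho k" and "y = rho j" and "z = rho (k - j)"
 have p: "1 <= x" "1 <= y" "1 <= z" by (auto simp: x_def y_def z_def rho_ge1)
 define S where "S = am v (k - j) * (1 + (x^2 + x * y) / z^2)"
 have a: "0 <= al v (k - j)" "0 <= et v (k - j)" "al v (k - j) <= am v (k - j)" "et v (k - j) <= am v (k - j)" "0 <= am v (k - j)"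
  using al_nonneg et_nonneg by (auto simp: am_def)
 have q: "0 <= x^2 / z^2" "0 <= x * y / z^2" using p by auto
 have b1: "al v (k - j) <= S"
 proof -
  have "al v (k - j) * 1 <= am v (k - j) * (1 + (x^2 + x * y) / z^2)" using a q by (intro mult_mono) (auto simp: add_divide_distrib)
  then show ?thesis by (simp add: S_def)
 qed
 have b2: "x^2 * (al v (k - j) / z^2) <= S"
 proof -
  have "al v (k - j) * (x^2 / z^2) <= am v (k - j) * (1 + (x^2 + x * y) / z^2)" using a q by (intro mult_mono) (auto simp: add_divide_distrib)
  then show ?thesis by (simp add: S_def mult_ac)
 qed
 have b3: "al v (k - j) * (x * y) / z^2 <= S" "et v (k - j) * (x * y) / z^2 <= S"
 proof -
  have "al v (k - j) * (x * y / z^2) <= am v (k - j) * (1 + (x^2 + x * y) / z^2)" "et v (k - j) * (x * y / z^2) <= am v (k - j) * (1 + (x^2 + x * y) / z^2)"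
   using a q by (intro mult_mono; auto simp: add_divide_distrib)+
  then show "al v (k - j) * (x * y) / z^2 <= S" "et v (k - j) * (x * y) / z^2 <= S" by (simp_all add: S_def)
 qed
 \<comment> \<open>On the diagonal \<open>rho (k - j) = 1\<close> and \<open>am\<close> is at least
   1, so the weight \<open>rho k ^ 2\<close> on the right dominates the symbol of the
   Laplacian.\<close>
 have dg: "norm (if j = k then - cor (nu * (kap^2 * (norm (freq k))^2)) else 0) <= \<bar>nu\<bar> * c0^2 * S"
 proof (cases "j = k")
  case True
  have z1: "z = 1" by (simp add: z_def True)
  have "1 <= am v (k - j)" using a al_nonneg et_nonneg True by (simp add: am_def)
  then have S1: "x^2 <= S" unfolding S_def z1 using p mult_mono[of 1 "am v (k - j)" "x^2" "1 + (x^2 + x * y) / 1^2"] by simp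
  have "kap^2 * (norm (freq k))^2 <= c0^2 * x^2"
  proof -
   have "cc^2 * (norm (freq k))^2 <= x^2" unfolding x_def rho_sq by simp
   then have "a1 * (kap^2 * (norm (freq k))^2) <= x^2" unfolding cc_sq by (simp only: mult.assoc)
   then have "kap^2 * (norm (freq k))^2 <= x^2 / a1" using a1_pos by (simp only: pos_le_divide_eq mult.commute)
   then show ?thesis using a1_pos by (simp add: power_divide)
  qed
  also have "... <= c0^2 * S" by (intro mult_left_mono S1) simp
  finally have "\<bar>nu\<bar> * (kap^2 * (norm (freq k))^2) <= \<bar>nu\<bar> * (c0^2 * S)" by (rule mult_left_mono) simp
  moreover have "norm (- cor (nu * (kap^2 * (norm (freq k))^2))) = \<bar>nu\<bar> * (kap^2 * (norm (freq k))^2)"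
   unfolding norm_minus_cancel norm_of_real abs_mult[of nu] by simp
  ultimately show ?thesis using True by (simp only: if_True simp_thms mult.assoc)
 next
  case False
  have "0 <= S" using b1 a by linarith
  then show ?thesis using False by simp
 qed
 have t2: "norm (- cn (K2 v) k j) <= 4 * c0 * S" "norm (cn (K4 v) k j) <= 4 * c0 * S"
  using norm_K2[of v k j] norm_K4[of v k j] mult_left_mono[OF b1, of "4 * c0"] c0_pos by (auto simp del: divide_const_simps)
 have t3: "norm (- (cor ((rho k)^2) * cn (K3 v) k j)) <= 4 * c0 * S"
 proof -
  have "norm (- (cor ((rho k)^2) * cn (K3 v) k j)) = x^2 * norm (cn (K3 v) k j)" by (simp add: norm_mult x_def norm_power)
  also have "... <= x^2 * (4 * c0 * (al v (k - j) / z^2))" unfolding z_def by (intro mult_left_mono norm_K3) simp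
  also have "... = 4 * c0 * (x^2 * (al v (k - j) / z^2))" by (simp only: mult_ac)
  also have "... <= 4 * c0 * S" by (rule mult_left_mono[OF b2]) (use a1_pos in simp)
  finally show ?thesis .
 qed
 have t5: "norm (cor (a1 + a2) * cn (K5 v) k j) <= \<bar>a1 + a2\<bar> * (64 * c0 ^ 3) * S"
 proof -
  have "norm (cn (K5 v) k j) <= 64 * c0 ^ 3 * S"
   using order_trans[OF norm_K5[of v k j] mult_left_mono[OF b3(1)[unfolded x_def y_def z_def], of "64 * c0 ^ 3"]] a1_pos by simp
  then have "\<bar>a1 + a2\<bar> * norm (cn (K5 v) k j) <= \<bar>a1 + a2\<bar> * (64 * c0 ^ 3 * S)" by (rule mult_left_mono) simp
  then show ?thesis by (simp only: norm_mult norm_of_real mult.assoc)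
 qed
 have k67: "norm (cn (K6 v) k j) <= 32 * c0^2 * S" "norm (cn (K7 v) k j) <= 32 * c0^2 * S"
  using order_trans[OF norm_K6[of v k j] mult_left_mono[OF b3(2)[unfolded x_def y_def z_def], of "32 * c0^2"]]
   order_trans[OF norm_K7[of v k j] mult_left_mono[OF b3(2)[unfolded x_def y_def z_def], of "32 * c0^2"]] by auto
 have t6: "norm (cor be * cn (K6 v) k j) <= \<bar>be\<bar> * (32 * c0^2) * S"
  using mult_left_mono[OF k67(1), of "\<bar>be\<bar>"] by (simp only: norm_mult norm_of_real mult.assoc abs_ge_zero simp_thms)
 have t7: "norm (cor (2 * be) * cn (K7 v) k j) <= \<bar>2 * be\<bar> * (32 * c0^2) * S"
  using mult_left_mono[OF k67(2), of "\<bar>2 * be\<bar>"] by (simp only: norm_mult norm_of_real mult.assoc abs_ge_zero simp_thms)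
 have "norm (RR nu a2 be v k j) <= norm (- cn (K2 v) k j) + norm (- (cor ((rho k)^2) * cn (K3 v) k j)) + norm (cn (K4 v) k j)
  + norm (cor (a1 + a2) * cn (K5 v) k j) + norm (cor be * cn (K6 v) k j) + norm (cor (2 * be) * cn (K7 v) k j)
  + norm (if j = k then - cor (nu * (kap^2 * (norm (freq k))^2)) else 0)"
  unfolding RR_def diff_conv_add_uminus by (intro norm_triangle_le add_mono order_refl)
 also have "... <= 4 * c0 * S + 4 * c0 * S + 4 * c0 * S + \<bar>a1 + a2\<bar> * (64 * c0 ^ 3) * S + \<bar>be\<bar> * (32 * c0^2) * S + \<bar>2 * be\<bar> * (32 * c0^2) * S + \<bar>nu\<bar> * c0^2 * S"
  by (intro add_mono t2 t3 t5 t6 t7 dg)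
 also have "... = MR nu a2 be * S" unfolding MR_def distrib_right by simp
 finally show ?thesis unfolding S_def x_def y_def z_def by (simp only: mult.assoc)
qed

lemma cn_Kc: "cn (Kc v) k j = (SUM i:UNIV. Vc v i (k - j) * ik j i) * (SUM b:UNIV. cnj (nv k b) * nv j b)"
 by (simp add: cn_def Kc_def UNIV_2 algebra_simps)

text \<open>Incompressibility: the derivative falling on mode \<open>j\<close> may be moved to mode
  \<open>k\<close>, since the difference is the divergence of \<open>v\<close> at frequency
  \<open>k - j\<close>. Both the skew symmetry and the minimum in \<open>norm_Kc\<close> rest on
  this.\<close>

lemma Vc_solen: "solen v ==> (SUM i:UNIV. Vc v i (k - j) * ik j i) = (SUM i:UNIV. Vc v i (k - j) * ik k i)"
proof -
 assume s: "solen v"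
 have "(SUM i:UNIV. Vc v i (k - j) * ik (k - j) i) = \<i> * cor kap * (SUM i:UNIV. real_of_int ((k - j) $ i) * fc (cp v i) (k - j))"
  unfolding Vc_def ik_def of_real_mult by (simp only: sum_distrib_left mult_ac)
 also have "... = 0" using s[unfolded solen_def, rule_format, of "k - j"] by (simp only: mult_zero_right)
 finally have 0: "(SUM i:UNIV. Vc v i (k - j) * ik (k - j) i) = 0" .
 have "ik k i = ik (k - j) i + ik j i" for i using ik_add[of "k - j" j i] by simp
 then have "(SUM i:UNIV. Vc v i (k - j) * ik k i) = (SUM i:UNIV. Vc v i (k - j) * ik (k - j) i) + (SUM i:UNIV. Vc v i (k - j) * ik j i)"
  by (simp only: distrib_left sum.distrib)
 then show ?thesis using 0 by simp
qed

text \<open>The matrix form of \<open>b(v, w, w) = 0\<close> for solenoidal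
  \<open>v\<close>.\<close>

lemma Kc_antisym:
 assumes "solen v" shows "cnj (cn (Kc v) j k) = - cn (Kc v) k j"
proof -
 have V: "cnj (Vc v i (j - k)) = Vc v i (k - j)" for i using Vc_uminus[of v i "j - k"] by simp
 have "cnj (cn (Kc v) j k) = (SUM i:UNIV. Vc v i (k - j) * - ik k i) * (SUM b:UNIV. nv j b * cnj (nv k b))"
  unfolding cn_Kc by (simp add: V ik_cnj)
 also have "... = - ((SUM i:UNIV. Vc v i (k - j) * ik k i) * (SUM b:UNIV. cnj (nv k b) * nv j b))"
  by (simp add: sum_negf mult.commute)
 finally show ?thesis unfolding cn_Kc[of v k j] Vc_solen[OF assms, of k j] .
qed

text \<open>By \<open>Vc_solen\<close> the derivative can be charged to either frequency, hence to
  the smaller one.\<close>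

lemma norm_Kc:
 assumes "solen v" shows "norm (cn (Kc v) k j) <= 4 * c0 * am v (k - j) * (min (rho k) (rho j) / rho (k - j) ^ 3)"
proof -
 have t: "norm (SUM i:UNIV. Vc v i (k - j) * ik m i) <= 2 * (al v (k - j) / rho (k - j) ^ 3 * (rho m / sqrt a1))" for m
  by (rule norm_sum2_le) (unfold norm_mult, intro mult_mono norm_ik norm_Vc, auto simp: al_nonneg)
 have n: "norm (SUM b:UNIV. cnj (nv k b) * nv j b) <= 2 * 1"
  by (rule norm_sum2_le) (unfold norm_mult complex_mod_cnj, intro mult_le_one norm_nv, auto)
 have *: "norm (cn (Kc v) k j) <= 4 * c0 * am v (k - j) * (rho m / rho (k - j) ^ 3)" if m: "m = j | m = k" for m
 proof -
  have "cn (Kc v) k j = (SUM i:UNIV. Vc v i (k - j) * ik m i) * (SUM b:UNIV. cnj (nv k b) * nv j b)"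
   using m cn_Kc[of v k j] Vc_solen[OF assms, of k j] by auto
  then have "norm (cn (Kc v) k j) <= (2 * (al v (k - j) / rho (k - j) ^ 3 * (rho m / sqrt a1))) * (2 * 1)"
   unfolding norm_mult by (simp only: norm_mult) (intro mult_mono t n, auto simp: al_nonneg a1_pos less_imp_le)
  also have "... = (4 * c0 * (rho m / rho (k - j) ^ 3)) * al v (k - j)" by (simp add: mult_ac)
  also have "... <= (4 * c0 * (rho m / rho (k - j) ^ 3)) * am v (k - j)"
   using a1_pos by (intro mult_left_mono) (auto simp: am_def et_nonneg)
  finally show ?thesis by (simp only: mult_ac)
 qed
 show ?thesis using *[of j] *[of k] by (cases "rho k <= rho j") (auto simp: min_def)
qed

text \<open>The entry bounds \<open>4 * c0\<close> and \<open>MR\<close> times the largest factors,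
  6 and 8, left by the weight estimates, followed by the constant of \<open>master_kernel\<close>
  for the profile \<open>am\<close>.\<close>

definition CK :: "real => real => real => real => real" where
 "CK nu a2 be A = (24 * c0 + 8 * MR nu a2 be) * (3 * (2 * A + 16 * (12 * (2 * (A / sqrt a1)) * SS * (2 * (A / sqrt a1))) + 1) * SS)"

text \<open>The first, third and fourth bounds are \<open>S0\<close>, \<open>S1\<close> and
  \<open>S2\<close> of \<open>evol\<close>. The second maps \<open>D(A)\<close> into sequences with
  one weight \<open>rho\<close> to spare and serves to place the time derivative in
  \<open>V\<close>. In the symmetrized bounds skew symmetry leaves only the differences of the
  weights.\<close>

theorem KK_schur:
 assumes v: "fsb 3 A v" and vs: "solen v"
 shows "sch (CK nu a2 be A) (%k j. norm (KK nu a2 be v k j) / ((rho k)^2 * rho j))"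
  and "sch (CK nu a2 be A) (%k j. norm (KK nu a2 be v k j) / (rho k * (rho j)^2))"
  and "sch (CK nu a2 be A) (%k j. norm (KK nu a2 be v k j + cnj (KK nu a2 be v j k)) / (rho k * rho j))"
  and "sch (CK nu a2 be A) (%k j. norm ((rho k)^2 * KK nu a2 be v k j + cnj ((rho j)^2 * KK nu a2 be v j k)) / ((rho k)^2 * (rho j)^2))"
  and "0 <= CK nu a2 be A"
proof -
 let ?K = "KK nu a2 be v" and ?M = "MR nu a2 be"
 have M: "0 <= ?M" by (rule MR_nonneg)
 define S where "S k j = 1 / (rho (k - j))^2 + 1 / (rho j)^2 + 1 / (rho k)^2" for k j
 have S0: "0 <= S k j" for k j by (simp add: S_def)
 have Ssym: "S j k = S k j" for k j by (simp add: S_def rho_diff_commute)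
 have amsym: "am v (j - k) = am v (k - j)" for j k using am_uminus[of v "k - j"] by simp
 have N: "0 <= am v m" for m by (rule am_nonneg)
 have master: "sch (CK nu a2 be A) (%k j. (24 * c0 + 8 * ?M) * (am v (k - j) * S k j))"
  unfolding CK_def S_def by (intro sch_cmul master_kernel l2b_am v N) (use M a1_pos in auto)
 have fin: "sch (CK nu a2 be A) X" if "!!k j. X k j <= (24 * c0 + 8 * ?M) * (am v (k - j) * S k j)" for X
  by (rule sch_mono[OF master that])
 have A: "0 <= A" using v hsb_nonneg by (auto simp: fsb_def)
 show "0 <= CK nu a2 be A" unfolding CK_def using A M SS_nonneg a1_pos by simp
 define F where "F k j = 1 + ((rho k)^2 + rho k * rho j) / (rho (k - j))^2" for k j
 have Rb: "norm (RR nu a2 be v k j) <= ?M * am v (k - j) * F k j" for k j unfolding F_def by (rule norm_RR)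
 define G where "G k j = min (rho k) (rho j) / rho (k - j) ^ 3" for k j
 have Tb: "norm (cn (Kc v) k j) <= 4 * c0 * am v (k - j) * G k j" for k j unfolding G_def by (rule norm_Kc[OF vs])
 note we = weight_estimates[OF rho_ge1 rho_ge1 rho_ge1 rho_triangle rho_triangle2]
 have R: "F k j / ((rho k)^2 * rho j) <= 4 * S k j" "F k j / (rho k * rho j) <= 4 * S k j" "F k j / (rho j)^2 <= 4 * S k j" for k j
  unfolding F_def S_def by (rule we(1), rule we(2), rule we(3))
 have Tg: "(rho k)^2 * G k j / ((rho k)^2 * rho j) <= 2 * S k j" "(rho k)^2 * G k j / (rho k * (rho j)^2) <= 2 * S k j"
  "\<bar>(rho k)^2 - (rho j)^2\<bar> * G k j / (rho k * rho j) <= 2 * S k j" "\<bar>rho k ^ 4 - rho j ^ 4\<bar> * G k j / ((rho k)^2 * (rho j)^2) <= 6 * S k j" for k j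
 proof -
  have g: "G k j <= rho j / rho (k - j) ^ 3" unfolding G_def by (intro divide_right_mono) auto
  have "(rho k)^2 * G k j / ((rho k)^2 * rho j) <= (rho k)^2 * (rho j / rho (k - j) ^ 3) / ((rho k)^2 * rho j)"
   by (intro divide_right_mono mult_left_mono g) auto
  also have "... <= S k j" unfolding S_def by (rule we(4))
  finally show "(rho k)^2 * G k j / ((rho k)^2 * rho j) <= 2 * S k j" using S0[of k j] by linarith
  have "(rho k)^2 * G k j / (rho k * (rho j)^2) <= (rho k)^2 * (rho j / rho (k - j) ^ 3) / (rho k * (rho j)^2)"
   by (intro divide_right_mono mult_left_mono g) auto
  also have "... <= 2 * S k j" unfolding S_def by (rule we(5))
  finally show "(rho k)^2 * G k j / (rho k * (rho j)^2) <= 2 * S k j" .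
  show "\<bar>(rho k)^2 - (rho j)^2\<bar> * G k j / (rho k * rho j) <= 2 * S k j" unfolding G_def S_def by (rule we(6))
  show "\<bar>rho k ^ 4 - rho j ^ 4\<bar> * G k j / ((rho k)^2 * (rho j)^2) <= 6 * S k j" unfolding G_def S_def by (rule we(7))
 qed
 \<comment> \<open>After symmetrization the transport part is at most 6 and the lower order part, a
   sum of two entries, at most 8 times the master weight.\<close>
 have comb: "(4 * c0 * am v (k - j) * t + ?M * am v (k - j) * r) / d <= (24 * c0 + 8 * ?M) * (am v (k - j) * S k j)"
  if "t / d <= 6 * S k j" "r / d <= 8 * S k j" for t r d k j
 proof -
  have "(4 * c0 * am v (k - j) * t + ?M * am v (k - j) * r) / d = (4 * c0 * am v (k - j)) * (t / d) + (?M * am v (k - j)) * (r / d)"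
   by (simp add: add_divide_distrib)
  also have "... <= (4 * c0 * am v (k - j)) * (6 * S k j) + (?M * am v (k - j)) * (8 * S k j)"
   using that N[of "k - j"] M a1_pos by (intro add_mono mult_left_mono) auto
  also have "... = (24 * c0 + 8 * ?M) * (am v (k - j) * S k j)" by (simp add: algebra_simps)
  finally show ?thesis .
 qed
 have K1: "norm (?K k j) <= 4 * c0 * am v (k - j) * ((rho k)^2 * G k j) + ?M * am v (k - j) * F k j" for k j
 proof -
  have "norm (?K k j) <= (rho k)^2 * norm (cn (Kc v) k j) + norm (RR nu a2 be v k j)"
   unfolding KK_def by (rule order_trans[OF norm_triangle_ineq]) (simp add: norm_mult norm_power)
  also have "... <= (rho k)^2 * (4 * c0 * am v (k - j) * G k j) + ?M * am v (k - j) * F k j"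
   by (intro add_mono mult_left_mono Tb Rb) simp
  finally show ?thesis by (simp only: mult_ac)
 qed
 have S8: "4 * S k j <= 8 * S k j" "2 * S k j <= 6 * S k j" for k j using S0[of k j] by auto
 show "sch (CK nu a2 be A) (%k j. norm (?K k j) / ((rho k)^2 * rho j))"
 proof (rule fin)
  fix k j
  have "norm (?K k j) / ((rho k)^2 * rho j) <= (4 * c0 * am v (k - j) * ((rho k)^2 * G k j) + ?M * am v (k - j) * F k j) / ((rho k)^2 * rho j)"
   by (intro divide_right_mono K1) auto
  also have "... <= (24 * c0 + 8 * ?M) * (am v (k - j) * S k j)"
   by (rule comb[OF order_trans[OF Tg(1) S8(2)] order_trans[OF R(1) S8(1)]])
  finally show "norm (?K k j) / ((rho k)^2 * rho j) <= (24 * c0 + 8 * ?M) * (am v (k - j) * S k j)" .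
 qed
 show "sch (CK nu a2 be A) (%k j. norm (?K k j) / (rho k * (rho j)^2))"
 proof (rule fin)
  fix k j
  have "norm (?K k j) / (rho k * (rho j)^2) <= (4 * c0 * am v (k - j) * ((rho k)^2 * G k j) + ?M * am v (k - j) * F k j) / (rho k * (rho j)^2)"
   by (intro divide_right_mono K1) auto
  also have "... <= (24 * c0 + 8 * ?M) * (am v (k - j) * S k j)"
  proof (rule comb[OF order_trans[OF Tg(2) S8(2)] order_trans[OF _ S8(1)]])
   have F0: "0 <= F k j" unfolding F_def by simp
   have "F k j / (rho k * (rho j)^2) <= F k j / (1 * (rho j)^2)"
    by (intro divide_left_mono mult_right_mono F0) (auto simp: rho_ge1)
   then show "F k j / (rho k * (rho j)^2) <= 4 * S k j" using R(3)[of k j] by simp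
  qed
  finally show "norm (?K k j) / (rho k * (rho j)^2) <= (24 * c0 + 8 * ?M) * (am v (k - j) * S k j)" .
 qed
 have anti: "cnj (cn (Kc v) j k) = - cn (Kc v) k j" for j k by (rule Kc_antisym[OF vs])
 show "sch (CK nu a2 be A) (%k j. norm (?K k j + cnj (?K j k)) / (rho k * rho j))"
 proof (rule fin)
  fix k j
  have "?K k j + cnj (?K j k) = cor ((rho k)^2 - (rho j)^2) * cn (Kc v) k j + (RR nu a2 be v k j + cnj (RR nu a2 be v j k))"
   unfolding KK_def by (simp add: anti algebra_simps)
  then have "norm (?K k j + cnj (?K j k)) <= norm (cor ((rho k)^2 - (rho j)^2) * cn (Kc v) k j) + (norm (RR nu a2 be v k j) + norm (cnj (RR nu a2 be v j k)))"
   by (metis norm_triangle_le add_left_mono norm_triangle_ineq)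
  also have "... <= \<bar>(rho k)^2 - (rho j)^2\<bar> * (4 * c0 * am v (k - j) * G k j) + (?M * am v (k - j) * F k j + ?M * am v (k - j) * F j k)"
   using Rb[of k j] Rb[of j k] unfolding norm_mult norm_of_real complex_mod_cnj amsym[of j k] by (intro add_mono mult_left_mono Tb) auto
  also have "... = 4 * c0 * am v (k - j) * (\<bar>(rho k)^2 - (rho j)^2\<bar> * G k j) + ?M * am v (k - j) * (F k j + F j k)"
   by (simp add: algebra_simps)
  finally have "norm (?K k j + cnj (?K j k)) / (rho k * rho j) <= (4 * c0 * am v (k - j) * (\<bar>(rho k)^2 - (rho j)^2\<bar> * G k j) + ?M * am v (k - j) * (F k j + F j k)) / (rho k * rho j)"
   by (intro divide_right_mono) auto
  also have "... <= (24 * c0 + 8 * ?M) * (am v (k - j) * S k j)"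
  proof (rule comb[OF order_trans[OF Tg(3) S8(2)]])
   show "(F k j + F j k) / (rho k * rho j) <= 8 * S k j"
    using R(2)[of k j] R(2)[of j k] unfolding Ssym[of k j] by (simp add: add_divide_distrib mult.commute)
  qed
  finally show "norm (?K k j + cnj (?K j k)) / (rho k * rho j) <= (24 * c0 + 8 * ?M) * (am v (k - j) * S k j)" .
 qed
 show "sch (CK nu a2 be A) (%k j. norm ((rho k)^2 * ?K k j + cnj ((rho j)^2 * ?K j k)) / ((rho k)^2 * (rho j)^2))"
 proof (rule fin)
  fix k j
  have "(rho k)^2 * ?K k j + cnj ((rho j)^2 * ?K j k) = cor (rho k ^ 4 - rho j ^ 4) * cn (Kc v) k j + (cor ((rho k)^2) * RR nu a2 be v k j + cor ((rho j)^2) * cnj (RR nu a2 be v j k))"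
   unfolding KK_def by (simp add: anti algebra_simps power2_eq_square power4_eq_xxxx)
  then have "norm ((rho k)^2 * ?K k j + cnj ((rho j)^2 * ?K j k)) <= norm (cor (rho k ^ 4 - rho j ^ 4) * cn (Kc v) k j) + (norm (cor ((rho k)^2) * RR nu a2 be v k j) + norm (cor ((rho j)^2) * cnj (RR nu a2 be v j k)))"
   by (metis norm_triangle_le add_left_mono norm_triangle_ineq)
  also have "... <= \<bar>rho k ^ 4 - rho j ^ 4\<bar> * (4 * c0 * am v (k - j) * G k j) + ((rho k)^2 * (?M * am v (k - j) * F k j) + (rho j)^2 * (?M * am v (k - j) * F j k))"
   using Rb[of k j] Rb[of j k] unfolding norm_mult norm_of_real complex_mod_cnj amsym[of j k] abs_power2 by (intro add_mono mult_left_mono Tb) auto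
  also have "... = 4 * c0 * am v (k - j) * (\<bar>rho k ^ 4 - rho j ^ 4\<bar> * G k j) + ?M * am v (k - j) * ((rho k)^2 * F k j + (rho j)^2 * F j k)"
   by (simp add: algebra_simps)
  finally have "norm ((rho k)^2 * ?K k j + cnj ((rho j)^2 * ?K j k)) / ((rho k)^2 * (rho j)^2) <= (4 * c0 * am v (k - j) * (\<bar>rho k ^ 4 - rho j ^ 4\<bar> * G k j) + ?M * am v (k - j) * ((rho k)^2 * F k j + (rho j)^2 * F j k)) / ((rho k)^2 * (rho j)^2)"
   by (intro divide_right_mono) auto
  also have "... <= (24 * c0 + 8 * ?M) * (am v (k - j) * S k j)"
  proof (rule comb[OF Tg(4)])
   have "((rho k)^2 * F k j + (rho j)^2 * F j k) / ((rho k)^2 * (rho j)^2) = F k j / (rho j)^2 + F j k / (rho k)^2"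
    by (simp add: add_divide_distrib)
   then show "((rho k)^2 * F k j + (rho j)^2 * F j k) / ((rho k)^2 * (rho j)^2) <= 8 * S k j"
    using R(3)[of k j] R(3)[of j k] unfolding Ssym[of k j] by simp
  qed
  finally show "norm ((rho k)^2 * ?K k j + cnj ((rho j)^2 * ?K j k)) / ((rho k)^2 * (rho j)^2) <= (24 * c0 + 8 * ?M) * (am v (k - j) * S k j)" .
 qed
qed

text \<open>The operator maps real fields to real fields. This later makes the limit sequence
  Hermitian, so that it belongs to a real field.\<close>

lemma KK_herm: "KK nu a2 be v (- k) (- j) = cnj (KK nu a2 be v k j)"
proof -
 have d: "- k - - j = - (k - j)" by simp
 have I: "ik (- m) i = cnj (ik m i)" for m i by (simp add: ik_uminus ik_cnj)
 have U: "Uc v i (- m) = cnj (Uc v i m)" for i m by (simp add: Uc_def Vc_uminus)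
 have G: "GA v a b (- m) = cnj (GA v a b m)" for a b m by (simp add: GA_def Vc_uminus I)
 have P: "PA (- m) a b = cnj (PA m a b)" for a b m by (simp add: PA_def nv_uminus I)
 have c: "cn (Kc v) (- k) (- j) = cnj (cn (Kc v) k j)" "cn (K2 v) (- k) (- j) = cnj (cn (K2 v) k j)"
  "cn (K3 v) (- k) (- j) = cnj (cn (K3 v) k j)" "cn (K4 v) (- k) (- j) = cnj (cn (K4 v) k j)"
  "cn (K5 v) (- k) (- j) = cnj (cn (K5 v) k j)" "cn (K6 v) (- k) (- j) = cnj (cn (K6 v) k j)"
  "cn (K7 v) (- k) (- j) = cnj (cn (K7 v) k j)"
  unfolding cn_def Kc_def K2_def K3_def K4_def K5_def K6_def K7_def d U G P Vc_uminus HH_uminus I nv_uminus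
  by (simp_all only: cnj_sum complex_cnj_mult complex_cnj_add)
 show ?thesis unfolding KK_def RR_def c by (auto simp: freq_simps)
qed

end

section \<open>Test functions in time and the du Bois-Reymond lemma\<close>

text \<open>The classical flat function \<open>exp (- 1 / x)\<close>, with a polynomial in
  \<open>1 / x\<close> as a factor so that the class is closed under differentiation.\<close>

definition flat :: "real poly => real => real" where
 "flat P x = (if x > 0 then poly P (1 / x) * exp (- (1 / x)) else 0)"

lemma poly_exp_tendsto: "((%y. poly P y * exp (- y)) \<longlongrightarrow> 0) at_top" for P :: "real poly"
proof -
 have "((%y::real. SUM i<=degree P. coeff P i * (y ^ i / exp y)) \<longlongrightarrow> (SUM i<=degree P. coeff P i * 0)) at_top"
  by (intro tendsto_sum tendsto_mult tendsto_const tendsto_power_div_exp_0)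
 moreover have "(%y. SUM i<=degree P. coeff P i * (y ^ i / exp y)) = (%y. poly P y * exp (- y))"
  by (simp add: poly_altdef exp_minus sum_distrib_right divide_inverse mult.assoc)
 ultimately show ?thesis by simp
qed

lemma flat_tendsto: "(flat P \<longlongrightarrow> 0) (at_right 0)"
proof -
 have "((%x. poly P (inverse x) * exp (- inverse x)) \<longlongrightarrow> 0) (at_right 0)"
  using filterlim_compose[OF poly_exp_tendsto filterlim_inverse_at_top_right] .
 then show ?thesis
  by (rule Lim_transform_eventually) (auto simp: flat_def eventually_at_right_field inverse_eq_divide intro!: exI[of _ 1])
qed

text \<open>\<open>[:0, 0, 1:]\<close> is the square of the variable and comes from the inner
  derivative of \<open>1 / x\<close>. At 0 the difference quotient is again flat, with polynomial
  \<open>[:0, 1:] * P\<close>.\<close>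

lemma flat_deriv: "(flat P has_real_derivative flat ([:0, 0, 1:] * (P - pderiv P)) x) (at x)"
proof -
 consider "x > 0" | "x < 0" | "x = 0" by linarith
 then show ?thesis
 proof cases
  case 1
  have "((%x. poly P (1 / x) * exp (- (1 / x))) has_real_derivative flat ([:0, 0, 1:] * (P - pderiv P)) x) (at x)"
   using 1 by (auto intro!: derivative_eq_intros DERIV_chain2[OF poly_DERIV] simp: flat_def field_simps power2_eq_square)
  then show ?thesis
   by (rule has_field_derivative_transform_within_open[where S = "{0<..}"]) (use 1 in "auto simp: flat_def")
 next
  case 2
  have "((%x. 0) has_real_derivative flat ([:0, 0, 1:] * (P - pderiv P)) x) (at x)" using 2 by (simp add: flat_def)
  then show ?thesis
   by (rule has_field_derivative_transform_within_open[where S = "{..<0}"]) (use 2 in "auto simp: flat_def")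
 next
  case 3
  have "((%h. flat P h / h) \<longlongrightarrow> 0) (at 0)" unfolding filterlim_at_split
  proof
   show "((%h. flat P h / h) \<longlongrightarrow> 0) (at_left 0)"
    by (rule Lim_transform_eventually[OF tendsto_const])
     (auto simp: flat_def eventually_at_left_field intro!: exI[of _ "-1"])
   show "((%h. flat P h / h) \<longlongrightarrow> 0) (at_right 0)"
    by (rule Lim_transform_eventually[OF flat_tendsto[of "[:0, 1:] * P"]])
     (auto simp: flat_def eventually_at_right_field intro!: exI[of _ 1])
  qed
  then show ?thesis unfolding 3 by (simp add: DERIV_def flat_def)
 qed
qed

text \<open>Products of a function flat to the left of \<open>a\<close> and one flat to the right of
  \<open>b\<close>. Sums are included because the product rule produces them.\<close>

inductive_set bumps :: "(real => real) set" where
 prod: "(%x. c * (flat P (x - a) * flat Q (b - x))) : bumps"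
| add: "f : bumps ==> g : bumps ==> (%x. f x + g x) : bumps"

lemma bumps_deriv: "f : bumps ==> EX f':bumps. ALL x. (f has_real_derivative f' x) (at x)"
proof (induction rule: bumps.induct)
 case (prod c P a Q b)
 let ?D = "%P. [:0, 0, 1:] * (P - pderiv P) :: real poly"
 have 1: "((%x. flat P (x - a)) has_real_derivative flat (?D P) (x - a)) (at x)" for x
  using DERIV_chain2[where f = "flat P" and g = "%x. x - a", OF flat_deriv DERIV_diff[OF DERIV_ident DERIV_const]] by simp
 have 2: "((%x. flat Q (b - x)) has_real_derivative - flat (?D Q) (b - x)) (at x)" for x
  using DERIV_chain2[where f = "flat Q" and g = "%x. b - x", OF flat_deriv DERIV_diff[OF DERIV_const DERIV_ident]] by simp
 show ?case
  by (rule bexI[OF _ bumps.add[OF bumps.prod[of c "?D P" a Q b] bumps.prod[of "- c" P a "?D Q" b]]])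
   (intro allI DERIV_cong[OF DERIV_cmult[OF DERIV_mult[OF 1 2]]], simp only: algebra_simps)
next
 case (add f g)
 then obtain f' g' where "f' : bumps" "g' : bumps" "ALL x. (f has_real_derivative f' x) (at x)" "ALL x. (g has_real_derivative g' x) (at x)"
  by blast
 then show ?case by (intro bexI[of _ "%x. f' x + g' x"] bumps.add) (auto intro: DERIV_add)
qed

definition smooth_fun :: "(real => real) => bool" where
 "smooth_fun f \<longleftrightarrow> (ALL n x. (deriv ^^ n) f differentiable (at x))"

lemma smooth_fun_coinduct:
 assumes f: "f : C" and C: "!!h. h : C ==> EX h':C. ALL x. (h has_real_derivative h' x) (at x)"
 shows "smooth_fun f"
proof -
 have "(deriv ^^ n) f : C" for n
 proof (induction n)
  case (Suc n)
  then obtain h' where h: "h' : C" "ALL x. ((deriv ^^ n) f has_real_derivative h' x) (at x)" using C by blast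
  then have "deriv ((deriv ^^ n) f) = h'" using DERIV_imp_deriv by blast
  then show ?case using h by simp
 qed (simp add: f)
 then show ?thesis unfolding smooth_fun_def using C by (meson real_differentiable_def)
qed

lemma smooth_fun_deriv:
 assumes "smooth_fun f"
 shows "(f has_real_derivative deriv f x) (at x)" "continuous_on A (deriv f)" "continuous_on A f"
proof -
 have d: "f differentiable (at x)" "deriv f differentiable (at x)" for x
  using assms[unfolded smooth_fun_def, rule_format, of 0 x] assms[unfolded smooth_fun_def, rule_format, of 1 x] by auto
 show "(f has_real_derivative deriv f x) (at x)" using d(1) DERIV_deriv_iff_real_differentiable by blast
 show "continuous_on A (deriv f)" "continuous_on A f"
  by (intro continuous_at_imp_continuous_on ballI differentiable_imp_continuous_within d)+
qed

lemma itail_of_real: "itail T (%s. cor (f s)) t = cor (itail T f t)"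
 unfolding itail_def by (rule integral_complex_of_real)

definition test_fun :: "real => (real => real) => bool" where
 "test_fun T psi \<longleftrightarrow> smooth_fun psi & (EX a b. 0 < a & b < T & (ALL t. t ~: {a..b} --> psi t = 0))"

lemma test_fun_parts:
 fixes y :: "real => complex"
 assumes T: "0 < T" and y: "integrable (iv T) y" and psi: "test_fun T psi"
 shows "itail T (%t. cor (deriv psi t) * itail T y t) 0 = itail T (%t. cor (psi t) * y t) 0"
proof -
 have s: "smooth_fun psi" and e: "psi 0 = 0" "psi T = 0" using psi by (auto simp: test_fun_def)
 note d = smooth_fun_deriv[OF s]
 have I: "integrable (iv T) (deriv psi)" by (rule integrable_continuous_on[OF d(2)])
 have f: "itail T (deriv psi) t = - psi t" if "t : {0..T}" for t
 proof -
  have "(deriv psi has_integral psi T - psi t) {t..T}"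
   using that d(1) by (intro fundamental_theorem_of_calculus)
    (auto simp: has_real_derivative_iff_has_vector_derivative[symmetric] intro: has_field_derivative_at_within)
  then show ?thesis using that e itail_eq_integral[OF I, of t] by (simp add: integral_unique)
 qed
 have "itail T (%s. cor (deriv psi s)) 0 * itail T y 0 = itail T (%s. cor (deriv psi s) * itail T y s) 0
   + itail T (%s. itail T (%s. cor (deriv psi s)) s * y s) 0"
  by (rule itail_parts[OF _ y]) (use I in auto)
 moreover have "itail T (%s. itail T (%s. cor (deriv psi s)) s * y s) 0 = itail T (%s. (-1) * (cor (psi s) * y s)) 0"
  by (rule itail_cong) (simp add: itail_of_real f)
 moreover have "itail T (%s. cor (deriv psi s)) 0 = 0" unfolding itail_of_real using f[of 0] T e by simp
 ultimately show ?thesis unfolding itail_cmul by simp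
qed

lemma bump_exists:
 assumes d: "0 < e" "0 <= x - e" "x + e <= T"
 obtains f where "f : bumps" "!!t. 0 <= f t" "!!t. \<bar>t - x\<bar> >= e ==> f t = 0" "integral {0..T} f > 0" "continuous_on UNIV f"
proof -
 define f where "f = (%t. 1 * (flat 1 (t - (x - e)) * flat 1 ((x + e) - t)))"
 have b: "f : bumps" unfolding f_def by (rule bumps.prod)
 have 0: "0 <= f t" for t by (simp add: f_def flat_def)
 have c: "continuous_on A f" for A using bumps_deriv[OF b] by (meson DERIV_isCont continuous_at_imp_continuous_on)
 have x: "f x > 0" using d by (simp add: f_def flat_def)
 have "integral {0..T} f ~= 0"
 proof
  assume "integral {0..T} f = 0"
  then have "(f has_integral 0) (cbox 0 T)"
   using integrable_integral[OF integrable_continuous_interval[OF c[of "{0..T}"]]] by (simp add: cbox_interval)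
  then have "f x = 0" by (rule has_integral_0_cbox_imp_0[rotated 2]) (use 0 c d in auto)
  then show False using x by simp
 qed
 moreover have "0 <= integral {0..T} f" by (rule integral_nonneg[OF integrable_continuous_interval[OF c]]) (rule 0)
 ultimately show ?thesis using that[OF b 0 _ _ c] by (auto simp: f_def flat_def abs_if split: if_splits)
qed

text \<open>Zero mean is what makes the primitive vanish again to the right of the support, so that
  it is a test function.\<close>

lemma bump_antiderivative:
 assumes f: "f : bumps" and lo: "0 < lo" "lo <= hi" "hi < T" and z: "!!t. t ~: {lo..hi} ==> f t = 0" and i: "integral {0..T} f = 0"
 obtains psi where "test_fun T psi" "deriv psi = f"
proof -
 define psi where "psi t = integral {0..t} f" for t
 have c: "continuous_on A f" for A using bumps_deriv[OF f] by (meson DERIV_isCont continuous_at_imp_continuous_on)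
 have I: "f integrable_on {a..b}" for a b by (rule integrable_continuous_interval[OF c])
 have z0: "integral {a..b} f = 0" if "!!t. t : {a..b} ==> t ~: {lo..hi}" for a b
  using Henstock_Kurzweil_Integration.integral_cong[of "{a..b}" f "%_. 0"] that z by simp
 have lo0: "psi t = 0" if "t < lo" for t unfolding psi_def using that by (intro z0) auto
 have d: "(psi has_real_derivative f t) (at t)" for t
 proof (cases "t < lo")
  case True
  have "((%t. 0) has_real_derivative f t) (at t)" using z[of t] True by auto
  then show ?thesis by (rule has_field_derivative_transform_within_open[where S = "{..<lo}"]) (use True lo0 in auto)
 next
  case False
  then have t: "0 < t" using lo by simp
  have "(psi has_real_derivative f t) (at t within {0..t + 1})"
   unfolding psi_def by (rule integral_has_real_derivative[OF c]) (use t in auto)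
  moreover have "at t within {0..t + 1} = at t" by (rule at_within_interior) (use t in auto)
  ultimately show ?thesis by simp
 qed
 have hi0: "psi t = 0" if "hi < t" for t
 proof -
  show ?thesis
  proof (cases "t <= T")
   case True
   have "psi t + integral {t..T} f = 0" unfolding psi_def
    using Henstock_Kurzweil_Integration.integral_combine[of 0 t T f, OF _ _ I] i True lo that by auto
   then show ?thesis using z0[of t T] that by auto
  next
   case False
   have "integral {0..T} f + integral {T..t} f = psi t" unfolding psi_def
    using Henstock_Kurzweil_Integration.integral_combine[of 0 T t f, OF _ _ I] False lo by auto
   then show ?thesis using z0[of T t] lo(3) i by auto
  qed
 qed
 have S: "smooth_fun psi"
  by (rule smooth_fun_coinduct[of _ "insert psi bumps"]) (use d f bumps_deriv in blast)+
 have "test_fun T psi" unfolding test_fun_def 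
  by (rule conjI[OF S], rule exI[of _ lo], rule exI[of _ hi]) (use lo lo0 hi0 in "auto simp: not_le")
 then show ?thesis by (rule that) (use d DERIV_imp_deriv in blast)
qed

text \<open>The sum of \<open>Phi\<close> and the tail integral of \<open>Tht\<close> pairs to 0
  with the derivative of every test function. If it took two values in the open interval, two bumps
  of balanced mass around these points would detect the difference.\<close>

theorem du_bois_reymond:
 fixes Phi Tht :: "real => real"
 assumes T: "0 < T" and c: "continuous_on {0..T} Phi" and I: "integrable (iv T) Tht"
  and w: "!!psi. test_fun T psi ==> (LINT t|iv T. deriv psi t * Phi t) = - (LINT t|iv T. psi t * Tht t)"
  and t: "t : {0..T}"
 shows "Phi t = Phi T - itail T Tht t"
proof -
 define Psi where "Psi t = Phi t + itail T Tht t" for t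
 have ct: "continuous_on {0..T} (itail T Tht)" by (rule itail_continuous[OF I])
 have cPsi: "continuous_on {0..T} Psi" unfolding Psi_def by (intro continuous_intros c ct)
 have 0: "integral {0..T} (%t. deriv psi t * Psi t) = 0" if psi: "test_fun T psi" for psi
 proof -
  have cd: "continuous_on {0..T} (deriv psi)" using psi smooth_fun_deriv(2) by (auto simp: test_fun_def)
  have i: "integrable (iv T) (%t. deriv psi t * Phi t)" "integrable (iv T) (%t. deriv psi t * itail T Tht t)"
   by (intro integrable_continuous_on continuous_intros cd c ct)+
  have "cor (itail T (%t. deriv psi t * itail T Tht t) 0) = cor (itail T (%t. psi t * Tht t) 0)"
   using test_fun_parts[OF T _ psi, of "%s. cor (Tht s)"] I unfolding itail_of_real of_real_mult[symmetric] by auto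
  then have "itail T (%t. deriv psi t * Phi t + deriv psi t * itail T Tht t) 0 = 0"
   using itail_add(1)[OF i, of 0] w[OF psi] by (simp add: itail_def)
  then show ?thesis using itail_eq_integral[OF Bochner_Integration.integrable_add[OF i], of 0] by (simp add: Psi_def distrib_left)
 qed
 have avg: "EX e>0. ALL f. (ALL t. 0 <= f t) --> (ALL t. \<bar>t - x\<bar> >= e --> f t = 0) --> continuous_on UNIV f -->
   \<bar>integral {0..T} (%t. f t * Psi t) - integral {0..T} f * Psi x\<bar> <= d * integral {0..T} f"
  if x: "x : {0..T}" and d: "d > 0" for x d
 proof -
  obtain e where e: "e > 0" "!!t. t : {0..T} ==> dist t x < e ==> dist (Psi t) (Psi x) < d"
   using cPsi x d unfolding continuous_on_iff by metis
  show ?thesis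
  proof (intro exI[of _ e] conjI e(1) allI impI)
   fix f :: "real => real" assume f: "ALL t. 0 <= f t" "ALL t. \<bar>t - x\<bar> >= e --> f t = 0" and "continuous_on UNIV f"
   then have cf: "continuous_on {0..T} f" using continuous_on_subset by blast
   have i: "(%t. f t * Psi t) integrable_on {0..T}" "(%t. f t * Psi x) integrable_on {0..T}" "(%t. d * f t) integrable_on {0..T}"
    by (intro integrable_continuous_interval continuous_intros cf cPsi)+
   have "\<bar>integral {0..T} (%t. f t * Psi t - f t * Psi x)\<bar> <= integral {0..T} (%t. d * f t)"
    unfolding real_norm_def[symmetric]
   proof (rule integral_norm_bound_integral[OF integrable_diff[OF i(1,2)] i(3)])
    fix t assume "t : {0..T}"
    then have "\<bar>Psi t - Psi x\<bar> <= d | f t = 0" using e(2)[of t] f(2) by (cases "e <= \<bar>t - x\<bar>") (auto simp: dist_real_def)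
    then have "f t * \<bar>Psi t - Psi x\<bar> <= f t * d" using f(1) by (auto intro: mult_left_mono)
    then show "norm (f t * Psi t - f t * Psi x) <= d * f t"
     unfolding right_diff_distrib[symmetric] real_norm_def abs_mult using f(1) by (simp add: mult.commute[of d])
   qed
   then show "\<bar>integral {0..T} (%t. f t * Psi t) - integral {0..T} f * Psi x\<bar> <= d * integral {0..T} f"
    using Henstock_Kurzweil_Integration.integral_diff[OF i(1,2)] by simp
  qed
 qed
 have eq: "Psi x = Psi y" if x: "x : {0<..<T}" and y: "y : {0<..<T}" for x y
 proof (rule ccontr)
  assume "Psi x ~= Psi y"
  then have d: "\<bar>Psi x - Psi y\<bar> / 3 > 0" (is "?d > 0") by simp
  obtain e1 where e1: "e1 > 0" "!!f. (ALL t. 0 <= f t) ==> (ALL t. \<bar>t - x\<bar> >= e1 --> f t = 0) ==> continuous_on UNIV f ==>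
   \<bar>integral {0..T} (%t. f t * Psi t) - integral {0..T} f * Psi x\<bar> <= ?d * integral {0..T} f" using avg[of x ?d] x d by auto
  obtain e2 where e2: "e2 > 0" "!!f. (ALL t. 0 <= f t) ==> (ALL t. \<bar>t - y\<bar> >= e2 --> f t = 0) ==> continuous_on UNIV f ==>
   \<bar>integral {0..T} (%t. f t * Psi t) - integral {0..T} f * Psi y\<bar> <= ?d * integral {0..T} f" using avg[of y ?d] y d by auto
  define e where "e = Min {e1, e2, x / 2, y / 2, (T - x) / 2, (T - y) / 2}"
  have xy: "0 < x" "x < T" "0 < y" "y < T" using x y by auto
  have e0: "0 < e" unfolding e_def by (subst Min_gr_iff) (use xy e1(1) e2(1) in auto)
  have "e <= e1" "e <= e2" "e <= x / 2" "e <= y / 2" "e <= (T - x) / 2" "e <= (T - y) / 2" unfolding e_def by (rule Min_le; simp)+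
  then have e: "0 < e" "e <= e1" "e <= e2" "e < x" "e < y" "x + e < T" "y + e < T" using xy e0 by auto
  have lh: "0 < min x y - e" "min x y - e <= max x y + e" "max x y + e < T" using e by (simp_all add: min_def max_def)
  obtain f where f: "f : bumps" "!!t. 0 <= f t" "!!t. \<bar>t - x\<bar> >= e ==> f t = 0" "integral {0..T} f > 0" "continuous_on UNIV f"
   using bump_exists[of e x T] e by auto
  obtain h where h: "h : bumps" "!!t. 0 <= h t" "!!t. \<bar>t - y\<bar> >= e ==> h t = 0" "integral {0..T} h > 0" "continuous_on UNIV h"
   using bump_exists[of e y T] e by auto
  let ?cf = "integral {0..T} f" and ?ch = "integral {0..T} h"
  \<comment> \<open>Each bump is multiplied by the mass of the other, so the difference has zero
    mean and is the derivative of a test function.\<close>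
  define k where "k = (%t. ?ch * f t + - ?cf * h t)"
  have scale: "(%t. r * u t) : bumps" if "u : bumps" for r u
   using that
  proof (induction rule: bumps.induct)
   case (prod c P a Q b) then show ?case using bumps.prod[of "r * c" P a Q b] by (simp add: mult.assoc)
  next
   case (add f g) then show ?case using bumps.add[OF add.IH] by (simp add: distrib_left)
  qed
  have kb: "k : bumps" unfolding k_def by (intro bumps.add scale f h)
  have c': "continuous_on {0..T} f" "continuous_on {0..T} h" using continuous_on_subset[OF f(5)] continuous_on_subset[OF h(5)] by auto
  have i: "(%t. ?ch * f t) integrable_on {0..T}" "(%t. - ?cf * h t) integrable_on {0..T}"
   "(%t. ?ch * (f t * Psi t)) integrable_on {0..T}" "(%t. - ?cf * (h t * Psi t)) integrable_on {0..T}"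
   by (intro integrable_continuous_interval continuous_intros c' cPsi)+
  have "integral {0..T} k = 0" unfolding k_def using Henstock_Kurzweil_Integration.integral_add[OF i(1,2)] by simp
  moreover have kz: "k t = 0" if "t ~: {min x y - e..max x y + e}" for t
   using f(3)[of t] h(3)[of t] that by (auto simp: k_def min_def max_def abs_if split: if_splits)
  ultimately obtain psi where psi: "test_fun T psi" "deriv psi = k"
   using bump_antiderivative[OF kb lh] by blast
  have "0 = integral {0..T} (%t. ?ch * (f t * Psi t) + - ?cf * (h t * Psi t))"
   using 0[OF psi(1)] unfolding psi(2) k_def by (simp add: algebra_simps)
  also have "... = ?ch * integral {0..T} (%t. f t * Psi t) - ?cf * integral {0..T} (%t. h t * Psi t)"
   using Henstock_Kurzweil_Integration.integral_add[OF i(3,4)] by simp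
  finally have E: "?ch * integral {0..T} (%t. f t * Psi t) = ?cf * integral {0..T} (%t. h t * Psi t)" by simp
  have F: "\<bar>integral {0..T} (%t. f t * Psi t) - ?cf * Psi x\<bar> <= ?d * ?cf" by (rule e1(2)) (use f e in auto)
  have H: "\<bar>integral {0..T} (%t. h t * Psi t) - ?ch * Psi y\<bar> <= ?d * ?ch" by (rule e2(2)) (use h e in auto)
  define a where "a = integral {0..T} (%t. f t * Psi t) / ?cf"
  have a1: "integral {0..T} (%t. f t * Psi t) = ?cf * a" using f(4) by (simp add: a_def)
  have "?cf * integral {0..T} (%t. h t * Psi t) = ?cf * (?ch * a)" using E unfolding a1 by algebra
  then have a2: "integral {0..T} (%t. h t * Psi t) = ?ch * a" using f(4) by (simp only: mult_cancel_left) auto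
  have "\<bar>a - Psi x\<bar> <= ?d" "\<bar>a - Psi y\<bar> <= ?d"
   using F H f(4) h(4) unfolding a1 a2 by (auto simp: right_diff_distrib[symmetric] abs_mult mult.commute[of ?d])
  moreover have "\<bar>Psi x - Psi y\<bar> <= \<bar>a - Psi x\<bar> + \<bar>a - Psi y\<bar>" by simp
  ultimately show False using d by simp
 qed
 have "Psi t = Psi (T / 2)" if "t : {0..T}" for t
 proof (rule continuous_constant_on_closure[of "{0<..<T}" Psi])
  show "continuous_on (closure {0<..<T}) Psi" "t : closure {0<..<T}" using cPsi T that by (auto simp: closure_greaterThanLessThan)
  show "Psi x = Psi (T / 2)" if "x : {0<..<T}" for x by (rule eq[OF that]) (use T in auto)
 qed
 from this[OF t] this[of T] T show ?thesis by (simp add: Psi_def)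
qed

section \<open>Measurability\<close>

lemma space_nborel: "space (nborel X) = carr X"
 unfolding nborel_def by (rule space_measure_of) auto

lemma nborel_measurableI:
 fixes f :: "'a::minus => 'b::metric_space"
 assumes c: "!!u e. u : carr X ==> e > 0 ==> EX r>0. ALL w:carr X. nrm X (w - u) < r --> dist (f w) (f u) < e"
 shows "f : borel_measurable (nborel X)"
proof (rule borel_measurableI)
 fix S :: "'b set" assume S: "open S"
 have B: "f -` S Int carr X : {U. U <= carr X & (ALL u:U. EX r>0. ALL w:carr X. nrm X (w - u) < r --> w : U)}"
 proof (intro CollectI conjI ballI)
  fix u assume u: "u : f -` S Int carr X"
  then obtain e where e: "e > 0" "!!y. dist y (f u) < e ==> y : S" using S unfolding open_dist by blast
  show "EX r>0. ALL w:carr X. nrm X (w - u) < r --> w : f -` S Int carr X" using c[of u e] u e by auto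
 qed auto
 show "f -` S Int space (nborel X) : sets (nborel X)" unfolding space_nborel unfolding nborel_def
  by (subst sets_measure_of, blast, rule sigma_sets.Basic, rule B)
qed

text \<open>By separability each open set is a countable union of balls around points of
  \<open>D\<close> with radii \<open>1 / real (Suc n)\<close>, so the distances to these points
  decide measurability.\<close>

lemma measurable_nborelI:
 fixes X :: "'a::minus nspace"
 assumes h: "!!om. om : space M ==> h om : carr X" and D: "countable D" "D <= carr X"
  and dense: "!!u e. u : carr X ==> e > 0 ==> EX d:D. nrm X (u - d) < e"
  and tri: "!!u d w. u : carr X ==> d : carr X ==> w : carr X ==> nrm X (w - u) <= nrm X (w - d) + nrm X (u - d)"
  and meas: "!!d. d : D ==> (%om. nrm X (h om - d)) : borel_measurable M"
 shows "h : measurable M (nborel X)"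
 unfolding nborel_def
proof (rule measurable_measure_of)
 show "h : space M \<rightarrow> carr X" using h by auto
 fix U assume "U : {U. U <= carr X & (ALL u:U. EX r>0. ALL w:carr X. nrm X (w - u) < r --> w : U)}"
 then have U: "!!u. u : U ==> EX r>0. ALL w:carr X. nrm X (w - u) < r --> w : U" by auto
 define I where "I = {(d, n). d : D & (ALL w:carr X. nrm X (w - d) < 1 / real (Suc n) --> w : U)}"
 have cI: "countable I" by (rule countable_subset[of _ "D \<times> UNIV"]) (use D in "auto simp: I_def")
 have "h -` U Int space M = (UN i:I. {om:space M. nrm X (h om - fst i) < 1 / real (Suc (snd i))})"
 proof (intro equalityI subsetI)
  fix om assume w: "om : h -` U Int space M"
  then obtain r where r: "r > 0" "ALL w:carr X. nrm X (w - h om) < r --> w : U" using U by blast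
  obtain n where n: "1 / real (Suc n) < r / 2" using r(1) nat_approx_posE[of "r / 2"] by auto
  obtain d where d: "d : D" "nrm X (h om - d) < 1 / real (Suc n)" using dense[of "h om" "1 / real (Suc n)"] h w by auto
  have "w : U" if "w : carr X" "nrm X (w - d) < 1 / real (Suc n)" for w
   using tri[of "h om" d w] h[of om] w d D(2) that n r(2) by force
  then have "(d, n) : I" using d by (simp add: I_def)
  then show "om : (UN i:I. {om:space M. nrm X (h om - fst i) < 1 / real (Suc (snd i))})" using w d(2) by force
 next
  fix om assume "om : (UN i:I. {om:space M. nrm X (h om - fst i) < 1 / real (Suc (snd i))})"
  then show "om : h -` U Int space M" using h by (auto simp: I_def)
 qed
 also have "... : sets M"
 proof (rule sets.countable_UN'[OF cI], safe)
  fix d n assume "(d, n) : I"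
  then have "d : D" by (simp add: I_def)
  then show "{om:space M. nrm X (h om - fst (d, n)) < 1 / real (Suc (snd (d, n)))} : sets M"
   using borel_measurable_less[OF meas borel_measurable_const] by simp
 qed
 finally show "h -` U Int space M : sets M" .
qed auto

text \<open>Riemann sums involve the integrand at fixed times only. Measurability in the random
  parameter thus passes to the integral without any joint measurability.\<close>

lemma riemann_itail:
 fixes f :: "real => complex"
 assumes c: "continuous_on {0..T} f" and t: "t : {0..T}"
 shows "(%n. SUM i<n. ((T - t) / real n) *\<^sub>R f (t + real i * ((T - t) / real n))) ----> itail T f t"
proof (rule LIMSEQ_I)
 fix e :: real assume e: "e > 0"
 define e' where "e' = e / (T - t + 1)"
 have e': "e' > 0" "e' * (T - t) < e" using t e by (auto simp: e'_def field_simps)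
 have ct: "continuous_on {t..T} f" by (rule continuous_on_subset[OF c]) (use t in auto)
 obtain d where d: "d > 0" "!!x y. x : {t..T} ==> y : {t..T} ==> dist y x < d ==> dist (f y) (f x) < e'"
  using compact_uniformly_continuous[OF ct compact_Icc] e' unfolding uniformly_continuous_on_def by metis
 obtain N :: nat where N: "N > 0" "(T - t) / real N < d"
 proof -
  obtain N :: nat where "(T - t) / d < real N" using reals_Archimedean2 by blast
  moreover from this have "N > 0" using d(1) t by (cases N) (auto simp: divide_less_0_iff)
  ultimately show ?thesis using that d(1) by (auto simp: field_simps)
 qed
 show "EX no. ALL n>=no. norm ((SUM i<n. ((T - t) / real n) *\<^sub>R f (t + real i * ((T - t) / real n))) - itail T f t) < e"
 proof (intro exI[of _ N] allI impI)
  fix n assume n: "N <= n"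
  define h where "h = (T - t) / real n"
  define x where "x i = t + real i * h" for i
  have n0: "0 < n" using N n by simp
  have "h <= (T - t) / real N" unfolding h_def using N n t by (intro divide_left_mono) auto
  then have h: "0 <= h" "h < d" using t N n0 by (auto simp: h_def)
  have xn: "x n = T" using n0 by (simp add: x_def h_def)
  have xS: "x (Suc i) = x i + h" for i by (simp add: x_def algebra_simps)
  have xr: "x i : {t..T}" if "i <= n" for i
  proof -
   have "real i * h <= real n * h" using that h by (intro mult_right_mono) auto
   then show ?thesis using xn h by (auto simp: x_def)
  qed
  have I: "f integrable_on {a..b}" if "t <= a" "b <= T" for a b
   by (rule integrable_continuous_interval[OF continuous_on_subset[OF ct]]) (use that in auto)
  have split: "m <= n ==> integral {t..x m} f = (SUM i<m. integral {x i..x (Suc i)} f)" for m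
  proof (induction m)
   case 0 then show ?case by (simp add: x_def)
  next
   case (Suc m)
   have "integral {t..x (Suc m)} f = integral {t..x m} f + integral {x m..x (Suc m)} f"
    by (rule Henstock_Kurzweil_Integration.integral_combine[symmetric]) (use xr[of m] xr[of "Suc m"] Suc h in "auto simp: xS intro!: I")
   then show ?case using Suc by simp
  qed
  have "itail T f t = integral {t..x n} f" unfolding xn using itail_eq_integral[OF integrable_continuous_on[OF c]] t by simp
  then have "norm ((SUM i<n. h *\<^sub>R f (x i)) - itail T f t) = norm (SUM i<n. h *\<^sub>R f (x i) - integral {x i..x (Suc i)} f)"
   using split[of n] by (simp add: sum_subtractf)
  also have "... <= (SUM i<n. e' * h)"
  proof (rule sum_norm_le)
   fix i assume i: "i : {..<n}"
   have xi: "x i : {t..T}" "x (Suc i) : {t..T}" using i xr[of i] xr[of "Suc i"] by simp_all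
   have "h *\<^sub>R f (x i) - integral {x i..x (Suc i)} f = integral {x i..x (Suc i)} (%s. f (x i) - f s)"
    using h xi by (subst Henstock_Kurzweil_Integration.integral_diff) (auto intro!: I simp: xS)
   also have "norm ... <= e' * (x (Suc i) - x i)"
   proof (rule integral_bound)
    show "x i <= x (Suc i)" using h by (simp add: xS)
    show "continuous_on {x i..x (Suc i)} (%s. f (x i) - f s)"
     by (intro continuous_intros continuous_on_subset[OF ct]) (use xi in auto)
    show "norm (f (x i) - f s) <= e'" if "s : {x i..x (Suc i)}" for s
     using d(2)[of s "x i"] that xi h by (auto simp: dist_norm xS)
   qed
   finally show "norm (h *\<^sub>R f (x i) - integral {x i..x (Suc i)} f) <= e' * h" by (simp add: xS)
  qed
  also have "... = e' * (T - t)" using n0 by (simp add: h_def)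
  finally show "norm ((SUM i<n. ((T - t) / real n) *\<^sub>R f (t + real i * ((T - t) / real n))) - itail T f t) < e"
   using e'(2) by (simp only: h_def x_def)
 qed
qed

lemma itail_measurable:
 fixes F :: "'w => real => complex"
 assumes c: "!!om. om : space M ==> continuous_on {0..T} (F om)" and m: "!!s. s : {0..T} ==> (%om. F om s) : borel_measurable M"
  and t: "t : {0..T}"
 shows "(%om. itail T (F om) t) : borel_measurable M"
proof (rule borel_measurable_LIMSEQ_metric[OF _ riemann_itail[OF c t]])
 fix n
 have r: "t + real i * ((T - t) / real n) : {0..T}" if "i < n" for i
 proof -
  have "real i * ((T - t) / real n) <= real n * ((T - t) / real n)" using that t by (intro mult_right_mono) auto
  then show ?thesis using that t by auto
 qed
 show "(%om. SUM i<n. ((T - t) / real n) *\<^sub>R F om (t + real i * ((T - t) / real n))) : borel_measurable M"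
  by (intro borel_measurable_sum borel_measurable_scaleR borel_measurable_const m r) auto
qed

section \<open>Reality and measurability of the Picard and Galerkin limits\<close>

context evol begin

lemma pic_lim: "t : {0..T} ==> (%i. pic T rh K g {k. (rh k)^2 <= real n} i k t) ----> gal T rh K g n k t"
 unfolding gal_def by (rule galerkin_exists(3)[OF low])

lemma gal_lim: "t : {0..T} ==> (%n. gal T rh K g n k t) ----> evs T rh K g k t"
 using gn_lim[of t k] by (simp add: gn_def ev_def)

text \<open>A symmetry of the data is inherited by each Picard iterate and so by both limits;
  \<open>sg\<close> will be the reflection of frequencies.\<close>

lemma ev_cnj:
 assumes sg: "!!k. sg (sg k) = k" "!!k. rh (sg k) = rh k" "!!s k j. s : {0..T} ==> K s (sg k) (sg j) = cnj (K s k j)"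
  "!!s k. s : {0..T} ==> g (sg k) s = cnj (g k s)" and t: "t : {0..T}"
 shows "ev (sg k) t = cnj (ev k t)"
proof -
 have p: "pic T rh K g {k. (rh k)^2 <= n} i (sg k) t = cnj (pic T rh K g {k. (rh k)^2 <= n} i k t)" if "t : {0..T}" for n i k t
  using that
 proof (induction i arbitrary: k t)
  case (Suc i)
  let ?J = "{k. (rh k)^2 <= n}" and ?p = "pic T rh K g {k. (rh k)^2 <= n} i"
  have "(SUM j:?J. K s (sg k) j * ?p j s) = cnj (SUM j:?J. K s k j * ?p j s)" if s: "s : {t..T}" for s
  proof -
   have s': "s : {0..T}" using s Suc.prems by auto
   have "(SUM j:?J. K s (sg k) j * ?p j s) = (SUM j:?J. K s (sg k) (sg j) * ?p (sg j) s)"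
    by (rule sum.reindex_bij_witness[where i = sg and j = sg]) (auto simp: sg)
   also have "... = cnj (SUM j:?J. K s k j * ?p j s)" using Suc.IH[OF s'] sg(3)[OF s'] by simp
   finally show ?thesis .
  qed
  then have "itail T (%s. SUM j:?J. K s (sg k) j * ?p j s) t = cnj (itail T (%s. SUM j:?J. K s k j * ?p j s) t)"
   unfolding itail_cnj[symmetric] by (rule itail_cong)
  moreover have "itail T (g (sg k)) t = cnj (itail T (g k) t)"
   unfolding itail_cnj[symmetric] by (rule itail_cong) (use Suc.prems sg(4) in auto)
  ultimately show ?case by (simp add: sg(2))
 qed simp
 have "gal T rh K g n (sg k) t = cnj (gal T rh K g n k t)" for n
  by (rule LIMSEQ_unique[OF pic_lim[OF t]]) (use tendsto_cnj[OF pic_lim[OF t, of n k]] in "simp add: p[OF t]")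
 then show ?thesis unfolding ev_def
  by (intro LIMSEQ_unique[OF gal_lim[OF t]]) (use tendsto_cnj[OF gal_lim[OF t, of k]] in simp)
qed

end

text \<open>The forcing enters the iteration only through its tail integrals. Measurability is
  therefore asked of these and not of its values at fixed times, which are not determined by an
  element of a Bochner space.\<close>

lemma evs_measurable:
 assumes E: "!!om. om : space M ==> evol T (C om) rh (K om) (g om) (gam om)"
  and K: "!!s k j. s : {0..T} ==> (%om. K om s k j) : borel_measurable M"
  and G: "!!s k. s : {0..T} ==> (%om. itail T (g om k) s) : borel_measurable M" and t: "t : {0..T}"
 shows "(%om. evs T rh (K om) (g om) k t) : borel_measurable M"
proof -
 have pic: "(%om. pic T rh (K om) (g om) J i k t) : borel_measurable M" if "t : {0..T}" for J i k t
  using that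
 proof (induction i arbitrary: k t)
  case (Suc i)
  have "(%om. itail T (%s. SUM j:J. K om s k j * pic T rh (K om) (g om) J i j s) t) : borel_measurable M"
  proof (rule itail_measurable[OF _ _ Suc.prems])
   show "continuous_on {0..T} (%s. SUM j:J. K om s k j * pic T rh (K om) (g om) J i j s)" if "om : space M" for om
    by (intro continuous_intros evol.Kc[OF E[OF that]] evol.pic_continuous[OF E[OF that]])
   show "(%om. SUM j:J. K om s k j * pic T rh (K om) (g om) J i j s) : borel_measurable M" if "s : {0..T}" for s
    by (intro borel_measurable_sum borel_measurable_times K Suc.IH that)
  qed
  then show ?case using G[OF Suc.prems, of k] by (cases "k : J") auto
 qed simp
 have "(%om. gal T rh (K om) (g om) n k t) : borel_measurable M" for n
  by (rule borel_measurable_LIMSEQ_metric[OF pic[OF t] evol.pic_lim[OF E t]])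
 then show ?thesis by (rule borel_measurable_LIMSEQ_metric[OF _ evol.gal_lim[OF E t]])
qed

lemma lebesgue_on_measurable_AE:
 fixes f g :: "real => 'b::euclidean_space"
 assumes f: "f : borel_measurable (lebesgue_on {a..b})" and e: "AE t in lebesgue_on {a..b}. f t = g t"
 shows "g : borel_measurable (lebesgue_on {a..b})"
proof -
 have "(%x. if x : {a..b} then f x else 0) : borel_measurable lebesgue" using f by (subst borel_measurable_if) auto
 moreover have "AE x in lebesgue. (if x : {a..b} then f x else 0) = (if x : {a..b} then g x else 0)"
  using e by (auto simp: AE_restrict_space_iff)
 ultimately have "(%x. if x : {a..b} then g x else 0) : borel_measurable lebesgue" by (rule borel_measurable_AE)
 then show ?thesis by (subst (asm) borel_measurable_if) auto
qed

section \<open>Norms, continuity and measurability through scalar coefficients\<close>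

context helm begin

lemma pr_diff:
 "(!!i. integrable tor (cp u i)) ==> (!!i. integrable tor (cp w i)) ==> pr (u - w) k = pr u k - pr w k" for u w :: field
 unfolding pr_def by (simp add: fc_diff left_diff_distrib sum_subtractf)

lemma solen_diff:
 "(!!i. integrable tor (cp u i)) ==> (!!i. integrable tor (cp w i)) ==> solen u ==> solen w ==> solen (u - w)" for u w :: field
 unfolding solen_def by (simp add: fc_diff right_diff_distrib sum_subtractf)

lemma fsb_int: "fsb s A u ==> integrable tor (cp u i)"
 unfolding fsb_def using hsb_int by blast

lemma DA_D:
 assumes "u : carr (DS s)" "1 <= s"
 shows "fsb s (c1 ^ s * nrm (Hdot L (real s)) u) u" "solen u"
 using assms Hdot_fsb by (auto simp: DA_iff)

lemma DA_I: "fsb s A u ==> solen u ==> 1 <= s ==> u : carr (DS s)"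
 using fsb_Hdot(1) by (auto simp: DA_iff)

lemma DA_diff:
 assumes "u : carr (DS s)" "w : carr (DS s)" "1 <= s"
 shows "u - w : carr (DS s)" "pr (u - w) k = pr u k - pr w k"
proof -
 note u = DA_D[OF assms(1,3)] and w = DA_D[OF assms(2,3)]
 show "u - w : carr (DS s)"
  by (rule DA_I[OF fsb_diff[OF u(1) w(1)] solen_diff[OF fsb_int[OF u(1)] fsb_int[OF w(1)] u(2) w(2)] assms(3)])
 show "pr (u - w) k = pr u k - pr w k" by (rule pr_diff[OF fsb_int[OF u(1)] fsb_int[OF w(1)]])
qed

lemma nrm_DA: "nrm (DA L s) = nrm (Hdot L s)" by (simp add: DA_def)

lemma Vsp_DA: "Vsp L = DA L (real 1)"
 by (rule prod_eqI) (use Vsp_iff DA_iff[of 1] in "auto simp: nrm_DA Vsp_def")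

lemma nrm_Hdot_nonneg: "0 <= nrm (Hdot L s) u"
 by (auto simp: Hdot_def intro!: infsum_nonneg)

lemma nrm_DA_has_sum:
 assumes u: "u : carr (DS s)" and s: "1 <= s"
 shows "((%k. (norm (freq k) ^ s * norm (pr u k))^2) has_sum (nrm (DS s) u)^2) UNIV"
proof -
 let ?f = "%k. norm (freq k) powr (2 * real s) * (norm (fourier L u k))^2"
 note d = DA_D[OF u s]
 have S: "?f summable_on UNIV" using fsb_Hdot(1)[OF d(1)] by (simp add: Hdot_def)
 have "(?f has_sum (nrm (DS s) u)^2) UNIV"
  using has_sum_infsum[OF S] infsum_nonneg[of UNIV ?f] by (simp add: nrm_DA Hdot_def)
 moreover have "?f = (%k. (norm (freq k) ^ s * norm (pr u k))^2)"
 proof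
  fix k
  have f: "fc (cp u i) k = pr u k * nv k i" for i using d by (intro fc_pr) (auto simp: fsb_def)
  have "cor (SUM i:UNIV. (norm (nv k i))^2) = (SUM i:UNIV. nv k i * cnj (nv k i))"
   by (simp only: of_real_sum complex_norm_square)
  then have "(SUM i:UNIV. (norm (nv k i))^2) = 1" if "k ~= 0" unfolding nv_norm1 using that by (metis of_real_eq_1_iff)
  then have "(norm (fourier L u k))^2 = (norm (pr u k))^2" if "k ~= 0"
   unfolding norm_fourier_sq f norm_mult power_mult_distrib sum_distrib_left[symmetric] using that by simp
  then show "?f k = (norm (freq k) ^ s * norm (pr u k))^2" unfolding freq_powr by (simp add: power_mult_distrib)
 qed
 ultimately show ?thesis by simp
qed

lemma l2b_nrm_DA:
 assumes u: "u : carr (DS s)" and s: "1 <= s"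
 shows "l2b (nrm (DS s) u) (%k. norm (freq k) ^ s * norm (pr u k))"
proof -
 have "l2b (sqrt ((nrm (DS s) u)^2)) (%k. norm (freq k) ^ s * norm (pr u k))"
  by (rule l2b_I) (rule finite_sum_le_has_sum[OF nrm_DA_has_sum[OF u s]], auto)
 then show ?thesis using nrm_Hdot_nonneg by (simp add: nrm_DA)
qed

lemma nrm_DA_le:
 assumes u: "u : carr (DS s)" and s: "1 <= s" and b: "l2b B (%k. norm (freq k) ^ s * norm (pr u k))"
 shows "nrm (DS s) u <= B"
proof (rule power2_le_imp_le[OF _ l2b_nonneg[OF b]])
 show "(nrm (DS s) u)^2 <= B^2"
  by (rule has_sum_le_finite_sums[OF nrm_DA_has_sum[OF u s]]) (rule l2b_sum_sq[OF b])
qed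

lemma pr_DA_measurable:
 assumes s: "1 <= s" shows "(%u. pr u k) : borel_measurable (nborel (DS s))"
proof (cases "k = 0")
 case False
 then have f: "0 < norm (freq k) ^ s" by (simp add: freq_eq_0)
 show ?thesis
 proof (rule nborel_measurableI)
  fix u and e :: real assume u: "u : carr (DS s)" and e: "e > 0"
  show "EX r>0. ALL w:carr (DS s). nrm (DS s) (w - u) < r --> dist (pr w k) (pr u k) < e"
  proof (intro exI[of _ "e * norm (freq k) ^ s"] conjI ballI impI)
   fix w assume w: "w : carr (DS s)" "nrm (DS s) (w - u) < e * norm (freq k) ^ s"
   have "norm (freq k) ^ s * norm (pr (w - u) k) <= nrm (DS s) (w - u)"
    using l2b_point[OF l2b_nrm_DA[OF DA_diff(1)[OF w(1) u s] s], of k] by simp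
   then have "norm (freq k) ^ s * norm (pr (w - u) k) < norm (freq k) ^ s * e" using w(2) by (simp add: mult.commute)
   then show "dist (pr w k) (pr u k) < e" using f by (simp add: DA_diff(2)[OF w(1) u s] dist_norm)
  qed (use e f in auto)
 qed
qed simp

lemma DA_triangle:
 assumes "u : carr (DS s)" "d : carr (DS s)" "w : carr (DS s)" and s: "1 <= s"
 shows "nrm (DS s) (w - u) <= nrm (DS s) (w - d) + nrm (DS s) (u - d)"
proof (rule nrm_DA_le[OF DA_diff(1) s])
 note D = DA_diff(1)[OF _ _ s]
 show "l2b (nrm (DS s) (w - d) + nrm (DS s) (u - d)) (%k. norm (freq k) ^ s * norm (pr (w - u) k))"
 proof (rule l2b_mono_abs[OF l2b_add[OF l2b_nrm_DA[OF D s] l2b_nrm_DA[OF D s]]])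
  fix k
  have "norm (pr (w - u) k) <= norm (pr (w - d) k) + norm (pr (u - d) k)"
   using norm_triangle_ineq4[of "pr w k - pr d k" "pr u k - pr d k"] assms by (simp add: DA_diff(2)[OF _ _ s])
  then have "norm (freq k) ^ s * norm (pr (w - u) k) <= norm (freq k) ^ s * (norm (pr (w - d) k) + norm (pr (u - d) k))"
   by (rule mult_left_mono) simp
  then show "\<bar>norm (freq k) ^ s * norm (pr (w - u) k)\<bar> <= \<bar>norm (freq k) ^ s * norm (pr (w - d) k) + norm (freq k) ^ s * norm (pr (u - d) k)\<bar>"
   by (simp add: distrib_left)
 qed (use assms in auto)
qed (use assms in auto)

definition cq :: "complex set" where "cq = (%(p, q). Complex p q) ` (\<rat> \<times> \<rat>)"

lemma cq_dense: "e > 0 ==> EX a:cq. norm (a - z) < e"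
proof -
 assume e: "e > 0"
 obtain p q where p: "p : \<rat>" "\<bar>p - Re z\<bar> < e / 2" and q: "q : \<rat>" "\<bar>q - Im z\<bar> < e / 2"
 proof -
  obtain p where "p : \<rat>" "Re z < p" "p < Re z + e / 2" using Rats_dense_in_real[of "Re z" "Re z + e / 2"] e by auto
  moreover obtain q where "q : \<rat>" "Im z < q" "q < Im z + e / 2" using Rats_dense_in_real[of "Im z" "Im z + e / 2"] e by auto
  ultimately show ?thesis using that[of p q] by auto
 qed
 have "norm (Complex p q - z) < e" using cmod_le[of "Complex p q - z"] p q by simp
 then show ?thesis using p q by (intro bexI[of _ "Complex p q"]) (auto simp: cq_def)
qed

text \<open>Truncated and made Hermitian, so that any finite choice of complex rationals yields a
  real field. These fields form the countable dense set for
  \<open>measurable_nborelI\<close>.\<close>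

definition symm :: "nat => (int^2 => complex) => int^2 => complex" where
 "symm n a k = (if k : boxes n then (a k + cnj (a (- k))) / 2 else 0)"

lemma boxes_uminus: "- k : boxes n \<longleftrightarrow> k : boxes n" by (simp add: boxes_def)

lemma herm_symm: "herm (symm n a)"
 by (simp add: herm_def symm_def boxes_uminus add.commute)

lemma l2b_finite_support: fixes f :: "'k => real" shows "finite F ==> (!!k. k ~: F ==> f k = 0) ==> l2b (L2_set f F) f"
 unfolding l2b_def
proof (intro allI impI)
 fix G :: "'k set" assume F: "finite F" "!!k. k ~: F ==> f k = 0" "finite G"
 have "L2_set f G = L2_set f (G Int F)" unfolding L2_set_def using F by (intro arg_cong[of _ _ sqrt] sum.mono_neutral_right) auto
 also have "... <= L2_set f F" unfolding L2_set_def using F by (intro real_sqrt_le_mono sum_mono2) auto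
 finally show "L2_set f G <= L2_set f F" .
qed

lemma fld_symm:
 assumes s: "1 <= s"
 shows "fld (symm n a) : carr (DS s)" "pr (fld (symm n a)) k = (if k = 0 then 0 else symm n a k)"
proof -
 have "l2b (L2_set (%k. rho k ^ s * norm (symm n a k)) (boxes n)) (%k. rho k ^ s * norm (symm n a k))"
  by (rule l2b_finite_support[OF finite_boxes]) (simp add: symm_def)
 note f = fld[OF herm_symm this]
 show "fld (symm n a) : carr (DS s)" by (rule DA_I[OF f(2,3) s])
 show "pr (fld (symm n a)) k = (if k = 0 then 0 else symm n a k)" using f(4)[of k] by simp
qed

text \<open>Coefficients suffice: the distance to a fixed field is a limit of finite sums over
  boxes, and the fields with finitely many rational coefficients are dense.\<close>

lemma DA_measurableI:
 assumes s: "1 <= s" and h: "!!om. om : space M ==> h om : carr (DS s)"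
  and m: "!!k. (%om. pr (h om) k) : borel_measurable M"
 shows "h : measurable M (nborel (DS s))"
proof (rule measurable_nborelI[OF h])
 let ?D = "\<Union>n. (%a. fld (symm n a)) ` (PiE (boxes n) (%_. cq))"
 show "countable ?D"
  by (intro countable_UN countable_image countable_PiE finite_boxes) (auto simp: cq_def intro: countable_rat)
 show D: "?D <= carr (DS s)" using fld_symm(1)[OF s] by auto
 show "nrm (DS s) (w - u) <= nrm (DS s) (w - d) + nrm (DS s) (u - d)"
  if "u : carr (DS s)" "d : carr (DS s)" "w : carr (DS s)" for u d w by (rule DA_triangle[OF that s])
 show "(%om. nrm (DS s) (h om - d)) : borel_measurable M" if "d : ?D" for d
 proof (rule borel_measurable_LIMSEQ_real)
  have d: "d : carr (DS s)" using that D by blast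
  fix om assume w: "om : space M"
  have "(%n. sqrt (SUM k:boxes n. (norm (freq k) ^ s * norm (pr (h om - d) k))^2)) ----> sqrt ((nrm (DS s) (h om - d))^2)"
   by (intro tendsto_real_sqrt has_sum_boxes nrm_DA_has_sum DA_diff h w d s)
  then show "(%n. sqrt (SUM k:boxes n. (norm (freq k) ^ s * norm (pr (h om) k - pr d k))^2)) ----> nrm (DS s) (h om - d)"
   using nrm_Hdot_nonneg by (simp add: nrm_DA DA_diff(2)[OF h[OF w] d s])
 next
  show "(%om. sqrt (SUM k:boxes n. (norm (freq k) ^ s * norm (pr (h om) k - pr d k))^2)) : borel_measurable M" for n
   using m by measurable
 qed
 show "EX d:?D. nrm (DS s) (u - d) < e" if u: "u : carr (DS s)" and e: "e > 0" for u e
 proof -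
  let ?a = "%k. (norm (freq k) ^ s * norm (pr u k))^2"
  have S: "?a summable_on UNIV" using nrm_DA_has_sum[OF u s] by (rule has_sum_imp_summable)
  have X: "(%N. sqrt (\<Sum>\<^sub>\<infinity>k. if k : boxes N then 0 else ?a k)) ----> sqrt 0"
   by (intro tendsto_real_sqrt infsum_outside_boxes(1) S)
  obtain n where n: "sqrt (\<Sum>\<^sub>\<infinity>k. if k : boxes n then 0 else ?a k) < e / 3"
   using eventually_happens[OF order_tendstoD(2)[OF X, of "e / 3"]] e by auto
  \<comment> \<open>Accuracy per coefficient, chosen so that the weighted errors over the box add up
    to at most \<open>e / 3\<close>; the modes outside cost another \<open>e / 3\<close>.\<close>
  define de where "de = (e / 3) / (1 + (SUM k:boxes n. norm (freq k) ^ s))"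
  have ss: "0 <= (SUM k:boxes n. norm (freq k) ^ s)" by (intro sum_nonneg) auto
  have de: "0 < de" using e ss by (simp add: de_def)
  define a where "a = (\<lambda>k\<in>boxes n. SOME z. z : cq & norm (z - pr u k) < de)"
  have a: "a k : cq" "norm (a k - pr u k) < de" if "k : boxes n" for k
   using someI_ex[of "%z. z : cq & norm (z - pr u k) < de"] cq_dense[OF de, of "pr u k"] that unfolding a_def by auto
  define d where "d = fld (symm n a)"
  have dD: "d : ?D" unfolding d_def using a by (auto intro!: image_eqI[where x = a] simp: a_def)
  then have d: "d : carr (DS s)" using D by blast
  have dk: "norm (pr u k - pr d k) <= (if k : boxes n then de else norm (pr u k))" for k
  proof -
   have "norm (symm n a k - pr u k) <= de" if "k : boxes n"
   proof -
    have "symm n a k - pr u k = ((a k - pr u k) + cnj (a (- k) - pr u (- k))) / 2" using that by (simp add: symm_def pr_uminus field_simps)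
    also have "norm ... <= (norm (a k - pr u k) + norm (a (- k) - pr u (- k))) / 2"
     unfolding norm_divide using norm_triangle_ineq[of "a k - pr u k" "cnj (a (- k) - pr u (- k))"] by (simp only: complex_mod_cnj norm_numeral divide_right_mono zero_le_numeral)
    also have "... <= de" using a(2)[OF that] a(2)[of "- k"] that by (simp add: boxes_uminus)
    finally show ?thesis .
   qed
   then show ?thesis using de unfolding d_def fld_symm(2)[OF s] by (auto simp: norm_minus_commute symm_def)
  qed
  let ?f1 = "%k. if k : boxes n then 0 else norm (freq k) ^ s * norm (pr u k)"
  let ?f2 = "%k. if k : boxes n then norm (freq k) ^ s * de else 0"
  have f1s: "(%k. (?f1 k)^2) = (%k. if k : boxes n then 0 else ?a k)" by auto
  have "l2b (sqrt (\<Sum>\<^sub>\<infinity>k. (?f1 k)^2)) ?f1" by (rule summable_l2b) (simp only: f1s infsum_outside_boxes(2)[OF S])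
  then have f1: "l2b (e / 3) ?f1" unfolding f1s using l2b_weaken n less_imp_le by blast
  have "L2_set ?f2 (boxes n) <= (SUM k:boxes n. norm (freq k) ^ s * de)"
   using de by (intro order_trans[OF L2_set_le_sum]) (auto intro!: sum_mono)
  also have "... <= e / 3" unfolding sum_distrib_right[symmetric] de_def using ss e by (simp add: field_simps)
  finally have f2: "l2b (e / 3) ?f2" using l2b_weaken[OF l2b_finite_support[OF finite_boxes, of n ?f2]] by auto
  have "l2b (e / 3 + e / 3) (%k. norm (freq k) ^ s * norm (pr (u - d) k))"
  proof (rule l2b_mono_abs[OF l2b_add[OF f1 f2]])
   fix k
   have "norm (freq k) ^ s * norm (pr (u - d) k) <= norm (freq k) ^ s * (if k : boxes n then de else norm (pr u k))"
    unfolding DA_diff(2)[OF u d s] by (intro mult_left_mono dk) simp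
   then show "\<bar>norm (freq k) ^ s * norm (pr (u - d) k)\<bar> <= \<bar>?f1 k + ?f2 k\<bar>" using de by (auto split: if_splits)
  qed
  then have "nrm (DS s) (u - d) <= e / 3 + e / 3" by (rule nrm_DA_le[OF DA_diff(1)[OF u d s] s])
  then show ?thesis using dD e by (intro bexI[of _ d]) auto
 qed
qed

end

section \<open>Regularity of the data\<close>

lemma AE_dense:
 fixes T t e :: real
 assumes P: "AE s in iv T. P s" and T: "0 < T" and t: "t : {0..T}" and e: "e > 0"
 shows "EX s:{0..T}. \<bar>s - t\<bar> < e & P s"
proof (rule ccontr)
 assume n: "~ ?thesis"
 obtain N where N: "{s : space (iv T). ~ P s} <= N" "N : null_sets (iv T)" using P by (auto elim: AE_E3 simp: eventually_ae_filter)
 have N': "negligible N" using N(2) by (auto simp: negligible_iff_null_sets null_sets_restrict_space)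
 define a b where "a = max 0 (t - e / 2)" and "b = min T (t + e / 2)"
 have ab: "a < b" "0 <= a" "b <= T" "t - e / 2 <= a" "b <= t + e / 2" using T t e by (auto simp: a_def b_def)
 have "cbox a b <= N"
 proof
  fix s assume s: "s : cbox a b"
  then have "s : {0..T}" "\<bar>s - t\<bar> < e" using ab e by auto
  then show "s : N" using n N(1) by auto
 qed
 then have "box a b = {}" using negligible_subset[OF N'] negligible_interval(1) by blast
 then show False using ab by (simp add: box_real)
qed

text \<open>Finite sections of the norm are continuous in time, and a set of full measure is dense.
  So an essential bound along the path holds at every time, with no exceptional times left.\<close>

lemma l2b_AE_all:
 fixes x :: "'k => real => complex"
 assumes c: "!!k. continuous_on {0..T} (x k)" and a: "AE t in iv T. l2b A (%k. w k * norm (x k t))"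
  and T: "0 < T" and t: "t : {0..T}"
 shows "l2b A (%k. w k * norm (x k t))"
 unfolding l2b_def
proof (intro allI impI, rule ccontr)
 fix F :: "'k set" assume F: "finite F" and "~ L2_set (%k. w k * norm (x k t)) F <= A"
 then have d: "L2_set (%k. w k * norm (x k t)) F - A > 0" (is "?d > 0") by simp
 have C: "continuous_on {0..T} (%t. L2_set (%k. w k * norm (x k t)) F)"
  unfolding L2_set_def by (intro continuous_intros c)
 obtain e where e: "e > 0" "!!s. s : {0..T} ==> dist s t < e ==> dist (L2_set (%k. w k * norm (x k s)) F) (L2_set (%k. w k * norm (x k t)) F) < ?d"
  using C[unfolded continuous_on_iff, rule_format, OF t d] by blast
 obtain s where s: "s : {0..T}" "\<bar>s - t\<bar> < e" "l2b A (%k. w k * norm (x k s))" using AE_dense[OF a T t e(1)] by blast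
 show False using e(2)[OF s(1)] s(2) l2b_D[OF s(3) F] by (auto simp: dist_real_def)
qed

context helm begin

lemma cont_paths_pr:
 assumes h: "h : cont_paths I (DS s)" and s: "1 <= s"
 shows "continuous_on I (%t. pr (h t) k)"
proof (cases "k = 0")
 case False
 then have f: "0 < norm (freq k) ^ s" by (simp add: freq_eq_0)
 show ?thesis unfolding continuous_on_def
 proof
  fix t assume t: "t : I"
  have c: "h u : carr (DS s)" if "u : I" for u using h that by (auto simp: cont_paths_def)
  have z: "((%u. nrm (DS s) (h u - h t) / norm (freq k) ^ s) \<longlongrightarrow> 0) (at t within I)"
   by (rule tendsto_divide_zero) (use h t in "auto simp: cont_paths_def")
  have "((%u. pr (h u) k - pr (h t) k) \<longlongrightarrow> 0) (at t within I)"
  proof (rule Lim_null_comparison[OF _ z])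
   have "norm (pr (h u) k - pr (h t) k) <= nrm (DS s) (h u - h t) / norm (freq k) ^ s" if "u : I" for u
    using l2b_point[OF l2b_nrm_DA[OF DA_diff(1)[OF c[OF that] c[OF t] s] s], of k] f
    by (simp add: DA_diff(2)[OF c[OF that] c[OF t] s] field_simps)
   then show "\<forall>\<^sub>F u in at t within I. norm (pr (h u) k - pr (h t) k) <= nrm (DS s) (h u - h t) / norm (freq k) ^ s"
    by (auto simp: eventually_at_filter)
  qed
  then show "((%u. pr (h u) k) \<longlongrightarrow> pr (h t) k) (at t within I)" using LIM_zero_iff by blast
 qed
qed simp

lemma fsb_of_pr:
 assumes u: "fsb s' B u" "solen u" and p: "l2b A (%k. rho k ^ s * norm (pr u k))"
 shows "fsb s A u"
proof -
 have f: "fc (cp u i) k = pr u k * nv k i" for i k using u by (intro fc_pr) (auto simp: fsb_def)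
 have "l2b A (%k. rho k ^ s * norm (fc (cp u i) k))" for i
  by (rule l2b_mono_abs[OF p]) (simp add: f norm_mult norm_nv mult_left_le)
 then show ?thesis using u(1) by (simp add: fsb_def hsb_def)
qed

lemma Linf_l2b:
 assumes h: "h : bochner_Linf (iv T) (DS s)" and s: "1 <= s"
 shows "EX A. AE t in iv T. l2b A (%k. rho k ^ s * norm (pr (h t) k))"
proof -
 obtain h' C where h': "h' : measurable (iv T) (nborel (DS s))"
  "AE t in iv T. nrm (DS s) (h' t) <= C" "AE t in iv T. h t = h' t"
  using h unfolding bochner_Linf_def by blast
 have "AE t in iv T. t : space (iv T)" by (rule AE_space)
 then have "AE t in iv T. l2b (2 * (c1 ^ s * C)) (%k. rho k ^ s * norm (pr (h t) k))"
  using h'(2,3)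
 proof eventually_elim
  case (elim t)
  have "h t : carr (DS s)" using measurable_space[OF h'(1) elim(1)] elim(3) by (simp add: space_nborel)
  then have "l2b (2 * (c1 ^ s * nrm (DS s) (h t))) (%k. rho k ^ s * norm (pr (h t) k))"
   using DA_D(1)[OF _ s] by (intro l2b_pr) (auto simp: fsb_def nrm_DA)
  then show ?case by (rule l2b_weaken) (use elim c1_ge1 in "auto intro!: mult_left_mono")
 qed
 then show ?thesis by blast
qed

lemma path_bound:
 assumes h: "h : cont_paths {0..T} (DA L (real s'))" "1 <= s'" and i: "h : bochner_Linf (iv T) (DS s)" "1 <= s" and T: "0 < T"
 shows "EX A. ALL t:{0..T}. fsb s A (h t) & solen (h t) & l2b A (%k. rho k ^ s * norm (pr (h t) k))"
proof -
 obtain A where A: "AE t in iv T. l2b A (%k. rho k ^ s * norm (pr (h t) k))" using Linf_l2b[OF i] by blast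
 have "fsb s A (h t) & solen (h t) & l2b A (%k. rho k ^ s * norm (pr (h t) k))" if t: "t : {0..T}" for t
 proof -
  have c: "h t : carr (DA L (real s'))" using h t by (auto simp: cont_paths_def)
  have "l2b A (%k. rho k ^ s * norm (pr (h t) k))" by (rule l2b_AE_all[OF cont_paths_pr[OF h] A T t])
  then show ?thesis using fsb_of_pr[OF DA_D(1)[OF c h(2)]] DA_D(2)[OF c h(2)] by blast
 qed
 then show ?thesis by blast
qed

lemma Vc_pr: "fsb s A u ==> solen u ==> Vc u i k = pr u k * nv k i"
 unfolding Vc_def by (rule fc_pr) (auto simp: fsb_def)

text \<open>The majorant depends on \<open>v\<close> only through the bound \<open>A\<close>, so
  along a path the series converges uniformly in time and its sum is continuous there.\<close>

lemma HH_has_sum: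
 assumes v: "fsb 3 A v"
 shows "((%j. GA v a b j * GA v c d (m - j)) has_sum HH v a b c d m) UNIV"
  "norm (GA v a b j * GA v c d (m - j)) <= (4 * c0 * A)^2 * (1 / (rho j)^2 * (1 / (rho (m - j))^2))"
proof -
 have v3: "hsb (Suc 2) A (cp v i)" for i using v by (simp add: fsb_def)
 have G: "fc (%x. Am L v x $ a $ b) = GA v a b" for a b using hsb_Am(2)[OF v3] by (auto simp: GA_def Vc_def)
 show "((%j. GA v a b j * GA v c d (m - j)) has_sum HH v a b c d m) UNIV"
  using fc_mult[OF hsb_D(2)[OF hsb_Am(1)[OF v3]] hsb_D(2)[OF hsb_Am(1)[OF v3]], of a b c d m] unfolding G HH_def .
 have g: "norm (GA v a b m) <= 4 * c0 * A * (1 / (rho m)^2)" for a b m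
 proof -
  have "al v m <= (SUM i:(UNIV::2 set). A)" unfolding al_def Vc_def
  proof (rule sum_mono)
   fix i show "rho m ^ 3 * norm (fc (cp v i) m) <= A"
    using l2b_point[OF hsb_D(3)[OF v3[of i]], of m] by (simp add: numeral_3_eq_3 numeral_2_eq_2)
  qed
  then have "2 * c0 * al v m <= 2 * c0 * (2 * A)" using a1_pos by (intro mult_left_mono) auto
  then have "2 * c0 * al v m / (rho m)^2 <= 2 * c0 * (2 * A) / (rho m)^2" by (rule divide_right_mono) simp
  then show ?thesis using order_trans[OF norm_GA[of v a b m]] by simp
 qed
 have A0: "0 <= A" using hsb_nonneg[OF v3] .
 have "norm (GA v a b j * GA v c d (m - j)) <= (4 * c0 * A * (1 / (rho j)^2)) * (4 * c0 * A * (1 / (rho (m - j))^2))"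
  unfolding norm_mult using A0 a1_pos by (intro mult_mono g) auto
 then show "norm (GA v a b j * GA v c d (m - j)) <= (4 * c0 * A)^2 * (1 / (rho j)^2 * (1 / (rho (m - j))^2))"
  by (simp only: power2_eq_square mult_ac)
qed

lemma HH_continuous:
 assumes v: "!!t. t : S ==> fsb 3 A (v t)" and c: "!!i k. continuous_on S (%t. Vc (v t) i k)"
 shows "continuous_on S (%t. HH (v t) a b c d m)"
proof -
 have s: "(%j. (4 * c0 * A)^2 * (1 / (rho j)^2 * (1 / (rho (m - j))^2))) summable_on UNIV"
  by (intro summable_on_cmult_right l2b_prod_summable(1)[OF l2b_rho_m2 l2b_reindex[OF l2b_rho_m2]]) (auto simp: inj_def)
 have "uniform_limit S (%X t. SUM j:X. GA (v t) a b j * GA (v t) c d (m - j)) (%t. \<Sum>\<^sub>\<infinity>j. GA (v t) a b j * GA (v t) c d (m - j)) (finite_subsets_at_top UNIV)"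
  by (rule Weierstrass_m_test_general[OF HH_has_sum(2)[OF v] s])
 then have "continuous_on S (%t. \<Sum>\<^sub>\<infinity>j. GA (v t) a b j * GA (v t) c d (m - j))"
  by (rule uniform_limit_theorem[rotated]) (auto simp: GA_def intro!: always_eventually continuous_intros c)
 then show ?thesis by (rule continuous_on_eq) (use infsumI[OF HH_has_sum(1)[OF v]] in auto)
qed

lemma HH_measurable:
 assumes v: "!!om. om : space M ==> EX A. fsb 3 A (v om)" and c: "!!i k. (%om. Vc (v om) i k) : borel_measurable M"
 shows "(%om. HH (v om) a b c d m) : borel_measurable M"
proof (rule borel_measurable_LIMSEQ_metric)
 show "(%n. SUM j:boxes n. GA (v om) a b j * GA (v om) c d (m - j)) ----> HH (v om) a b c d m" if "om : space M" for om
  using v[OF that] has_sum_boxes[OF HH_has_sum(1)] by blast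
 show "(%om. SUM j:boxes n. GA (v om) a b j * GA (v om) c d (m - j)) : borel_measurable M" for n
  unfolding GA_def by (intro borel_measurable_sum borel_measurable_times borel_measurable_add borel_measurable_const c)
qed

lemma KK_continuous:
 assumes v: "!!t. t : S ==> fsb 3 A (v t)" and c: "!!i k. continuous_on S (%t. Vc (v t) i k)"
 shows "continuous_on S (%t. KK nu a2 be (v t) k j)"
 unfolding KK_def RR_def cn_def Kc_def K2_def K3_def K4_def K5_def K6_def K7_def GA_def Uc_def
 by (intro continuous_intros c HH_continuous[OF v c])

lemma KK_measurable:
 assumes v: "!!om. om : space M ==> EX A. fsb 3 A (v om)" and c: "!!i k. (%om. Vc (v om) i k) : borel_measurable M"
 shows "(%om. KK nu a2 be (v om) k j) : borel_measurable M"
 unfolding KK_def RR_def cn_def Kc_def K2_def K3_def K4_def K5_def K6_def K7_def GA_def Uc_def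
 by (intro borel_measurable_sum borel_measurable_times borel_measurable_add borel_measurable_diff borel_measurable_uminus borel_measurable_const c HH_measurable[OF v c])

section \<open>Coefficients of the forcing\<close>

lemma L2dot_l2t: "u : carr (L2dot L) ==> l2t (cp u i)" "u : carr (L2dot L) ==> integrable tor (cp u i)"
 using l2t_integrable by (auto simp: L2dot_iff)

lemma L2dot_diff:
 assumes u: "u : carr (L2dot L)" and w: "w : carr (L2dot L)"
 shows "u - w : carr (L2dot L)"
 using u w fc_diff[OF L2dot_l2t(2)[OF u] L2dot_l2t(2)[OF w]] by (auto simp: L2dot_iff periodic_def intro: l2t_diff)

lemma nrm_L2dot_nonneg: "0 <= nrm (L2dot L) u"
 by (simp add: L2dot_def ip_def)

lemma nrm_L2dot_has_sum:
 assumes u: "u : carr (L2dot L)"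
 shows "((%k. SUM i:UNIV. (norm (fc (cp u i) k))^2) has_sum (nrm (L2dot L) u)^2 / L^2) UNIV"
proof -
 have "((%k. (norm (fc (cp u 1) k))^2 + (norm (fc (cp u 2) k))^2) has_sum (LINT x|tor. (u x $ 1)^2) / L^2 + (LINT x|tor. (u x $ 2)^2) / L^2) UNIV"
  by (intro has_sum_add parseval_sq L2dot_l2t u)
 moreover have "(nrm (L2dot L) u)^2 = (LINT x|tor. (u x $ 1)^2) + (LINT x|tor. (u x $ 2)^2)"
  using ip_self[OF L2dot_l2t(1)[OF u]] by (simp add: L2dot_def ip_def UNIV_2)
 ultimately show ?thesis by (simp add: UNIV_2 add_divide_distrib)
qed

lemma L2dot_coeff:
 assumes u: "u : carr (L2dot L)"
 shows "norm (fc (cp u i) k) <= nrm (L2dot L) u / L" "norm (pr u k) <= 2 * (nrm (L2dot L) u / L)"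
  "finite F ==> (SUM k:F. (norm (pr u k))^2) <= 2 * ((nrm (L2dot L) u)^2 / L^2)"
proof -
 have *: "norm (fc (cp u i) k) <= nrm (L2dot L) u / L" for i
 proof (rule power2_le_imp_le)
  have "(norm (fc (cp u i) k))^2 <= (SUM i:UNIV. (norm (fc (cp u i) k))^2)" by (rule member_le_sum) auto
  also have "... = (SUM k:{k}. SUM i:UNIV. (norm (fc (cp u i) k))^2)" by simp
  also have "... <= (nrm (L2dot L) u)^2 / L^2" by (rule finite_sum_le_has_sum[OF nrm_L2dot_has_sum[OF u]]) (auto intro: sum_nonneg)
  finally show "(norm (fc (cp u i) k))^2 <= (nrm (L2dot L) u / L)^2" by (simp add: power_divide)
 qed (use nrm_L2dot_nonneg L_pos in simp)
 then show "norm (fc (cp u i) k) <= nrm (L2dot L) u / L" .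
 show "norm (pr u k) <= 2 * (nrm (L2dot L) u / L)"
  using norm_pr_le[of u k] *[of 1] *[of 2] by (simp add: UNIV_2)
 show "(SUM k:F. (norm (pr u k))^2) <= 2 * ((nrm (L2dot L) u)^2 / L^2)" if F: "finite F"
 proof -
  have "(norm (pr u k))^2 <= 2 * (SUM i:UNIV. (norm (fc (cp u i) k))^2)" for k
  proof -
   have "(norm (pr u k))^2 <= (norm (fc (cp u 1) k) + norm (fc (cp u 2) k))^2"
    using norm_pr_le[of u k] by (intro power_mono) (auto simp: UNIV_2)
   also have "... <= 2 * ((norm (fc (cp u 1) k))^2 + (norm (fc (cp u 2) k))^2)"
    using sum_squares_bound[of "norm (fc (cp u 1) k)" "norm (fc (cp u 2) k)"] by (simp add: power2_sum)
   finally show ?thesis by (simp add: UNIV_2)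
  qed
  then have "(SUM k:F. (norm (pr u k))^2) <= (SUM k:F. 2 * (SUM i:UNIV. (norm (fc (cp u i) k))^2))" by (rule sum_mono)
  also have "... <= 2 * ((nrm (L2dot L) u)^2 / L^2)" unfolding sum_distrib_left[symmetric]
   by (intro mult_left_mono finite_sum_le_has_sum[OF nrm_L2dot_has_sum[OF u]] F) (auto intro: sum_nonneg)
  finally show ?thesis .
 qed
qed

lemma fc_L2dot_measurable: "(%u. fc (cp u i) k) : borel_measurable (nborel (L2dot L))"
proof (rule nborel_measurableI)
 fix u :: field and e :: real assume u: "u : carr (L2dot L)" and e: "e > 0"
 show "EX r>0. ALL w:carr (L2dot L). nrm (L2dot L) (w - u) < r --> dist (fc (cp w i) k) (fc (cp u i) k) < e"
 proof (intro exI[of _ "e * L"] conjI ballI impI)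
  fix w assume w: "w : carr (L2dot L)" and n: "nrm (L2dot L) (w - u) < e * L"
  have "norm (fc (cp w i) k - fc (cp u i) k) <= nrm (L2dot L) (w - u) / L"
   using L2dot_coeff(1)[OF L2dot_diff[OF w u], of i k] fc_diff[OF L2dot_l2t(2)[OF w] L2dot_l2t(2)[OF u], of i i k] by simp
  also have "... < e" using n L_pos by (simp add: field_simps)
  finally show "dist (fc (cp w i) k) (fc (cp u i) k) < e" by (simp add: dist_norm)
 qed (use e L_pos in auto)
qed

lemma bochner_rep:
 assumes u: "u : carr (bochner_Lp (iv T) (L2dot L) 2)"
 obtains u' where "!!t. t : {0..T} ==> u' t : carr (L2dot L)" "!!i k. (%t. fc (cp (u' t) i) k) : borel_measurable (iv T)"
  "integrable (iv T) (%t. (nrm (L2dot L) (u' t))^2)" "AE t in iv T. u t = u' t"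
proof -
 obtain u' where u': "u' : measurable (iv T) (nborel (L2dot L))"
  "integrable (iv T) (%t. nrm (L2dot L) (u' t) powr 2)" "AE t in iv T. u t = u' t"
  using u unfolding bochner_Lp_def fst_conv by blast
 show ?thesis
 proof (rule that[of u'])
  show "u' t : carr (L2dot L)" if "t : {0..T}" for t using measurable_space[OF u'(1), of t] that by (simp add: space_nborel)
  show "(%t. fc (cp (u' t) i) k) : borel_measurable (iv T)" for i k
   by (rule measurable_compose[OF u'(1) fc_L2dot_measurable])
  show "integrable (iv T) (%t. (nrm (L2dot L) (u' t))^2)" using u'(2) nrm_L2dot_nonneg by simp
 qed (rule u'(3))
qed

text \<open>A total version of \<open>pr\<close>: an element of the Bochner space may leave
  \<open>L2dot\<close> on a null set of times, where the coefficient is set to 0.\<close>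

definition prc :: "field => int^2 => complex" where "prc u k = (if u : carr (L2dot L) then pr u k else 0)"

lemma prc_rep:
 assumes c: "!!t. t : {0..T} ==> u' t : carr (L2dot L)" and m: "!!i k. (%t. fc (cp (u' t) i) k) : borel_measurable (iv T)"
  and i: "integrable (iv T) (%t. (nrm (L2dot L) (u' t))^2)" and e: "AE t in iv T. u t = u' t"
 shows "integrable (iv T) (%t. pr (u' t) k)" "AE t in iv T. prc (u t) k = pr (u' t) k"
  "integrable (iv T) (%t. prc (u t) k)" "0 <= t ==> itail T (%s. prc (u s) k) t = itail T (%s. pr (u' s) k) t"
proof -
 have pm: "(%t. pr (u' t) k) : borel_measurable (iv T)"
  unfolding pr_def by (intro borel_measurable_sum borel_measurable_times borel_measurable_const m)
 show 1: "integrable (iv T) (%t. pr (u' t) k)"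
 proof (rule Bochner_Integration.integrable_bound[OF _ pm])
  show "integrable (iv T) (%t. (1 + (nrm (L2dot L) (u' t))^2) / L)"
   by (intro integrable_divide Bochner_Integration.integrable_add integrable_continuous_on continuous_intros i)
  have "norm (pr (u' t) k) <= norm ((1 + (nrm (L2dot L) (u' t))^2) / L)" if "t : {0..T}" for t
  proof -
   have "2 * nrm (L2dot L) (u' t) / L <= (1 + (nrm (L2dot L) (u' t))^2) / L"
    using sum_squares_bound[of 1 "nrm (L2dot L) (u' t)"] L_pos by (intro divide_right_mono) auto
   then show ?thesis using L2dot_coeff(2)[OF c[OF that], of k] L_pos by simp
  qed
  then show "AE t in iv T. norm (pr (u' t) k) <= norm ((1 + (nrm (L2dot L) (u' t))^2) / L)" by (intro AE_I2) auto
 qed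
 show 2: "AE t in iv T. prc (u t) k = pr (u' t) k"
  using e AE_space by eventually_elim (use c in "auto simp: prc_def")
 have m2: "(%t. prc (u t) k) : borel_measurable (iv T)"
  by (rule lebesgue_on_measurable_AE[OF pm]) (use 2 in "auto elim: eventually_mono")
 show "integrable (iv T) (%t. prc (u t) k)"
  by (rule integrable_cong_AE_imp[OF 1 m2]) (use 2 in "auto elim: eventually_mono")
 show "itail T (%s. prc (u s) k) t = itail T (%s. pr (u' s) k) t" if "0 <= t"
  by (rule itail_cong_AE[OF 2 m2 pm that])
qed

text \<open>Integrating in time makes the coefficient a continuous functional on the Bochner space,
  and continuity gives measurability.\<close>

lemma itail_prc_measurable:
 assumes t: "t : {0..T}"
 shows "(%u. itail T (%s. prc (u s) k) t) : borel_measurable (nborel (bochner_Lp (iv T) (L2dot L) 2))"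
proof (rule nborel_measurableI)
 let ?Y = "bochner_Lp (iv T) (L2dot L) 2"
 fix u :: "real => field" and e :: real assume u: "u : carr ?Y" and e: "e > 0"
 obtain u' where u': "!!t. t : {0..T} ==> u' t : carr (L2dot L)" "!!i k. (%t. fc (cp (u' t) i) k) : borel_measurable (iv T)"
  "integrable (iv T) (%t. (nrm (L2dot L) (u' t))^2)" "AE t in iv T. u t = u' t" using bochner_rep[OF u] by blast
 define T1 where "T1 = T + 1"
 have T1: "T1 > 0" using t by (simp add: T1_def)
 \<comment> \<open>The closing estimate is \<open>(T + 1) * r / L\<close>, which is half of
   \<open>e\<close>.\<close>
 define r where "r = e * L / (2 * T1)"
 have r: "r > 0" "r * T1 / L < e" using T1 e L_pos by (auto simp: r_def)
 show "EX r>0. ALL w:carr ?Y. nrm ?Y (w - u) < r --> dist (itail T (%s. prc (w s) k) t) (itail T (%s. prc (u s) k) t) < e"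
 proof (intro exI[of _ r] conjI r(1) ballI impI)
  fix w assume w: "w : carr ?Y" and n: "nrm ?Y (w - u) < r"
  obtain w' where w': "!!t. t : {0..T} ==> w' t : carr (L2dot L)" "!!i k. (%t. fc (cp (w' t) i) k) : borel_measurable (iv T)"
   "integrable (iv T) (%t. (nrm (L2dot L) (w' t))^2)" "AE t in iv T. w t = w' t" using bochner_rep[OF w] by blast
  define D where "D t = (nrm (L2dot L) (w' t - u' t))^2" for t
  have D0: "0 <= D t" for t by (simp add: D_def)
  have d: "fc (%x. (w' t - u' t) x $ i) k = fc (cp (w' t) i) k - fc (cp (u' t) i) k" if "t : {0..T}" for t i k
   using fc_diff[OF L2dot_l2t(2)[OF w'(1)[OF that]] L2dot_l2t(2)[OF u'(1)[OF that]], of i i k] by simp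
  have Ds: "((%k. SUM i:UNIV. (norm (fc (cp (w' t) i) k - fc (cp (u' t) i) k))^2) has_sum D t / L^2) UNIV" if "t : {0..T}" for t
   using nrm_L2dot_has_sum[OF L2dot_diff[OF w'(1)[OF that] u'(1)[OF that]]] unfolding d[OF that] D_def .
  have "(%t. D t / L^2) : borel_measurable (iv T)"
  proof (rule borel_measurable_LIMSEQ_real)
   show "(%n. SUM k:boxes n. SUM i:UNIV. (norm (fc (cp (w' t) i) k - fc (cp (u' t) i) k))^2) ----> D t / L^2"
    if "t : space (iv T)" for t using has_sum_boxes[OF Ds] that by simp
   show "(%t. SUM k:boxes n. SUM i:UNIV. (norm (fc (cp (w' t) i) k - fc (cp (u' t) i) k))^2) : borel_measurable (iv T)" for n
    using w'(2) u'(2) by measurable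
  qed
  from borel_measurable_times[OF this borel_measurable_const[of "L^2"]]
  have Dm: "D : borel_measurable (iv T)" using L_pos by simp
  have Db: "D t <= 2 * ((nrm (L2dot L) (w' t))^2 + (nrm (L2dot L) (u' t))^2)" if "t : {0..T}" for t
  proof -
   have s: "((%k. 2 * ((SUM i:UNIV. (norm (fc (cp (w' t) i) k))^2) + (SUM i:UNIV. (norm (fc (cp (u' t) i) k))^2))) has_sum
     2 * ((nrm (L2dot L) (w' t))^2 / L^2 + (nrm (L2dot L) (u' t))^2 / L^2)) UNIV"
    by (intro has_sum_cmult_right has_sum_add nrm_L2dot_has_sum w'(1) u'(1) that)
   have "D t / L^2 <= 2 * ((nrm (L2dot L) (w' t))^2 / L^2 + (nrm (L2dot L) (u' t))^2 / L^2)"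
   proof (rule has_sum_mono[OF Ds[OF that] s])
    fix k
    have "(norm (a - b))^2 <= 2 * ((norm a)^2 + (norm b)^2)" for a b :: complex
    proof -
     have "(norm (a - b))^2 <= (norm a + norm b)^2" by (intro power_mono norm_triangle_ineq4) simp
     then show ?thesis using sum_squares_bound[of "norm a" "norm b"] by (simp add: power2_sum)
    qed
    then show "(SUM i:UNIV. (norm (fc (cp (w' t) i) k - fc (cp (u' t) i) k))^2) <= 2 * ((SUM i:UNIV. (norm (fc (cp (w' t) i) k))^2) + (SUM i:UNIV. (norm (fc (cp (u' t) i) k))^2))"
     unfolding sum.distrib[symmetric] sum_distrib_left by (rule sum_mono)
   qed
   then show ?thesis using L_pos by (simp add: field_simps)
  qed
  \<comment> \<open>For a function that is not integrable the Bochner integral is 0 by convention;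
    only integrability turns a small norm into information.\<close>
  have DI: "integrable (iv T) D"
  proof (rule Bochner_Integration.integrable_bound[OF _ Dm])
   show "integrable (iv T) (%t. 2 * ((nrm (L2dot L) (w' t))^2 + (nrm (L2dot L) (u' t))^2))"
    by (intro integrable_mult_right Bochner_Integration.integrable_add w'(3) u'(3))
   show "AE t in iv T. norm (D t) <= norm (2 * ((nrm (L2dot L) (w' t))^2 + (nrm (L2dot L) (u' t))^2))"
    by (rule AE_I2) (use Db D0 in auto)
  qed
  have De: "AE t in iv T. D t = nrm (L2dot L) (w t - u t) powr 2"
   using w'(4) u'(4) by eventually_elim (use nrm_L2dot_nonneg in "simp add: D_def")
  have "(LINT t|iv T. nrm (L2dot L) (w t - u t) powr 2) = (LINT t|iv T. D t)"
   by (rule integral_cong_AE[OF lebesgue_on_measurable_AE[OF Dm De] Dm]) (use De in "auto elim: eventually_mono")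
  moreover have "0 <= (LINT t|iv T. D t)" by (rule Bochner_Integration.integral_nonneg[OF D0])
  ultimately have "sqrt (LINT t|iv T. D t) < r" using n by (simp add: bochner_Lp_def powr_half_sqrt)
  then have ID: "(LINT t|iv T. D t) < r^2" using r(1) by (metis real_less_rsqrt real_sqrt_less_iff real_sqrt_abs abs_of_pos)
  have RI: "integrable (iv T) (%s. (1 / L) * (r + (1 / r) * D s))"
   by (intro integrable_mult_right Bochner_Integration.integrable_add integrable_continuous_on[of 0 T "%_. r"] continuous_on_const DI)
  have "norm (itail T (%s. pr (w' s) k - pr (u' s) k) t) <= itail T (%s. (1 / L) * (r + (1 / r) * D s)) t"
  proof (rule norm_itail_le[OF _ RI])
   fix s assume "s : {t..T}"
   then have s: "s : {0..T}" using t by auto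
   have "norm (pr (w' s) k - pr (u' s) k) <= 2 * (nrm (L2dot L) (w' s - u' s) / L)"
    using L2dot_coeff(2)[OF L2dot_diff[OF w'(1)[OF s] u'(1)[OF s]], of k] pr_diff[OF L2dot_l2t(2)[OF w'(1)[OF s]] L2dot_l2t(2)[OF u'(1)[OF s]], of k] by simp
   also have "... = (1 / L) * (2 * nrm (L2dot L) (w' s - u' s))" by simp
   also have "... <= (1 / L) * (r + (1 / r) * D s)"
   \<comment> \<open>Young's inequality with parameter \<open>r\<close> trades the norm for its
     square, whose time integral is below \<open>r^2\<close>.\<close>
   proof (rule mult_left_mono)
    have "r * (2 * nrm (L2dot L) (w' s - u' s)) <= r * (r + (1 / r) * D s)"
     using sum_squares_bound[of r "nrm (L2dot L) (w' s - u' s)"] r(1) by (simp add: D_def distrib_left power2_eq_square)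
    then show "2 * nrm (L2dot L) (w' s - u' s) <= r + (1 / r) * D s" using r(1) by (simp only: mult_le_cancel_left_pos)
   qed (use L_pos in simp)
   finally show "norm (pr (w' s) k - pr (u' s) k) <= (1 / L) * (r + (1 / r) * D s)" .
  qed (use t in "auto intro!: Bochner_Integration.integrable_diff prc_rep(1) u' w'")
  also have "... <= itail T (%s. (1 / L) * (r + (1 / r) * D s)) 0"
   by (rule itail_le_itail_0[OF RI]) (use t r D0 L_pos in auto)
  also have "... = (1 / L) * (T * r + (1 / r) * itail T D 0)"
  proof -
   have "itail T (%s. r + (1 / r) * D s) 0 = itail T (%s. r) 0 + itail T (%s. (1 / r) * D s) 0"
    by (rule itail_add(1)) (intro integrable_continuous_on continuous_intros integrable_mult_right DI order_refl)+
   then show ?thesis unfolding itail_cmul using t by (simp add: itail_const)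
  qed
  also have "... <= (1 / L) * (T * r + r)"
   using ID r(1) L_pos by (intro mult_left_mono add_left_mono) (auto simp: itail_def field_simps power2_eq_square)
  also have "... < e" using r(2) L_pos by (simp add: T1_def field_simps)
  finally have "norm (itail T (%s. pr (w' s) k - pr (u' s) k) t) < e" .
  moreover have "itail T (%s. pr (w' s) k - pr (u' s) k) t = itail T (%s. prc (w s) k) t - itail T (%s. prc (u s) k) t"
   using prc_rep(4)[OF u', of t k] prc_rep(4)[OF w', of t k] itail_add(2)[OF prc_rep(1)[OF w'] prc_rep(1)[OF u'], of t k k] t by simp
  ultimately show "dist (itail T (%s. prc (w s) k) t) (itail T (%s. prc (u s) k) t) < e" by (simp add: dist_norm)
 qed
qed

end

section \<open>The adjoint equation along a path\<close>

context helm begin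

lemma field_eq_AE:
 fixes u w :: field
 assumes "!!i. integrable tor (cp u i)" "!!i. integrable tor (cp w i)" "!!i k. fc (cp u i) k = fc (cp w i) k"
 shows "AE x in tor. u x = w x"
proof -
 have "AE x in tor. u x $ i = w x $ i" for i by (rule fc_eq_AE[OF assms])
 from this[of 1] this[of 2] show ?thesis by eventually_elim (simp add: vec_eq_iff forall_2)
qed

lemma nrm_DA_measurable:
 assumes s: "1 <= s" and h: "!!t. t : space M ==> h t : carr (DS s)"
  and m: "!!k. (%t. pr (h t) k) : borel_measurable M"
 shows "(%t. nrm (DS s) (h t)) : borel_measurable M"
proof (rule borel_measurable_LIMSEQ_real)
 show "(%t. sqrt (SUM k:boxes n. (norm (freq k) ^ s * norm (pr (h t) k))^2)) : borel_measurable M" for n using m by measurable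
 fix t assume "t : space M"
 from tendsto_real_sqrt[OF has_sum_boxes[OF nrm_DA_has_sum[OF h[OF this] s]]]
 show "(%n. sqrt (SUM k:boxes n. (norm (freq k) ^ s * norm (pr (h t) k))^2)) ----> nrm (DS s) (h t)"
  using nrm_Hdot_nonneg by (simp add: nrm_DA)
qed

lemma KK_0: "KK nu a2 be v 0 j = 0"
 unfolding KK_def RR_def cn_def by (simp add: freq_simps)

text \<open>A real test field carried by the two modes \<open>k\<close> and \<open>- k\<close>.
  Varying \<open>c\<close> extracts a single coefficient from any pairing.\<close>

definition md :: "complex => int^2 => field" where
 "md c k = fld (%j. if j = k then c else if j = - k then cnj c else 0)"

lemma neq_uminus: "k ~= 0 ==> k ~= - k" for k :: "int^2"
 by (auto simp: vec_eq_iff)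

lemma md:
 assumes k: "k ~= 0"
 shows "md c k : carr (Vsp L)" "md c k : carr (Hsp L)"
  "((%j. d j * cnj (pr (md c k) j)) has_sum s) UNIV ==> s = d k * cnj c + d (- k) * c"
proof -
 let ?c = "%j. if j = k then c else if j = - k then cnj c else 0"
 have h: "herm ?c" using neq_uminus[OF k] by (auto simp: herm_def equation_minus_iff)
 have l: "l2b (L2_set (%j. rho j ^ 1 * norm (?c j)) {k, - k}) (%j. rho j ^ 1 * norm (?c j))"
  by (rule l2b_finite_support) auto
 note f = fld[OF h l, folded md_def]
 show V: "md c k : carr (Vsp L)" unfolding Vsp_DA by (rule DA_I[OF f(2,3)]) simp
 show "md c k : carr (Hsp L)" by (rule Vsp_Hsp[OF V])
 have p: "pr (md c k) j = ?c j" for j using f(4)[of j] k by (cases "j = 0") auto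
 assume s: "((%j. d j * cnj (pr (md c k) j)) has_sum s) UNIV"
 have "((%j. d j * cnj (pr (md c k) j)) has_sum (SUM j:{k, - k}. d j * cnj (pr (md c k) j))) UNIV"
  by (rule has_sum_finite_neutralI) (auto simp: p)
 from has_sum_unique[OF s this] show "s = d k * cnj c + d (- k) * c"
  using neq_uminus[OF k] by (simp add: p)
qed

lemma ip_md:
 assumes k: "k ~= 0" and u: "!!i. l2t (cp u i)"
 shows "ip L u (md c k) = 2 * L^2 * Re (pr u k * cnj c)"
proof -
 have "cor (ip L u (md c k) / L^2) = pr u k * cnj c + pr u (- k) * c"
  by (rule md(3)[OF k ip_pr[OF u md(2)[OF k]]])
 also have "... = cor (2 * Re (pr u k * cnj c))" by (simp add: pr_uminus complex_eq_iff)
 finally have "ip L u (md c k) / L^2 = 2 * Re (pr u k * cnj c)" by (simp only: of_real_eq_iff)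
 then show ?thesis using L_pos by (simp add: field_simps)
qed

lemma Hsp_l2b: "ph : carr (Hsp L) ==> EX B. l2b B (%k. norm (pr ph k))"
 using l2b_I[of "%k. norm (pr ph k)"] L2dot_coeff(3)[of ph] Hsp_iff by blast

end

lemma itail_sum:
 fixes f :: "'k => real => complex"
 assumes "!!k. k : I ==> integrable (iv T) (f k)" "0 <= t"
 shows "itail T (%s. SUM k:I. f k s) t = (SUM k:I. itail T (f k) t)"
 unfolding itail_def by (rule Bochner_Integration.integral_sum) (rule integrable_tail[OF assms])

locale adjdata = helm L a1 for L a1 :: real +
 fixes T nu a2 be A :: real and v gf :: "real => field"
 assumes T0: "0 < T" and vb: "!!t. t : {0..T} ==> fsb 3 A (v t)" and vs: "!!t. t : {0..T} ==> solen (v t)"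
  and vc: "!!i k. continuous_on {0..T} (%t. Vc (v t) i k)"
  and gf: "gf : carr (bochner_Lp (iv T) (L2dot L) 2)"
begin

abbreviation I :: "real measure" where "I \<equiv> iv T"
abbreviation Kv :: "real => int^2 => int^2 => complex" where "Kv \<equiv> %t. KK nu a2 be (v t)"
definition gh :: "int^2 => real => complex" where "gh k t = prc (gf t) k"
text \<open>Zero where \<open>gf t\<close> leaves \<open>L2dot\<close>, in accordance with
  \<open>prc\<close>, so that the bound \<open>gb\<close> of \<open>evol\<close> holds at every
  time.\<close>

definition gm :: "real => real" where "gm t = (if gf t : carr (L2dot L) then 2 * ((nrm (L2dot L) (gf t))^2 / L^2) else 0)"

lemma gf_AE: "AE t in I. gf t : carr (L2dot L)"
proof -
 obtain u' where u': "!!t. t : {0..T} ==> u' t : carr (L2dot L)" "AE t in I. gf t = u' t" by (rule bochner_rep[OF gf]) blast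
 show ?thesis using u'(2) AE_space by eventually_elim (use u'(1) in auto)
qed

lemma evol_data: "evol T (CK nu a2 be A) rho Kv gh gm"
proof -
 obtain u' where u': "!!t. t : {0..T} ==> u' t : carr (L2dot L)" "!!i k. (%t. fc (cp (u' t) i) k) : borel_measurable I"
  "integrable I (%t. (nrm (L2dot L) (u' t))^2)" "AE t in I. gf t = u' t" using bochner_rep[OF gf] by blast
 have i: "integrable I (%t. 2 * ((nrm (L2dot L) (u' t))^2 / L^2))" by (intro integrable_mult_right integrable_divide u'(3))
 have e: "AE t in I. 2 * ((nrm (L2dot L) (u' t))^2 / L^2) = gm t"
  using u'(4) AE_space by eventually_elim (use u'(1) in "auto simp: gm_def")
 have gI: "integrable I gm"
  by (rule integrable_cong_AE_imp[OF i lebesgue_on_measurable_AE[OF borel_measurable_integrable[OF i] e]])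
   (use e in "auto elim: eventually_mono")
 have t0: "0 : {0..T}" using T0 by simp
 show ?thesis
 proof
  show "0 <= CK nu a2 be A" by (rule KK_schur(5)[OF vb[OF t0] vs[OF t0]])
  show "continuous_on {0..T} (%t. Kv t k j)" for k j by (rule KK_continuous[OF vb vc])
  show "integrable I (gh k)" for k unfolding gh_def[abs_def] by (rule prc_rep(3)[OF u'])
  show "(SUM k:F. (norm (gh k t))^2) <= gm t" if "finite F" for F t
   using L2dot_coeff(3)[OF _ that] by (simp add: gh_def gm_def prc_def)
 qed (assumption | rule T0 rho_ge1 finite_low gI KK_schur(1,3,4)[OF vb vs])+
qed

sublocale evol T "CK nu a2 be A" rho Kv gh gm by (rule evol_data)

lemma cnj_symmetry: "Kv s (- k) (- j) = cnj (Kv s k j)" "gh (- k) s = cnj (gh k s)"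
 by (rule KK_herm) (simp add: gh_def prc_def pr_uminus)

lemma ev_uminus: "t : {0..T} ==> ev (- k) t = cnj (ev k t)"
 by (rule ev_cnj[where sg = uminus]) (auto simp: cnj_symmetry)

lemma gh_0: "gh 0 t = 0" by (simp add: gh_def prc_def)

lemma ev_0: "t : {0..T} ==> ev 0 t = 0"
 by (subst ev_equation) (auto simp: gh_0 KK_0 itail_def)

definition psol :: "real => field" where "psol t = fld (%k. ev k t)"

lemma psol:
 assumes t: "t : {0..T}"
 shows "fsb 2 B0 (psol t)" "solen (psol t)" "pr (psol t) k = ev k t"
proof -
 have h: "herm (%k. ev k t)" by (simp add: herm_def ev_uminus[OF t])
 note f = fld[OF h ev_bound[OF t], folded psol_def]
 show "fsb 2 B0 (psol t)" "solen (psol t)" by (rule f)+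
 show "pr (psol t) k = ev k t" using f(4)[of k] ev_0[OF t] by (cases "k = 0") auto
qed

lemma psol_DA:
 assumes t: "t : {0..T}" and s: "s = 1 | s = 2" shows "psol t : carr (DS s)"
proof -
 have "fsb 1 B0 (psol t)" by (rule fsb_of_pr[OF psol(1,2)[OF t]]) (use ev_V[OF t] in "simp add: psol(3)[OF t]")
 then have "fsb s B0 (psol t)" using s psol(1)[OF t] by auto
 then show ?thesis by (rule DA_I[OF _ psol(2)[OF t]]) (use s in auto)
qed

lemma psol_Linf: "psol : bochner_Linf I (DA L 2)"
proof -
 have "psol : measurable I (nborel (DA L (real 2)))"
 proof (rule DA_measurableI)
  show "psol t : carr (DA L (real 2))" if "t : space I" for t using psol_DA[of t 2] that by simp
  show "(%t. pr (psol t) k) : borel_measurable I" for k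
   using borel_measurable_integrable[OF integrable_continuous_on[OF ev_continuous[of k]]]
   by (rule measurable_cong[THEN iffD1, rotated]) (simp add: psol(3))
 qed simp
 moreover have "AE t in I. nrm (DA L (real 2)) (psol t) <= (1 / cc)^2 * (2 * B0)"
  by (rule AE_I2) (use fsb_Hdot(2)[OF psol(1)] in "simp add: nrm_DA")
 ultimately show ?thesis unfolding bochner_Linf_def by auto
qed

text \<open>A comparison through one fixed Galerkin solution, which is continuous in
  \<open>V\<close> because it has finitely many modes. The factor \<open>cc\<close> converts
  \<open>rho\<close> into \<open>norm (freq k)\<close>.\<close>

lemma psol_cont: "psol : cont_paths {0..T} (Vsp L)"
 unfolding cont_paths_def Vsp_DA
proof (intro CollectI ballI conjI)
 fix t assume t: "t : {0..T}"
 show "psol t : carr (DA L (real 1))" using psol_DA[OF t] by blast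
 show "((%s. nrm (DA L (real 1)) (psol s - psol t)) \<longlongrightarrow> 0) (at t within {0..T})"
 proof (rule tendstoI)
  fix e :: real assume e: "e > 0"
  then have e': "e * cc / 3 > 0" using cc_pos by simp
  have "\<forall>\<^sub>F n in sequentially. en n < e * cc / 3 & 0 < n"
   using order_tendstoD(2)[OF en_lim e'] eventually_gt_at_top[of 0] by eventually_elim simp
  then obtain n where n: "en n < e * cc / 3" "0 < n" by (auto dest!: eventually_happens)
  let ?f = "%s. L2_set (%k. rho k * norm (gn n k s - gn n k t)) (Jn n)"
  have "continuous_on {0..T} ?f" unfolding L2_set_def by (intro continuous_intros gn_continuous)
  then have X: "(?f \<longlongrightarrow> ?f t) (at t within {0..T})" using t unfolding continuous_on_def by blast
  have "?f t < e * cc / 3" using e' by (simp add: L2_set_def)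
  from order_tendstoD(2)[OF X this] have "\<forall>\<^sub>F s in at t within {0..T}. ?f s < e * cc / 3" .
  moreover have "\<forall>\<^sub>F s in at t within {0..T}. s : {0..T}" by (simp add: eventually_at_filter)
  ultimately show "\<forall>\<^sub>F s in at t within {0..T}. dist (nrm (DA L (real 1)) (psol s - psol t)) 0 < e"
  proof eventually_elim
   case (elim s)
   note ps = psol_DA[OF elim(2), of 1] psol_DA[OF t, of 1]
   have b: "l2b (?f s) (%k. rho k * norm (gn n k s - gn n k t))" by (rule l2b_finite_support[OF finite_Jn]) (simp add: gn_out)
   have "l2b (1 / cc * (?f s + en n + en n)) (%k. norm (freq k) ^ 1 * norm (pr (psol s - psol t) k))"
   proof (rule l2b_mono_abs)
    show "l2b (1 / cc * (?f s + en n + en n)) (%k. 1 / cc * (rho k * norm (gn n k s - gn n k t) + rho k * norm (gn n k s - ev k s) + rho k * norm (gn n k t - ev k t)))"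
     using l2b_cmul[OF l2b_add[OF l2b_add[OF b gn_ev[OF n(2) elim(2)]] gn_ev[OF n(2) t]], of "1 / cc"] cc_pos by simp
    fix k
    have "ev k s - ev k t = (gn n k s - gn n k t) - (gn n k s - ev k s) + (gn n k t - ev k t)" by simp
    then have d: "norm (ev k s - ev k t) <= norm (gn n k s - gn n k t) + norm (gn n k s - ev k s) + norm (gn n k t - ev k t)"
     using norm_triangle_ineq[of "(gn n k s - gn n k t) - (gn n k s - ev k s)" "gn n k t - ev k t"] norm_triangle_ineq4[of "gn n k s - gn n k t" "gn n k s - ev k s"] by simp
    have f: "norm (freq k) <= 1 / cc * rho k" using norm_freq_le[of k] cc_pos by (simp add: field_simps)
    have "norm (freq k) * norm (ev k s - ev k t) <= (1 / cc * rho k) * (norm (gn n k s - gn n k t) + norm (gn n k s - ev k s) + norm (gn n k t - ev k t))"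
     by (rule mult_mono[OF f d]) (use cc_pos in auto)
    moreover have "pr (psol s - psol t) k = ev k s - ev k t" using DA_diff(2)[OF ps] by (simp add: psol(3)[OF elim(2)] psol(3)[OF t])
    ultimately show "\<bar>norm (freq k) ^ 1 * norm (pr (psol s - psol t) k)\<bar> <= \<bar>1 / cc * (rho k * norm (gn n k s - gn n k t) + rho k * norm (gn n k s - ev k s) + rho k * norm (gn n k t - ev k t))\<bar>"
     by (simp add: distrib_left mult.assoc)
   qed
   then have "nrm (DA L (real 1)) (psol s - psol t) <= 1 / cc * (?f s + en n + en n)"
    by (intro nrm_DA_le DA_diff(1) ps) auto
   also have "... < 1 / cc * (e * cc)" using elim(1) n(1) cc_pos by (intro mult_strict_left_mono) auto
   finally show ?case using nrm_Hdot_nonneg cc_pos by (simp add: nrm_DA dist_real_def)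
  qed
 qed
qed

lemma psol_end: "AE x in tor. psol T x = 0"
proof (rule field_eq_AE)
 have T: "T : {0..T}" using T0 by simp
 show "integrable tor (cp (psol T) i)" for i by (rule fsb_int[OF psol(1)[OF T]])
 have "ev k T = 0" for k by (subst ev_equation[OF T]) simp
 then show "fc (cp (psol T) i) k = fc (%x. 0 $ i) k" for i k
  using Vc_pr[OF psol(1,2)[OF T], of i k] psol(3)[OF T] by (simp add: Vc_def fc_def)
qed simp

section \<open>The time derivative and the equation it satisfies\<close>

definition qc :: "int^2 => real => complex" where
 "qc k t = - ((gh k t + (\<Sum>\<^sub>\<infinity>j. Kv t k j * ev j t)) / cor ((rho k)^2))"

lemma qc_integrable: "integrable I (qc k)"
 unfolding qc_def[abs_def]
 by (intro Bochner_Integration.integrable_minus integrable_divide Bochner_Integration.integrable_add gI integrable_continuous_on Kev_continuous)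

lemma ev_itail: "t : {0..T} ==> ev k t = itail T (%s. - qc k s) t"
 by (subst ev_equation) (auto simp: qc_def)

lemma qc_0: "qc 0 t = 0" by (simp add: qc_def gh_0 KK_0)

lemma qc_herm: "t : {0..T} ==> herm (%k. qc k t)"
 unfolding herm_def
proof
 fix k assume t: "t : {0..T}"
 have b: "bij_betw uminus (UNIV :: (int^2) set) UNIV" by (rule bij_betwI[of _ _ _ uminus]) auto
 have "(\<Sum>\<^sub>\<infinity>j. Kv t (- k) j * ev j t) = (\<Sum>\<^sub>\<infinity>j. Kv t (- k) (- j) * ev (- j) t)"
  using infsum_reindex_bij_betw[OF b, of "%j. Kv t (- k) j * ev j t"] by simp
 also have "... = cnj (\<Sum>\<^sub>\<infinity>j. Kv t k j * ev j t)"
  unfolding cnj_symmetry ev_uminus[OF t] complex_cnj_mult[symmetric] by (rule infsum_cnj)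
 finally show "qc (- k) t = cnj (qc k t)" by (simp add: qc_def cnj_symmetry)
qed

text \<open>By the second bound of \<open>KK_schur\<close>, a sequence in \<open>D(A)\<close> has an
  image that is square summable after division by \<open>rho k\<close>. Division by
  \<open>rho k ^ 2\<close> in the equation leaves one weight over, which is the \<open>V\<close>
  norm.\<close>

lemma qc_bound:
 assumes t: "t : {0..T}"
 shows "l2b (sqrt (gm t) + CK nu a2 be A * B0) (%k. rho k ^ 1 * norm (qc k t))"
proof -
 let ?X = "%k j. norm (Kv t k j) / (rho k * (rho j)^2)" and ?c = "%j. (rho j)^2 * norm (ev j t)"
 have 1: "l2b (sqrt (gm t)) (%k. norm (gh k t))" by (rule l2b_I) (rule gb[OF t])
 have 2: "l2b (CK nu a2 be A * B0) (%k. \<Sum>\<^sub>\<infinity>j. ?X k j * ?c j)"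
  by (rule sch_image(2)[OF KK_schur(2)[OF vb[OF t] vs[OF t]] _ ev_bound[OF t] _ C0]) auto
 show ?thesis
 proof (rule l2b_mono_abs[OF l2b_add[OF 1 2]])
  fix k
  have x: "?X k j * ?c j = 1 / rho k * norm (Kv t k j * ev j t)" for j by (simp add: norm_mult)
  have s: "norm (\<Sum>\<^sub>\<infinity>j. Kv t k j * ev j t) <= (\<Sum>\<^sub>\<infinity>j. norm (Kv t k j * ev j t))"
   by (rule norm_infsum_bound[OF kernel_row(1)[OF t ev_V[OF t]]])
  have "rho k * norm (qc k t) = norm (gh k t + (\<Sum>\<^sub>\<infinity>j. Kv t k j * ev j t)) / rho k"
  proof -
   have "norm (cor ((rho k)^2)) = (rho k)^2" by (simp only: norm_of_real abs_power2)
   then show ?thesis unfolding qc_def norm_minus_cancel norm_divide by (simp only:) (simp add: power2_eq_square)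
  qed
  also have "... <= (norm (gh k t) + (\<Sum>\<^sub>\<infinity>j. norm (Kv t k j * ev j t))) / rho k"
   by (intro divide_right_mono order_trans[OF norm_triangle_ineq add_left_mono[OF s]]) simp
  also have "... = norm (gh k t) / rho k + (\<Sum>\<^sub>\<infinity>j. ?X k j * ?c j)" unfolding x infsum_cmult_right' by (simp add: add_divide_distrib)
  also have "... <= norm (gh k t) + (\<Sum>\<^sub>\<infinity>j. ?X k j * ?c j)" using mult_left_mono[OF rho_ge1[of k], of "norm (gh k t)"] by (simp add: divide_le_eq)
  finally show "\<bar>rho k ^ 1 * norm (qc k t)\<bar> <= \<bar>norm (gh k t) + (\<Sum>\<^sub>\<infinity>j. ?X k j * ?c j)\<bar>" by simp
 qed
qed

definition qsol :: "real => field" where "qsol t = fld (%k. qc k t)"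

lemma qsol:
 assumes t: "t : {0..T}"
 shows "fsb 1 (sqrt (gm t) + CK nu a2 be A * B0) (qsol t)" "solen (qsol t)" "pr (qsol t) k = qc k t" "qsol t : carr (DA L (real 1))"
proof -
 note f = fld[OF qc_herm[OF t] qc_bound[OF t], folded qsol_def]
 show "fsb 1 (sqrt (gm t) + CK nu a2 be A * B0) (qsol t)" "solen (qsol t)" by (rule f)+
 show "pr (qsol t) k = qc k t" using f(4)[of k] qc_0 by (cases "k = 0") auto
 show "qsol t : carr (DA L (real 1))" by (rule DA_I[OF f(2,3)]) simp
qed

lemma qsol_Lp: "qsol : carr (bochner_Lp I (Vsp L) 2)"
proof -
 let ?D = "DA L (real 1)" and ?k = "8 * (1 / cc)^2" and ?C = "CK nu a2 be A * B0"
 have c: "qsol t : carr ?D" if "t : space I" for t using qsol(4)[of t] that by simp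
 have p: "(%t. pr (qsol t) k) : borel_measurable I" for k
  using borel_measurable_integrable[OF qc_integrable[of k]] by (rule measurable_cong[THEN iffD1, rotated]) (simp add: qsol(3))
 have m: "qsol : measurable I (nborel ?D)" by (rule DA_measurableI[OF _ c p]) simp_all
 have "integrable I (%t. nrm ?D (qsol t) powr 2)"
 proof (rule Bochner_Integration.integrable_bound)
  show "integrable I (%t. ?k * (gm t + ?C^2))"
   by (intro integrable_mult_right Bochner_Integration.integrable_add gamI integrable_continuous_on[of 0 T "%_. ?C^2"] continuous_on_const)
  show "(%t. nrm ?D (qsol t) powr 2) : borel_measurable I"
   using nrm_DA_measurable[OF _ c p] by measurable
  show "AE t in I. norm (nrm ?D (qsol t) powr 2) <= norm (?k * (gm t + ?C^2))"
  proof (rule AE_I2)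
   fix t assume "t : space I"
   then have t: "t : {0..T}" by simp
   have n: "nrm ?D (qsol t) <= (1 / cc) ^ 1 * (2 * (sqrt (gm t) + ?C))" using fsb_Hdot(2)[OF qsol(1)[OF t]] by (simp only: nrm_DA)
   have "(nrm ?D (qsol t))^2 <= ((1 / cc) ^ 1 * (2 * (sqrt (gm t) + ?C)))^2"
    by (rule power_mono[OF n]) (simp add: nrm_DA nrm_Hdot_nonneg)
   also have "... = 4 * (1 / cc)^2 * (sqrt (gm t) + ?C)^2"
    unfolding power_one_right power_mult_distrib by (simp add: mult_ac power2_eq_square)
   also have "... <= 4 * (1 / cc)^2 * (2 * ((sqrt (gm t))^2 + ?C^2))"
    using sum_squares_bound[of "sqrt (gm t)" ?C] by (intro mult_left_mono) (auto simp: power2_sum)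
   also have "... = ?k * (gm t + ?C^2)" using gam_nonneg[OF t] by simp
   finally show "norm (nrm ?D (qsol t) powr 2) <= norm (?k * (gm t + ?C^2))"
    using nrm_Hdot_nonneg gam_nonneg[OF t] by (simp add: nrm_DA)
  qed
 qed
 then show ?thesis unfolding bochner_Lp_def Vsp_DA fst_conv using m by blast
qed

text \<open>Exchange of the sum over modes with the time integral. The truncated pairings are
  dominated, through Cauchy-Schwarz, by the supremum of \<open>psi\<close> times \<open>w\<close>
  times the l2 bound of \<open>ph\<close>.\<close>

lemma ip_lim:
 assumes u: "!!t. t : {0..T} ==> fsb s (B t) (u t)" and x: "!!k t. t : {0..T} ==> pr (u t) k = x k t"
  and xI: "!!k. integrable I (x k)" and xb: "!!t. t : {0..T} ==> l2b (w t) (%k. norm (x k t))"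
  and w: "integrable I w" and psi: "continuous_on {0..T} psi" and ph: "ph : carr (Hsp L)"
 shows "(%n. LINT t|I. cor (psi t) * (SUM k:boxes n. x k t * cnj (pr ph k))) ----> cor (LINT t|I. psi t * (ip L (u t) ph / L^2))"
proof -
 obtain C where C: "l2b C (%k. norm (pr ph k))" using Hsp_l2b[OF ph] by blast
 obtain P where "ALL y:psi ` {0..T}. norm y <= P"
  using compact_imp_bounded[OF compact_continuous_image[OF psi compact_Icc]] unfolding bounded_iff by blast
 then have P: "\<bar>psi t\<bar> <= P" if "t : {0..T}" for t using that by auto
 have sm: "(%t. cor (psi t) * (SUM k:boxes n. x k t * cnj (pr ph k))) : borel_measurable I" for n
  using borel_measurable_integrable[OF integrable_continuous_on[OF psi]] borel_measurable_integrable[OF xI] by measurable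
 have lim: "(%n. cor (psi t) * (SUM k:boxes n. x k t * cnj (pr ph k))) ----> cor (psi t * (ip L (u t) ph / L^2))" if "t : space I" for t
 proof -
  have t: "t : {0..T}" using that by simp
  have "l2t (cp (u t) i)" for i using u[OF t] hsb_D(2) by (auto simp: fsb_def)
  from has_sum_boxes[OF ip_pr[OF this ph]] show ?thesis unfolding x[OF t] of_real_mult[of "psi t"] by (rule tendsto_mult_left)
 qed
 have "(%n. LINT t|I. cor (psi t) * (SUM k:boxes n. x k t * cnj (pr ph k))) ----> (LINT t|I. cor (psi t * (ip L (u t) ph / L^2)))"
 proof (rule integral_dominated_convergence[where w = "%t. P * (w t * C)"])
  show "(%t. cor (psi t * (ip L (u t) ph / L^2))) : borel_measurable I" by (rule borel_measurable_LIMSEQ_metric[OF sm lim])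
  show "integrable I (%t. P * (w t * C))" by (intro integrable_mult_right integrable_mult_left w)
  show "AE t in I. norm (cor (psi t) * (SUM k:boxes n. x k t * cnj (pr ph k))) <= P * (w t * C)" for n
  proof (rule AE_I2)
   fix t assume "t : space I"
   then have t: "t : {0..T}" by simp
   have "norm (SUM k:boxes n. x k t * cnj (pr ph k)) <= (SUM k:boxes n. norm (x k t) * norm (pr ph k))"
    by (rule order_trans[OF norm_sum]) (simp add: norm_mult)
   also have "... <= w t * C" by (rule l2b_prod_summable(2)[OF xb[OF t] C]) (auto simp: finite_boxes)
   finally show "norm (cor (psi t) * (SUM k:boxes n. x k t * cnj (pr ph k))) <= P * (w t * C)"
    unfolding norm_mult norm_of_real using P[OF t] by (intro mult_mono) auto
  qed
 qed (rule sm | (rule AE_I2, erule lim))+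
 then show ?thesis by (simp only: integral_complex_of_real)
qed

lemma psol_deriv: "time_deriv L T psol qsol"
 unfolding time_deriv_def
proof (intro allI ballI impI, elim conjE)
 fix psi :: "real => real" and ph assume ph: "ph : carr (Hsp L)"
  and "ALL n x. (deriv ^^ n) psi differentiable (at x)" "EX a b. 0 < a & b < T & (ALL t. t ~: {a..b} --> psi t = 0)"
 then have psi: "test_fun T psi" by (simp add: test_fun_def smooth_fun_def)
 then have sm: "smooth_fun psi" by (simp add: test_fun_def)
 let ?S = "%n t. SUM k:boxes n. ev k t * cnj (pr ph k)" and ?R = "%n t. SUM k:boxes n. qc k t * cnj (pr ph k)"
 have lS: "(%n. LINT t|I. cor (deriv psi t) * ?S n t) ----> cor (LINT t|I. deriv psi t * (ip L (psol t) ph / L^2))"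
 proof (rule ip_lim[where w = "%_. B0", OF psol(1) psol(3) _ _ _ smooth_fun_deriv(2)[OF sm] ph])
  show "l2b B0 (%k. norm (ev k t))" if "t : {0..T}" for t
   by (rule l2b_mono_abs[OF ev_V[OF that]]) (use rho_ge1 in "simp add: mult_le_cancel_right1")
 qed (auto intro!: integrable_continuous_on ev_continuous)
 have lR: "(%n. LINT t|I. cor (psi t) * ?R n t) ----> cor (LINT t|I. psi t * (ip L (qsol t) ph / L^2))"
 proof (rule ip_lim[where w = "%t. 1 + gm t + CK nu a2 be A * B0", OF qsol(1) qsol(3) qc_integrable _ _ smooth_fun_deriv(3)[OF sm] ph])
  show "l2b (1 + gm t + CK nu a2 be A * B0) (%k. norm (qc k t))" if t: "t : {0..T}" for t
  proof (rule l2b_weaken[OF l2b_mono_abs[OF qc_bound[OF t]]])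
   show "\<bar>norm (qc k t)\<bar> <= \<bar>rho k ^ 1 * norm (qc k t)\<bar>" for k using rho_ge1[of k] by (simp add: mult_le_cancel_right1)
   have "sqrt (gm t) <= 1 + gm t" using sum_squares_bound[of 1 "sqrt (gm t)"] gam_nonneg[OF t] by simp
   then show "sqrt (gm t) + CK nu a2 be A * B0 <= 1 + gm t + CK nu a2 be A * B0" by simp
  qed
  show "integrable I (%t. 1 + gm t + CK nu a2 be A * B0)"
   by (intro Bochner_Integration.integrable_add gamI integrable_continuous_on[of 0 T "%_. c" for c] continuous_on_const)
 qed
 have "(LINT t|I. cor (deriv psi t) * ?S n t) = - (LINT t|I. cor (psi t) * ?R n t)" for n
 proof -
  have RI: "integrable I (%s. - ?R n s)" by (intro Bochner_Integration.integrable_minus Bochner_Integration.integrable_sum integrable_mult_left qc_integrable)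
  have "?S n t = itail T (%s. - ?R n s) t" if t: "t : {0..T}" for t
  proof -
   have "itail T (%s. - ?R n s) t = itail T (%s. SUM k:boxes n. cnj (pr ph k) * - qc k s) t"
    by (simp add: sum_negf mult.commute)
   also have "... = (SUM k:boxes n. itail T (%s. cnj (pr ph k) * - qc k s) t)"
    by (rule itail_sum) (use t in "auto intro!: integrable_mult_right qc_integrable")
   also have "... = ?S n t" unfolding itail_cmul by (simp add: ev_itail[OF t] mult.commute)
   finally show ?thesis by simp
  qed
  then have "itail T (%t. cor (deriv psi t) * ?S n t) 0 = itail T (%t. cor (deriv psi t) * itail T (%s. - ?R n s) t) 0"
   by (intro itail_cong) auto
  also have "... = itail T (%t. cor (psi t) * - ?R n t) 0" by (rule test_fun_parts[OF T0 RI psi])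
  also have "... = - itail T (%t. cor (psi t) * ?R n t) 0" by (simp add: itail_def)
  finally show ?thesis by (simp add: itail_def)
 qed
 then have "cor (LINT t|I. deriv psi t * (ip L (psol t) ph / L^2)) = - cor (LINT t|I. psi t * (ip L (qsol t) ph / L^2))"
  using LIMSEQ_unique[OF lS] tendsto_minus[OF lR] by simp
 then have "(LINT t|I. deriv psi t * (ip L (psol t) ph / L^2)) = - (LINT t|I. psi t * (ip L (qsol t) ph / L^2))"
  by (simp only: of_real_minus[symmetric] of_real_eq_iff)
 then show "(LINT t|I. deriv psi t * ip L (psol t) ph) = - (LINT t|I. psi t * ip L (qsol t) ph)"
  using L_pos by (simp add: divide_minus_left[symmetric] del: divide_minus_left)
qed

lemma psol_equation:
 "AE t in I. ALL ph:carr (Vsp L). - helmholtz_pairing L a1 (qsol t) ph = adjoint_rhs L nu a1 a2 be (gf t) (v t) (psol t) ph"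
 using gf_AE AE_space
proof eventually_elim
 case (elim t)
 then have t: "t : {0..T}" and g: "gf t : carr (L2dot L)" by auto
 show ?case
 proof
  fix ph assume ph: "ph : carr (Vsp L)"
  have "((%k. cor ((rho k)^2) * pr (qsol t) k * cnj (pr ph k)) has_sum cor (helmholtz_pairing L a1 (qsol t) ph / L^2)) UNIV"
   by (rule helmholtz_pr[OF _ ph]) (use qsol(1)[OF t] in "auto simp: fsb_def")
  then have h: "((%k. - (cor ((rho k)^2) * pr (qsol t) k * cnj (pr ph k))) has_sum - cor (helmholtz_pairing L a1 (qsol t) ph / L^2)) UNIV"
   by (simp only: has_sum_uminus minus_minus)
  have a: "((%k. (pr (gf t) k + (\<Sum>\<^sub>\<infinity>j. Kv t k j * pr (psol t) j)) * cnj (pr ph k)) has_sum cor (adjoint_rhs L nu a1 a2 be (gf t) (v t) (psol t) ph / L^2)) UNIV"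
   by (rule adjoint_rhs_pr[OF vb[OF t] psol(1,2)[OF t] L2dot_l2t(1)[OF g] ph])
  have r: "cor ((rho k)^2) * qc k t = - (gh k t + (\<Sum>\<^sub>\<infinity>j. Kv t k j * ev j t))" for k by (simp add: qc_def)
  have e: "- (cor ((rho k)^2) * pr (qsol t) k * cnj (pr ph k)) = (pr (gf t) k + (\<Sum>\<^sub>\<infinity>j. Kv t k j * pr (psol t) j)) * cnj (pr ph k)" for k
   using g unfolding psol(3)[OF t] qsol(3)[OF t] by (simp only: r gh_def prc_def if_True minus_mult_left[symmetric] minus_minus)
  have "- cor (helmholtz_pairing L a1 (qsol t) ph / L^2) = cor (adjoint_rhs L nu a1 a2 be (gf t) (v t) (psol t) ph / L^2)"
   using has_sum_unique[OF h[unfolded e] a] .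
  then have "- (helmholtz_pairing L a1 (qsol t) ph / L^2) = adjoint_rhs L nu a1 a2 be (gf t) (v t) (psol t) ph / L^2"
   by (simp only: of_real_minus[symmetric] of_real_eq_iff)
  then show "- helmholtz_pairing L a1 (qsol t) ph = adjoint_rhs L nu a1 a2 be (gf t) (v t) (psol t) ph" using L_pos by (simp add: field_simps)
 qed
qed

text \<open>The given solution is reduced to its modes by the test fields \<open>md c k\<close>;
  \<open>path_bound\<close> supplies a \<open>D(A)\<close> bound valid at every time, as
  \<open>ev_unique\<close> demands.\<close>

lemma psol_unique:
 assumes p: "p : cont_paths {0..T} (Vsp L)" "p : bochner_Linf I (DA L 2)" "AE x in tor. p T x = 0"
  and q: "q : carr (bochner_Lp I (Vsp L) 2)" "time_deriv L T p q"
  and e: "AE t in I. ALL ph:carr (Vsp L). - helmholtz_pairing L a1 (q t) ph = adjoint_rhs L nu a1 a2 be (gf t) (v t) (p t) ph"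
  and t: "t : {0..T}"
 shows "AE x in tor. p t x = psol t x"
proof -
 have p1: "p : cont_paths {0..T} (DA L (real 1))" using p(1) unfolding Vsp_DA .
 have p2: "p : bochner_Linf I (DA L (real 2))" using p(2) by simp
 obtain B where B: "!!t. t : {0..T} ==> fsb 2 B (p t)" "!!t. t : {0..T} ==> solen (p t)" "!!t. t : {0..T} ==> l2b B (%k. (rho k)^2 * norm (pr (p t) k))"
  using path_bound[OF p1 le_refl p2 one_le_numeral T0] by blast
 have pl: "l2t (cp (p t) i)" if "t : {0..T}" for t i using B(1)[OF that] hsb_D(2) by (auto simp: fsb_def)
 obtain q' where q': "q' : measurable I (nborel (DA L (real 1)))" "integrable I (%t. nrm (DA L (real 1)) (q' t) powr 2)" "AE t in I. q t = q' t"
  using q(1) unfolding bochner_Lp_def Vsp_DA fst_conv by blast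
 have qD: "q' t : carr (DA L (real 1))" if "t : {0..T}" for t using measurable_space[OF q'(1), of t] that by (simp add: space_nborel)
 have qh: "hsb 1 (c1 ^ 1 * nrm (Hdot L (real 1)) (q' t)) (cp (q' t) i)" if "t : {0..T}" for t i
  using DA_D(1)[OF qD[OF that] le_refl] unfolding fsb_def by blast
 define y where "y k t = pr (q' t) k" for k t
 have yI: "integrable I (y k)" for k
 proof (cases "k = 0")
  case False
  then have f: "norm (freq k) > 0" by (simp add: freq_eq_0)
  show ?thesis
  proof (rule Bochner_Integration.integrable_bound)
   show "integrable I (%t. (1 + nrm (DA L (real 1)) (q' t) powr 2) / norm (freq k))"
    by (intro integrable_divide Bochner_Integration.integrable_add q'(2) integrable_continuous_on[of 0 T "%_. 1"] continuous_on_const)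
   show "y k : borel_measurable I" unfolding y_def by (rule measurable_compose[OF q'(1) pr_DA_measurable]) simp
   show "AE t in I. norm (y k t) <= norm ((1 + nrm (DA L (real 1)) (q' t) powr 2) / norm (freq k))"
   proof (rule AE_I2)
    fix t assume "t : space I"
    then have t: "t : {0..T}" by simp
    let ?n = "nrm (DA L (real 1)) (q' t)"
    have n: "0 <= ?n" by (simp only: nrm_DA nrm_Hdot_nonneg)
    have "norm (freq k) * norm (y k t) <= ?n" using l2b_point[OF l2b_nrm_DA[OF qD[OF t] le_refl], of k] by (simp add: y_def)
    also have "... <= 1 + ?n powr 2" using sum_squares_bound[of 1 ?n] n by simp
    finally show "norm (y k t) <= norm ((1 + ?n powr 2) / norm (freq k))" using f by (simp add: field_simps)
   qed
  qed
 qed (simp add: y_def[abs_def])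
 have pT: "pr (p T) k = 0" for k
 proof -
  have "fc (cp (p T) i) k = fc (%x. 0) k" for i
   by (rule fc_cong_AE) (use p(3) T0 l2t_meas[OF pl] in auto)
  then have "fc (cp (p T) i) k = 0" for i by (simp add: fc_def[of "%x. 0"])
  then show ?thesis by (simp add: pr_def)
 qed
 have x: "pr (p t) k = itail T (%s. - y k s) t" if t: "t : {0..T}" and k: "k ~= 0" for k t
 proof -
  \<comment> \<open>Real test fields see only real parts; \<open>c = 1\<close> and
    \<open>c = \<i>\<close> together recover the complex coefficient.\<close>
  have *: "Re (pr (p t) k * cnj c) = - Re (itail T (y k) t * cnj c)" for c
  proof -
   let ?Phi = "%t. ip L (p t) (md c k)" and ?Tht = "%t. ip L (q t) (md c k)"
   have Phi: "?Phi t = 2 * L^2 * Re (pr (p t) k * cnj c)" if "t : {0..T}" for t by (rule ip_md[OF k pl[OF that]])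
   have Thte: "AE t in I. 2 * L^2 * Re (y k t * cnj c) = ?Tht t"
    using q'(3) AE_space by eventually_elim (use ip_md[OF k hsb_D(2)[OF qh]] in "simp add: y_def")
   have Tht0: "integrable I (%t. 2 * L^2 * Re (y k t * cnj c))" by (intro integrable_mult_right integrable_Re integrable_mult_left yI)
   have Thtm: "?Tht : borel_measurable I" by (rule lebesgue_on_measurable_AE[OF borel_measurable_integrable[OF Tht0] Thte])
   have ThtI: "integrable I ?Tht" by (rule integrable_cong_AE_imp[OF Tht0 Thtm]) (use Thte in "auto elim: eventually_mono")
   have 1: "?Phi t = ?Phi T - itail T ?Tht t"
   proof (rule du_bois_reymond[OF T0 _ ThtI _ t])
    have "continuous_on {0..T} (%t. 2 * L^2 * Re (pr (p t) k * cnj c))" by (intro continuous_intros cont_paths_pr[OF p1]) simp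
    then show "continuous_on {0..T} ?Phi" by (rule continuous_on_eq) (simp only: Phi)
    show "(LINT t|I. deriv psi t * ?Phi t) = - (LINT t|I. psi t * ?Tht t)" if "test_fun T psi" for psi
     using q(2) md(2)[OF k] that unfolding time_deriv_def test_fun_def smooth_fun_def by blast
   qed
   have "itail T ?Tht t = itail T (%t. 2 * L^2 * Re (y k t * cnj c)) t"
    by (rule itail_cong_AE[OF _ Thtm borel_measurable_integrable[OF Tht0]]) (use Thte t in "auto elim: eventually_mono")
   also have "... = 2 * L^2 * Re (itail T (%s. cnj c * y k s) t)"
    unfolding itail_cmul[of _ "2 * L^2"] using itail_Re[of T "%s. cnj c * y k s" t] yI[of k] t by (simp add: mult.commute)
   also have "... = 2 * L^2 * Re (itail T (y k) t * cnj c)" unfolding itail_cmul by (simp add: mult.commute)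
   finally have 2: "itail T ?Tht t = 2 * L^2 * Re (itail T (y k) t * cnj c)" .
   have "?Phi T = 0" using Phi[of T] pT[of k] T0 by simp
   then have "2 * L^2 * Re (pr (p t) k * cnj c) = 2 * L^2 * - Re (itail T (y k) t * cnj c)"
    using 1 Phi[OF t] 2 by (simp only: mult_minus_right diff_0)
   then show ?thesis using L_pos by (subst (asm) mult_left_cancel) auto
  qed
  have "itail T (%s. - y k s) t = - itail T (y k) t" by (simp add: itail_def)
  then show ?thesis using *[of 1] *[of \<i>] by (simp add: complex_eq_iff)
 qed
 have D: "AE t in I. cor ((rho k)^2) * y k t + (gh k t + (\<Sum>\<^sub>\<infinity>j. Kv t k j * pr (p t) j)) = 0" if k: "k ~= 0" for k
  using e q'(3) gf_AE AE_space
 proof eventually_elim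
  case (elim t)
  then have t: "t : {0..T}" and g: "gf t : carr (L2dot L)" by auto
  let ?d = "%k. cor ((rho k)^2) * pr (q' t) k + (pr (gf t) k + (\<Sum>\<^sub>\<infinity>j. Kv t k j * pr (p t) j))"
  \<comment> \<open>The residual of the equation at mode \<open>k\<close> appears together with the
    one at \<open>- k\<close>; the choices \<open>c = 1\<close> and \<open>c = \<i>\<close> separate
    them.\<close>
  have d: "?d k * cnj c + ?d (- k) * c = 0" for c
  proof -
   note V = md(1)[OF k, of c]
   have "((%j. ?d j * cnj (pr (md c k) j)) has_sum cor (helmholtz_pairing L a1 (q' t) (md c k) / L^2) + cor (adjoint_rhs L nu a1 a2 be (gf t) (v t) (p t) (md c k) / L^2)) UNIV"
    unfolding distrib_right[of "cor _ * _"]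
    by (rule has_sum_add[OF helmholtz_pr[OF qh[OF t] V] adjoint_rhs_pr[OF vb[OF t] B(1,2)[OF t] L2dot_l2t(1)[OF g] V]])
   moreover have "helmholtz_pairing L a1 (q' t) (md c k) / L^2 + adjoint_rhs L nu a1 a2 be (gf t) (v t) (p t) (md c k) / L^2 = 0"
    using elim(1) V unfolding elim(2) by (auto simp: add_divide_distrib[symmetric] dest!: bspec[of _ _ "md c k"])
   ultimately show ?thesis using md(3)[OF k, of ?d c] unfolding of_real_add[symmetric] by simp
  qed
  have "z = 0" if "z * cnj 1 + w * 1 = 0" "z * cnj \<i> + w * \<i> = 0" for z w :: complex
   using that by (auto simp: complex_eq_iff)
  from this[OF d d] have "?d k = 0" .
  then show ?case using g by (simp add: y_def gh_def prc_def)
 qed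
 \<comment> \<open>Integrability of the infinite row sum is read off from the equation itself, where
   it equals integrable terms almost everywhere.\<close>
 have sI: "integrable I (%s. \<Sum>\<^sub>\<infinity>j. Kv s k j * pr (p s) j)" for k
 proof (cases "k = 0")
  case False
  have a: "AE s in I. - (cor ((rho k)^2) * y k s + gh k s) = (\<Sum>\<^sub>\<infinity>j. Kv s k j * pr (p s) j)"
   using D[OF False] by eventually_elim (simp add: minus_unique add.assoc)
  have i: "integrable I (%s. - (cor ((rho k)^2) * y k s + gh k s))"
   by (intro Bochner_Integration.integrable_minus Bochner_Integration.integrable_add integrable_mult_right yI gI)
  show ?thesis
   by (rule integrable_cong_AE_imp[OF i lebesgue_on_measurable_AE[OF borel_measurable_integrable[OF i] a]])
    (use a in "auto elim: eventually_mono")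
 qed (simp add: KK_0)
 have xe: "pr (p t) k = itail T (%s. (gh k s + (\<Sum>\<^sub>\<infinity>j. Kv s k j * pr (p s) j)) / cor ((rho k)^2)) t" if t: "t : {0..T}" for k t
 proof (cases "k = 0")
  case False
  have "itail T (%s. - y k s) t = itail T (%s. (gh k s + (\<Sum>\<^sub>\<infinity>j. Kv s k j * pr (p s) j)) / cor ((rho k)^2)) t"
  proof (rule itail_cong_AE)
   show "AE s in I. - y k s = (gh k s + (\<Sum>\<^sub>\<infinity>j. Kv s k j * pr (p s) j)) / cor ((rho k)^2)"
    using D[OF False]
   proof eventually_elim
    case (elim s)
    then have "gh k s + (\<Sum>\<^sub>\<infinity>j. Kv s k j * pr (p s) j) = - (cor ((rho k)^2) * y k s)" by (rule minus_unique[symmetric])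
    then show ?case by simp
   qed
   show "(%s. (gh k s + (\<Sum>\<^sub>\<infinity>j. Kv s k j * pr (p s) j)) / cor ((rho k)^2)) : borel_measurable I"
    by (intro borel_measurable_integrable integrable_divide Bochner_Integration.integrable_add gI sI)
  qed (use t borel_measurable_integrable[OF yI] in auto)
  then show ?thesis using x[OF t False] by simp
 qed (simp add: gh_0 KK_0 itail_def)
 have ev: "pr (p t) k = ev k t" for k by (rule ev_unique[OF B(3) sI xe t])
 show ?thesis
 proof (rule field_eq_AE)
  show "integrable tor (cp (p t) i)" "integrable tor (cp (psol t) i)" for i
   by (rule fsb_int[OF B(1)[OF t]], rule fsb_int[OF psol(1)[OF t]])
  show "fc (cp (p t) i) k = fc (cp (psol t) i) k" for i k
   using Vc_pr[OF B(1,2)[OF t], of i k] Vc_pr[OF psol(1,2)[OF t], of i k] by (simp add: Vc_def psol(3)[OF t] ev)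
 qed
qed

end

section \<open>The adjoint system\<close>

text \<open>The pathwise solution as one function of the path data. It does not refer to the bound
  \<open>A\<close>, which differs from path to path.\<close>

definition (in helm) psl :: "real => real => real => real => (real => field) => (real => field) => real => field" where
 "psl T nu a2 be v gf t = fld (%k. evs T rho (%s. KK nu a2 be (v s)) (%k s. prc (gf s) k) k t)"

context adjdata begin

lemma gh_eq: "gh = (%k s. prc (gf s) k)" by (intro ext) (rule gh_def)

lemma psl_psol: "psl T nu a2 be v gf = psol"
 unfolding psl_def psol_def[abs_def] unfolding ev_def unfolding gh_eq by (rule refl)

lemma psl_adjoint:
 "psl T nu a2 be v gf : cont_paths {0..T} (Vsp L) Int bochner_Linf (iv T) (DA L 2) &
 (AE x in torus L. psl T nu a2 be v gf T x = 0) &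
 (EX q:carr (bochner_Lp (iv T) (Vsp L) 2). time_deriv L T (psl T nu a2 be v gf) q &
   (AE t in iv T. ALL ph:carr (Vsp L).
    - helmholtz_pairing L a1 (q t) ph = adjoint_rhs L nu a1 a2 be (gf t) (v t) (psl T nu a2 be v gf t) ph))"
 unfolding psl_psol using psol_cont psol_Linf psol_end qsol_Lp psol_deriv psol_equation by blast

lemma psl_pr:
 assumes "t : {0..T}"
 shows "psl T nu a2 be v gf t : carr (DA L (real 1))"
  "pr (psl T nu a2 be v gf t) k = evs T rho (%s. KK nu a2 be (v s)) (%k s. prc (gf s) k) k t"
 using psol_DA[OF assms, of 1] psol(3)[OF assms, of k] unfolding psl_psol unfolding ev_def unfolding gh_eq by simp_all

lemma psl_evol: "EX gam. evol T (CK nu a2 be A) rho (%s. KK nu a2 be (v s)) (%k s. prc (gf s) k) gam"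
 using evol_data unfolding gh_eq by blast

end

lemma AE_sets_complete:
 assumes "AE om in M. P om" and c: "!!N B. N : null_sets M ==> B <= N ==> B : sets M"
 shows "{om:space M. P om} : sets M"
proof -
 obtain N where "{om:space M. ~ P om} <= N" "N : null_sets M" using assms(1) by (auto simp: eventually_ae_filter)
 then have "space M - {om:space M. ~ P om} : sets M" using c by blast
 also have "space M - {om:space M. ~ P om} = {om:space M. P om}" by blast
 finally show ?thesis .
qed

theorem theorem6p2:
 fixes L T \<nu> a1 a2 \<beta> r :: real
  and M :: "'w measure" and F :: "real \<Rightarrow> 'w measure"
  and G :: "'u::{real_inner,complete_space} \<Rightarrow> field"
  and W f g v :: "'w \<Rightarrow> real \<Rightarrow> field" and v0 :: field
 assumes "L > 0" and "T > 0"
  and "\<nu> > 0" and "a1 > 0" and "\<beta> > 0" and "\<bar>a1 + a2\<bar> \<le> sqrt (24 * \<nu> * \<beta>)"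
  and "prob_space M" and "usual_filtration M F"
  and "hilbert_schmidt L G" and "wiener_process L M F (\<lambda>\<phi>. G (adj L G \<phi>)) W"
  and "f \<in> carr (bochner_Lp M (bochner_Lp (lebesgue_on {0..T}) (Hdot L 1) 2) 2)"
  and "v0 \<in> carr (DA L 3)"
  and "r > 2"
  and "g \<in> carr (bochner_Lp M (bochner_Lp (lebesgue_on {0..T}) (L2dot L) 2) r)"
  and "state_solution L T \<nu> a1 a2 \<beta> M F W f v0 v"
  and "\<And>c t. c > 0 \<Longrightarrow> t \<in> {0..T} \<Longrightarrow>
     (\<integral>\<^sup>+\<omega>. ennreal (exp (c * (LINT s|lebesgue_on {0..t}. (nrm (Hdot L 3) (v \<omega> s))\<^sup>2))) \<partial>M) < \<infinity>"
 shows "\<exists>p. adjoint_solution L T \<nu> a1 a2 \<beta> M g v p \<and>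
     (\<forall>q. adjoint_solution L T \<nu> a1 a2 \<beta> M g v q \<longrightarrow>
       (AE \<omega> in M. \<forall>t\<in>{0..T}. AE x in torus L. q \<omega> t x = p \<omega> t x))"
proof -
 interpret helm L a1 by unfold_locales (use assms in auto)
 let ?I = "iv T" and ?Y = "bochner_Lp (iv T) (L2dot L) 2"
 have sub: "subalgebra M (F t)" if "0 <= t" for t using assms(8) that by (auto simp: usual_filtration_def)
 \<comment> \<open>\<open>F 0\<close> contains every subset of a null set and is a subalgebra of
   \<open>M\<close>, so \<open>M\<close> is complete.\<close>
 have complete: "B : sets M" if "N : null_sets M" "B <= N" for N B
  using assms(8) that sub[of 0] unfolding usual_filtration_def subalgebra_def by blast
 obtain g' where g': "g' : measurable M (nborel ?Y)" "AE \<omega> in M. g \<omega> = g' \<omega>"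
  using assms(14) unfolding bochner_Lp_def[of M] fst_conv by blast
 have vm: "(%\<omega>. v \<omega> t) : measurable M (nborel (DA L (real 2)))" if "t : {0..T}" for t
 proof -
  have "(%\<omega>. v \<omega> t) : measurable (F t) (nborel (DA L 2))" using assms(15) that unfolding state_solution_def by blast
  from measurable_from_subalg[OF sub this] that show ?thesis by simp
 qed
 \<comment> \<open>The event on which the path of \<open>v\<close> is regular and \<open>g\<close>
   agrees with its measurable version. It is measurable by completeness.\<close>
 define good where "good \<omega> \<longleftrightarrow> v \<omega> : cont_paths {0..T} (DA L 2) Int bochner_Linf ?I (DA L 3) & g \<omega> = g' \<omega>" for \<omega>
 have good: "AE \<omega> in M. good \<omega>"
  using assms(15) g'(2) unfolding good_def state_solution_def by (auto intro: AE_conjI)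
 have gm: "{\<omega>:space M. good \<omega>} : sets M" by (rule AE_sets_complete[OF good complete])
 \<comment> \<open>Off this event the zero path is substituted, so that the pathwise theory applies
   at every point of the probability space and measurability involves no exceptional set.\<close>
 define v' where "v' \<omega> = (if good \<omega> then v \<omega> else (%t x. 0))" for \<omega>
 have zero: "fsb s 0 (%x. 0)" "solen (%x. 0)" "Vc (%x. 0) i k = 0" for s i k
  using hsb_zero[of s] by (simp_all add: fsb_def solen_def Vc_def fc_def)
 have vb: "EX A. ALL t:{0..T}. fsb 3 A (v' \<omega> t) & solen (v' \<omega> t)" for \<omega>
 proof (cases "good \<omega>")
  case True
  then show ?thesis using path_bound[of "v \<omega>" T 2 3] assms(2) by (auto simp: good_def v'_def)
 next
  case False
  then show ?thesis using zero by (auto simp: v'_def intro!: exI[of _ 0])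
 qed
 \<comment> \<open>The bounds are picked separately for each path, with no measurability; the
   solution is a limit of Picard iterations in which they do not occur.\<close>
 then obtain A where A: "!!\<omega> t. t : {0..T} ==> fsb 3 (A \<omega>) (v' \<omega> t)" "!!\<omega> t. t : {0..T} ==> solen (v' \<omega> t)" by metis
 have vc: "continuous_on {0..T} (%t. Vc (v' \<omega> t) i k)" for \<omega> i k
 proof (cases "good \<omega>")
  case True
  then have "continuous_on {0..T} (%t. pr (v \<omega> t) k * nv k i)"
   using cont_paths_pr[of "v \<omega>" "{0..T}" 2 k] by (intro continuous_intros) (auto simp: good_def)
  then show ?thesis by (rule continuous_on_eq) (use True Vc_pr[OF A(1)[of _ \<omega>] A(2)[of _ \<omega>]] in "simp add: v'_def")
 next
  case False
  then show ?thesis by (simp add: v'_def zero)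
 qed
 have D: "adjdata L a1 T (A \<omega>) (v' \<omega>) (g' \<omega>)" if "\<omega> : space M" for \<omega>
  using assms(2) A vc measurable_space[OF g'(1) that] by unfold_locales (auto simp: space_nborel)
 let ?K = "%\<omega> s. KK \<nu> a2 \<beta> (v' \<omega> s)" and ?g = "%\<omega> k s. prc (g' \<omega> s) k"
 define p where "p \<omega> = psl T \<nu> a2 \<beta> (v' \<omega>) (g' \<omega>)" for \<omega>
 have "ALL \<omega>:space M. EX gam. evol T (CK \<nu> a2 \<beta> (A \<omega>)) rho (?K \<omega>) (?g \<omega>) gam"
  using adjdata.psl_evol[OF D] by blast
 then obtain gam where E: "!!\<omega>. \<omega> : space M ==> evol T (CK \<nu> a2 \<beta> (A \<omega>)) rho (?K \<omega>) (?g \<omega>) (gam \<omega>)" by metis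
 have Vm: "(%\<omega>. Vc (v' \<omega> s) i k) : borel_measurable M" if s: "s : {0..T}" for s i k
 proof -
  have "(%\<omega>. if good \<omega> then pr (v \<omega> s) k * nv k i else 0) : borel_measurable M"
   by (intro measurable_If borel_measurable_times measurable_compose[OF vm[OF s] pr_DA_measurable] gm) auto
  then show ?thesis
  proof (rule measurable_cong[THEN iffD1, rotated])
   show "(if good \<omega> then pr (v \<omega> s) k * nv k i else 0) = Vc (v' \<omega> s) i k" for \<omega>
    using Vc_pr[OF A(1)[OF s, of \<omega>] A(2)[OF s, of \<omega>], of i k] by (cases "good \<omega>") (auto simp: v'_def zero(3))
  qed
 qed
 have pm: "(%\<omega>. p \<omega> t) : measurable M (nborel (Vsp L))" if t: "t : {0..T}" for t
  unfolding Vsp_DA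
 proof (rule DA_measurableI)
  show "p \<omega> t : carr (DA L (real 1))" if "\<omega> : space M" for \<omega> unfolding p_def by (rule adjdata.psl_pr(1)[OF D[OF that] t])
  have "(%\<omega>. evs T rho (?K \<omega>) (?g \<omega>) k t) : borel_measurable M" for k
  proof (rule evs_measurable[OF E _ _ t])
   show "(%\<omega>. ?K \<omega> s k j) : borel_measurable M" if "s : {0..T}" for s k j
    using KK_measurable[OF _ Vm[OF that]] A(1)[OF that] by blast
   show "(%\<omega>. itail T (?g \<omega> k) s) : borel_measurable M" if "s : {0..T}" for s k
    by (rule measurable_compose[OF g'(1) itail_prc_measurable[OF that]])
  qed
  then show "(%\<omega>. pr (p \<omega> t) k) : borel_measurable M" for k
   by (rule measurable_cong[THEN iffD1, rotated]) (simp add: p_def adjdata.psl_pr(2)[OF D t])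
 qed simp
 have v'g: "v' \<omega> = v \<omega>" "g' \<omega> = g \<omega>" if "good \<omega>" for \<omega> using that by (simp_all add: v'_def good_def)
 have "adjoint_solution L T \<nu> a1 a2 \<beta> M g v p" unfolding adjoint_solution_def
 proof (intro conjI ballI pm)
  show "AE \<omega> in M. p \<omega> : cont_paths {0..T} (Vsp L) Int bochner_Linf ?I (DA L 2) & (AE x in torus L. p \<omega> T x = 0) &
   (EX q:carr (bochner_Lp ?I (Vsp L) 2). time_deriv L T (p \<omega>) q & (AE t in ?I. ALL \<phi>:carr (Vsp L).
     - helmholtz_pairing L a1 (q t) \<phi> = adjoint_rhs L \<nu> a1 a2 \<beta> (g \<omega> t) (v \<omega> t) (p \<omega> t) \<phi>))"
   using good AE_space
  proof eventually_elim
   case (elim \<omega>)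
   show ?case using adjdata.psl_adjoint[OF D[OF elim(2)], of \<nu> a2 \<beta>] unfolding p_def v'g[OF elim(1)] .
  qed
 qed
 moreover have "AE \<omega> in M. ALL t:{0..T}. AE x in torus L. q \<omega> t x = p \<omega> t x" if q: "adjoint_solution L T \<nu> a1 a2 \<beta> M g v q" for q
  using q[unfolded adjoint_solution_def, THEN conjunct2] good AE_space
 proof eventually_elim
  case (elim \<omega>)
  note D' = D[OF elim(3), unfolded v'g[OF elim(2)]]
  show ?case unfolding p_def v'g[OF elim(2)] adjdata.psl_psol[OF D']
   using elim(1) adjdata.psol_unique[OF D', of "q \<omega>"] by blast
 qed
 ultimately show ?thesis by blast
qed

end
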